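(* Let $\mathcal C\subset[0,1]$ be the standard (middle-thirds) Cantor set, $M=\mathcal C+\mathbb Z=\{y+k:y\in\mathcal C,k\in\mathbb Z\}$ with the Euclidean distance $d(x,y)=|x-y|$, and let $m$ be the Hausdorff measure on $M$ (of dimension $\alpha=\log_3 2$). Put $V(r)=\max(r^\alpha,r)$ and $B_k=(2k-1,2k+1)\cap M$ for $k\in\mathbb Z$. Let $p\in(1,\infty)$, $\beta\in(0,p)$, and for $x\ne y$ in $M$ define $$J(x,y)=\frac1{V(|x-y|)\,|x-y|^\beta}+\sum_{n\in\mathbb Z\setminus\{0\}}\frac1{|n|^\beta}\mathbf 1_{B_n\times B_{-n}}(x,y).$$ Define $\mathcal E(u)=\int_{M^2_{\mathrm{od}}}|u(x)-u(y)|^pJ(x,y)\,dm(y)\,dm(x)$ and let $\mathcal F$ be the closure of $\{u\in C_c(M):\mathcal E(u)<\infty\}$ under the norm $\mathcal E_1^{1/p}=(\mathcal E(\cdot)+\|\cdot\|_{L^p(M,m)}^p)^{1/p}$. Then, with scale function $W(x,r)=r^\beta$ and $\overline R=1/2$ (conditions as defined in the context): (1) $(\mathcal E,\mathcal F)$ is a purely nonlocal $p$-energy form on $(M,m)$. (2) (TJ) and (UJS) hold, while ($\mathrm J_\le$) fails. (3) The cutoff Sobolev inequality (CS) and the Poincaré inequality (PI) hold; consequently the Harnack inequalities (wEH) and (sEH) hold.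
   Context: **Forms.** $B(x,r)$ is the open ball of $(M,d)$, $\lambda B=B(x,\lambda r)$ for $B=B(x,r)$, $C_c(M)$ the continuous functions with compact support, $M^2_{\mathrm{od}}=\{(x,y)\in M\times M:x\ne y\}$, $\operatorname{supp}_m(f)$ the support of $|f|\,dm$. $U\Subset V$ means that $U$ is precompact with closure contained in $V$. A $p$-energy form on $(M,m)$ is a pair $(\mathcal E,\mathcal F)$ with $\mathcal F$ a linear subspace of $L^p(M,m)$ and $\mathcal E:\mathcal F\to[0,\infty)$ such that $\mathcal E^{1/p}$ is a seminorm; $\mathcal E_1(u)=\mathcal E(u)+\|u\|_{L^p(M,m)}^p$. It is closed if $(\mathcal F,\mathcal E_1^{1/p})$ is a Banach space; regular if $\mathcal F\cap C_c(M)$ is dense in $(\mathcal F,\mathcal E_1^{1/p})$ and in $(C_c(M),\|\cdot\|_{\sup})$; Markovian if for all $\psi\in C(\mathbb R)$ with $\psi(0)=0$, $|\psi(s)-\psi(t)|\le|s-t|$, and all $u\in\mathcal F$, one has $\psi\circ u\in\mathcal F$ and $\mathcal E(\psi\circ u)\le\mathcal E(u)$; strongly local if $\mathcal E(u+v)=\mathcal E(u)+\mathcal E(v)$ for all $u,v\in\mathcal F$ with $\operatorname{supp}_m(u),\operatorname{supp}_m(v)$ compact and $\operatorname{supp}_m(u)\cap\operatorname{supp}_m(v+a)=\emptyset$ for some $a\in\mathbb R$. (Cla): for all $u,v\in\mathcal F$, $\mathcal E(u+v)+\mathcal E(u-v)\ge 2(\mathcal E(u)^{1/(p-1)}+\mathcal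 E(v)^{1/(p-1)})^{p-1}$ if $p\in(1,2]$, with $\le$ in place of $\ge$ if $p\in[2,\infty)$. (SubAdd): for all $u,v\in\mathcal F\cap L^\infty(M,m)$, $u\wedge v,u\vee v\in\mathcal F\cap L^\infty$ and $\mathcal E(u\wedge v)+\mathcal E(u\vee v)\le\mathcal E(u)+\mathcal E(v)$. $(\mathcal E,\mathcal F)$ is a mixed local and nonlocal $p$-energy form if (E1) it is closed, regular and satisfies (SubAdd); (E2) there is a symmetric Radon measure $j$ on $M^2_{\mathrm{od}}$ (the jump measure) such that $\mathcal E^{(L)}(u):=\mathcal E(u)-\int_{M^2_{\mathrm{od}}}|u(x)-u(y)|^p\,dj(x,y)$, $u\in\mathcal F\cap C_c(M)$, defines a strongly local $p$-energy form; (E3) this form is Markovian; (E4) it satisfies (Cla). It is purely nonlocal if $\mathcal E^{(L)}(u)=0$ for all $u\in\mathcal F\cap C_c(M)$; here $dj(x,y)=J(x,y)\,dm(x)dm(y)$. **Capacity.** For open $A$, $\operatorname{Cap}_1(A)=\inf\{\mathcal E_1(u):u\in\mathcal F,\ u\ge1\ m\text{-a.e. on }A\}$ ($\inf\emptyset=\infty$); for general $A$, $\operatorname{Cap}_1(A)=\inf\{\operatorname{Cap}_1(G):G\supset A\text{ open}\}$. "$\mathcal E$-q.e." means outside a set of zero capacity. $u$ is $\mathcal E$-quasi-continuous if for each $\epsilon>0$ there is an open $G$ with $\operatorname{Cap}_1(G)<\epsilon$ and $u|_{M\setminus G}$ finite and continuous. Each $u\in\mathcal F$ has an $\mathcal E$-quasi-continuous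 $m$-version $\tilde u$. For open $\Omega$, $\mathcal F(\Omega)=\{u\in\mathcal F:\tilde u=0\ \mathcal E\text{-q.e. on }M\setminus\Omega\}$. For open $U\subset V$, $\operatorname{cutoff}(U,V)=\{\phi\in\mathcal F:0\le\phi\le1,\ \phi|_U=1,\ \phi|_{V^c}=0\}$. $\mathcal E(u;v)=\frac1p\frac{d}{dt}\mathcal E(u+tv)|_{t=0}$; $\mathcal F'=\{u+a:u\in\mathcal F,a\in\mathbb R\}$, $\mathcal E(u+a;v+b)=\mathcal E(u;v)$, $\widetilde{u+a}=\tilde u+a$. For open $\Omega$ and $u\in\mathcal F'$, the energy measure is (the local part being zero here) $d\Gamma_\Omega\langle u\rangle(x)=\big(\int_{\Omega}|\tilde u(x)-\tilde u(y)|^pJ(x,y)\,dm(y)\big)dm(x)$. **Conditions** (with $\overline R=1/2$, $W(x,r)=r^\beta$, $W(B)=W(x,R)$ for $B=B(x,R)$). (TJ): $\exists C>0$: $\int_{B(x,r)^c}J(x,y)\,dm(y)\le C/W(x,r)$ for all $x\in M$, $r>0$. (UJS): there are $C>0,\sigma\in(0,1)$ such that for all $R\in(0,\sigma\overline R)$, $J(x,y)\le\frac{C}{m(B(x,R))}\int_{B(x,R)}J(z,y)\,dm(z)$ for $m\otimes m$-a.e. $(x,y)\in M^2_{\mathrm{od}}$ with $d(x,y)\ge2R$. ($\mathrm J_\le$): $\exists C>0$: $J(x,y)\le\dfrac{C}{m(B(x,d(x,y)))\,W(x,d(x,y))}$ for $m\otimes m$-a.e. $(x,y)\in M^2_{\mathrm{od}}$.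 (CS): $\exists\eta,C\in(0,\infty)$ such that for all $x_0\in M$, $R,r>0$ with $R+2r<\overline R$, with $B_0=B(x_0,R)$, $B_1=B(x_0,R+r)$, $\Omega=B(x_0,R+2r)$, there is $\phi\in\operatorname{cutoff}(B_0,B_1)$ with $\int_\Omega|\tilde u|^p\,d\Gamma_\Omega\langle\phi\rangle\le\eta\int_\Omega d\Gamma_\Omega\langle u\rangle+\sup_{x\in\Omega}\frac{C}{W(x,r)}\int_\Omega|u|^p\,dm$ for all $u\in\mathcal F'\cap L^\infty(M,m)$. (PI): $\exists C_{PI}>0,\kappa\ge1$ such that for every ball $B$ of radius $r\in(0,\kappa^{-1}\overline R)$ and $u\in\mathcal F'\cap L^\infty$: $\int_B|u-u_B|^p\,dm\le C_{PI}W(B)\int_{\kappa B}d\Gamma_{\kappa B}\langle u\rangle$, $u_B=\frac1{m(B)}\int_Bu\,dm$. For open $U$, $u\in\mathcal F'$ is superharmonic (subharmonic) in $U$ if $\mathcal E(u;v)\ge0$ ($\le0$) for all $0\le v\in\mathcal F(U)$; harmonic if both. For open $U\Subset V$: $T_{U,V}(v)=\operatorname{esup}_{x\in U}\big(\int_{V^c}|\tilde v(y)|^{p-1}J(x,y)\,dm(y)\big)^{1/(p-1)}$. esup/einf are essential w.r.t. $m$; $u_-=\max(-u,0)$. (wEH): $\exists q,\delta,\sigma\in(0,1)$, $C\ge1$ such that for all $x\in M$, $R\in(0,\sigma\overline R)$, $r\in(0,\delta R]$, with $B_r=B(x,r)$, $B_R=B(x,R)$, and all $u\in\mathcal F'$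 nonnegative and superharmonic in $B_R$: $\big(\frac1{m(B_r)}\int_{B_r}u^q\,dm\big)^{1/q}\le C\big(\operatorname{einf}_{B_r}u+W(B_r)^{1/(p-1)}T_{\frac12B_R,B_R}(u_-)\big)$. (sEH): $\exists\delta,\sigma\in(0,1)$, $C\ge1$ such that for all $x\in M$, $R\in(0,\sigma\overline R)$, $r\in(0,\delta R]$ and all $u\in\mathcal F'$ nonnegative and harmonic in $B_R$: $\operatorname{esup}_{B_r}u\le C\big(\operatorname{einf}_{B_r}u+W(B_r)^{1/(p-1)}T_{\frac12B_R,B_R}(u_-)\big)$. *)

theory Defs
  imports "HOL-Probability.Essential_Supremum"
begin

text \<open>
  A metric measure space is given by a measure \<open>m\<close> over a type of class \<open>metric_space\<close>: its underlying
  set \<open>M\<close> is \<open>space m\<close>, with the restricted metric. Elements of \<open>L\<^sup>p(M,m)\<close> are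
  represented by functions; a linear subspace of \<open>L\<^sup>p(M,m)\<close> is represented by a set of
  representatives. Integrals of nonnegative functions, capacities and essential bounds take
  values in \<open>ennreal\<close>, so no inequality below holds merely because an integral fails to be finite.
\<close>

section \<open>Function spaces and supports\<close>

definition mball :: "'a::metric_space measure \<Rightarrow> 'a \<Rightarrow> real \<Rightarrow> 'a set" where
  "mball m x r = ball x r \<inter> space m"

definition off_diag :: "'a set \<Rightarrow> ('a \<times> 'a) set" where
  "off_diag M = {(x, y) \<in> M \<times> M. x \<noteq> y}"

definition Lp :: "'a measure \<Rightarrow> real \<Rightarrow> ('a \<Rightarrow> real) set" where
  "Lp m p = {u \<in> borel_measurable m. integrable m (\<lambda>x. \<bar>u x\<bar> powr p)}"

definition Linf :: "'a measure \<Rightarrow> ('a \<Rightarrow> real) set" where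
  "Linf m = {u \<in> borel_measurable m. \<exists>c. AE x in m. \<bar>u x\<bar> \<le> c}"

definition Cc :: "'a::metric_space set \<Rightarrow> ('a \<Rightarrow> real) set" where
  "Cc M = {u. continuous_on M u \<and> (\<exists>K. compact K \<and> K \<subseteq> M \<and> (\<forall>x\<in>M - K. u x = 0))}"

definition msupp :: "'a::metric_space measure \<Rightarrow> ('a \<Rightarrow> real) \<Rightarrow> 'a set" where
  "msupp m f = {x \<in> space m. \<forall>r>0. emeasure (density m (\<lambda>y. ennreal \<bar>f y\<bar>)) (mball m x r) > 0}"

section \<open>Energy forms\<close>

definition E1 :: "'a measure \<Rightarrow> real \<Rightarrow> (('a \<Rightarrow> real) \<Rightarrow> real) \<Rightarrow> ('a \<Rightarrow> real) \<Rightarrow> real" where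
  "E1 m p E u = E u + (\<integral>x. \<bar>u x\<bar> powr p \<partial>m)"

definition E1_norm :: "'a measure \<Rightarrow> real \<Rightarrow> (('a \<Rightarrow> real) \<Rightarrow> real) \<Rightarrow> ('a \<Rightarrow> real) \<Rightarrow> real" where
  "E1_norm m p E u = E1 m p E u powr (1 / p)"

text \<open>The last condition says that \<open>E\<close> is a function on \<open>m\<close>-equivalence classes.\<close>

definition p_energy_form ::
  "'a measure \<Rightarrow> real \<Rightarrow> (('a \<Rightarrow> real) \<Rightarrow> real) \<Rightarrow> ('a \<Rightarrow> real) set \<Rightarrow> bool" where
  "p_energy_form m p E F \<longleftrightarrow>
     F \<subseteq> Lp m p \<and>
     (\<lambda>x. 0) \<in> F \<and>
     (\<forall>u\<in>F. \<forall>v\<in>F. (\<lambda>x. u x + v x) \<in> F) \<and>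
     (\<forall>u\<in>F. \<forall>c. (\<lambda>x. c * u x) \<in> F) \<and>
     (\<forall>u\<in>F. 0 \<le> E u) \<and>
     (\<forall>u\<in>F. \<forall>c. E (\<lambda>x. c * u x) powr (1 / p) = \<bar>c\<bar> * E u powr (1 / p)) \<and>
     (\<forall>u\<in>F. \<forall>v\<in>F. E (\<lambda>x. u x + v x) powr (1 / p) \<le> E u powr (1 / p) + E v powr (1 / p)) \<and>
     (\<forall>u\<in>F. \<forall>v\<in>F. (AE x in m. u x = v x) \<longrightarrow> E u = E v)"

definition closed_form ::
  "'a measure \<Rightarrow> real \<Rightarrow> (('a \<Rightarrow> real) \<Rightarrow> real) \<Rightarrow> ('a \<Rightarrow> real) set \<Rightarrow> bool" where
  "closed_form m p E F \<longleftrightarrow>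
     (\<forall>s :: nat \<Rightarrow> 'a \<Rightarrow> real.
        (\<forall>n. s n \<in> F) \<and>
        (\<forall>\<epsilon>>0. \<exists>N. \<forall>i\<ge>N. \<forall>j\<ge>N. E1_norm m p E (\<lambda>x. s i x - s j x) < \<epsilon>) \<longrightarrow>
        (\<exists>u\<in>F. (\<lambda>n. E1_norm m p E (\<lambda>x. s n x - u x)) \<longlonglongrightarrow> 0))"

definition regular_form ::
  "'a::metric_space measure \<Rightarrow> real \<Rightarrow> (('a \<Rightarrow> real) \<Rightarrow> real) \<Rightarrow> ('a \<Rightarrow> real) set \<Rightarrow> bool" where
  "regular_form m p E F \<longleftrightarrow>
     (\<forall>u\<in>F. \<forall>\<epsilon>>0. \<exists>f\<in>F \<inter> Cc (space m). E1_norm m p E (\<lambda>x. u x - f x) < \<epsilon>) \<and>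
     (\<forall>u\<in>Cc (space m). \<forall>\<epsilon>>0. \<exists>f\<in>F \<inter> Cc (space m). \<forall>x\<in>space m. \<bar>u x - f x\<bar> < \<epsilon>)"

definition markovian :: "(('a \<Rightarrow> real) \<Rightarrow> real) \<Rightarrow> ('a \<Rightarrow> real) set \<Rightarrow> bool" where
  "markovian E F \<longleftrightarrow>
     (\<forall>\<psi> :: real \<Rightarrow> real.
        continuous_on UNIV \<psi> \<and> \<psi> 0 = 0 \<and> (\<forall>s t. \<bar>\<psi> s - \<psi> t\<bar> \<le> \<bar>s - t\<bar>) \<longrightarrow>
        (\<forall>u\<in>F. (\<lambda>x. \<psi> (u x)) \<in> F \<and> E (\<lambda>x. \<psi> (u x)) \<le> E u))"

definition strongly_local ::
  "'a::metric_space measure \<Rightarrow> (('a \<Rightarrow> real) \<Rightarrow> real) \<Rightarrow> ('a \<Rightarrow> real) set \<Rightarrow> bool" where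
  "strongly_local m E F \<longleftrightarrow>
     (\<forall>u\<in>F. \<forall>v\<in>F.
        compact (msupp m u) \<and> compact (msupp m v) \<and>
        (\<exists>a. msupp m u \<inter> msupp m (\<lambda>x. v x + a) = {}) \<longrightarrow>
        E (\<lambda>x. u x + v x) = E u + E v)"

definition Cla :: "real \<Rightarrow> (('a \<Rightarrow> real) \<Rightarrow> real) \<Rightarrow> ('a \<Rightarrow> real) set \<Rightarrow> bool" where
  "Cla p E F \<longleftrightarrow>
     (\<forall>u\<in>F. \<forall>v\<in>F.
        (1 < p \<and> p \<le> 2 \<longrightarrow>
           E (\<lambda>x. u x + v x) + E (\<lambda>x. u x - v x)
             \<ge> 2 * (E u powr (1 / (p - 1)) + E v powr (1 / (p - 1))) powr (p - 1)) \<and>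
        (2 \<le> p \<longrightarrow>
           E (\<lambda>x. u x + v x) + E (\<lambda>x. u x - v x)
             \<le> 2 * (E u powr (1 / (p - 1)) + E v powr (1 / (p - 1))) powr (p - 1)))"

definition SubAdd :: "'a measure \<Rightarrow> (('a \<Rightarrow> real) \<Rightarrow> real) \<Rightarrow> ('a \<Rightarrow> real) set \<Rightarrow> bool" where
  "SubAdd m E F \<longleftrightarrow>
     (\<forall>u\<in>F \<inter> Linf m. \<forall>v\<in>F \<inter> Linf m.
        (\<lambda>x. min (u x) (v x)) \<in> F \<inter> Linf m \<and>
        (\<lambda>x. max (u x) (v x)) \<in> F \<inter> Linf m \<and>
        E (\<lambda>x. min (u x) (v x)) + E (\<lambda>x. max (u x) (v x)) \<le> E u + E v)"

definition symmetric_radon :: "'a::metric_space set \<Rightarrow> ('a \<times> 'a) measure \<Rightarrow> bool" where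
  "symmetric_radon M j \<longleftrightarrow>
     space j = off_diag M \<and>
     sets j = sets (restrict_space borel (off_diag M)) \<and>
     (\<forall>A\<in>sets j. emeasure j (prod.swap ` A) = emeasure j A) \<and>
     (\<forall>z\<in>off_diag M. \<exists>G. open G \<and> z \<in> G \<and> emeasure j (G \<inter> off_diag M) < \<infinity>) \<and>
     (\<forall>A\<in>sets j. emeasure j A = (SUP K\<in>{K. compact K \<and> K \<subseteq> A}. emeasure j K))"

definition local_part ::
  "real \<Rightarrow> (('a \<Rightarrow> real) \<Rightarrow> real) \<Rightarrow> ('a \<times> 'a) measure \<Rightarrow> ('a \<Rightarrow> real) \<Rightarrow> real" where
  "local_part p E j u = E u - (\<integral>z. \<bar>u (fst z) - u (snd z)\<bar> powr p \<partial>j)"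

text \<open>
  The integrability condition makes the local part well defined; without it the Bochner integral
  would silently be zero.
\<close>

definition mixed_form ::
  "'a::metric_space measure \<Rightarrow> real \<Rightarrow> (('a \<Rightarrow> real) \<Rightarrow> real) \<Rightarrow> ('a \<Rightarrow> real) set
    \<Rightarrow> ('a \<times> 'a) measure \<Rightarrow> bool" where
  "mixed_form m p E F j \<longleftrightarrow>
     p_energy_form m p E F \<and> closed_form m p E F \<and> regular_form m p E F \<and> SubAdd m E F \<and>
     symmetric_radon (space m) j \<and>
     (\<forall>u\<in>F \<inter> Cc (space m). integrable j (\<lambda>z. \<bar>u (fst z) - u (snd z)\<bar> powr p)) \<and>
     p_energy_form m p (local_part p E j) (F \<inter> Cc (space m)) \<and>
     strongly_local m (local_part p E j) (F \<inter> Cc (space m)) \<and>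
     markovian (local_part p E j) (F \<inter> Cc (space m)) \<and>
     Cla p (local_part p E j) (F \<inter> Cc (space m))"

definition jump_measure :: "'a measure \<Rightarrow> ('a \<Rightarrow> 'a \<Rightarrow> real) \<Rightarrow> ('a \<times> 'a) measure" where
  "jump_measure m J =
     density (restrict_space (m \<Otimes>\<^sub>M m) (off_diag (space m))) (\<lambda>z. ennreal (J (fst z) (snd z)))"

definition purely_nonlocal_form ::
  "'a::metric_space measure \<Rightarrow> real \<Rightarrow> (('a \<Rightarrow> real) \<Rightarrow> real) \<Rightarrow> ('a \<Rightarrow> real) set
    \<Rightarrow> ('a \<Rightarrow> 'a \<Rightarrow> real) \<Rightarrow> bool" where
  "purely_nonlocal_form m p E F J \<longleftrightarrow>
     mixed_form m p E F (jump_measure m J) \<and>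
     (\<forall>u\<in>F \<inter> Cc (space m). local_part p E (jump_measure m J) u = 0)"

section \<open>Capacity and quasi-continuity\<close>

definition Cap_open ::
  "'a measure \<Rightarrow> real \<Rightarrow> (('a \<Rightarrow> real) \<Rightarrow> real) \<Rightarrow> ('a \<Rightarrow> real) set \<Rightarrow> 'a set \<Rightarrow> ennreal" where
  "Cap_open m p E F A = (INF u\<in>{u \<in> F. AE x in m. x \<in> A \<longrightarrow> 1 \<le> u x}. ennreal (E1 m p E u))"

definition Cap ::
  "'a::metric_space measure \<Rightarrow> real \<Rightarrow> (('a \<Rightarrow> real) \<Rightarrow> real) \<Rightarrow> ('a \<Rightarrow> real) set
    \<Rightarrow> 'a set \<Rightarrow> ennreal" where
  "Cap m p E F A =
     (INF G\<in>{G. openin (top_of_set (space m)) G \<and> A \<subseteq> G}. Cap_open m p E F G)"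

definition quasi_continuous ::
  "'a::metric_space measure \<Rightarrow> real \<Rightarrow> (('a \<Rightarrow> real) \<Rightarrow> real) \<Rightarrow> ('a \<Rightarrow> real) set
    \<Rightarrow> ('a \<Rightarrow> real) \<Rightarrow> bool" where
  "quasi_continuous m p E F u \<longleftrightarrow>
     (\<forall>\<epsilon>>0. \<exists>G. openin (top_of_set (space m)) G \<and> Cap m p E F G < ennreal \<epsilon> \<and>
               continuous_on (space m - G) u)"

text \<open>
  The quasi-continuous version; it is unique up to sets of zero capacity, and for \<open>u = f + a\<close>
  with \<open>f\<close> in the domain it is a version of \<open>f\<close> plus \<open>a\<close>.
\<close>

definition qc_version ::
  "'a::metric_space measure \<Rightarrow> real \<Rightarrow> (('a \<Rightarrow> real) \<Rightarrow> real) \<Rightarrow> ('a \<Rightarrow> real) set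
    \<Rightarrow> ('a \<Rightarrow> real) \<Rightarrow> 'a \<Rightarrow> real" where
  "qc_version m p E F u =
     (SOME v. v \<in> borel_measurable m \<and> (AE x in m. v x = u x) \<and> quasi_continuous m p E F v)"

definition dom_in ::
  "'a::metric_space measure \<Rightarrow> real \<Rightarrow> (('a \<Rightarrow> real) \<Rightarrow> real) \<Rightarrow> ('a \<Rightarrow> real) set
    \<Rightarrow> 'a set \<Rightarrow> ('a \<Rightarrow> real) set" where
  "dom_in m p E F U =
     {u \<in> F. \<exists>N. Cap m p E F N = 0 \<and> (\<forall>x\<in>space m - U - N. qc_version m p E F u x = 0)}"

definition dom_const :: "('a \<Rightarrow> real) set \<Rightarrow> ('a \<Rightarrow> real) set" where
  "dom_const F = {u. \<exists>f\<in>F. \<exists>a. u = (\<lambda>x. f x + a)}"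

definition cutoff ::
  "'a measure \<Rightarrow> ('a \<Rightarrow> real) set \<Rightarrow> 'a set \<Rightarrow> 'a set \<Rightarrow> ('a \<Rightarrow> real) set" where
  "cutoff m F U V =
     {\<phi> \<in> F. (\<forall>x\<in>space m. 0 \<le> \<phi> x \<and> \<phi> x \<le> 1) \<and> (\<forall>x\<in>U. \<phi> x = 1) \<and> (\<forall>x\<in>space m - V. \<phi> x = 0)}"

section \<open>Energy measures, harmonic functions, tails\<close>

definition energy_measure ::
  "'a::metric_space measure \<Rightarrow> real \<Rightarrow> (('a \<Rightarrow> real) \<Rightarrow> real) \<Rightarrow> ('a \<Rightarrow> real) set
    \<Rightarrow> ('a \<Rightarrow> 'a \<Rightarrow> real) \<Rightarrow> 'a set \<Rightarrow> ('a \<Rightarrow> real) \<Rightarrow> 'a measure" where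
  "energy_measure m p E F J \<Omega> u =
     (let v = qc_version m p E F u
      in density m (\<lambda>x. \<integral>\<^sup>+y\<in>\<Omega>. ennreal (\<bar>v x - v y\<bar> powr p * J x y) \<partial>m))"

definition energy_pair ::
  "real \<Rightarrow> (('a \<Rightarrow> real) \<Rightarrow> real) \<Rightarrow> ('a \<Rightarrow> real) \<Rightarrow> ('a \<Rightarrow> real) \<Rightarrow> real" where
  "energy_pair p E u v = (1 / p) * deriv (\<lambda>t. E (\<lambda>x. u x + t * v x)) 0"

text \<open>For \<open>u = f + a\<close> with \<open>f\<close> in the domain, the pairing of \<open>u\<close> with \<open>v\<close> is that of \<open>f\<close> with \<open>v\<close>.\<close>

definition superharmonic ::
  "'a::metric_space measure \<Rightarrow> real \<Rightarrow> (('a \<Rightarrow> real) \<Rightarrow> real) \<Rightarrow> ('a \<Rightarrow> real) set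
    \<Rightarrow> 'a set \<Rightarrow> ('a \<Rightarrow> real) \<Rightarrow> bool" where
  "superharmonic m p E F U u \<longleftrightarrow>
     (\<exists>f\<in>F. \<exists>a. u = (\<lambda>x. f x + a) \<and>
        (\<forall>v\<in>dom_in m p E F U. (AE x in m. 0 \<le> v x) \<longrightarrow> 0 \<le> energy_pair p E f v))"

definition subharmonic ::
  "'a::metric_space measure \<Rightarrow> real \<Rightarrow> (('a \<Rightarrow> real) \<Rightarrow> real) \<Rightarrow> ('a \<Rightarrow> real) set
    \<Rightarrow> 'a set \<Rightarrow> ('a \<Rightarrow> real) \<Rightarrow> bool" where
  "subharmonic m p E F U u \<longleftrightarrow>
     (\<exists>f\<in>F. \<exists>a. u = (\<lambda>x. f x + a) \<and>
        (\<forall>v\<in>dom_in m p E F U. (AE x in m. 0 \<le> v x) \<longrightarrow> energy_pair p E f v \<le> 0))"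

definition harmonic ::
  "'a::metric_space measure \<Rightarrow> real \<Rightarrow> (('a \<Rightarrow> real) \<Rightarrow> real) \<Rightarrow> ('a \<Rightarrow> real) set
    \<Rightarrow> 'a set \<Rightarrow> ('a \<Rightarrow> real) \<Rightarrow> bool" where
  "harmonic m p E F U u \<longleftrightarrow> superharmonic m p E F U u \<and> subharmonic m p E F U u"

definition ennpowr :: "ennreal \<Rightarrow> real \<Rightarrow> ennreal" where
  "ennpowr x a = (if x = \<infinity> then \<infinity> else ennreal (enn2real x powr a))"

definition esup :: "'a measure \<Rightarrow> 'a set \<Rightarrow> ('a \<Rightarrow> ennreal) \<Rightarrow> ennreal" where
  "esup m U f = esssup (restrict_space m U) f"

definition einf :: "'a measure \<Rightarrow> 'a set \<Rightarrow> ('a \<Rightarrow> ennreal) \<Rightarrow> ennreal" where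
  "einf m U f = Sup {c. AE x in restrict_space m U. c \<le> f x}"

definition tail ::
  "'a::metric_space measure \<Rightarrow> real \<Rightarrow> (('a \<Rightarrow> real) \<Rightarrow> real) \<Rightarrow> ('a \<Rightarrow> real) set
    \<Rightarrow> ('a \<Rightarrow> 'a \<Rightarrow> real) \<Rightarrow> 'a set \<Rightarrow> 'a set \<Rightarrow> ('a \<Rightarrow> real) \<Rightarrow> ennreal" where
  "tail m p E F J U V u =
     (let v = qc_version m p E F u
      in esup m U (\<lambda>x. ennpowr
           (\<integral>\<^sup>+y\<in>space m - V. ennreal (\<bar>v y\<bar> powr (p - 1) * J x y) \<partial>m) (1 / (p - 1))))"

section \<open>The analytic conditions\<close>

definition TJ ::
  "'a::metric_space measure \<Rightarrow> ('a \<Rightarrow> real \<Rightarrow> real) \<Rightarrow> ('a \<Rightarrow> 'a \<Rightarrow> real) \<Rightarrow> bool" where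
  "TJ m W J \<longleftrightarrow>
     (\<exists>C>0. \<forall>x\<in>space m. \<forall>r>0.
        (\<integral>\<^sup>+y\<in>space m - mball m x r. ennreal (J x y) \<partial>m) \<le> ennreal (C / W x r))"

definition UJS :: "'a::metric_space measure \<Rightarrow> real \<Rightarrow> ('a \<Rightarrow> 'a \<Rightarrow> real) \<Rightarrow> bool" where
  "UJS m Rbar J \<longleftrightarrow>
     (\<exists>C>0. \<exists>\<sigma>. 0 < \<sigma> \<and> \<sigma> < 1 \<and>
        (\<forall>R. 0 < R \<and> R < \<sigma> * Rbar \<longrightarrow>
           (AE z in m \<Otimes>\<^sub>M m. fst z \<noteq> snd z \<and> 2 * R \<le> dist (fst z) (snd z) \<longrightarrow>
              ennreal (J (fst z) (snd z))
                \<le> ennreal C / emeasure m (mball m (fst z) R)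
                    * (\<integral>\<^sup>+x\<in>mball m (fst z) R. ennreal (J x (snd z)) \<partial>m))))"

definition J_le ::
  "'a::metric_space measure \<Rightarrow> ('a \<Rightarrow> real \<Rightarrow> real) \<Rightarrow> ('a \<Rightarrow> 'a \<Rightarrow> real) \<Rightarrow> bool" where
  "J_le m W J \<longleftrightarrow>
     (\<exists>C>0. AE z in m \<Otimes>\<^sub>M m. fst z \<noteq> snd z \<longrightarrow>
        ennreal (J (fst z) (snd z))
          \<le> ennreal C / (emeasure m (mball m (fst z) (dist (fst z) (snd z)))
                          * ennreal (W (fst z) (dist (fst z) (snd z)))))"

definition CS ::
  "'a::metric_space measure \<Rightarrow> real \<Rightarrow> (('a \<Rightarrow> real) \<Rightarrow> real) \<Rightarrow> ('a \<Rightarrow> real) set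
    \<Rightarrow> ('a \<Rightarrow> 'a \<Rightarrow> real) \<Rightarrow> ('a \<Rightarrow> real \<Rightarrow> real) \<Rightarrow> real \<Rightarrow> bool" where
  "CS m p E F J W Rbar \<longleftrightarrow>
     (\<exists>\<eta>>0. \<exists>C>0. \<forall>x0\<in>space m. \<forall>R>0. \<forall>r>0. R + 2 * r < Rbar \<longrightarrow>
        (let B0 = mball m x0 R; B1 = mball m x0 (R + r); \<Omega> = mball m x0 (R + 2 * r)
         in \<exists>\<phi>\<in>cutoff m F B0 B1. \<forall>u\<in>dom_const F \<inter> Linf m.
              (\<integral>\<^sup>+x\<in>\<Omega>. ennreal (\<bar>qc_version m p E F u x\<bar> powr p) \<partial>energy_measure m p E F J \<Omega> \<phi>)
                \<le> ennreal \<eta> * emeasure (energy_measure m p E F J \<Omega> u) \<Omega>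
                  + (SUP x\<in>\<Omega>. ennreal (C / W x r)) * (\<integral>\<^sup>+x\<in>\<Omega>. ennreal (\<bar>u x\<bar> powr p) \<partial>m)))"

definition avg :: "'a measure \<Rightarrow> 'a set \<Rightarrow> ('a \<Rightarrow> real) \<Rightarrow> real" where
  "avg m B u = (1 / measure m B) * (LINT x:B|m. u x)"

definition PI ::
  "'a::metric_space measure \<Rightarrow> real \<Rightarrow> (('a \<Rightarrow> real) \<Rightarrow> real) \<Rightarrow> ('a \<Rightarrow> real) set
    \<Rightarrow> ('a \<Rightarrow> 'a \<Rightarrow> real) \<Rightarrow> ('a \<Rightarrow> real \<Rightarrow> real) \<Rightarrow> real \<Rightarrow> bool" where
  "PI m p E F J W Rbar \<longleftrightarrow>
     (\<exists>C>0. \<exists>\<kappa>\<ge>1. \<forall>x\<in>space m. \<forall>r. 0 < r \<and> r < Rbar / \<kappa> \<longrightarrow>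
        (let B = mball m x r; \<kappa>B = mball m x (\<kappa> * r)
         in \<forall>u\<in>dom_const F \<inter> Linf m.
              (\<integral>\<^sup>+y\<in>B. ennreal (\<bar>u y - avg m B u\<bar> powr p) \<partial>m)
                \<le> ennreal (C * W x r) * emeasure (energy_measure m p E F J \<kappa>B u) \<kappa>B))"

text \<open>
  In both Harnack inequalities \<open>u\<close> is nonnegative almost everywhere on the larger ball, so that the
  coercion of its values to \<open>ennreal\<close> on the smaller ball loses nothing.
\<close>

definition wEH ::
  "'a::metric_space measure \<Rightarrow> real \<Rightarrow> (('a \<Rightarrow> real) \<Rightarrow> real) \<Rightarrow> ('a \<Rightarrow> real) set
    \<Rightarrow> ('a \<Rightarrow> 'a \<Rightarrow> real) \<Rightarrow> ('a \<Rightarrow> real \<Rightarrow> real) \<Rightarrow> real \<Rightarrow> bool" where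
  "wEH m p E F J W Rbar \<longleftrightarrow>
     (\<exists>q \<delta> \<sigma> C. 0 < q \<and> q < 1 \<and> 0 < \<delta> \<and> \<delta> < 1 \<and> 0 < \<sigma> \<and> \<sigma> < 1 \<and> 1 \<le> C \<and>
        (\<forall>x\<in>space m. \<forall>R r. 0 < R \<and> R < \<sigma> * Rbar \<and> 0 < r \<and> r \<le> \<delta> * R \<longrightarrow>
           (let Br = mball m x r; BR = mball m x R
            in \<forall>u\<in>dom_const F.
                 (AE y in m. y \<in> BR \<longrightarrow> 0 \<le> u y) \<and> superharmonic m p E F BR u \<longrightarrow>
                 ennpowr ((\<integral>\<^sup>+y\<in>Br. ennreal (u y powr q) \<partial>m) / emeasure m Br) (1 / q)
                   \<le> ennreal C * (einf m Br (\<lambda>y. ennreal (u y))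
                       + ennreal (W x r powr (1 / (p - 1)))
                         * tail m p E F J (mball m x (R / 2)) BR (\<lambda>y. max (- u y) 0)))))"

definition sEH ::
  "'a::metric_space measure \<Rightarrow> real \<Rightarrow> (('a \<Rightarrow> real) \<Rightarrow> real) \<Rightarrow> ('a \<Rightarrow> real) set
    \<Rightarrow> ('a \<Rightarrow> 'a \<Rightarrow> real) \<Rightarrow> ('a \<Rightarrow> real \<Rightarrow> real) \<Rightarrow> real \<Rightarrow> bool" where
  "sEH m p E F J W Rbar \<longleftrightarrow>
     (\<exists>\<delta> \<sigma> C. 0 < \<delta> \<and> \<delta> < 1 \<and> 0 < \<sigma> \<and> \<sigma> < 1 \<and> 1 \<le> C \<and>
        (\<forall>x\<in>space m. \<forall>R r. 0 < R \<and> R < \<sigma> * Rbar \<and> 0 < r \<and> r \<le> \<delta> * R \<longrightarrow>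
           (let Br = mball m x r; BR = mball m x R
            in \<forall>u\<in>dom_const F.
                 (AE y in m. y \<in> BR \<longrightarrow> 0 \<le> u y) \<and> harmonic m p E F BR u \<longrightarrow>
                 esup m Br (\<lambda>y. ennreal (u y))
                   \<le> ennreal C * (einf m Br (\<lambda>y. ennreal (u y))
                       + ennreal (W x r powr (1 / (p - 1)))
                         * tail m p E F J (mball m x (R / 2)) BR (\<lambda>y. max (- u y) 0)))))"

section \<open>Hausdorff measure\<close>

text \<open>
  Boundedness of the covering sets is required because \<open>diameter\<close> carries no information
  for unbounded sets. The normalisation is the one without a dimensional constant.
\<close>

definition hausdorff_content :: "real \<Rightarrow> real \<Rightarrow> 'a::metric_space set \<Rightarrow> ennreal" where
  "hausdorff_content s \<delta> A =
     (INF U\<in>{U :: nat \<Rightarrow> 'a set. A \<subseteq> (\<Union>i. U i) \<and> (\<forall>i. bounded (U i) \<and> diameter (U i) \<le> \<delta>)}.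
        \<Sum>i. ennreal (diameter (U i) powr s))"

definition hausdorff_outer :: "real \<Rightarrow> 'a::metric_space set \<Rightarrow> ennreal" where
  "hausdorff_outer s A = (SUP \<delta>\<in>{0<..}. hausdorff_content s \<delta> A)"

definition hausdorff_measure :: "real \<Rightarrow> 'a::metric_space measure" where
  "hausdorff_measure s = measure_of UNIV (sets borel) (hausdorff_outer s)"

section \<open>The periodic Cantor set and its jump kernel\<close>

primrec cantor_stage :: "nat \<Rightarrow> real set" where
  "cantor_stage 0 = {0..1}"
| "cantor_stage (Suc n) =
     (\<lambda>x. x / 3) ` cantor_stage n \<union> (\<lambda>x. 2 / 3 + x / 3) ` cantor_stage n"

definition cantor_set :: "real set" where
  "cantor_set = (\<Inter>n. cantor_stage n)"

definition cantor_line :: "real set" where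
  "cantor_line = {y + of_int k | y k. y \<in> cantor_set}"

definition cantor_dim :: real where
  "cantor_dim = log 3 2"

definition cantor_measure :: "real measure" where
  "cantor_measure = restrict_space (hausdorff_measure cantor_dim) cantor_line"

definition cantor_V :: "real \<Rightarrow> real" where
  "cantor_V r = max (r powr cantor_dim) r"

definition cantor_block :: "int \<Rightarrow> real set" where
  "cantor_block k = {2 * of_int k - 1 <..< 2 * of_int k + 1} \<inter> cantor_line"

definition cantor_J :: "real \<Rightarrow> real \<Rightarrow> real \<Rightarrow> real" where
  "cantor_J \<beta> x y =
     1 / (cantor_V \<bar>x - y\<bar> * \<bar>x - y\<bar> powr \<beta>)
     + (\<Sum>\<^sub>\<infinity>n\<in>UNIV - {0}. 1 / \<bar>of_int n\<bar> powr \<beta>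
          * indicat_real (cantor_block n \<times> cantor_block (- n)) (x, y))"

text \<open>
  The energy is first defined with values in \<open>ennreal\<close> for arbitrary functions. The closure of the
  core is taken inside \<open>L\<^sup>p\<close>, in the norm whose \<open>p\<close>-th power is energy plus the \<open>p\<close>-th power of the
  \<open>L\<^sup>p\<close>-norm; membership is invariant under modification on null sets.
\<close>

definition nl_energy :: "'a measure \<Rightarrow> real \<Rightarrow> ('a \<Rightarrow> 'a \<Rightarrow> real) \<Rightarrow> ('a \<Rightarrow> real) \<Rightarrow> ennreal" where
  "nl_energy m p J u =
     (\<integral>\<^sup>+x. (\<integral>\<^sup>+y\<in>space m - {x}. ennreal (\<bar>u x - u y\<bar> powr p * J x y) \<partial>m) \<partial>m)"

definition nl_form :: "'a measure \<Rightarrow> real \<Rightarrow> ('a \<Rightarrow> 'a \<Rightarrow> real) \<Rightarrow> ('a \<Rightarrow> real) \<Rightarrow> real" where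
  "nl_form m p J u = enn2real (nl_energy m p J u)"

definition nl_core ::
  "'a::metric_space measure \<Rightarrow> real \<Rightarrow> ('a \<Rightarrow> 'a \<Rightarrow> real) \<Rightarrow> ('a \<Rightarrow> real) set" where
  "nl_core m p J = {u \<in> Cc (space m). nl_energy m p J u < \<infinity>}"

definition nl_dom ::
  "'a::metric_space measure \<Rightarrow> real \<Rightarrow> ('a \<Rightarrow> 'a \<Rightarrow> real) \<Rightarrow> ('a \<Rightarrow> real) set" where
  "nl_dom m p J =
     {u \<in> Lp m p. nl_energy m p J u < \<infinity> \<and>
        (\<forall>\<epsilon>>0. \<exists>f\<in>nl_core m p J.
           nl_energy m p J (\<lambda>x. u x - f x) < \<infinity> \<and> E1_norm m p (nl_form m p J) (\<lambda>x. u x - f x) < \<epsilon>)}"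

abbreviation power_scale :: "real \<Rightarrow> 'a \<Rightarrow> real \<Rightarrow> real" where
  "power_scale \<beta> \<equiv> (\<lambda>x r. r powr \<beta>)"

end

theory Submission
  imports Defs
begin

text \<open>
  Every interval of length at most one contains a gap of \<open>M\<close> of comparable length. Hence any two concentric balls
  are separated by a relatively compact open and closed set \<open>K\<close> whose distance to \<open>M - K\<close> is comparable to the
  difference of the radii, and multiplication by the indicator of \<open>K\<close> preserves \<open>\<F>\<close>. The indicator itself is
  the cutoff function in (CS), while (PI) is Jensen's inequality together with the lower bound of \<open>J\<close> near the diagonal.

  The Harnack inequalities need no iteration. Testing a supersolution \<open>u\<close> with \<open>1\<^sub>K (k - u)\<^sub>+\<close>, where \<open>k\<close> exceeds
  the essential infimum and the scaled tail, bounds the integral of \<open>(u - k)\<^sub>+\<^bsup>p - 1\<^esup>\<close> over \<open>K\<close> and, at points where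
  \<open>u\<close> is small, also the nonlocal tail of \<open>u\<close>. An averaging property of the kernel, the same that gives (UJS), makes the
  latter bound pointwise, after which testing a harmonic function with \<open>1\<^sub>K (u - l)\<^sub>+\<close> for large \<open>l\<close> shows that
  \<open>u \<le> l\<close> on \<open>K\<close>. The blocks \<open>B\<^sub>n\<close> and \<open>B\<^sub>-\<^sub>n\<close> violate the pointwise upper bound but have unit size, so they do not affect
  any of the integrated conditions at scales below \<open>1/2\<close>.
\<close>

section \<open>Hausdorff measure\<close>

text \<open>Why the blocks are harmless: a point of \<open>cantor_block n\<close> jumps to
  \<open>cantor_block (- n)\<close> with density |n|^-\<beta>, but that block has bounded mass and
  lies at distance of order |n|, so the total rate is what (TJ) allows. Only the pointwise bound is
  lost, since it also divides by the mass, of order |n|, of a ball reaching that far. The far part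
  of the kernel is constant on products of blocks, so averages are taken over
  \<open>cantor_side\<close>, the points in the same block as the centre.

  Two obstacles shape the rest. The domain is a closure, so stability under Lipschitz operations and
  cutting off must be proved on the core and carried to limits, with the
  \<open>ennreal\<close>-valued \<open>total\<close> in place of the norm. And the conditions speak
  of quasi-continuous versions obtained by choice, which carry no information until such versions
  are shown to exist; afterwards almost everywhere equality suffices, because every test function
  vanishes identically off a clopen set.

  The numerical constants descend from the gap ratio 1/18 and from the bounds r^alpha/8 and 8
  r^alpha for the mass of small balls, alpha being \<open>cantor_dim\<close>.\<close>

lemma hausdorff_content_le:
  assumes "A \<subseteq> (\<Union>i. U i)" "\<And>i. bounded (U i)" "\<And>i. diameter (U i) \<le> \<delta>"
  shows "hausdorff_content s \<delta> A \<le> (\<Sum>i. ennreal (diameter (U i) powr s))"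
  unfolding hausdorff_content_def by (rule INF_lower) (use assms in auto)

lemma hausdorff_content_empty: "0 \<le> \<delta> \<Longrightarrow> hausdorff_content s \<delta> {} = 0"
  using hausdorff_content_le[of "{}" "\<lambda>_. {}" \<delta> s] by simp

lemma hausdorff_content_mono: "A \<subseteq> B \<Longrightarrow> hausdorff_content s \<delta> A \<le> hausdorff_content s \<delta> B"
  unfolding hausdorff_content_def by (rule INF_superset_mono) auto

lemma hausdorff_content_antimono: "\<delta> \<le> \<delta>' \<Longrightarrow> hausdorff_content s \<delta>' A \<le> hausdorff_content s \<delta> A"
  unfolding hausdorff_content_def by (rule INF_superset_mono) (auto intro: order_trans)

text \<open>Near-optimal covers of the pieces, with errors e/2^(i+1), are merged into a single
  sequence by the pairing function. An infinite right-hand side is set aside because strict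
  near-optimality needs finite contents.\<close>

lemma hausdorff_content_UN_le:
  fixes A :: "nat \<Rightarrow> 'a::metric_space set"
  shows "hausdorff_content s \<delta> (\<Union>i. A i) \<le> (\<Sum>i. hausdorff_content s \<delta> (A i))"
proof (cases "(\<Sum>i. hausdorff_content s \<delta> (A i)) = \<infinity>")
  case False
  then have fin: "hausdorff_content s \<delta> (A i) \<noteq> \<infinity>" for i
    using ennreal_suminf_lessD[of "\<lambda>i. hausdorff_content s \<delta> (A i)" \<infinity> i] by (auto simp: less_top)
  show ?thesis
  proof (rule ennreal_le_epsilon)
    fix e :: real assume e: "0 < e"
    have "\<exists>U. A i \<subseteq> (\<Union>j. U j) \<and> (\<forall>j. bounded (U j) \<and> diameter (U j) \<le> \<delta>) \<and>
       (\<Sum>j. ennreal (diameter (U j) powr s)) < hausdorff_content s \<delta> (A i) + ennreal (e * (1/2)^Suc i)" for i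
    proof -
      have "hausdorff_content s \<delta> (A i) < hausdorff_content s \<delta> (A i) + ennreal (e * (1/2)^Suc i)"
        using fin[of i] e
        by (cases "hausdorff_content s \<delta> (A i)") (auto simp: ennreal_less_iff ennreal_plus[symmetric] simp del: ennreal_plus)
      then show ?thesis
        unfolding hausdorff_content_def[of s \<delta> "A i"] INF_less_iff by auto
    qed
    then obtain U where U: "\<And>i. A i \<subseteq> (\<Union>j. U i j)" "\<And>i j. bounded (U i j)" "\<And>i j. diameter (U i j) \<le> \<delta>"
       "\<And>i. (\<Sum>j. ennreal (diameter (U i j) powr s)) < hausdorff_content s \<delta> (A i) + ennreal (e * (1/2)^Suc i)"
      by metis
    let ?V = "\<lambda>n. case prod_decode n of (i, j) \<Rightarrow> U i j"
    have "hausdorff_content s \<delta> (\<Union>i. A i) \<le> (\<Sum>n. ennreal (diameter (?V n) powr s))"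
    proof (rule hausdorff_content_le)
      show "(\<Union>i. A i) \<subseteq> (\<Union>n. ?V n)"
      proof
        fix x assume "x \<in> (\<Union>i. A i)"
        then obtain i j where "x \<in> U i j" using U(1) by blast
        then show "x \<in> (\<Union>n. ?V n)" by (intro UN_I[of "prod_encode (i, j)"]) auto
      qed
    qed (simp_all split: prod.split add: U)
    also have "\<dots> = (\<Sum>i. \<Sum>j. ennreal (diameter (U i j) powr s))"
    proof -
      define f where "f x = ennreal (diameter (U (fst x) (snd x)) powr s)" for x
      have "(\<Sum>n. ennreal (diameter (?V n) powr s)) = (\<Sum>n. f (prod_decode n))"
        by (intro suminf_cong) (simp add: f_def case_prod_beta)
      also have "\<dots> = (\<Sum>i. \<Sum>j. ennreal (diameter (U i j) powr s))"
        by (rule suminf_ennreal_2dimen) (simp add: f_def)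
      finally show ?thesis .
    qed
    also have "\<dots> \<le> (\<Sum>i. hausdorff_content s \<delta> (A i) + ennreal (e * (1/2)^Suc i))"
      by (intro suminf_le less_imp_le U) auto
    also have "\<dots> = (\<Sum>i. hausdorff_content s \<delta> (A i)) + (\<Sum>i. ennreal (e * (1/2)^Suc i))"
      by (rule suminf_add[symmetric]) auto
    also have "(\<Sum>i. ennreal (e * (1/2)^Suc i)) = ennreal e"
      using sums_mult[OF power_half_series, of e] e
      by (subst suminf_ennreal2) (auto simp: sums_iff)
    finally show "hausdorff_content s \<delta> (\<Union>i. A i) \<le> (\<Sum>i. hausdorff_content s \<delta> (A i)) + ennreal e" .
  qed
qed simp

lemma hausdorff_content_Un_le:
  assumes "0 \<le> \<delta>"
  shows "hausdorff_content s \<delta> (A \<union> B) \<le> hausdorff_content s \<delta> A + hausdorff_content s \<delta> B"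
proof -
  have eq: "(\<Union>i. binaryset A B i) = A \<union> B" by (rule UN_binaryset_eq)
  have *: "hausdorff_content s \<delta> (A \<union> B) \<le> (\<Sum>i. hausdorff_content s \<delta> (binaryset A B i))"
    unfolding eq[symmetric] by (rule hausdorff_content_UN_le)
  have "(\<Sum>i. hausdorff_content s \<delta> (binaryset A B i)) = (\<Sum>i\<in>{0,1}. hausdorff_content s \<delta> (binaryset A B i))"
    by (rule suminf_finite) (auto simp: binaryset_def hausdorff_content_empty assms)
  with * show ?thesis by (simp add: binaryset_def)
qed

lemma hausdorff_content_le_outer: "0 < \<delta> \<Longrightarrow> hausdorff_content s \<delta> A \<le> hausdorff_outer s A"
  unfolding hausdorff_outer_def by (rule SUP_upper) auto

lemma hausdorff_outer_empty: "hausdorff_outer s {} = 0"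
  by (auto simp: hausdorff_outer_def hausdorff_content_empty intro!: SUP_eq_const)

lemma hausdorff_outer_mono: "A \<subseteq> B \<Longrightarrow> hausdorff_outer s A \<le> hausdorff_outer s B"
  unfolding hausdorff_outer_def by (intro SUP_mono') (rule hausdorff_content_mono)

lemma hausdorff_outer_UN_le:
  fixes A :: "nat \<Rightarrow> 'a::metric_space set"
  shows "hausdorff_outer s (\<Union>i. A i) \<le> (\<Sum>i. hausdorff_outer s (A i))"
  unfolding hausdorff_outer_def[of s "\<Union>i. A i"]
proof (rule SUP_least)
  fix \<delta> :: real assume "\<delta> \<in> {0<..}"
  have "hausdorff_content s \<delta> (\<Union>i. A i) \<le> (\<Sum>i. hausdorff_content s \<delta> (A i))"
    by (rule hausdorff_content_UN_le)
  also have "\<dots> \<le> (\<Sum>i. hausdorff_outer s (A i))"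
    using \<open>\<delta> \<in> _\<close> by (intro suminf_le hausdorff_content_le_outer) auto
  finally show "hausdorff_content s \<delta> (\<Union>i. A i) \<le> (\<Sum>i. hausdorff_outer s (A i))" .
qed

lemma hausdorff_outer_Un_le:
  "hausdorff_outer s (A \<union> B) \<le> hausdorff_outer s A + hausdorff_outer s B"
  unfolding hausdorff_outer_def[of s "A \<union> B"]
proof (rule SUP_least)
  fix \<delta> :: real assume "\<delta> \<in> {0<..}"
  then show "hausdorff_content s \<delta> (A \<union> B) \<le> hausdorff_outer s A + hausdorff_outer s B"
    by (intro order_trans[OF hausdorff_content_Un_le add_mono] hausdorff_content_le_outer) auto
qed

lemma hausdorff_outer_space:
  "outer_measure_space (Pow UNIV) (hausdorff_outer s :: 'a::metric_space set \<Rightarrow> ennreal)"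
  unfolding outer_measure_space_def positive_def increasing_def countably_subadditive_def
  by (auto simp: hausdorff_outer_empty hausdorff_outer_mono hausdorff_outer_UN_le)

text \<open>Covering sets of diameter below e cannot meet both A and B, so every fine cover of the
  union splits into a cover of A and a cover of B, with the emptied sets contributing diameter
  0.\<close>

lemma hausdorff_outer_separated:
  fixes A B :: "'a::metric_space set"
  assumes e: "0 < e" and sep: "\<And>x y. x \<in> A \<Longrightarrow> y \<in> B \<Longrightarrow> e \<le> dist x y"
  shows "hausdorff_outer s A + hausdorff_outer s B \<le> hausdorff_outer s (A \<union> B)"
proof -
  have *: "hausdorff_content s \<delta> A + hausdorff_content s \<delta> B \<le> hausdorff_content s \<delta> (A \<union> B)"
    if "0 < \<delta>" "\<delta> < e" for \<delta>
    unfolding hausdorff_content_def[of s \<delta> "A \<union> B"]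
  proof (rule INF_greatest, clarify)
    fix U :: "nat \<Rightarrow> 'a set"
    assume U: "A \<union> B \<subseteq> (\<Union>i. U i)" "\<forall>i. bounded (U i) \<and> diameter (U i) \<le> \<delta>"
    define V where "V i = (if U i \<inter> A = {} then {} else U i)" for i
    define W where "W i = (if U i \<inter> A = {} then U i else {})" for i
    have "hausdorff_content s \<delta> A \<le> (\<Sum>i. ennreal (diameter (V i) powr s))"
      using U that by (intro hausdorff_content_le) (fastforce simp: V_def)+
    moreover have "hausdorff_content s \<delta> B \<le> (\<Sum>i. ennreal (diameter (W i) powr s))"
    proof (intro hausdorff_content_le)
      show "B \<subseteq> (\<Union>i. W i)"
      proof
        fix y assume y: "y \<in> B"
        then obtain i where i: "y \<in> U i" using U by auto
        have "U i \<inter> A = {}"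
        proof (rule ccontr)
          assume "U i \<inter> A \<noteq> {}"
          then obtain x where x: "x \<in> U i" "x \<in> A" by auto
          have "dist x y \<le> diameter (U i)"
            using U i x by (intro diameter_bounded_bound) auto
          then show False using sep[OF x(2) y] U(2) that by (smt (verit))
        qed
        then show "y \<in> (\<Union>i. W i)" using i by (auto simp: W_def)
      qed
    qed (use U that in \<open>auto simp: W_def\<close>)
    moreover have "(\<Sum>i. ennreal (diameter (V i) powr s)) + (\<Sum>i. ennreal (diameter (W i) powr s))
       = (\<Sum>i. ennreal (diameter (U i) powr s))"
      by (subst suminf_add) (auto simp: V_def W_def intro!: suminf_cong)
    ultimately show "hausdorff_content s \<delta> A + hausdorff_content s \<delta> B \<le> (\<Sum>i. ennreal (diameter (U i) powr s))"
      by (metis add_mono)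
  qed
  \<comment> \<open>The supremum over all scales is rewritten along an increasing sequence, because
    a supremum of sums splits only for monotone sequences. The double \<open>Suc\<close> keeps every
    scale strictly below e.\<close>
  have out: "hausdorff_outer s X = (SUP n. hausdorff_content s (e / real (Suc (Suc n))) X)" for X :: "'a set"
    unfolding hausdorff_outer_def
  proof (intro SUP_eq)
    fix \<delta> :: real assume d: "\<delta> \<in> {0<..}"
    obtain n where "e / \<delta> < real n" using reals_Archimedean2 by blast
    then have "e < real n * \<delta>" using d by (simp add: pos_divide_less_eq)
    also have "\<dots> \<le> real (Suc (Suc n)) * \<delta>" using d by (intro mult_right_mono) auto
    finally have "e / real (Suc (Suc n)) \<le> \<delta>" by (simp add: pos_divide_le_eq mult.commute)
    then show "\<exists>n\<in>UNIV. hausdorff_content s \<delta> X \<le> hausdorff_content s (e / real (Suc (Suc n))) X"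
      by (auto intro!: hausdorff_content_antimono)
  next
    fix n :: nat
    show "\<exists>\<delta>\<in>{0<..}. hausdorff_content s (e / real (Suc (Suc n))) X \<le> hausdorff_content s \<delta> X"
      using e by (intro bexI[of _ "e / real (Suc (Suc n))"]) simp_all
  qed
  have inc: "incseq (\<lambda>n. hausdorff_content s (e / real (Suc (Suc n))) X)" for X :: "'a set"
    using e by (intro incseq_SucI hausdorff_content_antimono) (auto simp: field_simps)
  have "hausdorff_outer s A + hausdorff_outer s B
     = (SUP n. hausdorff_content s (e / real (Suc (Suc n))) A + hausdorff_content s (e / real (Suc (Suc n))) B)"
    unfolding out by (rule ennreal_SUP_add[symmetric]) (rule inc)+
  also have "\<dots> \<le> (SUP n. hausdorff_content s (e / real (Suc (Suc n))) (A \<union> B))"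
    by (intro SUP_mono' *) (use e in \<open>auto simp: field_simps add_pos_nonneg\<close>)
  finally show ?thesis unfolding out .
qed

text \<open>The shells between the distances \<open>1/(n+2)\<close> and \<open>1/(n+1)\<close> of every second index are mutually separated.\<close>

lemma hausdorff_outer_closed_caratheodory:
  fixes S X :: "'a::metric_space set"
  assumes "closed S"
  shows "hausdorff_outer s (X \<inter> S) + hausdorff_outer s (X - S) \<le> hausdorff_outer s X"
proof (cases "hausdorff_outer s X = \<infinity> \<or> S = {}")
  case True then show ?thesis by (auto simp: hausdorff_outer_empty)
next
  case False
  then have fin: "hausdorff_outer s X < \<infinity>" and ne: "S \<noteq> {}" by (auto simp: less_top)
  let ?H = "hausdorff_outer s"
  define T where "T n = {x\<in>X. 1 / real (Suc n) \<le> infdist x S}" for n :: nat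
  define R where "R n = {x\<in>X. 1 / real (Suc (Suc n)) \<le> infdist x S \<and> infdist x S < 1 / real (Suc n)}" for n :: nat
  have sub: "?H (X \<inter> S) + ?H (T n) \<le> ?H X" for n
  proof -
    have "?H (X \<inter> S) + ?H (T n) \<le> ?H ((X \<inter> S) \<union> T n)"
    proof (rule hausdorff_outer_separated[of "1 / real (Suc n)"])
      fix x y assume "x \<in> X \<inter> S" "y \<in> T n"
      then show "1 / real (Suc n) \<le> dist x y"
        using infdist_le[of x S y] by (auto simp: T_def dist_commute)
    qed simp
    also have "\<dots> \<le> ?H X" by (rule hausdorff_outer_mono) (auto simp: T_def)
    finally show ?thesis .
  qed
  \<comment> \<open>With indices of one parity, the omitted shell \<open>R (2 * n + c - 1)\<close>
    lies between the union so far and the next shell; its width 1/(2n+c) - 1/(2n+c+1) is the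
    separation used.\<close>
  have sepR: "(\<Sum>i<n. ?H (R (2 * i + c))) \<le> ?H (\<Union>i<n. R (2 * i + c))" for n c
  proof (induction n)
    case (Suc n)
    have "(\<Sum>i<Suc n. ?H (R (2 * i + c))) \<le> ?H (\<Union>i<n. R (2 * i + c)) + ?H (R (2 * n + c))"
      using Suc by (auto intro: add_mono)
    also have "\<dots> \<le> ?H ((\<Union>i<n. R (2 * i + c)) \<union> R (2 * n + c))"
    proof (cases "2 * n + c = 0")
      case True then show ?thesis by (simp add: hausdorff_outer_empty)
    next
      case False
      have gap: "0 < 1 / real (2 * n + c) - 1 / real (Suc (2 * n + c))"
        using False by (intro diff_gt_0_iff_gt[THEN iffD2] divide_strict_left_mono) auto
      show ?thesis
      proof (rule hausdorff_outer_separated[OF gap])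
      fix x y assume x: "x \<in> (\<Union>i<n. R (2 * i + c))" and y: "y \<in> R (2 * n + c)"
      then obtain i where i: "i < n" "x \<in> R (2 * i + c)" by auto
      have "1 / real (2 * n + c) \<le> 1 / real (Suc (Suc (2 * i + c)))"
        using i by (intro divide_left_mono) auto
      also have "\<dots> \<le> infdist x S" using i by (auto simp: R_def)
      also have "\<dots> \<le> infdist y S + dist x y" by (rule infdist_triangle)
      also have "infdist y S \<le> 1 / real (Suc (2 * n + c))" using y by (auto simp: R_def)
      finally show "1 / real (2 * n + c) - 1 / real (Suc (2 * n + c)) \<le> dist x y" by simp
    qed
    qed
    also have "(\<Union>i<n. R (2 * i + c)) \<union> R (2 * n + c) = (\<Union>i<Suc n. R (2 * i + c))"
      by (auto simp: lessThan_Suc)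
    finally show ?case .
  qed (simp add: hausdorff_outer_empty)
  have half: "(\<Sum>i. ?H (R (2 * i + c))) \<le> ?H X" for c
  proof (rule suminf_le_const)
    fix n
    have "?H (\<Union>i<n. R (2 * i + c)) \<le> ?H X" by (rule hausdorff_outer_mono) (auto simp: R_def)
    then show "(\<Sum>i<n. ?H (R (2 * i + c))) \<le> ?H X" by (rule order_trans[OF sepR])
  qed simp
  have sumR: "(\<Sum>i. ?H (R i)) < \<infinity>"
  proof -
    have "(\<Sum>i<n. ?H (R i)) \<le> ?H X + ?H X" for n
    proof -
      have "(\<Sum>i<n. ?H (R i)) \<le> (\<Sum>i<2*n. ?H (R i))" by (rule sum_mono2) auto
      also have "\<dots> = (\<Sum>i<n. ?H (R (2 * i + 0))) + (\<Sum>i<n. ?H (R (2 * i + 1)))"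
        by (induction n) (simp_all add: add.assoc add.left_commute add.commute)
      also have "\<dots> \<le> ?H X + ?H X"
        by (intro add_mono order_trans[OF sum_le_suminf half]) auto
      finally show ?thesis .
    qed
    then have "(\<Sum>i. ?H (R i)) \<le> ?H X + ?H X" by (intro suminf_le_const) auto
    then show ?thesis using fin by (auto simp: top_unique less_top[symmetric])
  qed
  have XS: "X - S \<subseteq> T n \<union> (\<Union>i. R (n + i))" for n
  proof
    fix x assume x: "x \<in> X - S"
    have pos: "0 < infdist x S"
      using x assms ne in_closed_iff_infdist_zero[of S x] infdist_nonneg[of x S] by (auto simp: less_le)
    show "x \<in> T n \<union> (\<Union>i. R (n + i))"
    proof (cases "x \<in> T n")
      case False
      then have lt: "infdist x S < 1 / real (Suc n)" using x by (auto simp: T_def)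
      obtain m where m: "1 / infdist x S \<le> real m" using real_arch_simple by blast
      define k where "k = (LEAST j. 1 / real (Suc (Suc (n + j))) \<le> infdist x S)"
      have ex: "1 / real (Suc (Suc (n + m))) \<le> infdist x S"
      proof -
        have "1 \<le> real m * infdist x S" using m pos by (simp add: field_simps)
        also have "\<dots> \<le> real (Suc (Suc (n + m))) * infdist x S" using pos by (intro mult_right_mono) auto
        finally show ?thesis by (simp add: field_simps)
      qed
      have 1: "1 / real (Suc (Suc (n + k))) \<le> infdist x S" unfolding k_def by (rule LeastI[where P="\<lambda>j. 1 / real (Suc (Suc (n + j))) \<le> infdist x S", OF ex])
      have 2: "infdist x S < 1 / real (Suc (n + k))"
      proof (cases k)
        case 0 then show ?thesis using lt by simp
      next
        case (Suc j)
        then have "\<not> 1 / real (Suc (Suc (n + j))) \<le> infdist x S"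
          unfolding k_def by (intro not_less_Least) auto
        then show ?thesis using Suc by simp
      qed
      have "x \<in> R (n + k)" using 1 2 x unfolding R_def by simp
      then show ?thesis by blast
    qed simp
  qed
  \<comment> \<open>Both parities together bound the sum of the shells by twice the measure of X, so
    its tails vanish and \<open>T n\<close> exhausts \<open>X - S\<close> up to an error tending to
    0.\<close>
  have lim: "(\<lambda>n. \<Sum>i. ?H (R (i + n))) \<longlonglongrightarrow> 0"
  proof -
    have fR: "?H (R i) < \<infinity>" for i
      by (rule le_less_trans[OF hausdorff_outer_mono fin]) (auto simp: R_def)
    then have "ennreal (enn2real (?H (R i))) = ?H (R i)" for i by (simp add: less_top)
    then have sm: "summable (\<lambda>i. enn2real (?H (R i)))"
      using sumR by (intro summable_suminf_not_top) (simp_all add: less_top)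
    have "(\<lambda>n. \<Sum>i. enn2real (?H (R (i + n)))) \<longlonglongrightarrow> 0"
      by (rule suminf_exist_split2[OF sm])
    moreover have "(\<Sum>i. ?H (R (i + n))) = ennreal (\<Sum>i. enn2real (?H (R (i + n))))" for n
    proof -
      have "summable (\<lambda>i. enn2real (?H (R (i + n))))" using sm by (rule summable_ignore_initial_segment)
      then have "ennreal (\<Sum>i. enn2real (?H (R (i + n)))) = (\<Sum>i. ennreal (enn2real (?H (R (i + n)))))"
        by (intro suminf_ennreal2[symmetric]) auto
      then show ?thesis using fR by (simp add: less_top)
    qed
    ultimately show ?thesis using tendsto_ennrealI[of "\<lambda>n. \<Sum>i. enn2real (?H (R (i + n)))" 0] by simp
  qed
  have "?H (X \<inter> S) + ?H (X - S) \<le> ?H X + (\<Sum>i. ?H (R (i + n)))" for n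
  proof -
    have "?H (X - S) \<le> ?H (T n) + ?H (\<Union>i. R (n + i))"
      by (rule order_trans[OF hausdorff_outer_mono[OF XS] hausdorff_outer_Un_le])
    also have "?H (\<Union>i. R (n + i)) \<le> (\<Sum>i. ?H (R (n + i)))" by (rule hausdorff_outer_UN_le)
    finally have "?H (X \<inter> S) + ?H (X - S) \<le> ?H (X \<inter> S) + (?H (T n) + (\<Sum>i. ?H (R (i + n))))"
      by (auto intro!: add_mono simp: ac_simps)
    also have "\<dots> = (?H (X \<inter> S) + ?H (T n)) + (\<Sum>i. ?H (R (i + n)))" by (simp add: ac_simps)
    also have "\<dots> \<le> ?H X + (\<Sum>i. ?H (R (i + n)))" using sub by (intro add_mono) auto
    finally show ?thesis .
  qed
  moreover have "(\<lambda>n. ?H X + (\<Sum>i. ?H (R (i + n)))) \<longlonglongrightarrow> ?H X + 0"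
    by (intro tendsto_add tendsto_const lim)
  ultimately show ?thesis
    by (intro LIMSEQ_le_const[of "\<lambda>n. ?H X + (\<Sum>i. ?H (R (i + n)))"]) auto
qed

lemma borel_subset_hausdorff_lambda_system:
  "sets borel \<subseteq> lambda_system UNIV (Pow UNIV) (hausdorff_outer s :: 'a::metric_space set \<Rightarrow> ennreal)"
proof -
  interpret sigma_algebra "UNIV :: 'a set" "Pow UNIV" by (rule sigma_algebra_Pow)
  let ?L = "lambda_system UNIV (Pow UNIV) (hausdorff_outer s :: 'a set \<Rightarrow> ennreal)"
  have ms: "measure_space UNIV ?L (hausdorff_outer s)"
    by (rule caratheodory_lemma[OF hausdorff_outer_space])
  then have sa: "sigma_algebra UNIV ?L" by (simp add: measure_space_def)
  have "S \<in> ?L" if "closed S" for S :: "'a set"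
  proof -
    have "hausdorff_outer s (X \<inter> S) + hausdorff_outer s (X - S) = hausdorff_outer s X" for X
    proof (rule antisym[OF hausdorff_outer_closed_caratheodory[OF that]])
      have "hausdorff_outer s ((X \<inter> S) \<union> (X - S)) \<le> hausdorff_outer s (X \<inter> S) + hausdorff_outer s (X - S)"
        by (rule hausdorff_outer_Un_le)
      then show "hausdorff_outer s X \<le> hausdorff_outer s (X \<inter> S) + hausdorff_outer s (X - S)"
        by (simp add: Un_Diff_Int Int_Diff_Un)
    qed
    then show ?thesis by (simp add: lambda_system_eq del: Pow_UNIV)
  qed
  then have "sigma_sets UNIV (Collect closed) \<subseteq> ?L"
    by (intro sigma_algebra.sigma_sets_subset[OF sa]) auto
  then show ?thesis by (simp add: borel_eq_closed)
qed

lemma space_hausdorff_measure [simp]: "space (hausdorff_measure s) = UNIV"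
  by (simp add: hausdorff_measure_def space_measure_of_conv)

lemma sets_hausdorff_measure [simp, measurable_cong]: "sets (hausdorff_measure s) = sets borel"
  unfolding hausdorff_measure_def
  by (metis sets.sigma_sets_eq sets.space_closed sets_measure_of space_borel)

text \<open>\<open>measure_of\<close> returns the zero measure unless its set function is countably
  additive on the generated sigma-algebra. Caratheodory's theorem gives additivity on the measurable
  sets of the outer measure, and these contain the Borel sets.\<close>

lemma emeasure_hausdorff_measure:
  fixes A :: "'a::metric_space set"
  assumes "A \<in> sets borel"
  shows "emeasure (hausdorff_measure s) A = hausdorff_outer s A"
proof (rule emeasure_measure_of[OF hausdorff_measure_def])
  let ?L = "lambda_system UNIV (Pow UNIV) (hausdorff_outer s :: 'a set \<Rightarrow> ennreal)"
  interpret sigma_algebra "UNIV :: 'a set" "Pow UNIV" by (rule sigma_algebra_Pow)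
  have ms: "measure_space UNIV ?L (hausdorff_outer s)"
    by (rule caratheodory_lemma[OF hausdorff_outer_space])
  have "countably_additive ?L (hausdorff_outer s)"
    using ms by (simp add: measure_space_def)
  then show "countably_additive (sets (hausdorff_measure s)) (hausdorff_outer s :: 'a set \<Rightarrow> ennreal)"
    unfolding countably_additive_def sets_hausdorff_measure
    using borel_subset_hausdorff_lambda_system[of s, where 'a='a] sets.countable_UN
    by (meson subset_trans subsetD)
qed (use assms in \<open>auto simp: positive_def hausdorff_outer_empty\<close>)

lemma diameter_le_dist:
  fixes S :: "'a::metric_space set"
  assumes "0 \<le> d" "\<And>x y. x \<in> S \<Longrightarrow> y \<in> S \<Longrightarrow> dist x y \<le> d"
  shows "diameter S \<le> d"
  using assms by (auto simp: diameter_def intro!: cSUP_least)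

lemma hausdorff_content_lipschitz_image:
  fixes f :: "'a::metric_space \<Rightarrow> 'b::metric_space"
  assumes L: "0 < L" and s: "0 \<le> s" and lip: "\<And>x y. x \<in> A \<Longrightarrow> y \<in> A \<Longrightarrow> dist (f x) (f y) \<le> L * dist x y"
  shows "hausdorff_content s (L * \<delta>) (f ` A) \<le> ennreal (L powr s) * hausdorff_content s \<delta> A"
proof -
  have *: "hausdorff_content s (L * \<delta>) (f ` A) \<le> ennreal (L powr s) * (\<Sum>i. ennreal (diameter (U i) powr s))"
    if U: "A \<subseteq> (\<Union>i. U i)" "\<forall>i. bounded (U i) \<and> diameter (U i) \<le> \<delta>" for U :: "nat \<Rightarrow> 'a set"
  proof -
    have d: "dist (f x) (f y) \<le> L * diameter (U i)" if "x \<in> U i \<inter> A" "y \<in> U i \<inter> A" for x y i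
    proof -
      have "dist (f x) (f y) \<le> L * dist x y" using that lip by auto
      also have "\<dots> \<le> L * diameter (U i)"
        using that U L by (intro mult_left_mono diameter_bounded_bound) auto
      finally show ?thesis .
    qed
    have nn: "0 \<le> diameter (U i)" for i using U by (intro diameter_ge_0) auto
    have b: "bounded (f ` (U i \<inter> A))" for i
      unfolding bounded_two_points using d by blast
    have di: "diameter (f ` (U i \<inter> A)) \<le> L * diameter (U i)" for i
      by (rule diameter_le_dist) (use d nn L in auto)
    have "hausdorff_content s (L * \<delta>) (f ` A) \<le> (\<Sum>i. ennreal (diameter (f ` (U i \<inter> A)) powr s))"
    proof (rule hausdorff_content_le)
      show "f ` A \<subseteq> (\<Union>i. f ` (U i \<inter> A))" using U(1) by blast
      show "diameter (f ` (U i \<inter> A)) \<le> L * \<delta>" for i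
        by (rule order_trans[OF di]) (use U L in auto)
    qed (rule b)
    also have "\<dots> \<le> (\<Sum>i. ennreal (L powr s) * ennreal (diameter (U i) powr s))"
    proof (intro suminf_le)
      fix i
      have "diameter (f ` (U i \<inter> A)) powr s \<le> (L * diameter (U i)) powr s"
        using di[of i] s diameter_ge_0[OF b[of i]] by (intro powr_mono2) auto
      then show "ennreal (diameter (f ` (U i \<inter> A)) powr s) \<le> ennreal (L powr s) * ennreal (diameter (U i) powr s)"
        using L nn by (simp add: powr_mult ennreal_mult[symmetric] ennreal_leI)
    qed auto
    also have "\<dots> = ennreal (L powr s) * (\<Sum>i. ennreal (diameter (U i) powr s))" by simp
    finally show ?thesis .
  qed
  \<comment> \<open>The factor is moved to the left so that the infimum on the right can be
    introduced cover by cover; it is cancelled afterwards.\<close>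
  have "ennreal (1 / L powr s) * hausdorff_content s (L * \<delta>) (f ` A) \<le> hausdorff_content s \<delta> A"
    unfolding hausdorff_content_def[of s \<delta> A]
  proof (rule INF_greatest, clarify)
    fix U :: "nat \<Rightarrow> 'a set"
    assume U: "A \<subseteq> (\<Union>i. U i)" "\<forall>i. bounded (U i) \<and> diameter (U i) \<le> \<delta>"
    have "ennreal (1 / L powr s) * hausdorff_content s (L * \<delta>) (f ` A)
      \<le> ennreal (1 / L powr s) * (ennreal (L powr s) * (\<Sum>i. ennreal (diameter (U i) powr s)))"
      by (rule mult_left_mono[OF *[OF U]]) simp
    also have "\<dots> = (\<Sum>i. ennreal (diameter (U i) powr s))"
      using L by (simp add: mult.assoc[symmetric] ennreal_mult'[symmetric])
    finally show "ennreal (1 / L powr s) * hausdorff_content s (L * \<delta>) (f ` A)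
      \<le> (\<Sum>i. ennreal (diameter (U i) powr s))" .
  qed
  then have "ennreal (L powr s) * (ennreal (1 / L powr s) * hausdorff_content s (L * \<delta>) (f ` A))
     \<le> ennreal (L powr s) * hausdorff_content s \<delta> A"
    by (rule mult_left_mono) simp
  then show ?thesis
    using L by (simp add: mult.assoc[symmetric] ennreal_mult'[symmetric])
qed

lemma hausdorff_outer_lipschitz_image:
  fixes f :: "'a::metric_space \<Rightarrow> 'b::metric_space"
  assumes L: "0 < L" and s: "0 \<le> s" and lip: "\<And>x y. x \<in> A \<Longrightarrow> y \<in> A \<Longrightarrow> dist (f x) (f y) \<le> L * dist x y"
  shows "hausdorff_outer s (f ` A) \<le> ennreal (L powr s) * hausdorff_outer s A"
  unfolding hausdorff_outer_def[of s "f ` A"]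
proof (rule SUP_least)
  fix \<delta> :: real assume d: "\<delta> \<in> {0<..}"
  have "hausdorff_content s \<delta> (f ` A) = hausdorff_content s (L * (\<delta> / L)) (f ` A)" using L by simp
  also have "\<dots> \<le> ennreal (L powr s) * hausdorff_content s (\<delta> / L) A"
    using L s lip by (intro hausdorff_content_lipschitz_image) auto
  also have "\<dots> \<le> ennreal (L powr s) * hausdorff_outer s A"
    using L d by (intro mult_left_mono hausdorff_content_le_outer) auto
  finally show "hausdorff_content s \<delta> (f ` A) \<le> ennreal (L powr s) * hausdorff_outer s A" .
qed

text \<open>The map and its inverse are Lipschitz with reciprocal constants, so the one-sided
  Lipschitz bound gives both inequalities.\<close>

lemma hausdorff_outer_affine_image:
  fixes A :: "real set"
  assumes L: "0 < L" and s: "0 \<le> s"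
  shows "hausdorff_outer s ((\<lambda>x. L * x + t) ` A) = ennreal (L powr s) * hausdorff_outer s A"
proof (rule antisym)
  show "hausdorff_outer s ((\<lambda>x. L * x + t) ` A) \<le> ennreal (L powr s) * hausdorff_outer s A"
    using L s by (intro hausdorff_outer_lipschitz_image) (auto simp: dist_real_def abs_mult right_diff_distrib[symmetric])
  let ?B = "(\<lambda>x. L * x + t) ` A"
  have "hausdorff_outer s ((\<lambda>x. (x - t) / L) ` ?B) \<le> ennreal ((1 / L) powr s) * hausdorff_outer s ?B"
    using L s by (intro hausdorff_outer_lipschitz_image) (auto simp: dist_real_def diff_divide_distrib[symmetric])
  also have "(\<lambda>x. (x - t) / L) ` ?B = A" using L by (auto simp: image_image)
  finally have "ennreal (L powr s) * hausdorff_outer s A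
     \<le> ennreal (L powr s) * (ennreal ((1 / L) powr s) * hausdorff_outer s ?B)"
    by (rule mult_left_mono) simp
  also have "\<dots> = ennreal (L powr s * (1 / L) powr s) * hausdorff_outer s ?B"
    by (simp add: ennreal_mult mult.assoc)
  also have "L powr s * (1 / L) powr s = 1" using L by (simp flip: powr_mult)
  finally show "ennreal (L powr s) * hausdorff_outer s A \<le> hausdorff_outer s ?B" by simp
qed

section \<open>Geometry of the periodic Cantor set\<close>

lemma cantor_stage_Suc_iff: "x \<in> cantor_stage (Suc n) \<longleftrightarrow> 3 * x \<in> cantor_stage n \<or> 3 * x - 2 \<in> cantor_stage n"
proof -
  have "x \<in> (\<lambda>x. x / 3) ` cantor_stage n \<longleftrightarrow> 3 * x \<in> cantor_stage n"
    by (auto intro: image_eqI[where x="3 * x"])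
  moreover have "x \<in> (\<lambda>x. 2 / 3 + x / 3) ` cantor_stage n \<longleftrightarrow> 3 * x - 2 \<in> cantor_stage n"
    by (auto intro!: image_eqI[where x="3 * x - 2"] simp: field_simps)
  ultimately show ?thesis by simp
qed

lemma cantor_stage_subset: "cantor_stage n \<subseteq> {0..1}"
proof (induction n)
  case (Suc n)
  show ?case
  proof
    fix x assume "x \<in> cantor_stage (Suc n)"
    then have "3 * x \<in> {0..1} \<or> 3 * x - 2 \<in> {0..1}"
      using Suc unfolding cantor_stage_Suc_iff by blast
    then show "x \<in> {0..1}" by auto
  qed
qed simp

lemma compact_cantor_stage: "compact (cantor_stage n)"
  by (induction n) (auto intro!: compact_Un compact_continuous_image continuous_intros)

lemma cantor_set_subset: "cantor_set \<subseteq> {0..1}"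
  unfolding cantor_set_def using cantor_stage_subset by blast

lemma cantor_setD: "x \<in> cantor_set \<Longrightarrow> 0 \<le> x \<and> x \<le> 1"
  using cantor_set_subset by auto

lemma compact_cantor_set: "compact cantor_set"
proof -
  have "closed cantor_set"
    unfolding cantor_set_def by (intro closed_INT ballI compact_imp_closed compact_cantor_stage)
  moreover have "bounded cantor_set" using cantor_set_subset by (rule bounded_subset[rotated]) simp
  ultimately show ?thesis by (simp add: compact_eq_bounded_closed)
qed

lemma cantor_set_iff: "x \<in> cantor_set \<longleftrightarrow> 3 * x \<in> cantor_set \<or> 3 * x - 2 \<in> cantor_set"
proof
  assume x: "x \<in> cantor_set"
  then have st: "3 * x \<in> cantor_stage n \<or> 3 * x - 2 \<in> cantor_stage n" for n
    unfolding cantor_set_def cantor_stage_Suc_iff[symmetric] by blast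
  show "3 * x \<in> cantor_set \<or> 3 * x - 2 \<in> cantor_set"
  \<comment> \<open>The disjunction holds at each stage separately; it has to be resolved in the
    same way at all of them. For x at most 1/2 the point 3x - 2 is negative and lies in no stage,
    otherwise 3x exceeds 1 and lies in none.\<close>
  proof (cases "x \<le> 1/2")
    case True
    then have "3 * x - 2 \<notin> cantor_stage n" for n using cantor_stage_subset[of n] by auto
    then show ?thesis using st by (auto simp: cantor_set_def)
  next
    case False
    then have "3 * x \<notin> cantor_stage n" for n using cantor_stage_subset[of n] by auto
    then show ?thesis using st by (auto simp: cantor_set_def)
  qed
next
  assume a: "3 * x \<in> cantor_set \<or> 3 * x - 2 \<in> cantor_set"
  have suc: "x \<in> cantor_stage (Suc n)" for n
    using a unfolding cantor_stage_Suc_iff by (auto simp: cantor_set_def)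
  have "x \<in> cantor_stage n" for n
  proof (cases n)
    case 0 then show ?thesis using suc[of 0] cantor_stage_subset[of "Suc 0"] by auto
  qed (use suc in auto)
  then show "x \<in> cantor_set" by (simp add: cantor_set_def)
qed

lemma zero_in_cantor_set: "0 \<in> cantor_set"
proof -
  have "0 \<in> cantor_stage n" for n
  proof (induction n)
    case (Suc n) then show ?case unfolding cantor_stage_Suc_iff by simp
  qed simp
  then show ?thesis by (simp add: cantor_set_def)
qed

lemma cantor_line_iff: "x \<in> cantor_line \<longleftrightarrow> (\<exists>k. x - of_int k \<in> cantor_set)"
proof
  assume "\<exists>k. x - of_int k \<in> cantor_set"
  then obtain k where "x - of_int k \<in> cantor_set" by blast
  moreover have "x = (x - of_int k) + of_int k" by simp
  ultimately show "x \<in> cantor_line" unfolding cantor_line_def by blast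
next
  assume "x \<in> cantor_line"
  then obtain y k where "y \<in> cantor_set" "x = y + of_int k" unfolding cantor_line_def by blast
  then show "\<exists>k. x - of_int k \<in> cantor_set" by (intro exI[of _ k]) simp
qed

lemma cantor_lineE:
  assumes "x \<in> cantor_line"
  obtains k where "x - of_int k \<in> cantor_set"
  using assms by (auto simp: cantor_line_iff)

lemma cantor_line_eq: "cantor_line = (\<Union>k. (\<lambda>x. x + of_int k) ` cantor_set)"
  unfolding cantor_line_def by auto

lemma cantor_line_borel [measurable]: "cantor_line \<in> sets borel"
  unfolding cantor_line_eq
  by (intro sets.countable_UN'' borel_closed compact_imp_closed compact_continuous_image
      continuous_intros compact_cantor_set) auto

text \<open>Only finitely many integer translates of the compact Cantor set meet a bounded
  interval.\<close>

lemma compact_cantor_line_Int: "compact (cantor_line \<inter> {a..b})"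
proof -
  have "cantor_line \<inter> {a..b} = (\<Union>k\<in>{\<lfloor>a\<rfloor> - 1..\<lceil>b\<rceil>}. (\<lambda>x. x + of_int k) ` cantor_set) \<inter> {a..b}"
  proof (intro equalityI subsetI)
    fix x assume x: "x \<in> cantor_line \<inter> {a..b}"
    then obtain k where k: "x - of_int k \<in> cantor_set" by (auto simp: cantor_line_iff)
    then have "0 \<le> x - of_int k" "x - of_int k \<le> 1" using cantor_setD by blast+
    then have "k \<in> {\<lfloor>a\<rfloor> - 1..\<lceil>b\<rceil>}" using x by auto linarith+
    then show "x \<in> (\<Union>k\<in>{\<lfloor>a\<rfloor> - 1..\<lceil>b\<rceil>}. (\<lambda>x. x + of_int k) ` cantor_set) \<inter> {a..b}"
      using x k by (auto intro!: bexI[of _ k] image_eqI[of _ _ "x - of_int k"])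
  qed (auto simp: cantor_line_eq)
  also have "compact \<dots>"
    by (intro compact_Int_closed compact_UN compact_continuous_image continuous_intros compact_cantor_set) auto
  finally show ?thesis .
qed

text \<open>Self-similarity in expanding form. Iterated, it pulls the middle-third gaps of unit
  scale back to every ternary scale.\<close>

lemma cantor_line_triple: "x \<in> cantor_line \<Longrightarrow> 3 * x \<in> cantor_line"
proof (erule cantor_lineE)
  fix k assume "x - of_int k \<in> cantor_set"
  then have "3 * x - of_int (3 * k) \<in> cantor_set \<or> 3 * x - of_int (3 * k + 2) \<in> cantor_set"
    using cantor_set_iff[of "x - of_int k"] by (simp add: algebra_simps)
  then show ?thesis unfolding cantor_line_iff by blast
qed

lemma cantor_line_power: "x \<in> cantor_line \<Longrightarrow> 3 ^ n * x \<in> cantor_line"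
  by (induction n) (auto dest: cantor_line_triple simp: mult.assoc)

lemma cantor_line_gap:
  assumes "of_int k + 1 / 3 < x" "x < of_int k + 2 / 3"
  shows "x \<notin> cantor_line"
proof
  assume "x \<in> cantor_line"
  then obtain j where j: "x - of_int j \<in> cantor_set" by (rule cantor_lineE)
  then have "0 \<le> x - of_int j" "x - of_int j \<le> 1" using cantor_setD by blast+
  then have "j = k" using assms by linarith
  moreover have "3 * (x - of_int j) \<le> 1 \<or> 0 \<le> 3 * (x - of_int j) - 2"
    using j cantor_set_iff[of "x - of_int j"] cantor_setD by blast
  ultimately show False using assms by auto
qed

lemma ex_ternary_scale:
  fixes d :: real
  assumes "0 < d" "d < 1"
  obtains n where "(1/3) ^ Suc n \<le> d" "d < (1/3) ^ n"
proof -
  obtain m where "(1/3) ^ m < d" using real_arch_pow_inv[of d "1/3"] assms by auto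
  then have ex: "(1/3) ^ m \<le> d" by simp
  define l where "l = (LEAST n. (1/3) ^ n \<le> d)"
  have l: "(1/3) ^ l \<le> d" unfolding l_def by (rule LeastI[where P="\<lambda>n. (1/3) ^ n \<le> d", OF ex])
  then have "l \<noteq> 0" using assms by (intro notI) auto
  then obtain n where n: "l = Suc n" by (cases l) auto
  have "\<not> (1/3) ^ n \<le> d" using not_less_Least[of n "\<lambda>n. (1/3) ^ n \<le> d"] n by (auto simp: l_def)
  then show ?thesis using that[of n] l n by auto
qed

text \<open>Take the ternary scale q with 2q <= r < 6q and the first multiple of q to the right of
  a. It lies before a + q, so the middle third of the q-cell starting there is a gap inside the
  interval, and its length q/3 exceeds r/18.\<close>

lemma cantor_line_porous:
  assumes r: "0 < r" "r \<le> 1"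
  obtains b where "a \<le> b" "b + r / 18 \<le> a + r" "cantor_line \<inter> {b<..<b + r / 18} = {}"
proof -
  obtain n where n: "(1/3) ^ Suc n \<le> r / 2" "r / 2 < (1/3) ^ n"
    using ex_ternary_scale[of "r / 2"] r by auto
  define q :: real where "q = (1/3) ^ Suc n"
  have q: "0 < q" "2 * q \<le> r" "r < 6 * q" using n by (auto simp: q_def)
  have q3: "3 ^ Suc n * q = 1" by (simp add: q_def power_mult_distrib[symmetric] del: power_Suc)
  define k where "k = \<lceil>a / q\<rceil>"
  have k1: "a \<le> q * of_int k" using q pos_divide_le_eq[of q a "of_int k"] le_of_int_ceiling[of "a / q"] unfolding k_def by (simp add: mult.commute)
  have k2: "q * of_int k < a + q"
  proof -
    have "of_int k < a / q + 1" unfolding k_def by linarith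
    then show ?thesis using q by (simp add: field_simps)
  qed
  show ?thesis
  proof (rule that[of "q * of_int k + q / 3"])
    show "cantor_line \<inter> {q * of_int k + q / 3<..<q * of_int k + q / 3 + r / 18} = {}"
    proof (rule ccontr)
      assume "cantor_line \<inter> {q * of_int k + q / 3<..<q * of_int k + q / 3 + r / 18} \<noteq> {}"
      then obtain x where x: "x \<in> cantor_line" "q * of_int k + q / 3 < x" "x < q * of_int k + q / 3 + r / 18"
        by auto
      have "x < q * of_int k + 2 * q / 3" using x q by linarith
      then have "3 ^ Suc n * x < 3 ^ Suc n * (q * of_int k + 2 * q / 3)" by (intro mult_strict_left_mono) auto
      also have "\<dots> = (3 ^ Suc n * q) * (of_int k + 2 / 3)" by (simp add: algebra_simps)
      finally have 1: "3 ^ Suc n * x < of_int k + 2 / 3" unfolding q3 by (simp only: mult_1)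
      have "3 ^ Suc n * x > 3 ^ Suc n * (q * of_int k + q / 3)" using x by (intro mult_strict_left_mono) auto
      also have "3 ^ Suc n * (q * of_int k + q / 3) = (3 ^ Suc n * q) * (of_int k + 1 / 3)" by (simp add: algebra_simps)
      finally have 2: "3 ^ Suc n * x > of_int k + 1 / 3" unfolding q3 by (simp only: mult_1)
      show False using cantor_line_gap[OF 2 1] cantor_line_power[OF x(1), of "Suc n"] by blast
    qed
  qed (use q k1 k2 in auto)
qed

text \<open>The closed interval runs from the right end of a gap on the left of the inner ball to
  the left end of a gap on its right. A point of the line outside it has to lie beyond one of these
  gaps.\<close>

lemma cantor_line_clopen:
  assumes r: "0 < r" "r \<le> 1"
  obtains a b where "ball x R \<subseteq> {a..b}" "{a..b} \<subseteq> ball x (R + r) \<or> b < a"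
    "\<And>y z. y \<in> {a..b} \<Longrightarrow> z \<in> cantor_line - {a..b} \<Longrightarrow> r / 18 \<le> \<bar>y - z\<bar>"
proof -
  obtain b where b: "x + R \<le> b" "b + r / 18 \<le> x + R + r" "cantor_line \<inter> {b<..<b + r / 18} = {}"
    using cantor_line_porous[OF r] by blast
  obtain a where a: "x - R - r \<le> a" "a + r / 18 \<le> x - R - r + r" "cantor_line \<inter> {a<..<a + r / 18} = {}"
    using cantor_line_porous[OF r] by blast
  show ?thesis
  proof (rule that[of "a + r / 18" b])
    show "ball x R \<subseteq> {a + r / 18..b}" using a b by (auto simp: dist_real_def)
    show "{a + r / 18..b} \<subseteq> ball x (R + r) \<or> b < a + r / 18" using a b r by (auto simp: dist_real_def)
  next
    fix y z assume y: "y \<in> {a + r / 18..b}" and z: "z \<in> cantor_line - {a + r / 18..b}"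
    have "z \<notin> {b<..<b + r / 18}" "z \<notin> {a<..<a + r / 18}" using z a(3) b(3) by auto
    then show "r / 18 \<le> \<bar>y - z\<bar>" using y z by auto
  qed
qed

section \<open>The Hausdorff measure of the periodic Cantor set\<close>

abbreviation "cantor_H \<equiv> (hausdorff_outer cantor_dim :: real set \<Rightarrow> ennreal)"

lemma cantor_dim_bounds: "0 < cantor_dim" "cantor_dim < 1"
  by (simp_all add: cantor_dim_def log_less_one_cancel_iff)

lemma third_powr_cantor_dim: "(1/3) powr cantor_dim = (1/2 :: real)"
  by (simp add: cantor_dim_def powr_divide powr_log_cancel)

lemma third_power_powr_cantor_dim: "((1/3) ^ n) powr cantor_dim = (1/2 :: real) ^ n"
proof (induction n)
  case (Suc n)
  have "((1/3 :: real) ^ Suc n) powr cantor_dim = ((1/3) * (1/3) ^ n) powr cantor_dim" by (simp only: power_Suc)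
  also have "\<dots> = (1/3) powr cantor_dim * ((1/3) ^ n) powr cantor_dim" by (rule powr_mult)
  also have "\<dots> = (1/2) * (1/2) ^ n" by (simp only: third_powr_cantor_dim Suc.IH)
  finally show ?case by (simp only: power_Suc)
qed simp

lemma cantor_H_third_image:
  assumes "B \<subseteq> (\<lambda>x. x / 3 + t) ` A"
  shows "cantor_H B \<le> ennreal (1/2) * cantor_H A"
proof -
  have "cantor_H B \<le> cantor_H ((\<lambda>x. (1/3) * x + t) ` A)" using assms by (intro hausdorff_outer_mono) simp
  also have "\<dots> = ennreal (1/2) * cantor_H A"
    using cantor_dim_bounds by (subst hausdorff_outer_affine_image) (simp, simp, simp only: third_powr_cantor_dim)
  finally show ?thesis .
qed

lemma cantor_H_translate: "cantor_H ((\<lambda>x. x + t) ` A) = cantor_H A"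
  using hausdorff_outer_affine_image[of 1 cantor_dim t A] cantor_dim_bounds by simp

lemma cantor_set_halves:
  "cantor_set = (\<lambda>x. (1/3) * x) ` cantor_set \<union> (\<lambda>x. (1/3) * x + 2/3) ` cantor_set"
proof (intro equalityI subsetI)
  fix x assume "x \<in> cantor_set"
  then have "3 * x \<in> cantor_set \<or> 3 * x - 2 \<in> cantor_set" using cantor_set_iff by blast
  then show "x \<in> (\<lambda>x. (1/3) * x) ` cantor_set \<union> (\<lambda>x. (1/3) * x + 2/3) ` cantor_set"
  proof
    assume "3 * x - 2 \<in> cantor_set"
    then have "x \<in> (\<lambda>x. (1/3) * x + 2/3) ` cantor_set" by (intro image_eqI[where x="3 * x - 2"]) (simp_all add: field_simps)
    then show ?thesis by blast
  next
    assume "3 * x \<in> cantor_set"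
    then have "x \<in> (\<lambda>x. (1/3) * x) ` cantor_set" by (intro image_eqI[where x="3 * x"]) auto
    then show ?thesis by blast
  qed
next
  fix x assume "x \<in> (\<lambda>x. (1/3) * x) ` cantor_set \<union> (\<lambda>x. (1/3) * x + 2/3) ` cantor_set"
  then show "x \<in> cantor_set" by (subst cantor_set_iff) auto
qed

text \<open>Induction over the mesh 3^-n: the set consists of two copies contracted by 1/3,
  contraction refines the mesh by one step, and each copy has content at most (1/3)^alpha = 1/2
  times the old bound.\<close>

lemma cantor_H_cantor_set_le: "cantor_H cantor_set \<le> 1"
proof -
  have "hausdorff_content cantor_dim ((1/3) ^ n) cantor_set \<le> 1" for n
  proof (induction n)
    case 0
    have "hausdorff_content cantor_dim ((1/3) ^ 0) cantor_set
      \<le> (\<Sum>i. ennreal (diameter (if i = (0::nat) then {0..1::real} else {}) powr cantor_dim))"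
      using cantor_set_subset by (intro hausdorff_content_le) auto
    also have "\<dots> = (\<Sum>i\<in>{0::nat}. ennreal (diameter (if i = (0::nat) then {0..1::real} else {}) powr cantor_dim))"
      by (intro suminf_finite) auto
    finally show ?case by simp
  next
    case (Suc n)
    have half: "hausdorff_content cantor_dim ((1/3) * (1/3) ^ n) ((\<lambda>x. (1/3) * x + t) ` cantor_set)
       \<le> ennreal (1/2) * 1" for t :: real
    proof -
      have "hausdorff_content cantor_dim ((1/3) * (1/3) ^ n) ((\<lambda>x. (1/3) * x + t) ` cantor_set)
       \<le> ennreal ((1/3) powr cantor_dim) * hausdorff_content cantor_dim ((1/3) ^ n) cantor_set"
        using cantor_dim_bounds by (intro hausdorff_content_lipschitz_image) (auto simp: dist_real_def abs_if)
      also have "\<dots> \<le> ennreal (1/2) * 1"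
        unfolding third_powr_cantor_dim by (intro mult_left_mono Suc.IH) auto
      finally show ?thesis .
    qed
    have "hausdorff_content cantor_dim ((1/3) ^ Suc n) cantor_set
      \<le> hausdorff_content cantor_dim ((1/3) * (1/3) ^ n) ((\<lambda>x. (1/3) * x) ` cantor_set)
       + hausdorff_content cantor_dim ((1/3) * (1/3) ^ n) ((\<lambda>x. (1/3) * x + 2/3) ` cantor_set)"
      by (subst cantor_set_halves, unfold power_Suc) (rule hausdorff_content_Un_le, simp)
    also have "\<dots> \<le> ennreal (1/2) * 1 + ennreal (1/2) * 1"
      using half[of 0] half[of "2/3"] by (intro add_mono) auto
    also have "\<dots> = 1" unfolding mult_1_right by (subst ennreal_plus[symmetric]) auto
    finally show ?case .
  qed
  then have "hausdorff_content cantor_dim \<delta> cantor_set \<le> 1" if d: "0 < \<delta>" for \<delta>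
  proof -
    obtain n where "(1/3) ^ n < \<delta>" using real_arch_pow_inv[of \<delta> "1/3"] d by auto
    then have "hausdorff_content cantor_dim \<delta> cantor_set \<le> hausdorff_content cantor_dim ((1/3)^n) cantor_set"
      by (intro hausdorff_content_antimono) auto
    also have "\<dots> \<le> 1" by fact
    finally show ?thesis .
  qed
  then show ?thesis unfolding hausdorff_outer_def by (intro SUP_least) auto
qed

text \<open>
  Reading binary digits of \<open>t\<close> as ternary digits \<open>0, 2\<close> gives a map into the Cantor set whose inverse is
  Hoelder continuous of exponent \<open>cantor_dim\<close>; it transports coverings of the Cantor set to coverings of the unit interval.
\<close>

primrec cantor_digits :: "nat \<Rightarrow> real \<Rightarrow> real" where
  "cantor_digits 0 t = 0"
| "cantor_digits (Suc n) t = (if t < 1/2 then cantor_digits n (2 * t) / 3 else 2/3 + cantor_digits n (2 * t - 1) / 3)"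

definition cantor_embed :: "real \<Rightarrow> real" where
  "cantor_embed t = lim (\<lambda>n. cantor_digits n t)"

lemma cantor_digits_in: "cantor_digits n t \<in> cantor_set"
proof (induction n arbitrary: t)
  case (Suc n)
  have "3 * cantor_digits (Suc n) t = cantor_digits n (2 * t) \<or> 3 * cantor_digits (Suc n) t - 2 = cantor_digits n (2 * t - 1)"
    by auto
  then show ?case using Suc by (subst cantor_set_iff) metis
qed (simp add: zero_in_cantor_set)

lemma cantor_digits_lim: "(\<lambda>n. cantor_digits n t) \<longlonglongrightarrow> cantor_embed t"
proof -
  have "cantor_digits n t \<le> cantor_digits (Suc n) t" for n
  proof (induction n arbitrary: t)
    case (Suc n)
    show ?case
    proof (cases "t < 1/2")
      case True
      then show ?thesis using Suc[of "2 * t"] by (subst (1 2) cantor_digits.simps(2)) simp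
    next
      case False
      then show ?thesis using Suc[of "2 * t - 1"] by (subst (1 2) cantor_digits.simps(2)) simp
    qed
  qed auto
  then have "incseq (\<lambda>n. cantor_digits n t)" by (rule incseq_SucI)
  then have "\<exists>L. (\<lambda>n. cantor_digits n t) \<longlonglongrightarrow> L"
    using cantor_setD[OF cantor_digits_in] by (meson incseq_convergent)
  then show ?thesis unfolding cantor_embed_def by (simp add: convergent_def flip: convergent_LIMSEQ_iff)
qed

lemma cantor_embed_in: "cantor_embed t \<in> cantor_set"
  using closed_sequentially[OF compact_imp_closed[OF compact_cantor_set] _ cantor_digits_lim] cantor_digits_in by blast

lemma cantor_embed_rec:
  "cantor_embed t = (if t < 1/2 then cantor_embed (2 * t) / 3 else 2/3 + cantor_embed (2 * t - 1) / 3)"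
proof (rule LIMSEQ_unique)
  show "(\<lambda>n. cantor_digits (Suc n) t) \<longlonglongrightarrow> cantor_embed t" by (rule LIMSEQ_Suc[OF cantor_digits_lim])
  show "(\<lambda>n. cantor_digits (Suc n) t) \<longlonglongrightarrow> (if t < 1/2 then cantor_embed (2 * t) / 3 else 2/3 + cantor_embed (2 * t - 1) / 3)"
    by (cases "t < 1/2") (auto intro!: tendsto_intros cantor_digits_lim)
qed

text \<open>Parameters in different halves have images in different outer thirds, at distance at
  least 1/3, which the hypothesis excludes. Parameters in the same half are rescaled by 2 while the
  images are rescaled by 3.\<close>

lemma cantor_embed_separates:
  "t \<in> {0..<1} \<Longrightarrow> t' \<in> {0..<1} \<Longrightarrow> \<bar>cantor_embed t - cantor_embed t'\<bar> < (1/3) ^ n \<Longrightarrow> \<bar>t - t'\<bar> \<le> (1/2) ^ n"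
proof (induction n arbitrary: t t')
  case (Suc n)
  have third: "(1/3 :: real) ^ Suc n \<le> 1/3" by (simp add: power_le_one)
  note E = cantor_setD[OF cantor_embed_in]
  consider "t < 1/2" "t' < 1/2" | "1/2 \<le> t" "1/2 \<le> t'" | "t < 1/2" "1/2 \<le> t'" | "1/2 \<le> t" "t' < 1/2" by linarith
  then show ?case
  proof cases
    case 1
    then have "cantor_embed t = cantor_embed (2 * t) / 3" "cantor_embed t' = cantor_embed (2 * t') / 3"
      by (subst cantor_embed_rec, simp)+
    then have "\<bar>cantor_embed (2 * t) - cantor_embed (2 * t')\<bar> < (1/3) ^ n"
      using Suc.prems(3) by (simp add: abs_if split: if_splits)
    then have "\<bar>2 * t - 2 * t'\<bar> \<le> (1/2) ^ n" using 1 Suc.prems by (intro Suc.IH) auto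
    then show ?thesis by (simp add: abs_if split: if_splits)
  next
    case 2
    then have "cantor_embed t = 2/3 + cantor_embed (2 * t - 1) / 3" "cantor_embed t' = 2/3 + cantor_embed (2 * t' - 1) / 3"
      by (subst cantor_embed_rec, simp)+
    then have "\<bar>cantor_embed (2 * t - 1) - cantor_embed (2 * t' - 1)\<bar> < (1/3) ^ n"
      using Suc.prems(3) by (simp add: abs_if split: if_splits)
    then have "\<bar>(2 * t - 1) - (2 * t' - 1)\<bar> \<le> (1/2) ^ n" using 2 Suc.prems by (intro Suc.IH) auto
    then show ?thesis by (simp add: abs_if split: if_splits)
  next
    case 3
    then have "cantor_embed t \<le> 1/3" "2/3 \<le> cantor_embed t'"
      using E[of "2 * t"] E[of "2 * t' - 1"] by (subst cantor_embed_rec, simp)+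
    then show ?thesis using Suc.prems(3) third by linarith
  next
    case 4
    then have "cantor_embed t' \<le> 1/3" "2/3 \<le> cantor_embed t"
      using E[of "2 * t'"] E[of "2 * t - 1"] by (subst cantor_embed_rec, simp)+
    then show ?thesis using Suc.prems(3) third by linarith
  qed
qed auto

text \<open>For 3^-(n+1) <= d < 3^-n the previous lemma gives 2^-n, which is 2 (3^-(n+1))^alpha and
  hence at most 2 d^alpha. The factor 2 is the loss from rounding d to a ternary scale.\<close>

lemma cantor_embed_inverse_holder:
  assumes t: "t \<in> {0..<1}" "t' \<in> {0..<1}" and d: "\<bar>cantor_embed t - cantor_embed t'\<bar> \<le> d"
  shows "\<bar>t - t'\<bar> \<le> 2 * d powr cantor_dim"
proof -
  consider "d = 0" | "1 \<le> d" | "0 < d" "d < 1" using d by linarith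
  then show ?thesis
  proof cases
    case 1
    have "\<bar>t - t'\<bar> \<le> (1/2) ^ n" for n using d 1 by (intro cantor_embed_separates t) auto
    moreover have "(\<lambda>n. (1/2 :: real) ^ n) \<longlonglongrightarrow> 0" by (rule LIMSEQ_power_zero) simp
    ultimately have "\<bar>t - t'\<bar> \<le> 0" by (intro LIMSEQ_le_const[of "\<lambda>n. (1/2 :: real) ^ n" 0]) auto
    then show ?thesis by (metis mult_nonneg_nonneg order_trans powr_ge_zero zero_le_numeral)
  next
    case 2
    then have "1 \<le> d powr cantor_dim" using cantor_dim_bounds by (intro ge_one_powr_ge_zero) auto
    then show ?thesis using t by auto
  next
    case 3
    then obtain n where n: "(1/3) ^ Suc n \<le> d" "d < (1/3) ^ n" by (rule ex_ternary_scale)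
    have "\<bar>t - t'\<bar> \<le> (1/2) ^ n" using d n by (intro cantor_embed_separates t) auto
    also have "\<dots> = 2 * ((1/3) ^ Suc n) powr cantor_dim" unfolding third_power_powr_cantor_dim by simp
    also have "\<dots> \<le> 2 * d powr cantor_dim" using n cantor_dim_bounds by (intro mult_left_mono powr_mono2) auto
    finally show ?thesis .
  qed
qed

text \<open>A cover by sets \<open>U i\<close> makes the parameters mapped into \<open>U i\<close>
  lie in an interval of length 4 (diam U_i)^alpha around any one of them. These intervals cover
  [0,1), so the lengths sum to at least 1. Intervals replace the preimages because the latter need
  not be measurable; where a preimage is empty the chosen centre is arbitrary and harmless.\<close>

lemma cantor_H_cantor_set_ge: "ennreal (1/4) \<le> cantor_H cantor_set"
proof -
  have "ennreal (1/4) \<le> (\<Sum>i. ennreal (diameter (U i) powr cantor_dim))"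
    if U: "cantor_set \<subseteq> (\<Union>i. U i)" "\<forall>i. bounded (U i) \<and> diameter (U i) \<le> 1" for U :: "nat \<Rightarrow> real set"
  proof -
    define D where "D i = {t\<in>{0..<1}. cantor_embed t \<in> U i}" for i
    define t where "t i = (SOME t. t \<in> D i)" for i
    define I where "I i = {t i - 2 * diameter (U i) powr cantor_dim .. t i + 2 * diameter (U i) powr cantor_dim}" for i
    have DI: "D i \<subseteq> I i" for i
    proof
      fix s assume s: "s \<in> D i"
      then have ti: "t i \<in> D i" unfolding t_def by (rule someI)
      have "\<bar>t i - s\<bar> \<le> 2 * diameter (U i) powr cantor_dim"
      proof (rule cantor_embed_inverse_holder)
        have "dist (cantor_embed (t i)) (cantor_embed s) \<le> diameter (U i)"
          using U(2) ti s by (intro diameter_bounded_bound) (auto simp: D_def)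
        then show "\<bar>cantor_embed (t i) - cantor_embed s\<bar> \<le> diameter (U i)" by (simp add: dist_real_def)
      qed (use ti s in \<open>auto simp: D_def\<close>)
      then show "s \<in> I i" by (auto simp: I_def)
    qed
    have cov: "{0..<1} \<subseteq> (\<Union>i. D i)"
    proof
      fix s :: real assume "s \<in> {0..<1}"
      moreover obtain i where "cantor_embed s \<in> U i" using U(1) cantor_embed_in[of s] by blast
      ultimately show "s \<in> (\<Union>i. D i)" by (auto simp: D_def)
    qed
    have "{0..<1} \<subseteq> (\<Union>i. I i)" by (rule order_trans[OF cov UN_mono[OF order_refl DI]])
    then have "emeasure lborel {0..<1::real} \<le> emeasure lborel (\<Union>i. I i)"
      by (intro emeasure_mono) (auto simp: I_def)
    also have "\<dots> \<le> (\<Sum>i. emeasure lborel (I i))"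
      by (intro emeasure_subadditive_countably) (auto simp: I_def)
    also have "\<dots> = (\<Sum>i. ennreal 4 * ennreal (diameter (U i) powr cantor_dim))"
      by (intro suminf_cong) (simp add: I_def ennreal_mult[symmetric] del: ennreal_numeral)
    also have "\<dots> = ennreal 4 * (\<Sum>i. ennreal (diameter (U i) powr cantor_dim))" by simp
    finally have "ennreal (1/4) * 1 \<le> ennreal (1/4) * (ennreal 4 * (\<Sum>i. ennreal (diameter (U i) powr cantor_dim)))"
      by (intro mult_left_mono) auto
    then show ?thesis by (simp add: mult.assoc[symmetric] ennreal_mult[symmetric] del: ennreal_numeral)
  qed
  then have "ennreal (1/4) \<le> hausdorff_content cantor_dim 1 cantor_set"
    unfolding hausdorff_content_def by (intro INF_greatest) auto
  also have "\<dots> \<le> cantor_H cantor_set" by (rule hausdorff_content_le_outer) simp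
  finally show ?thesis .
qed

text \<open>An interval shorter than 1/3 cannot meet both outer thirds, so one of the two
  similarities maps the piece onto a piece three times as long, at the cost of a factor 1/2.\<close>

lemma cantor_H_cantor_set_Int_le: "b - a < (1/3) ^ n \<Longrightarrow> cantor_H (cantor_set \<inter> {a..b}) \<le> ennreal ((1/2) ^ n)"
proof (induction n arbitrary: a b)
  case 0
  have "cantor_H (cantor_set \<inter> {a..b}) \<le> cantor_H cantor_set" by (rule hausdorff_outer_mono) auto
  then show ?case using cantor_H_cantor_set_le by simp
next
  case (Suc n)
  have third: "(1/3 :: real) ^ Suc n \<le> 1/3" by (simp add: power_le_one)
  have e: "ennreal (1/2) * ennreal ((1/2) ^ n) = ennreal ((1/2) ^ Suc n)"
    by (subst ennreal_mult[symmetric]) auto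
  have "b < 2/3 \<or> 1/3 < a" using Suc.prems third by linarith
  then show ?case
  proof
    assume "b < 2/3"
    have "cantor_H (cantor_set \<inter> {a..b}) \<le> ennreal (1/2) * cantor_H (cantor_set \<inter> {3 * a..3 * b})"
    proof (rule cantor_H_third_image[of _ 0], rule subsetI)
      fix x assume x: "x \<in> cantor_set \<inter> {a..b}"
      then have "3 * x \<in> cantor_set" using \<open>b < 2/3\<close> cantor_set_iff[of x] cantor_setD[of "3 * x - 2"] by auto
      then show "x \<in> (\<lambda>x. x / 3 + 0) ` (cantor_set \<inter> {3 * a..3 * b})" using x by (auto intro!: image_eqI[of _ _ "3 * x"])
    qed
    also have "\<dots> \<le> ennreal (1/2) * ennreal ((1/2) ^ n)"
      using Suc.prems by (intro mult_left_mono Suc.IH) auto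
    finally show ?thesis unfolding e .
  next
    assume "1/3 < a"
    have "cantor_H (cantor_set \<inter> {a..b}) \<le> ennreal (1/2) * cantor_H (cantor_set \<inter> {3 * a - 2..3 * b - 2})"
    proof (rule cantor_H_third_image[of _ "2/3"], rule subsetI)
      fix x assume x: "x \<in> cantor_set \<inter> {a..b}"
      then have "3 * x - 2 \<in> cantor_set" using \<open>1/3 < a\<close> cantor_set_iff[of x] cantor_setD[of "3 * x"] by auto
      then show "x \<in> (\<lambda>x. x / 3 + 2/3) ` (cantor_set \<inter> {3 * a - 2..3 * b - 2})"
        using x by (auto intro!: image_eqI[of _ _ "3 * x - 2"] simp: field_simps)
    qed
    also have "\<dots> \<le> ennreal (1/2) * ennreal ((1/2) ^ n)"
      using Suc.prems by (intro mult_left_mono Suc.IH) auto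
    finally show ?thesis unfolding e .
  qed
qed

lemma cantor_H_cantor_set_Int_ge:
  "x \<in> cantor_set \<Longrightarrow> ennreal (1/4 * (1/2) ^ n) \<le> cantor_H (cantor_set \<inter> {x - (1/3) ^ n..x + (1/3) ^ n})"
proof (induction n arbitrary: x)
  case 0
  then have "cantor_set \<inter> {x - (1/3) ^ 0..x + (1/3) ^ 0} = cantor_set"
    using cantor_setD[OF 0] cantor_setD by fastforce
  then show ?case using cantor_H_cantor_set_ge by simp
next
  case (Suc n)
  obtain t where t: "t = 0 \<or> t = 2" "3 * x - t \<in> cantor_set"
    using Suc.prems cantor_set_iff[of x] by (metis diff_zero)
  let ?A = "cantor_set \<inter> {3 * x - t - (1/3) ^ n..3 * x - t + (1/3) ^ n}"
  have "ennreal (1/4 * (1/2) ^ Suc n) = ennreal (1/2) * ennreal (1/4 * (1/2) ^ n)"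
    by (subst ennreal_mult[symmetric]) auto
  also have "\<dots> \<le> ennreal (1/2) * cantor_H ?A" by (intro mult_left_mono Suc.IH t) auto
  also have "\<dots> = cantor_H ((\<lambda>y. (1/3) * y + t / 3) ` ?A)"
    using cantor_dim_bounds by (subst hausdorff_outer_affine_image) (simp, simp, simp only: third_powr_cantor_dim)
  also have "\<dots> \<le> cantor_H (cantor_set \<inter> {x - (1/3) ^ Suc n..x + (1/3) ^ Suc n})"
  proof (rule hausdorff_outer_mono, clarify)
    fix y assume y: "y \<in> cantor_set" "y \<in> {3 * x - t - (1/3) ^ n..3 * x - t + (1/3) ^ n}"
    have "(1/3) * y + t / 3 \<in> cantor_set" using t(1) y(1) by (subst cantor_set_iff) auto
    then show "(1/3) * y + t / 3 \<in> cantor_set \<inter> {x - (1/3) ^ Suc n..x + (1/3) ^ Suc n}" using y(2) by auto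
  qed
  finally show ?case .
qed

text \<open>An interval shorter than 1 meets at most the unit cells with index k - 1 and k, where k
  is the ceiling of a; hence the factor 2.\<close>

lemma cantor_H_line_Int_le:
  assumes "b - a < (1/3) ^ n"
  shows "cantor_H (cantor_line \<inter> {a..b}) \<le> ennreal (2 * (1/2) ^ n)"
proof -
  define k where "k = \<lceil>a\<rceil>"
  have n1: "(1/3 :: real) ^ n \<le> 1" by (simp add: power_le_one)
  have sub: "cantor_line \<inter> {a..b} \<subseteq> (\<lambda>x. x + of_int (k - 1)) ` (cantor_set \<inter> {a - of_int (k - 1)..b - of_int (k - 1)})
     \<union> (\<lambda>x. x + of_int k) ` (cantor_set \<inter> {a - of_int k..b - of_int k})"
  proof
    fix x assume x: "x \<in> cantor_line \<inter> {a..b}"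
    then obtain j where j: "x - of_int j \<in> cantor_set" by (auto simp: cantor_line_iff)
    then have "0 \<le> x - of_int j" "x - of_int j \<le> 1" using cantor_setD by blast+
    then have "j = k - 1 \<or> j = k" using x assms n1 unfolding k_def by auto linarith
    then show "x \<in> (\<lambda>x. x + of_int (k - 1)) ` (cantor_set \<inter> {a - of_int (k - 1)..b - of_int (k - 1)})
     \<union> (\<lambda>x. x + of_int k) ` (cantor_set \<inter> {a - of_int k..b - of_int k})"
      using j x by (auto intro!: image_eqI[of _ _ "x - of_int j"])
  qed
  have "cantor_H (cantor_line \<inter> {a..b}) \<le>
     cantor_H ((\<lambda>x. x + of_int (k - 1)) ` (cantor_set \<inter> {a - of_int (k - 1)..b - of_int (k - 1)}))
     + cantor_H ((\<lambda>x. x + of_int k) ` (cantor_set \<inter> {a - of_int k..b - of_int k}))"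
    by (rule order_trans[OF hausdorff_outer_mono[OF sub] hausdorff_outer_Un_le])
  also have "\<dots> \<le> ennreal ((1/2) ^ n) + ennreal ((1/2) ^ n)"
    unfolding cantor_H_translate using assms by (intro add_mono cantor_H_cantor_set_Int_le) auto
  also have "\<dots> = ennreal (2 * (1/2) ^ n)" by (simp flip: ennreal_plus)
  finally show ?thesis .
qed

lemma cantor_V_nonneg: "0 \<le> cantor_V r" by (simp add: cantor_V_def le_max_iff_disj)

lemma cantor_V_pos: "0 < r \<Longrightarrow> 0 < cantor_V r" by (simp add: cantor_V_def less_max_iff_disj)

lemma cantor_V_small: "0 \<le> r \<Longrightarrow> r \<le> 1 \<Longrightarrow> cantor_V r = r powr cantor_dim"
proof -
  assume r: "0 \<le> r" "r \<le> 1"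
  have "r powr 1 \<le> r powr cantor_dim" using r cantor_dim_bounds by (intro powr_mono') auto
  then show ?thesis using r by (simp add: cantor_V_def max_def)
qed

lemma cantor_V_mono: "0 \<le> r \<Longrightarrow> r \<le> s \<Longrightarrow> cantor_V r \<le> cantor_V s"
  unfolding cantor_V_def using cantor_dim_bounds by (intro max.mono powr_mono2) auto

text \<open>Because the dimension is below 1, c^alpha <= c, and linear growth dominates both
  branches of the maximum.\<close>

lemma cantor_V_mult_le: "1 \<le> c \<Longrightarrow> 0 \<le> r \<Longrightarrow> cantor_V (c * r) \<le> c * cantor_V r"
proof -
  assume c: "1 \<le> c" and r: "0 \<le> r"
  have "c powr cantor_dim \<le> c powr 1" using c cantor_dim_bounds by (intro powr_mono) auto
  then have "c powr cantor_dim * r powr cantor_dim \<le> c * r powr cantor_dim" using c by (intro mult_right_mono) auto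
  also have "c * r powr cantor_dim \<le> c * cantor_V r" using c by (intro mult_left_mono) (auto simp: cantor_V_def)
  finally have "(c * r) powr cantor_dim \<le> c * cantor_V r" using c r by (simp add: powr_mult)
  moreover have "c * r \<le> c * cantor_V r" using c by (intro mult_left_mono) (auto simp: cantor_V_def)
  ultimately show ?thesis by (simp add: cantor_V_def[of "c * r"])
qed

text \<open>Below length 1 the constant 4 is 2 for two unit cells times 2 for rounding to a ternary
  scale. From length 1 on, at most b - a + 2 cells of mass at most 1 are counted.\<close>

lemma cantor_H_line_Int_le_V:
  assumes "a < b"
  shows "cantor_H (cantor_line \<inter> {a..b}) \<le> ennreal (4 * cantor_V (b - a))"
proof (cases "b - a < 1")
  case True
  then obtain n where n: "(1/3) ^ Suc n \<le> b - a" "b - a < (1/3) ^ n"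
    using ex_ternary_scale[of "b - a"] assms by auto
  have "cantor_H (cantor_line \<inter> {a..b}) \<le> ennreal (2 * (1/2) ^ n)" by (rule cantor_H_line_Int_le[OF n(2)])
  also have "2 * (1/2) ^ n = 4 * ((1/3) ^ Suc n) powr cantor_dim"
    unfolding third_power_powr_cantor_dim by simp
  also have "\<dots> \<le> 4 * (b - a) powr cantor_dim" using n cantor_dim_bounds by (intro mult_left_mono powr_mono2) auto
  also have "(b - a) powr cantor_dim = cantor_V (b - a)" using True assms by (simp add: cantor_V_small)
  finally show ?thesis by (simp add: ennreal_leI)
next
  case False
  define I where "I = {\<lceil>a\<rceil> - 1..\<lfloor>b\<rfloor>}"
  have "cantor_line \<inter> {a..b} \<subseteq> (\<Union>k\<in>I. (\<lambda>x. x + of_int k) ` cantor_set)"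
  proof
    fix x assume x: "x \<in> cantor_line \<inter> {a..b}"
    then obtain j where j: "x - of_int j \<in> cantor_set" by (auto simp: cantor_line_iff)
    then have "0 \<le> x - of_int j" "x - of_int j \<le> 1" using cantor_setD by blast+
    then have "j \<in> I" using x unfolding I_def by auto linarith+
    then show "x \<in> (\<Union>k\<in>I. (\<lambda>x. x + of_int k) ` cantor_set)"
      using j by (auto intro!: bexI[of _ j] image_eqI[of _ _ "x - of_int j"])
  qed
  then have "cantor_H (cantor_line \<inter> {a..b}) \<le> cantor_H (\<Union>k\<in>I. (\<lambda>x. x + of_int k) ` cantor_set)"
    by (rule hausdorff_outer_mono)
  also have "\<dots> \<le> (\<Sum>k\<in>I. cantor_H ((\<lambda>x. x + of_int k) ` cantor_set))"
  proof -
    have "cantor_H (\<Union>k\<in>F. (\<lambda>x. x + of_int k) ` cantor_set) \<le> (\<Sum>k\<in>F. cantor_H ((\<lambda>x. x + of_int k) ` cantor_set))"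
      if "finite F" for F :: "int set"
      using that
    proof induction
      case (insert k F)
      have "cantor_H (\<Union>k\<in>insert k F. (\<lambda>x. x + of_int k) ` cantor_set) \<le>
        cantor_H ((\<lambda>x. x + of_int k) ` cantor_set) + cantor_H (\<Union>k\<in>F. (\<lambda>x. x + of_int k) ` cantor_set)"
        unfolding UN_insert by (rule hausdorff_outer_Un_le)
      also have "\<dots> \<le> cantor_H ((\<lambda>x. x + of_int k) ` cantor_set) + (\<Sum>k\<in>F. cantor_H ((\<lambda>x. x + of_int k) ` cantor_set))"
        by (intro add_mono insert.IH order_refl)
      also have "\<dots> = (\<Sum>k\<in>insert k F. cantor_H ((\<lambda>x. x + of_int k) ` cantor_set))"
        by (rule sum.insert[OF insert.hyps, symmetric])
      finally show ?case .
    qed (simp add: hausdorff_outer_empty)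
    then show ?thesis by (simp add: I_def)
  qed
  also have "\<dots> \<le> (\<Sum>k\<in>I. 1)" unfolding cantor_H_translate by (intro sum_mono cantor_H_cantor_set_le)
  also have "\<dots> = ennreal (real (card I))" by (simp add: ennreal_of_nat_eq_real_of_nat)
  also have "\<dots> \<le> ennreal (4 * (b - a))"
  proof (rule ennreal_leI)
    have "real (card I) = of_int (\<lfloor>b\<rfloor> - (\<lceil>a\<rceil> - 1) + 1)"
      using False unfolding I_def by (simp add: of_nat_nat) linarith
    also have "\<dots> \<le> b - a + 2" by simp linarith
    finally show "real (card I) \<le> 4 * (b - a)" using False by simp
  qed
  also have "\<dots> \<le> ennreal (4 * cantor_V (b - a))" by (intro ennreal_leI mult_left_mono) (simp_all add: cantor_V_def)
  finally show ?thesis .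
qed

lemma space_cantor_measure: "space cantor_measure = cantor_line"
  by (simp add: cantor_measure_def space_restrict_space)

lemma sets_cantor_measure: "sets cantor_measure = sets (restrict_space borel cantor_line)"
  unfolding cantor_measure_def by (rule sets_restrict_space_cong) simp

lemma sets_cantor_measure_iff: "A \<in> sets cantor_measure \<longleftrightarrow> A \<in> sets borel \<and> A \<subseteq> cantor_line"
  unfolding sets_cantor_measure by (subst sets_restrict_space_iff) auto

lemma emeasure_cantor_measure:
  "A \<in> sets cantor_measure \<Longrightarrow> emeasure cantor_measure A = cantor_H A"
  using sets_cantor_measure_iff[of A] unfolding cantor_measure_def
  by (subst emeasure_restrict_space) (simp_all add: emeasure_hausdorff_measure)

lemma Int_cantor_line_sets: "A \<in> sets borel \<Longrightarrow> A \<inter> cantor_line \<in> sets cantor_measure"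
  by (auto simp: sets_cantor_measure_iff)

lemma emeasure_cantor_interval_le:
  "a < b \<Longrightarrow> emeasure cantor_measure (cantor_line \<inter> {a..b}) \<le> ennreal (4 * cantor_V (b - a))"
  by (subst emeasure_cantor_measure) (auto simp: sets_cantor_measure_iff cantor_H_line_Int_le_V)

lemma emeasure_cantor_subset_interval_le:
  assumes "A \<in> sets cantor_measure" "A \<subseteq> {a..b}" "a < b"
  shows "emeasure cantor_measure A \<le> ennreal (4 * cantor_V (b - a))"
proof -
  have "emeasure cantor_measure A \<le> emeasure cantor_measure (cantor_line \<inter> {a..b})"
    using assms by (intro emeasure_mono) (auto simp: sets_cantor_measure_iff)
  then show ?thesis using emeasure_cantor_interval_le[OF assms(3)] by (rule order_trans)
qed

lemma emeasure_cantor_singleton: "emeasure cantor_measure {x} = 0"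
proof (cases "x \<in> cantor_line")
  case True
  have "emeasure cantor_measure {x} \<le> ennreal (2 * (1/2) ^ n)" for n
  proof -
    have "emeasure cantor_measure {x} \<le> emeasure cantor_measure (cantor_line \<inter> {x..x})"
      using True by simp
    also have "\<dots> \<le> ennreal (2 * (1/2) ^ n)"
    proof (subst emeasure_cantor_measure)
      show "cantor_H (cantor_line \<inter> {x..x}) \<le> ennreal (2 * (1/2) ^ n)" by (rule cantor_H_line_Int_le) simp
    qed (auto simp: sets_cantor_measure_iff)
    finally show ?thesis .
  qed
  moreover have "(\<lambda>n. ennreal (2 * (1/2) ^ n)) \<longlonglongrightarrow> ennreal (2 * 0)"
    by (intro tendsto_intros LIMSEQ_power_zero) simp
  ultimately have "emeasure cantor_measure {x} \<le> ennreal (2 * 0)"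
    by (intro LIMSEQ_le_const[of "\<lambda>n. ennreal (2 * (1/2) ^ n)"]) auto
  then show ?thesis by simp
qed (simp add: emeasure_notin_sets sets_cantor_measure_iff)

text \<open>Only the unit cell containing x is used, so that the piece stays on one side of every
  integer. The constant is 1/4 from the mass of the Cantor set times 1/2 from rounding r.\<close>

lemma emeasure_cantor_piece_ge:
  assumes x: "x - of_int k \<in> cantor_set" and r: "0 < r" "r \<le> 1"
  shows "ennreal (r powr cantor_dim / 8) \<le> emeasure cantor_measure (ball x r \<inter> (\<lambda>y. y + of_int k) ` cantor_set)"
proof -
  \<comment> \<open>The left inequality is strict because a closed interval of radius 3^-(n+1) has
    to fit into the open ball; if r is itself a power of 1/3, the next exponent is taken.\<close>
  obtain n where n: "(1/3) ^ Suc n < r" "r \<le> (1/3) ^ n"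
  proof (cases "r = 1")
    case True then show ?thesis using that[of 0] by simp
  next
    case False
    then obtain n where n: "(1/3) ^ Suc n \<le> r" "r < (1/3) ^ n" using ex_ternary_scale[of r] r by auto
    show ?thesis
    proof (cases "(1/3) ^ Suc n = r")
      case True
      then show ?thesis using that[of "Suc n"] r(1) by (simp add: field_simps)
    qed (use n that[of n] in auto)
  qed
  have meas: "ball x r \<inter> (\<lambda>y. y + of_int k) ` cantor_set \<in> sets cantor_measure"
    unfolding sets_cantor_measure_iff cantor_line_eq
    by (intro conjI sets.Int borel_open[OF open_ball] borel_closed[OF compact_imp_closed[OF compact_continuous_image]]
        continuous_intros compact_cantor_set) auto
  have "r powr cantor_dim \<le> ((1/3) ^ n) powr cantor_dim" using n r cantor_dim_bounds by (intro powr_mono2) auto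
  then have "r powr cantor_dim / 8 \<le> 1/4 * (1/2) ^ Suc n" unfolding third_power_powr_cantor_dim by simp
  then have "ennreal (r powr cantor_dim / 8) \<le> ennreal (1/4 * (1/2) ^ Suc n)" by (rule ennreal_leI)
  also have "\<dots> \<le> cantor_H (cantor_set \<inter> {x - of_int k - (1/3) ^ Suc n..x - of_int k + (1/3) ^ Suc n})"
    by (rule cantor_H_cantor_set_Int_ge[OF x])
  also have "\<dots> = cantor_H ((\<lambda>y. y + of_int k) ` (cantor_set \<inter> {x - of_int k - (1/3) ^ Suc n..x - of_int k + (1/3) ^ Suc n}))"
    by (rule cantor_H_translate[symmetric])
  also have "\<dots> \<le> cantor_H (ball x r \<inter> (\<lambda>y. y + of_int k) ` cantor_set)"
    using n by (intro hausdorff_outer_mono) (auto simp: dist_real_def)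
  also have "\<dots> = emeasure cantor_measure (ball x r \<inter> (\<lambda>y. y + of_int k) ` cantor_set)"
    by (rule emeasure_cantor_measure[OF meas, symmetric])
  finally show ?thesis .
qed

section \<open>Elementary inequalities for powers\<close>

text \<open>The odd extension of the power function. With exponent p - 1 it is, up to the factor p,
  the derivative of |x|^p, and so the nonlinearity in the first variation of the energy.\<close>

definition spow :: "real \<Rightarrow> real \<Rightarrow> real" where
  "spow q x = sgn x * \<bar>x\<bar> powr q"

lemma abs_spow: "\<bar>spow q x\<bar> = \<bar>x\<bar> powr q"
  by (simp add: spow_def abs_mult sgn_if)

lemma spow_nonneg: "0 \<le> x \<Longrightarrow> spow q x = x powr q"
  by (auto simp: spow_def sgn_if)

lemma spow_minus: "spow q (- x) = - spow q x"
  by (simp add: spow_def sgn_minus)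

lemma spow_mult_self: "0 < q \<Longrightarrow> spow q x * x = \<bar>x\<bar> powr (q + 1)"
  by (auto simp: spow_def sgn_if powr_add abs_if)

lemma spow_mono: "0 < q \<Longrightarrow> x \<le> y \<Longrightarrow> spow q x \<le> spow q y"
proof -
  assume q: "0 < q" and "x \<le> y"
  consider "0 \<le> x" | "y \<le> 0" | "x < 0" "0 < y" by linarith
  then show ?thesis
  proof cases
    case 1
    then show ?thesis using \<open>x \<le> y\<close> q by (simp add: spow_nonneg powr_mono2)
  next
    case 2
    then have "spow q (- y) \<le> spow q (- x)" using \<open>x \<le> y\<close> q by (simp add: spow_nonneg powr_mono2)
    then show ?thesis by (simp add: spow_minus)
  next
    case 3
    then have "spow q x \<le> 0" "0 \<le> spow q y" by (auto simp: spow_def sgn_if)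
    then show ?thesis by simp
  qed
qed

lemma borel_measurable_spow [measurable]: "spow q \<in> borel_measurable borel"
  unfolding spow_def[abs_def] by measurable

lemma has_real_derivative_abs_powr:
  assumes "1 < p"
  shows "((\<lambda>x. \<bar>x\<bar> powr p) has_real_derivative p * spow (p - 1) x) (at x)"
proof -
  consider "0 < x" | "x < 0" | "x = 0" by linarith
  then show ?thesis
  proof cases
    case 1
    have "((\<lambda>x. x powr p) has_real_derivative p * x powr (p - 1)) (at x)"
      by (rule has_real_derivative_powr[OF 1])
    moreover have "eventually (\<lambda>y. y powr p = \<bar>y\<bar> powr p) (nhds x)"
      using eventually_nhds_in_open[of "{0<..}" x] 1 by (auto elim: eventually_mono)
    ultimately show ?thesis using 1 by (simp add: spow_nonneg DERIV_cong_ev)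
  next
    case 2
    have "((\<lambda>x. x powr p) has_real_derivative p * (- x) powr (p - 1)) (at (- x))"
      using 2 by (intro has_real_derivative_powr) simp
    then have "((\<lambda>x. (- x) powr p) has_real_derivative (p * (- x) powr (p - 1)) * (- 1)) (at x)"
      by (rule DERIV_chain2) (auto intro!: derivative_eq_intros)
    moreover have "eventually (\<lambda>y. (- y) powr p = \<bar>y\<bar> powr p) (nhds x)"
      using eventually_nhds_in_open[of "{..<0}" x] 2 by (auto elim: eventually_mono)
    ultimately have "((\<lambda>x. \<bar>x\<bar> powr p) has_real_derivative (p * (- x) powr (p - 1)) * (- 1)) (at x)"
      by (subst (asm) DERIV_cong_ev[OF refl _ refl])
    then show ?thesis using 2 by (simp add: spow_def sgn_if)
  next
    case 3
    have "((\<lambda>h. (\<bar>0 + h\<bar> powr p - \<bar>0\<bar> powr p) / h) \<longlongrightarrow> 0) (at 0)"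
    proof (rule Lim_null_comparison)
      show "\<forall>\<^sub>F h in at 0. norm ((\<bar>0 + h\<bar> powr p - \<bar>0\<bar> powr p) / h) \<le> \<bar>h\<bar> powr (p - 1)"
        using assms by (intro always_eventually) (auto simp: powr_diff abs_divide)
      show "((\<lambda>h. \<bar>h\<bar> powr (p - 1)) \<longlongrightarrow> 0) (at (0::real))"
        using assms by (auto intro!: tendsto_eq_intros tendsto_powr'[where a=0 and b="p - 1", simplified])
    qed
    then show ?thesis using 3 by (simp add: DERIV_def spow_def)
  qed
qed

lemma convex_on_abs_powr:
  assumes "1 < p" shows "convex_on UNIV (\<lambda>x :: real. \<bar>x\<bar> powr p)"
  by (rule convex_on_realI[OF connected_UNIV has_real_derivative_abs_powr[OF assms]])
     (use assms in \<open>auto intro: spow_mono\<close>)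

lemma abs_powr_convex_comb:
  fixes p l x y :: real
  assumes "1 < p" "0 \<le> l" "l \<le> 1"
  shows "\<bar>(1 - l) * x + l * y\<bar> powr p \<le> (1 - l) * \<bar>x\<bar> powr p + l * \<bar>y\<bar> powr p"
  using convex_onD[OF convex_on_abs_powr[OF assms(1)], of l x y] assms by simp

text \<open>Two numbers with the same sum as s and t and lying between them are complementary convex
  combinations of s and t; add the two convexity inequalities.\<close>

lemma abs_powr_majorization:
  fixes p s t x y :: real
  assumes p: "1 < p" and "s \<le> x" "x \<le> t" "x + y = s + t"
  shows "\<bar>x\<bar> powr p + \<bar>y\<bar> powr p \<le> \<bar>s\<bar> powr p + \<bar>t\<bar> powr p"
proof (cases "s = t")
  case False
  define l where "l = (x - s) / (t - s)"
  have st: "0 < t - s" using assms False by simp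
  have l: "0 \<le> l" "l \<le> 1" using assms st by (auto simp: l_def)
  have "l * (t - s) = x - s" using st by (simp add: l_def)
  then have x: "x = (1 - l) * s + l * t" by (simp add: algebra_simps)
  have y: "y = (1 - (1 - l)) * s + (1 - l) * t" using assms(4) x by (simp add: algebra_simps)
  show ?thesis
    using abs_powr_convex_comb[OF p l, of s t] abs_powr_convex_comb[OF p, of "1 - l" s t] l
    unfolding x[symmetric] y[symmetric] by (simp add: algebra_simps)
qed (use assms in auto)

text \<open>The pointwise form of (SubAdd). If the two pairs are ordered alike, both sides agree; if
  they are ordered oppositely, a - d and b - c have the same sum as a - c and b - d and lie between
  them.\<close>

lemma min_max_abs_powr_le:
  fixes a b c d p :: real
  assumes p: "1 < p"
  shows "\<bar>min a b - min c d\<bar> powr p + \<bar>max a b - max c d\<bar> powr p \<le> \<bar>a - c\<bar> powr p + \<bar>b - d\<bar> powr p"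
proof -
  consider "a \<le> b" "c \<le> d" | "b \<le> a" "d \<le> c" | "a \<le> b" "d \<le> c" | "b \<le> a" "c \<le> d" by linarith
  then show ?thesis
  proof cases
    case 3
    then show ?thesis
      using abs_powr_majorization[OF p, of "a - c" "a - d" "b - d" "b - c"] by (simp add: min_def max_def)
  next
    case 4
    then show ?thesis
      using abs_powr_majorization[OF p, of "b - d" "b - c" "a - c" "a - d"] by (simp add: min_def max_def)
  qed (auto simp: min_def max_def)
qed

lemma powr_add_le:
  fixes a b q :: real
  assumes "0 \<le> a" "0 \<le> b" "0 < q"
  shows "(a + b) powr q \<le> 2 powr q * (a powr q + b powr q)"
proof -
  have "(a + b) powr q \<le> (2 * max a b) powr q" using assms by (intro powr_mono2) auto
  also have "\<dots> = 2 powr q * (max a b) powr q" using assms by (simp add: powr_mult)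
  also have "\<dots> \<le> 2 powr q * (a powr q + b powr q)" by (intro mult_left_mono) (auto simp: max_def)
  finally show ?thesis .
qed

lemma abs_add_powr_le:
  fixes a b q :: real
  assumes "0 < q"
  shows "\<bar>a + b\<bar> powr q \<le> 2 powr q * (\<bar>a\<bar> powr q + \<bar>b\<bar> powr q)"
proof -
  have "\<bar>a + b\<bar> powr q \<le> (\<bar>a\<bar> + \<bar>b\<bar>) powr q" using assms by (intro powr_mono2) auto
  also have "\<dots> \<le> 2 powr q * (\<bar>a\<bar> powr q + \<bar>b\<bar> powr q)" using assms by (intro powr_add_le) auto
  finally show ?thesis .
qed

lemma abs_diff_powr_le:
  fixes a b q :: real
  assumes "0 < q"
  shows "\<bar>a - b\<bar> powr q \<le> 2 powr q * (\<bar>a\<bar> powr q + \<bar>b\<bar> powr q)"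
  using abs_add_powr_le[OF assms, of a "- b"] by simp

lemma powr_inverse_cancel: "0 \<le> a \<Longrightarrow> p \<noteq> 0 \<Longrightarrow> (a powr (1/p)) powr p = (a::real)"
  by (simp add: powr_powr)

text \<open>For positive a, b bounding the two norms, convexity with weights a/(a+b) and b/(a+b)
  gives the bound (a+b)^p. Vanishing norms are reached by adding 1/(n+1) to each norm and letting n
  tend to infinity.\<close>

lemma nn_integral_minkowski:
  assumes [measurable]: "f \<in> borel_measurable M" "g \<in> borel_measurable M" and p: "1 < p"
    and f: "(\<integral>\<^sup>+x. ennreal (\<bar>f x\<bar> powr p) \<partial>M) = ennreal A" "0 \<le> A"
    and g: "(\<integral>\<^sup>+x. ennreal (\<bar>g x\<bar> powr p) \<partial>M) = ennreal B" "0 \<le> B"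
  shows "(\<integral>\<^sup>+x. ennreal (\<bar>f x + g x\<bar> powr p) \<partial>M) \<le> ennreal ((A powr (1/p) + B powr (1/p)) powr p)"
proof -
  have pos: "(\<integral>\<^sup>+x. ennreal (\<bar>f x + g x\<bar> powr p) \<partial>M) \<le> ennreal ((a + b) powr p)"
    if a: "0 < a" "A \<le> a powr p" and b: "0 < b" "B \<le> b powr p" for a b
  proof -
    define l where "l = b / (a + b)"
    have l: "0 < l" "l < 1" "1 - l = a / (a + b)" using a b by (auto simp: l_def field_simps)
    have "(\<integral>\<^sup>+x. ennreal (\<bar>f x + g x\<bar> powr p) \<partial>M)
      \<le> (\<integral>\<^sup>+x. ennreal ((a + b) powr p * (1 - l) / a powr p) * ennreal (\<bar>f x\<bar> powr p)
            + ennreal ((a + b) powr p * l / b powr p) * ennreal (\<bar>g x\<bar> powr p) \<partial>M)"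
    proof (rule nn_integral_mono)
      fix x
      have "f x + g x = (a + b) * ((1 - l) * (f x / a) + l * (g x / b))"
      proof -
        have "(a + b) * (1 - l) = a" "(a + b) * l = b" using a b unfolding l(3) by (auto simp: l_def)
        then have "(a + b) * ((1 - l) * (f x / a) + l * (g x / b)) = a * (f x / a) + b * (g x / b)"
          by (simp only: distrib_left mult.assoc[symmetric])
        then show ?thesis using a b by simp
      qed
      then have "\<bar>f x + g x\<bar> powr p = (a + b) powr p * \<bar>(1 - l) * (f x / a) + l * (g x / b)\<bar> powr p"
        using a b by (simp add: abs_mult powr_mult)
      also have "\<dots> \<le> (a + b) powr p * ((1 - l) * \<bar>f x / a\<bar> powr p + l * \<bar>g x / b\<bar> powr p)"
        using l p by (intro mult_left_mono abs_powr_convex_comb) auto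
      also have "\<dots> = (a + b) powr p * (1 - l) / a powr p * \<bar>f x\<bar> powr p + (a + b) powr p * l / b powr p * \<bar>g x\<bar> powr p"
        using a b by (simp add: powr_divide abs_divide algebra_simps)
      finally have "\<bar>f x + g x\<bar> powr p \<le> (a + b) powr p * (1 - l) / a powr p * \<bar>f x\<bar> powr p + (a + b) powr p * l / b powr p * \<bar>g x\<bar> powr p" .
      then have "ennreal (\<bar>f x + g x\<bar> powr p) \<le> ennreal ((a + b) powr p * (1 - l) / a powr p * \<bar>f x\<bar> powr p + (a + b) powr p * l / b powr p * \<bar>g x\<bar> powr p)"
        by (rule ennreal_leI)
      also have "\<dots> = ennreal ((a + b) powr p * (1 - l) / a powr p) * ennreal (\<bar>f x\<bar> powr p)
            + ennreal ((a + b) powr p * l / b powr p) * ennreal (\<bar>g x\<bar> powr p)"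
      proof -
        have "0 \<le> (a + b) powr p * (1 - l) / a powr p" "0 \<le> (a + b) powr p * l / b powr p"
          using l(1,2) by (auto intro!: divide_nonneg_nonneg mult_nonneg_nonneg)
        then show ?thesis by (simp only: ennreal_plus mult_nonneg_nonneg powr_ge_zero ennreal_mult)
      qed
      finally show "ennreal (\<bar>f x + g x\<bar> powr p) \<le> ennreal ((a + b) powr p * (1 - l) / a powr p) * ennreal (\<bar>f x\<bar> powr p)
            + ennreal ((a + b) powr p * l / b powr p) * ennreal (\<bar>g x\<bar> powr p)" .
    qed
    also have "\<dots> = ennreal ((a + b) powr p * (1 - l) / a powr p) * ennreal A + ennreal ((a + b) powr p * l / b powr p) * ennreal B"
      by (subst nn_integral_add, measurable) (simp add: nn_integral_cmult f g)
    also have "\<dots> = ennreal ((a + b) powr p * (1 - l) / a powr p * A + (a + b) powr p * l / b powr p * B)"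
      using l a b f g by (subst ennreal_plus) (auto simp: ennreal_mult[symmetric] intro!: mult_nonneg_nonneg divide_nonneg_nonneg)
    also have "\<dots> \<le> ennreal ((a + b) powr p)"
    proof (rule ennreal_leI)
      have "(a + b) powr p * (1 - l) / a powr p * A \<le> (a + b) powr p * (1 - l) / a powr p * a powr p"
        using l(1,2) a by (intro mult_left_mono) auto
      moreover have "(a + b) powr p * l / b powr p * B \<le> (a + b) powr p * l / b powr p * b powr p"
        using l(1,2) b by (intro mult_left_mono) auto
      ultimately have "(a + b) powr p * (1 - l) / a powr p * A + (a + b) powr p * l / b powr p * B
         \<le> (a + b) powr p * (1 - l) + (a + b) powr p * l"
        using a b by simp
      also have "\<dots> = (a + b) powr p" by (simp add: algebra_simps)
      finally show "(a + b) powr p * (1 - l) / a powr p * A + (a + b) powr p * l / b powr p * B \<le> (a + b) powr p" .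
    qed
    finally show ?thesis .
  qed
  let ?a = "A powr (1/p)" and ?b = "B powr (1/p)"
  have lim: "(\<lambda>n. ennreal (((?a + 1 / real (Suc n)) + (?b + 1 / real (Suc n))) powr p)) \<longlonglongrightarrow> ennreal (((?a + 0) + (?b + 0)) powr p)"
    using p by (intro tendsto_ennrealI tendsto_powr' tendsto_add tendsto_const LIMSEQ_Suc[OF lim_1_over_n]) auto
  show ?thesis
  proof (rule LIMSEQ_le_const[OF lim[unfolded add_0_right]], intro exI allI impI)
    fix n :: nat
    have e: "0 < 1 / real (Suc n)" by simp
    have "A \<le> (?a + 1 / real (Suc n)) powr p"
      using powr_mono2[of p ?a "?a + 1 / real (Suc n)"] e p f powr_inverse_cancel[of A p] by auto
    moreover have "B \<le> (?b + 1 / real (Suc n)) powr p"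
      using powr_mono2[of p ?b "?b + 1 / real (Suc n)"] e p g powr_inverse_cancel[of B p] by auto
    ultimately show "(\<integral>\<^sup>+x. ennreal (\<bar>f x + g x\<bar> powr p) \<partial>M) \<le> ennreal (((?a + 1 / real (Suc n)) + (?b + 1 / real (Suc n))) powr p)"
      using e by (intro pos) (auto intro: add_nonneg_pos)
  qed
qed

lemma AE_tendsto_of_summable_powr:
  fixes f :: "nat \<Rightarrow> 'a \<Rightarrow> real"
  assumes [measurable]: "\<And>n. f n \<in> borel_measurable M" and p: "0 < p"
    and sum: "(\<Sum>n. \<integral>\<^sup>+x. ennreal (\<bar>f n x\<bar> powr p) \<partial>M) < \<infinity>"
  shows "AE x in M. (\<lambda>n. f n x) \<longlonglongrightarrow> 0"
proof -
  have "(\<integral>\<^sup>+x. (\<Sum>n. ennreal (\<bar>f n x\<bar> powr p)) \<partial>M) \<noteq> \<infinity>"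
    using sum by (subst nn_integral_suminf) auto
  then have "AE x in M. (\<Sum>n. ennreal (\<bar>f n x\<bar> powr p)) \<noteq> \<infinity>"
    by (intro nn_integral_PInf_AE) auto
  then show ?thesis
  proof eventually_elim
    fix x assume "(\<Sum>n. ennreal (\<bar>f n x\<bar> powr p)) \<noteq> \<infinity>"
    then have "summable (\<lambda>n. \<bar>f n x\<bar> powr p)" by (intro summable_suminf_not_top) auto
    then have "(\<lambda>n. \<bar>f n x\<bar> powr p) \<longlonglongrightarrow> 0" by (rule summable_LIMSEQ_zero)
    then have "(\<lambda>n. (\<bar>f n x\<bar> powr p) powr (1/p)) \<longlonglongrightarrow> 0 powr (1/p)"
      using p by (intro tendsto_powr') auto
    then have "(\<lambda>n. \<bar>f n x\<bar>) \<longlonglongrightarrow> 0" using p by (simp add: powr_powr)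
    then show "(\<lambda>n. f n x) \<longlonglongrightarrow> 0" by (simp add: tendsto_rabs_zero_iff)
  qed
qed

section \<open>Nonlocal energy forms\<close>

text \<open>One class containing sums, differences, multiples, minimum, maximum and Lipschitz
  functions of one variable fixing 0, so that stability of the domain is proved once. The value 0 at
  the origin preserves compact support and p-integrability.\<close>

definition lip2 :: "real \<Rightarrow> (real \<Rightarrow> real \<Rightarrow> real) \<Rightarrow> bool" where
  "lip2 L \<phi> \<longleftrightarrow> 0 \<le> L \<and> \<phi> 0 0 = 0 \<and> (\<forall>a b c d. \<bar>\<phi> a b - \<phi> c d\<bar> \<le> L * (\<bar>a - c\<bar> + \<bar>b - d\<bar>))"

lemma lip2_continuous: "lip2 L \<phi> \<Longrightarrow> continuous_on UNIV (\<lambda>z. \<phi> (fst z) (snd z))"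
proof (rule lipschitz_on_continuous_on[of "2 * L"])
  assume l: "lip2 L \<phi>"
  show "(2 * L)-lipschitz_on UNIV (\<lambda>z. \<phi> (fst z) (snd z))"
  proof (rule lipschitz_onI)
    fix z w :: "real \<times> real"
    have "dist (\<phi> (fst z) (snd z)) (\<phi> (fst w) (snd w)) \<le> L * (\<bar>fst z - fst w\<bar> + \<bar>snd z - snd w\<bar>)"
      using l by (simp add: lip2_def dist_real_def)
    also have "\<dots> \<le> L * (dist z w + dist z w)"
      using l dist_fst_le[of z w] dist_snd_le[of z w]
      by (intro mult_left_mono add_mono) (auto simp: lip2_def dist_real_def)
    finally show "dist (\<phi> (fst z) (snd z)) (\<phi> (fst w) (snd w)) \<le> 2 * L * dist z w" by simp
  qed (use l in \<open>simp add: lip2_def\<close>)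
qed

lemma lip2_compose_continuous:
  assumes "lip2 L \<phi>" "continuous_on S u" "continuous_on S v"
  shows "continuous_on S (\<lambda>x. \<phi> (u x) (v x))"
  using continuous_on_compose2[OF lip2_continuous[OF assms(1)] continuous_on_Pair[OF assms(2,3)]] by simp

lemma lip2_measurable:
  assumes "lip2 L \<phi>" "u \<in> borel_measurable M" "v \<in> borel_measurable M"
  shows "(\<lambda>x. \<phi> (u x) (v x)) \<in> borel_measurable M"
  using measurable_compose[OF borel_measurable_Pair[OF assms(2,3)] borel_measurable_continuous_onI[OF lip2_continuous[OF assms(1)]]]
  by simp

lemma lip2_powr_le:
  assumes l: "lip2 L \<phi>" and p: "0 < p"
  shows "\<bar>\<phi> a b - \<phi> c d\<bar> powr p \<le> (2 * L) powr p * (\<bar>a - c\<bar> powr p + \<bar>b - d\<bar> powr p)"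
proof -
  have "\<bar>\<phi> a b - \<phi> c d\<bar> powr p \<le> (L * (\<bar>a - c\<bar> + \<bar>b - d\<bar>)) powr p"
    using l p by (intro powr_mono2) (auto simp: lip2_def)
  also have "\<dots> = L powr p * (\<bar>a - c\<bar> + \<bar>b - d\<bar>) powr p" using l by (simp add: powr_mult lip2_def)
  also have "\<dots> \<le> L powr p * (2 powr p * (\<bar>a - c\<bar> powr p + \<bar>b - d\<bar> powr p))"
    using p by (intro mult_left_mono powr_add_le) auto
  also have "\<dots> = (2 * L) powr p * (\<bar>a - c\<bar> powr p + \<bar>b - d\<bar> powr p)"
    using l by (simp add: powr_mult lip2_def)
  finally show ?thesis .
qed

lemma lip2_add: "lip2 1 (\<lambda>a b. a + b)" by (auto simp: lip2_def)
lemma lip2_diff: "lip2 1 (\<lambda>a b. a - b)" by (auto simp: lip2_def)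
lemma lip2_scale: "lip2 \<bar>c\<bar> (\<lambda>a b. c * a)"
  unfolding lip2_def by (auto simp: right_diff_distrib[symmetric] abs_mult intro!: mult_left_mono)
lemma lip2_min: "lip2 1 (\<lambda>a b. min a b)" by (auto simp: lip2_def min_def)
lemma lip2_max: "lip2 1 (\<lambda>a b. max a b)" by (auto simp: lip2_def max_def)
lemma lip2_unary:
  assumes "\<psi> 0 = 0" "0 \<le> L" "\<And>s t. \<bar>\<psi> s - \<psi> t\<bar> \<le> L * \<bar>s - t\<bar>"
  shows "lip2 L (\<lambda>a b. \<psi> a)"
  unfolding lip2_def
proof (intro conjI allI)
  fix a b c d :: real
  have "\<bar>\<psi> a - \<psi> c\<bar> \<le> L * \<bar>a - c\<bar>" by (rule assms)
  also have "\<dots> \<le> L * (\<bar>a - c\<bar> + \<bar>b - d\<bar>)" using assms by (intro mult_left_mono) auto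
  finally show "\<bar>\<psi> a - \<psi> c\<bar> \<le> L * (\<bar>a - c\<bar> + \<bar>b - d\<bar>)" .
qed (use assms in auto)

text \<open>The part of the theory that uses only a symmetric kernel and a measure finite on compact
  sets. Second countability makes the distance measurable on the product.\<close>

locale jump_form = sigma_finite_measure m
  for m :: "'a::{metric_space, second_countable_topology} measure" +
  fixes p :: real and J :: "'a \<Rightarrow> 'a \<Rightarrow> real"
  assumes p_gt_1: "1 < p"
    and sets_m: "sets m = sets (restrict_space borel (space m))"
    and compact_finite: "\<And>K. compact K \<Longrightarrow> K \<subseteq> space m \<Longrightarrow> emeasure m K < \<infinity>"
    and J_nonneg: "\<And>x y. 0 \<le> J x y"
    and J_sym: "\<And>x y. J x y = J y x"
    and J_pair_measurable: "(\<lambda>z. J (fst z) (snd z)) \<in> borel_measurable (m \<Otimes>\<^sub>M m)"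
begin

sublocale pair: pair_sigma_finite m m by unfold_locales

lemma p_pos: "0 < p" "0 \<le> p" "p \<noteq> 0" using p_gt_1 by auto

lemma measurable_J [measurable (raw)]:
  assumes "f \<in> N \<rightarrow>\<^sub>M m" "g \<in> N \<rightarrow>\<^sub>M m"
  shows "(\<lambda>x. J (f x) (g x)) \<in> borel_measurable N"
  using measurable_compose[OF measurable_Pair[OF assms] J_pair_measurable] by simp

lemma measurable_m_borel: "(\<lambda>x. x) \<in> m \<rightarrow>\<^sub>M borel"
  unfolding measurable_cong_sets[OF sets_m refl] by (intro measurable_restrict_space1) simp

lemma borel_Int_space: "A \<in> sets borel \<Longrightarrow> A \<inter> space m \<in> sets m"
  unfolding sets_m by (auto simp: sets_restrict_space)

lemma compact_sets: "compact K \<Longrightarrow> K \<subseteq> space m \<Longrightarrow> K \<in> sets m"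
  using borel_Int_space[OF borel_compact] by (metis Int_absorb2)

lemma continuous_on_measurable: "continuous_on (space m) u \<Longrightarrow> u \<in> borel_measurable m"
  unfolding measurable_cong_sets[OF sets_m refl] by (rule borel_measurable_continuous_on_restrict)

text \<open>The diagonal is kept, so that Fubini applies on the full product; integrands built from
  differences vanish there, and the integrals agree with those for
  \<open>jump_measure\<close>.\<close>

definition jm :: "('a \<times> 'a) measure" where
  "jm = density (m \<Otimes>\<^sub>M m) (\<lambda>z. ennreal (J (fst z) (snd z)))"

lemma space_jm [simp]: "space jm = space m \<times> space m"
  by (simp add: jm_def space_pair_measure)

lemma sets_jm [measurable_cong, simp]: "sets jm = sets (m \<Otimes>\<^sub>M m)"
  by (simp add: jm_def)

lemma nn_integral_jm:
  assumes [measurable]: "f \<in> borel_measurable (m \<Otimes>\<^sub>M m)"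
  shows "(\<integral>\<^sup>+z. f z \<partial>jm) = (\<integral>\<^sup>+x. \<integral>\<^sup>+y. ennreal (J x y) * f (x, y) \<partial>m \<partial>m)"
  unfolding jm_def by (subst nn_integral_density) (auto simp: nn_integral_fst[symmetric])

lemma nn_integral_jm_swap:
  assumes [measurable]: "f \<in> borel_measurable (m \<Otimes>\<^sub>M m)"
  shows "(\<integral>\<^sup>+z. f (snd z, fst z) \<partial>jm) = (\<integral>\<^sup>+z. f z \<partial>jm)"
proof -
  have "(\<integral>\<^sup>+z. f (snd z, fst z) \<partial>jm) = (\<integral>\<^sup>+x. \<integral>\<^sup>+y. ennreal (J x y) * f (y, x) \<partial>m \<partial>m)"
    by (subst nn_integral_jm) auto
  also have "\<dots> = (\<integral>\<^sup>+y. \<integral>\<^sup>+x. ennreal (J x y) * f (y, x) \<partial>m \<partial>m)"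
    by (rule pair.Fubini'[symmetric]) measurable
  also have "\<dots> = (\<integral>\<^sup>+z. f z \<partial>jm)" by (subst nn_integral_jm) (auto simp: J_sym)
  finally show ?thesis .
qed

lemma AE_jm:
  assumes "AE x in m. P x"
  shows "AE z in jm. P (fst z) \<and> P (snd z)"
proof -
  obtain N where N: "{x\<in>space m. \<not> P x} \<subseteq> N" "N \<in> null_sets m"
    using assms by (auto simp: eventually_ae_filter)
  have [measurable]: "N \<in> sets m" using N by auto
  have "N \<times> space m \<in> null_sets (m \<Otimes>\<^sub>M m)" "space m \<times> N \<in> null_sets (m \<Otimes>\<^sub>M m)"
    using N by (auto simp: null_sets_def emeasure_pair_measure_Times)
  then have "AE z in m \<Otimes>\<^sub>M m. z \<notin> N \<times> space m \<and> z \<notin> space m \<times> N"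
    by (auto intro: AE_not_in)
  moreover have "AE z in m \<Otimes>\<^sub>M m. z \<in> space (m \<Otimes>\<^sub>M m)" by (rule AE_space)
  ultimately have "AE z in m \<Otimes>\<^sub>M m. P (fst z) \<and> P (snd z)"
    by eventually_elim (use N in \<open>auto simp: space_pair_measure\<close>)
  then show ?thesis unfolding jm_def by (subst AE_density) auto
qed

abbreviation energy :: "('a \<Rightarrow> real) \<Rightarrow> ennreal" where "energy \<equiv> nl_energy m p J"
abbreviation E :: "('a \<Rightarrow> real) \<Rightarrow> real" where "E \<equiv> nl_form m p J"
abbreviation F :: "('a \<Rightarrow> real) set" where "F \<equiv> nl_dom m p J"
abbreviation core :: "('a \<Rightarrow> real) set" where "core \<equiv> nl_core m p J"

lemma energy_iterated:
  assumes [measurable]: "u \<in> borel_measurable m"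
  shows "energy u = (\<integral>\<^sup>+x. \<integral>\<^sup>+y. ennreal (J x y) * ennreal (\<bar>u x - u y\<bar> powr p) \<partial>m \<partial>m)"
  unfolding nl_energy_def
  by (intro nn_integral_cong) (auto simp: indicator_def ennreal_mult J_nonneg mult.commute p_pos)

lemma energy_eq:
  assumes [measurable]: "u \<in> borel_measurable m"
  shows "energy u = (\<integral>\<^sup>+z. ennreal (\<bar>u (fst z) - u (snd z)\<bar> powr p) \<partial>jm)"
  unfolding energy_iterated[OF assms] by (subst nn_integral_jm) auto

text \<open>The p-th power of the norm, with values in \<open>ennreal\<close>: finiteness and
  convergence can be discussed before membership in the domain is known. Without taking roots the
  triangle inequality costs a factor 2^p.\<close>

definition total :: "('a \<Rightarrow> real) \<Rightarrow> ennreal" where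
  "total u = energy u + (\<integral>\<^sup>+x. ennreal (\<bar>u x\<bar> powr p) \<partial>m)"

lemma energy_le_total: "energy u \<le> total u" and lp_le_total: "(\<integral>\<^sup>+x. ennreal (\<bar>u x\<bar> powr p) \<partial>m) \<le> total u"
  by (auto simp: total_def)

lemma total_lip2_le:
  assumes l: "lip2 L \<phi>" and [measurable]: "u \<in> borel_measurable m" "v \<in> borel_measurable m"
  shows "total (\<lambda>x. \<phi> (u x) (v x)) \<le> ennreal ((2 * L) powr p) * (total u + total v)"
proof -
  have [measurable]: "(\<lambda>x. \<phi> (u x) (v x)) \<in> borel_measurable m" by (rule lip2_measurable[OF l]) auto
  have pt: "ennreal (\<bar>\<phi> a b - \<phi> c d\<bar> powr p) \<le> ennreal ((2 * L) powr p) * (ennreal (\<bar>a - c\<bar> powr p) + ennreal (\<bar>b - d\<bar> powr p))" for a b c d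
    using lip2_powr_le[OF l p_pos(1), of a b c d]
    by (simp add: ennreal_mult[symmetric] ennreal_plus[symmetric] ennreal_leI del: ennreal_plus)
  have p0: "\<phi> 0 0 = 0" using l by (simp add: lip2_def)
  have "(\<integral>\<^sup>+z. ennreal (\<bar>\<phi> (u (fst z)) (v (fst z)) - \<phi> (u (snd z)) (v (snd z))\<bar> powr p) \<partial>jm)
    \<le> (\<integral>\<^sup>+z. ennreal ((2 * L) powr p) * (ennreal (\<bar>u (fst z) - u (snd z)\<bar> powr p) + ennreal (\<bar>v (fst z) - v (snd z)\<bar> powr p)) \<partial>jm)"
    by (intro nn_integral_mono pt)
  also have "\<dots> = ennreal ((2 * L) powr p) * (energy u + energy v)"
    by (subst nn_integral_cmult, measurable) (subst nn_integral_add, auto simp: energy_eq)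
  finally have 1: "energy (\<lambda>x. \<phi> (u x) (v x)) \<le> ennreal ((2 * L) powr p) * (energy u + energy v)"
    by (subst energy_eq) auto
  have "(\<integral>\<^sup>+x. ennreal (\<bar>\<phi> (u x) (v x)\<bar> powr p) \<partial>m)
    \<le> (\<integral>\<^sup>+x. ennreal ((2 * L) powr p) * (ennreal (\<bar>u x\<bar> powr p) + ennreal (\<bar>v x\<bar> powr p)) \<partial>m)"
    using pt[of _ _ 0 0] by (intro nn_integral_mono) (simp add: p0)
  also have "\<dots> = ennreal ((2 * L) powr p) * ((\<integral>\<^sup>+x. ennreal (\<bar>u x\<bar> powr p) \<partial>m) + (\<integral>\<^sup>+x. ennreal (\<bar>v x\<bar> powr p) \<partial>m))"
    by (subst nn_integral_cmult, measurable) (subst nn_integral_add, auto)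
  finally have 2: "(\<integral>\<^sup>+x. ennreal (\<bar>\<phi> (u x) (v x)\<bar> powr p) \<partial>m)
    \<le> ennreal ((2 * L) powr p) * ((\<integral>\<^sup>+x. ennreal (\<bar>u x\<bar> powr p) \<partial>m) + (\<integral>\<^sup>+x. ennreal (\<bar>v x\<bar> powr p) \<partial>m))" .
  show ?thesis
    using add_mono[OF 1 2] unfolding total_def by (simp only: distrib_left ac_simps)
qed

lemma total_add_le:
  assumes "u \<in> borel_measurable m" "v \<in> borel_measurable m"
  shows "total (\<lambda>x. u x + v x) \<le> ennreal (2 powr p) * (total u + total v)"
  using total_lip2_le[OF lip2_add assms] by simp

lemma total_diff_le:
  assumes "u \<in> borel_measurable m" "v \<in> borel_measurable m"
  shows "total (\<lambda>x. u x - v x) \<le> ennreal (2 powr p) * (total u + total v)"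
  using total_lip2_le[OF lip2_diff assms] by simp

lemma total_triangle:
  assumes "u \<in> borel_measurable m" "v \<in> borel_measurable m" "w \<in> borel_measurable m"
  shows "total (\<lambda>x. u x - w x) \<le> ennreal (2 powr p) * (total (\<lambda>x. u x - v x) + total (\<lambda>x. v x - w x))"
  using total_add_le[of "\<lambda>x. u x - v x" "\<lambda>x. v x - w x"] assms by simp

lemma total_uminus: "total (\<lambda>x. u x - v x) = total (\<lambda>x. v x - u x)"
  unfolding total_def nl_energy_def
  by (intro arg_cong2[of _ _ _ _ "(+)"] nn_integral_cong)
     (simp_all add: abs_minus_commute[of "u _ - v _ - (u _ - v _)"] abs_minus_commute algebra_simps)

lemma energy_scale:
  assumes [measurable]: "u \<in> borel_measurable m"
  shows "energy (\<lambda>x. c * u x) = ennreal (\<bar>c\<bar> powr p) * energy u"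
  by (subst (1 2) energy_eq, measurable)
     (simp add: nn_integral_cmult[symmetric] ennreal_mult[symmetric] powr_mult[symmetric] abs_mult[symmetric] right_diff_distrib)

lemma energy_cong_AE:
  assumes [measurable]: "u \<in> borel_measurable m" "v \<in> borel_measurable m" and "AE x in m. u x = v x"
  shows "energy u = energy v"
  unfolding energy_eq[OF assms(1)] energy_eq[OF assms(2)]
  by (rule nn_integral_cong_AE) (use AE_jm[OF assms(3)] in \<open>eventually_elim, auto\<close>)

lemma E1_eq:
  assumes [measurable]: "u \<in> borel_measurable m" and "total u < \<infinity>"
  shows "E1 m p E u = enn2real (total u)"
proof -
  have "(\<integral>x. \<bar>u x\<bar> powr p \<partial>m) = enn2real (\<integral>\<^sup>+x. ennreal (\<bar>u x\<bar> powr p) \<partial>m)"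
    by (intro integral_eq_nn_integral) auto
  then show ?thesis
    using assms unfolding E1_def nl_form_def total_def by (subst enn2real_plus) (auto simp: less_top[symmetric])
qed

lemma E1_norm_less_iff:
  assumes "u \<in> borel_measurable m" "total u < \<infinity>" "0 < e"
  shows "E1_norm m p E u < e \<longleftrightarrow> total u < ennreal (e powr p)"
proof -
  obtain t where t: "total u = ennreal t" "0 \<le> t" using assms(2) by (cases "total u") auto
  have "t powr (1/p) < e \<longleftrightarrow> t < e powr p"
  proof -
    have "t powr (1/p) < e \<longleftrightarrow> (t powr (1/p)) powr p < e powr p"
      using assms p_pos t by (metis less_eq_real_def not_less powr_ge_zero powr_less_mono2 powr_mono2)
    then show ?thesis using t p_pos by (simp add: powr_powr)
  qed
  then show ?thesis unfolding E1_norm_def E1_eq[OF assms(1,2)] t(1) using t(2) by (simp add: ennreal_less_iff)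
qed

lemma Lp_iff: "u \<in> Lp m p \<longleftrightarrow> u \<in> borel_measurable m \<and> (\<integral>\<^sup>+x. ennreal (\<bar>u x\<bar> powr p) \<partial>m) < \<infinity>"
  by (auto simp: Lp_def integrable_iff_bounded)

lemma Cc_measurable: "u \<in> Cc (space m) \<Longrightarrow> u \<in> borel_measurable m"
  by (auto simp: Cc_def intro: continuous_on_measurable)

lemma Cc_lp_finite:
  assumes "u \<in> Cc (space m)"
  shows "(\<integral>\<^sup>+x. ennreal (\<bar>u x\<bar> powr p) \<partial>m) < \<infinity>"
proof -
  obtain K where c: "continuous_on (space m) u" and K: "compact K" "K \<subseteq> space m" "\<forall>x\<in>space m - K. u x = 0"
    using assms by (auto simp: Cc_def)
  have "bounded (u ` K)"
    by (intro compact_imp_bounded compact_continuous_image continuous_on_subset[OF c] K)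
  then obtain B where B: "\<And>x. x \<in> K \<Longrightarrow> \<bar>u x\<bar> \<le> B" by (auto simp: bounded_iff)
  have "(\<integral>\<^sup>+x. ennreal (\<bar>u x\<bar> powr p) \<partial>m) \<le> (\<integral>\<^sup>+x. ennreal (B powr p) * indicator K x \<partial>m)"
    using K B p_pos by (intro nn_integral_mono) (auto simp: indicator_def intro!: ennreal_leI powr_mono2)
  also have "\<dots> = ennreal (B powr p) * emeasure m K"
    using K by (simp add: nn_integral_cmult_indicator compact_sets)
  also have "\<dots> < \<infinity>" using compact_finite[OF K(1,2)] by (simp add: ennreal_mult_less_top)
  finally show ?thesis .
qed

lemma core_iff: "u \<in> core \<longleftrightarrow> u \<in> Cc (space m) \<and> total u < \<infinity>"
  using Cc_lp_finite[of u] by (auto simp: nl_core_def total_def)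

lemma core_measurable: "u \<in> core \<Longrightarrow> u \<in> borel_measurable m"
  by (simp add: core_iff Cc_measurable)

text \<open>The working description of the domain, in which all statements about the norm become
  statements about \<open>total\<close>, with e replaced by its p-th power.\<close>

lemma F_iff: "u \<in> F \<longleftrightarrow> u \<in> borel_measurable m \<and> total u < \<infinity> \<and>
   (\<forall>e>0. \<exists>f\<in>core. total (\<lambda>x. u x - f x) < ennreal e)"
proof -
  have "(\<forall>e>0. \<exists>f\<in>core. energy (\<lambda>x. u x - f x) < \<infinity> \<and> E1_norm m p E (\<lambda>x. u x - f x) < e)
    \<longleftrightarrow> (\<forall>e>0. \<exists>f\<in>core. total (\<lambda>x. u x - f x) < ennreal e)"
    if u: "u \<in> borel_measurable m" "total u < \<infinity>"
  proof -
    have fin: "total (\<lambda>x. u x - f x) < \<infinity>" "energy (\<lambda>x. u x - f x) < \<infinity>" if "f \<in> core" for f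
    proof -
      have "total (\<lambda>x. u x - f x) \<le> ennreal (2 powr p) * (total u + total f)"
        by (rule total_diff_le[OF u(1) core_measurable[OF that]])
      also have "\<dots> < \<infinity>" using that u by (simp add: core_iff ennreal_mult_less_top)
      finally show "total (\<lambda>x. u x - f x) < \<infinity>" .
      then show "energy (\<lambda>x. u x - f x) < \<infinity>" using energy_le_total by (rule order_le_less_trans[rotated])
    qed
    have eq: "E1_norm m p E (\<lambda>x. u x - f x) < e \<longleftrightarrow> total (\<lambda>x. u x - f x) < ennreal (e powr p)"
      if "f \<in> core" "0 < e" for f e
      using that u core_measurable[OF that(1)] by (intro E1_norm_less_iff fin) auto
    show ?thesis
    proof safe
      fix e :: real assume e: "0 < e" and H: "\<forall>e>0. \<exists>f\<in>core. energy (\<lambda>x. u x - f x) < \<infinity> \<and> E1_norm m p E (\<lambda>x. u x - f x) < e"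
      have "0 < e powr (1/p)" using e by simp
      then obtain f where "f \<in> core" "E1_norm m p E (\<lambda>x. u x - f x) < e powr (1/p)" using H by blast
      then show "\<exists>f\<in>core. total (\<lambda>x. u x - f x) < ennreal e"
        using eq[of f "e powr (1/p)"] e p_pos by (auto simp: powr_powr)
    next
      fix e :: real assume e: "0 < e" and H: "\<forall>e>0. \<exists>f\<in>core. total (\<lambda>x. u x - f x) < ennreal e"
      then obtain f where "f \<in> core" "total (\<lambda>x. u x - f x) < ennreal (e powr p)"
        by (metis powr_gt_zero less_numeral_extra(3))
      then show "\<exists>f\<in>core. energy (\<lambda>x. u x - f x) < \<infinity> \<and> E1_norm m p E (\<lambda>x. u x - f x) < e"
        using eq[of f e] fin e by auto
    qed
  qed
  then show ?thesis unfolding nl_dom_def by (auto simp: Lp_iff total_def)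
qed

lemma F_measurable: "u \<in> F \<Longrightarrow> u \<in> borel_measurable m" by (simp add: F_iff)
lemma F_total: "u \<in> F \<Longrightarrow> total u < \<infinity>" by (simp add: F_iff)
lemma F_energy: "u \<in> F \<Longrightarrow> energy u < \<infinity>" using F_total energy_le_total by (rule order_le_less_trans[rotated])

lemma core_subset_F: "u \<in> core \<Longrightarrow> u \<in> F"
proof -
  have "total (\<lambda>x. 0 :: real) = 0" by (simp add: total_def nl_energy_def p_pos)
  then show "u \<in> core \<Longrightarrow> u \<in> F"
    by (auto simp: F_iff core_measurable core_iff intro!: bexI[of _ u])
qed

lemma F_approx:
  assumes "u \<in> F" and "\<And>n. 0 < e n"
  obtains f where "\<And>n :: nat. f n \<in> core" "\<And>n. total (\<lambda>x. u x - f n x) < ennreal (e n)"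
proof -
  have "\<exists>f\<in>core. total (\<lambda>x. u x - f x) < ennreal (e n)" for n using assms unfolding F_iff by blast
  then have "\<forall>n. \<exists>f. f \<in> core \<and> total (\<lambda>x. u x - f x) < ennreal (e n)" by blast
  then obtain f where "\<forall>n. f n \<in> core \<and> total (\<lambda>x. u x - f n x) < ennreal (e n)" by (auto dest: choice)
  then show thesis using that[of f] by blast
qed

lemma F_intro:
  assumes "u \<in> borel_measurable m" "\<And>n. f n \<in> F" "(\<lambda>n. total (\<lambda>x. u x - f n x)) \<longlonglongrightarrow> 0"
  shows "u \<in> F"
proof -
  have *: "\<exists>g\<in>F. total (\<lambda>x. u x - g x) < ennreal e" if "0 < e" for e
  proof -
    have "eventually (\<lambda>n. total (\<lambda>x. u x - f n x) < ennreal e) sequentially"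
      using assms(3) that by (intro order_tendstoD) auto
    then show ?thesis using assms(2) by (auto dest!: eventually_happens)
  qed
  have "total u < \<infinity>"
  proof -
    obtain g where g: "g \<in> F" "total (\<lambda>x. u x - g x) < ennreal 1" using *[of 1] by auto
    have "total u \<le> ennreal (2 powr p) * (total (\<lambda>x. u x - g x) + total g)"
      using total_add_le[of "\<lambda>x. u x - g x" g] assms(1) F_measurable[OF g(1)] by simp
    also have "\<dots> < \<infinity>" using F_total[OF g(1)] order.strict_trans[OF g(2)] by (simp add: ennreal_mult_less_top)
    finally show ?thesis .
  qed
  moreover have "\<exists>f\<in>core. total (\<lambda>x. u x - f x) < ennreal e" if e: "0 < e" for e
  proof -
    \<comment> \<open>Two errors d, joined by the quasi-triangle inequality with its factor 2^p, add
      up to e.\<close>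
    define d where "d = e / (2 * 2 powr p)"
    have d: "0 < d" using e by (simp add: d_def)
    obtain g where g: "g \<in> F" "total (\<lambda>x. u x - g x) < ennreal d" using *[OF d] by auto
    obtain f where f: "f \<in> core" "total (\<lambda>x. g x - f x) < ennreal d" using g(1) d unfolding F_iff by auto
    have "total (\<lambda>x. u x - f x) \<le> ennreal (2 powr p) * (total (\<lambda>x. u x - g x) + total (\<lambda>x. g x - f x))"
      by (intro total_triangle assms F_measurable[OF g(1)] core_measurable[OF f(1)])
    also have "\<dots> < ennreal (2 powr p) * (ennreal d + ennreal d)"
      using g f d by (intro ennreal_mult_strict_left_mono add_strict_mono) auto
    also have "\<dots> = ennreal e" using d e by (simp add: ennreal_plus[symmetric] ennreal_mult[symmetric] d_def del: ennreal_plus)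
    finally show ?thesis using f(1) by blast
  qed
  ultimately show ?thesis using assms(1) by (simp add: F_iff)
qed

lemma Cc_lip2:
  assumes l: "lip2 L \<phi>" and u: "u \<in> Cc (space m)" and v: "v \<in> Cc (space m)"
  shows "(\<lambda>x. \<phi> (u x) (v x)) \<in> Cc (space m)"
proof -
  obtain K1 where K1: "continuous_on (space m) u" "compact K1" "K1 \<subseteq> space m" "\<forall>x\<in>space m - K1. u x = 0"
    using u by (auto simp: Cc_def)
  obtain K2 where K2: "continuous_on (space m) v" "compact K2" "K2 \<subseteq> space m" "\<forall>x\<in>space m - K2. v x = 0"
    using v by (auto simp: Cc_def)
  have p0: "\<phi> 0 0 = 0" using l by (simp add: lip2_def)
  show ?thesis
    unfolding Cc_def
  proof (intro CollectI conjI exI[of _ "K1 \<union> K2"])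
    show "\<forall>x\<in>space m - (K1 \<union> K2). \<phi> (u x) (v x) = 0" using K1 K2 p0 by simp
  qed (use K1 K2 in \<open>auto intro!: lip2_compose_continuous[OF l] compact_Un\<close>)
qed

lemma core_lip2:
  assumes l: "lip2 L \<phi>" and u: "u \<in> core" and v: "v \<in> core"
  shows "(\<lambda>x. \<phi> (u x) (v x)) \<in> core"
proof -
  have "(\<lambda>x. \<phi> (u x) (v x)) \<in> Cc (space m)"
    using u v by (intro Cc_lip2[OF l]) (auto simp: core_iff)
  moreover have "total (\<lambda>x. \<phi> (u x) (v x)) \<le> ennreal ((2 * L) powr p) * (total u + total v)"
    by (intro total_lip2_le l core_measurable u v)
  then have "total (\<lambda>x. \<phi> (u x) (v x)) < \<infinity>"
    using u v by (auto simp: core_iff ennreal_mult_less_top intro: order_le_less_trans)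
  ultimately show ?thesis by (simp add: core_iff)
qed

lemma suminf_half_power_finite: "(\<Sum>n. ennreal ((1/2) ^ n)) < \<infinity>"
  using summable_geometric[of "1/2 :: real"] by (subst suminf_ennreal2) auto

lemma total_AE_tendsto:
  assumes "\<And>n. f n \<in> borel_measurable m" "u \<in> borel_measurable m"
    and "\<And>n. total (\<lambda>x. u x - f n x) \<le> ennreal ((1/2) ^ n)"
  shows "AE x in m. (\<lambda>n. f n x) \<longlonglongrightarrow> u x"
proof -
  have "AE x in m. (\<lambda>n. u x - f n x) \<longlonglongrightarrow> 0"
  proof (rule AE_tendsto_of_summable_powr[OF _ p_pos(1)])
    show "(\<lambda>x. u x - f n x) \<in> borel_measurable m" for n using assms by simp
    have "(\<Sum>n. \<integral>\<^sup>+x. ennreal (\<bar>u x - f n x\<bar> powr p) \<partial>m) \<le> (\<Sum>n. ennreal ((1/2) ^ n))"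
      by (intro suminf_le order_trans[OF lp_le_total assms(3)]) auto
    then show "(\<Sum>n. \<integral>\<^sup>+x. ennreal (\<bar>u x - f n x\<bar> powr p) \<partial>m) < \<infinity>"
      using suminf_half_power_finite by (rule order_le_less_trans)
  qed
  then show ?thesis
  proof eventually_elim
    fix x assume "(\<lambda>n. u x - f n x) \<longlonglongrightarrow> 0"
    then have "(\<lambda>n. u x - (u x - f n x)) \<longlonglongrightarrow> u x - 0" by (intro tendsto_intros)
    then show "(\<lambda>n. f n x) \<longlonglongrightarrow> u x" by simp
  qed
qed

text \<open>
  Lipschitz operations are continuous at \<open>u, v\<close> in the energy norm: the difference energies are dominated by a
  fixed integrable function plus a remainder whose integral tends to zero.
\<close>

lemma F_lip2:
  assumes l: "lip2 L \<phi>" and u: "u \<in> F" and v: "v \<in> F"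
  shows "(\<lambda>x. \<phi> (u x) (v x)) \<in> F"
proof -
  obtain f where f: "\<And>n. f n \<in> core" "\<And>n. total (\<lambda>x. u x - f n x) < ennreal ((1/2) ^ n)"
    using F_approx[OF u, of "\<lambda>n. (1/2) ^ n"] by auto
  obtain g where g: "\<And>n. g n \<in> core" "\<And>n. total (\<lambda>x. v x - g n x) < ennreal ((1/2) ^ n)"
    using F_approx[OF v, of "\<lambda>n. (1/2) ^ n"] by auto
  note [measurable] = F_measurable[OF u] F_measurable[OF v] core_measurable[OF f(1)] core_measurable[OF g(1)]
  let ?w = "\<lambda>x. \<phi> (u x) (v x)" and ?h = "\<lambda>n x. \<phi> (f n x) (g n x)"
  have [measurable]: "?w \<in> borel_measurable m" "\<And>n. ?h n \<in> borel_measurable m"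
    by (auto intro!: lip2_measurable[OF l])
  \<comment> \<open>One factor 2^p splits the difference, (2L)^p is the Lipschitz bound, and the
    last factor covers the terms in u, v and those created by expanding \<open>f n\<close>,
    \<open>g n\<close> around u, v.\<close>
  define C where "C = 2 powr p * ((2 * L) powr p * (2 * 2 powr p + 1))"
  have C: "0 \<le> C" by (simp add: C_def)
  define X where "X n z = ennreal (\<bar>(?w (fst z) - ?h n (fst z)) - (?w (snd z) - ?h n (snd z))\<bar> powr p)" for n z
  define G where "G z = ennreal C * (ennreal (\<bar>u (fst z) - u (snd z)\<bar> powr p) + ennreal (\<bar>v (fst z) - v (snd z)\<bar> powr p))" for z
  define R where "R n z = ennreal C * (ennreal (\<bar>(u (fst z) - f n (fst z)) - (u (snd z) - f n (snd z))\<bar> powr p)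
      + ennreal (\<bar>(v (fst z) - g n (fst z)) - (v (snd z) - g n (snd z))\<bar> powr p))" for n z
  have [measurable]: "\<And>n. X n \<in> borel_measurable jm" "G \<in> borel_measurable jm" "\<And>n. R n \<in> borel_measurable jm"
    unfolding X_def[abs_def] G_def[abs_def] R_def[abs_def] by measurable
  have XGR: "X n z \<le> G z + R n z" for n z
  proof -
    let ?x = "fst z" and ?y = "snd z"
    let ?P = "\<lambda>s. \<bar>s\<bar> powr p"
    have A: "?P (f n ?x - f n ?y) \<le> 2 powr p * (?P (u ?x - u ?y) + ?P ((u ?x - f n ?x) - (u ?y - f n ?y)))"
    proof -
      have eq: "f n ?x - f n ?y = (u ?x - u ?y) - ((u ?x - f n ?x) - (u ?y - f n ?y))" by simp
      show ?thesis by (subst eq) (rule abs_diff_powr_le[OF p_pos(1)])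
    qed
    have B: "?P (g n ?x - g n ?y) \<le> 2 powr p * (?P (v ?x - v ?y) + ?P ((v ?x - g n ?x) - (v ?y - g n ?y)))"
    proof -
      have eq: "g n ?x - g n ?y = (v ?x - v ?y) - ((v ?x - g n ?x) - (v ?y - g n ?y))" by simp
      show ?thesis by (subst eq) (rule abs_diff_powr_le[OF p_pos(1)])
    qed
    define a b c d where "a = ?P (u ?x - u ?y)" and "b = ?P (v ?x - v ?y)"
      and "c = ?P ((u ?x - f n ?x) - (u ?y - f n ?y))" and "d = ?P ((v ?x - g n ?x) - (v ?y - g n ?y))"
    have nn: "0 \<le> a" "0 \<le> b" "0 \<le> c" "0 \<le> d" by (auto simp: a_def b_def c_def d_def)
    have eq: "(?w ?x - ?h n ?x) - (?w ?y - ?h n ?y) = (?w ?x - ?w ?y) - (?h n ?x - ?h n ?y)" by simp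
    have "?P ((?w ?x - ?h n ?x) - (?w ?y - ?h n ?y)) \<le> 2 powr p * (?P (?w ?x - ?w ?y) + ?P (?h n ?x - ?h n ?y))"
      by (subst eq) (rule abs_diff_powr_le[OF p_pos(1)])
    also have "\<dots> \<le> 2 powr p * ((2 * L) powr p * (a + b) + (2 * L) powr p * (?P (f n ?x - f n ?y) + ?P (g n ?x - g n ?y)))"
      unfolding a_def b_def by (intro mult_left_mono add_mono lip2_powr_le[OF l p_pos(1)]) auto
    also have "\<dots> \<le> 2 powr p * ((2 * L) powr p * (a + b) + (2 * L) powr p * (2 powr p * (a + c) + 2 powr p * (b + d)))"
      using A B unfolding a_def b_def c_def d_def by (intro mult_left_mono add_mono) auto
    also have "\<dots> = 2 powr p * ((2 * L) powr p * ((a + b) * (2 powr p + 1) + 2 powr p * (c + d)))"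
      by (simp add: algebra_simps)
    also have "\<dots> \<le> 2 powr p * ((2 * L) powr p * ((a + b) * (2 * 2 powr p + 1) + (2 * 2 powr p + 1) * (c + d)))"
      using nn by (intro mult_left_mono add_mono mult_right_mono) auto
    also have "\<dots> = C * (a + b) + C * (c + d)" by (simp add: C_def algebra_simps)
    finally have "X n z \<le> ennreal (C * (a + b) + C * (c + d))" unfolding X_def by (rule ennreal_leI)
    also have "\<dots> = G z + R n z"
      using C nn unfolding G_def R_def a_def[symmetric] b_def[symmetric] c_def[symmetric] d_def[symmetric]
      by (simp add: ennreal_plus ennreal_mult)
    finally show ?thesis .
  qed
  have Gfin: "(\<integral>\<^sup>+z. G z \<partial>jm) < \<infinity>"
  proof -
    have "(\<integral>\<^sup>+z. G z \<partial>jm) = ennreal C * (energy u + energy v)"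
      unfolding G_def by (subst nn_integral_cmult, measurable) (subst nn_integral_add, auto simp: energy_eq)
    then show ?thesis using F_energy[OF u] F_energy[OF v] by (simp add: ennreal_mult_less_top)
  qed
  have Rle: "(\<integral>\<^sup>+z. R n z \<partial>jm) \<le> ennreal C * (ennreal ((1/2) ^ n) + ennreal ((1/2) ^ n))" for n
  proof -
    have "(\<integral>\<^sup>+z. R n z \<partial>jm) = ennreal C * (energy (\<lambda>x. u x - f n x) + energy (\<lambda>x. v x - g n x))"
      unfolding R_def by (subst nn_integral_cmult, measurable) (subst nn_integral_add, auto simp: energy_eq)
    also have "\<dots> \<le> ennreal C * (ennreal ((1/2) ^ n) + ennreal ((1/2) ^ n))"
      by (intro mult_left_mono add_mono order_trans[OF energy_le_total less_imp_le] f g) auto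
    finally show ?thesis .
  qed
  have lim0: "AE z in jm. (\<lambda>n. min (X n z) (G z)) \<longlonglongrightarrow> 0"
  proof -
    have "AE x in m. (\<lambda>n. f n x) \<longlonglongrightarrow> u x" "AE x in m. (\<lambda>n. g n x) \<longlonglongrightarrow> v x"
      by (intro total_AE_tendsto less_imp_le f g; measurable)+
    then have "AE x in m. (\<lambda>n. ?h n x) \<longlonglongrightarrow> ?w x"
    proof eventually_elim
      fix x assume "(\<lambda>n. f n x) \<longlonglongrightarrow> u x" "(\<lambda>n. g n x) \<longlonglongrightarrow> v x"
      then have "(\<lambda>n. (f n x, g n x)) \<longlonglongrightarrow> (u x, v x)" by (rule tendsto_Pair)
      then show "(\<lambda>n. ?h n x) \<longlonglongrightarrow> ?w x"
        using continuous_on_tendsto_compose[OF lip2_continuous[OF l]] by fastforce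
    qed
    from AE_jm[OF this] show ?thesis
    proof eventually_elim
      fix z assume a: "(\<lambda>n. ?h n (fst z)) \<longlonglongrightarrow> ?w (fst z) \<and> (\<lambda>n. ?h n (snd z)) \<longlonglongrightarrow> ?w (snd z)"
      have "(\<lambda>n. X n z) \<longlonglongrightarrow> ennreal (\<bar>(?w (fst z) - ?w (fst z)) - (?w (snd z) - ?w (snd z))\<bar> powr p)"
        unfolding X_def using a p_pos by (intro tendsto_ennrealI tendsto_powr' tendsto_intros) auto
      then have "(\<lambda>n. min (X n z) (G z)) \<longlonglongrightarrow> min 0 (G z)"
        using p_pos by (intro tendsto_min tendsto_const) simp
      then show "(\<lambda>n. min (X n z) (G z)) \<longlonglongrightarrow> 0" by (simp add: min_def)
    qed
  qed
  \<comment> \<open>\<open>X n\<close> itself has no fixed majorant, but its minimum with G has;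
    what exceeds G is at most \<open>R n\<close>, whose integral tends to 0.\<close>
  have lim1: "(\<lambda>n. \<integral>\<^sup>+z. min (X n z) (G z) \<partial>jm) \<longlonglongrightarrow> (\<integral>\<^sup>+z. 0 \<partial>jm)"
    by (rule nn_integral_dominated_convergence[where w=G]) (use lim0 Gfin in auto)
  have energy_le: "energy (\<lambda>x. ?w x - ?h n x) \<le> (\<integral>\<^sup>+z. min (X n z) (G z) \<partial>jm) + ennreal C * (ennreal ((1/2) ^ n) + ennreal ((1/2) ^ n))" for n
  proof -
    have "energy (\<lambda>x. ?w x - ?h n x) = (\<integral>\<^sup>+z. X n z \<partial>jm)" unfolding X_def by (subst energy_eq) auto
    also have "\<dots> \<le> (\<integral>\<^sup>+z. min (X n z) (G z) + R n z \<partial>jm)"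
      using XGR by (intro nn_integral_mono) (auto simp: min_def)
    also have "\<dots> = (\<integral>\<^sup>+z. min (X n z) (G z) \<partial>jm) + (\<integral>\<^sup>+z. R n z \<partial>jm)"
      by (rule nn_integral_add) auto
    also have "\<dots> \<le> (\<integral>\<^sup>+z. min (X n z) (G z) \<partial>jm) + ennreal C * (ennreal ((1/2) ^ n) + ennreal ((1/2) ^ n))"
      by (intro add_mono Rle order_refl)
    finally show ?thesis .
  qed
  have lp_le: "(\<integral>\<^sup>+x. ennreal (\<bar>?w x - ?h n x\<bar> powr p) \<partial>m) \<le> ennreal ((2 * L) powr p) * (ennreal ((1/2) ^ n) + ennreal ((1/2) ^ n))" for n
  proof -
    have "(\<integral>\<^sup>+x. ennreal (\<bar>?w x - ?h n x\<bar> powr p) \<partial>m) \<le>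
      (\<integral>\<^sup>+x. ennreal ((2 * L) powr p) * (ennreal (\<bar>u x - f n x\<bar> powr p) + ennreal (\<bar>v x - g n x\<bar> powr p)) \<partial>m)"
      using lip2_powr_le[OF l p_pos(1)]
      by (intro nn_integral_mono) (simp add: ennreal_mult[symmetric] ennreal_plus[symmetric] ennreal_leI del: ennreal_plus)
    also have "\<dots> = ennreal ((2 * L) powr p) * ((\<integral>\<^sup>+x. ennreal (\<bar>u x - f n x\<bar> powr p) \<partial>m) + (\<integral>\<^sup>+x. ennreal (\<bar>v x - g n x\<bar> powr p) \<partial>m))"
      by (subst nn_integral_cmult, measurable) (subst nn_integral_add, auto)
    also have "\<dots> \<le> ennreal ((2 * L) powr p) * (ennreal ((1/2) ^ n) + ennreal ((1/2) ^ n))"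
      by (intro mult_left_mono add_mono order_trans[OF lp_le_total less_imp_le] f g) auto
    finally show ?thesis .
  qed
  have half0: "(\<lambda>n. ennreal c * (ennreal ((1/2) ^ n) + ennreal ((1/2) ^ n))) \<longlonglongrightarrow> 0" if "0 \<le> c" for c
  proof -
    have "(\<lambda>n. ennreal (c * ((1/2) ^ n + (1/2) ^ n))) \<longlonglongrightarrow> ennreal (c * (0 + 0))"
      by (intro tendsto_intros LIMSEQ_power_zero) auto
    moreover have "ennreal (c * ((1/2) ^ n + (1/2) ^ n)) = ennreal c * (ennreal ((1/2) ^ n) + ennreal ((1/2) ^ n))" for n
    proof -
      have "0 \<le> (1/2 :: real) ^ n" by simp
      then show ?thesis using that by (simp only: ennreal_mult ennreal_plus add_nonneg_nonneg)
    qed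
    ultimately show ?thesis by simp
  qed
  have "(\<lambda>n. total (\<lambda>x. ?w x - ?h n x)) \<longlonglongrightarrow> 0"
  proof (rule tendsto_sandwich[OF _ _ tendsto_const])
    show "\<forall>\<^sub>F n in sequentially. total (\<lambda>x. ?w x - ?h n x) \<le>
      ((\<integral>\<^sup>+z. min (X n z) (G z) \<partial>jm) + ennreal C * (ennreal ((1/2) ^ n) + ennreal ((1/2) ^ n)))
       + ennreal ((2 * L) powr p) * (ennreal ((1/2) ^ n) + ennreal ((1/2) ^ n))"
      unfolding total_def by (intro always_eventually allI add_mono energy_le lp_le)
    show "(\<lambda>n. ((\<integral>\<^sup>+z. min (X n z) (G z) \<partial>jm) + ennreal C * (ennreal ((1/2) ^ n) + ennreal ((1/2) ^ n)))
       + ennreal ((2 * L) powr p) * (ennreal ((1/2) ^ n) + ennreal ((1/2) ^ n))) \<longlonglongrightarrow> 0"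
      using tendsto_add[OF tendsto_add[OF lim1 half0[OF C]] half0[of "(2 * L) powr p"]] by simp
  qed auto
  then show ?thesis
    by (rule F_intro[of ?w ?h, rotated 2]) (simp_all add: core_subset_F[OF core_lip2[OF l f(1) g(1)]])
qed

lemma F_add: "u \<in> F \<Longrightarrow> v \<in> F \<Longrightarrow> (\<lambda>x. u x + v x) \<in> F" by (rule F_lip2[OF lip2_add])
lemma F_diff: "u \<in> F \<Longrightarrow> v \<in> F \<Longrightarrow> (\<lambda>x. u x - v x) \<in> F" by (rule F_lip2[OF lip2_diff])
lemma F_scale: "u \<in> F \<Longrightarrow> (\<lambda>x. c * u x) \<in> F" by (rule F_lip2[OF lip2_scale])
lemma F_compose:
  assumes "u \<in> F" "\<psi> 0 = 0" "0 \<le> L" "\<And>s t. \<bar>\<psi> s - \<psi> t\<bar> \<le> L * \<bar>s - t\<bar>"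
  shows "(\<lambda>x. \<psi> (u x)) \<in> F"
  by (rule F_lip2[OF lip2_unary[OF assms(2-4)] assms(1,1)])

lemma Cc_zero: "(\<lambda>x. 0) \<in> Cc (space m)" by (auto simp: Cc_def intro!: exI[of _ "{}"])

lemma zero_in_F: "(\<lambda>x. 0) \<in> F"
  by (intro core_subset_F) (simp add: core_iff Cc_zero total_def nl_energy_def p_pos)

text \<open>Fatou's lemma is applied to the energy and to the norm separately, each bounded by c;
  hence the sum c + c.\<close>

lemma total_limit_le:
  assumes [measurable]: "\<And>n. f n \<in> borel_measurable m" "u \<in> borel_measurable m"
    and lim: "AE x in m. (\<lambda>n. f n x) \<longlonglongrightarrow> u x" and le: "\<And>n. n \<ge> N \<Longrightarrow> total (f n) \<le> c"
  shows "total u \<le> c + c"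
proof -
  have "energy u \<le> c"
  proof -
    have "energy u = (\<integral>\<^sup>+z. liminf (\<lambda>n. ennreal (\<bar>f n (fst z) - f n (snd z)\<bar> powr p)) \<partial>jm)"
      unfolding energy_eq[OF assms(2)]
    proof (rule nn_integral_cong_AE)
      show "AE z in jm. ennreal (\<bar>u (fst z) - u (snd z)\<bar> powr p) = liminf (\<lambda>n. ennreal (\<bar>f n (fst z) - f n (snd z)\<bar> powr p))"
        using AE_jm[OF lim]
      proof eventually_elim
        fix z assume "(\<lambda>n. f n (fst z)) \<longlonglongrightarrow> u (fst z) \<and> (\<lambda>n. f n (snd z)) \<longlonglongrightarrow> u (snd z)"
        then have "(\<lambda>n. ennreal (\<bar>f n (fst z) - f n (snd z)\<bar> powr p)) \<longlonglongrightarrow> ennreal (\<bar>u (fst z) - u (snd z)\<bar> powr p)"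
          using p_pos by (intro tendsto_ennrealI tendsto_powr' tendsto_intros) auto
        then show "ennreal (\<bar>u (fst z) - u (snd z)\<bar> powr p) = liminf (\<lambda>n. ennreal (\<bar>f n (fst z) - f n (snd z)\<bar> powr p))"
          by (intro lim_imp_Liminf[symmetric]) auto
      qed
    qed
    also have "\<dots> \<le> liminf (\<lambda>n. energy (f n))"
      by (subst energy_eq, simp) (rule nn_integral_liminf, measurable)
    also have "\<dots> \<le> c"
      by (rule Liminf_le) (auto simp: eventually_sequentially intro!: exI[of _ N] order_trans[OF energy_le_total le])
    finally show ?thesis .
  qed
  moreover have "(\<integral>\<^sup>+x. ennreal (\<bar>u x\<bar> powr p) \<partial>m) \<le> c"
  proof -
    have "(\<integral>\<^sup>+x. ennreal (\<bar>u x\<bar> powr p) \<partial>m) = (\<integral>\<^sup>+x. liminf (\<lambda>n. ennreal (\<bar>f n x\<bar> powr p)) \<partial>m)"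
    proof (rule nn_integral_cong_AE)
      show "AE x in m. ennreal (\<bar>u x\<bar> powr p) = liminf (\<lambda>n. ennreal (\<bar>f n x\<bar> powr p))"
        using lim
      proof eventually_elim
        fix x assume "(\<lambda>n. f n x) \<longlonglongrightarrow> u x"
        then have "(\<lambda>n. ennreal (\<bar>f n x\<bar> powr p)) \<longlonglongrightarrow> ennreal (\<bar>u x\<bar> powr p)"
          using p_pos by (intro tendsto_ennrealI tendsto_powr' tendsto_intros) auto
        then show "ennreal (\<bar>u x\<bar> powr p) = liminf (\<lambda>n. ennreal (\<bar>f n x\<bar> powr p))"
          by (intro lim_imp_Liminf[symmetric]) auto
      qed
    qed
    also have "\<dots> \<le> liminf (\<lambda>n. \<integral>\<^sup>+x. ennreal (\<bar>f n x\<bar> powr p) \<partial>m)"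
      by (rule nn_integral_liminf) measurable
    also have "\<dots> \<le> c"
      by (rule Liminf_le) (auto simp: eventually_sequentially intro!: exI[of _ N] order_trans[OF lp_le_total le])
    finally show ?thesis .
  qed
  ultimately show ?thesis unfolding total_def by (rule add_mono)
qed

text \<open>Besides completeness this supplies a subsequence converging almost everywhere, which the
  capacity estimate needs in order to compare the limit with partial sums.\<close>

lemma F_complete:
  assumes s: "\<And>n. s n \<in> F" and cauchy: "\<And>e. 0 < e \<Longrightarrow> \<exists>N. \<forall>i\<ge>N. \<forall>j\<ge>N. total (\<lambda>x. s i x - s j x) < ennreal e"
  obtains u r where "u \<in> F" "(\<lambda>n. total (\<lambda>x. s n x - u x)) \<longlonglongrightarrow> 0" "strict_mono r"
    "AE x in m. (\<lambda>n. s (r n) x) \<longlonglongrightarrow> u x"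
proof -
  note [measurable] = F_measurable[OF s]
  \<comment> \<open>Differences multiplied by 2^k then still have p-th powers bounded by (1/2)^(pk),
    so almost everywhere they stay bounded and the differences themselves decay like 2^-k.\<close>
  define d where "d k = ((1/4) powr p) ^ k" for k :: nat
  have d: "0 < d k" for k by (simp add: d_def)
  obtain N where N: "\<And>k i j. N k \<le> i \<Longrightarrow> N k \<le> j \<Longrightarrow> total (\<lambda>x. s i x - s j x) < ennreal (d k)"
    using cauchy[OF d] by metis
  \<comment> \<open>Summing the thresholds puts the index above each \<open>N k\<close>; the extra k
    makes it strictly increasing.\<close>
  define r where "r k = (\<Sum>i\<le>k. N i) + k" for k
  have rN: "N k \<le> r k" for k unfolding r_def by (intro trans_le_add1 member_le_sum) auto
  have r: "strict_mono r" unfolding r_def by (intro strict_monoI_Suc) simp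
  define t where "t k = s (r k)" for k
  have [measurable]: "t k \<in> borel_measurable m" for k by (simp add: t_def)
  have tt: "total (\<lambda>x. t (Suc k) x - t k x) \<le> ennreal (d k)" for k
    unfolding t_def using rN[of k] strict_mono_leD[OF r, of k "Suc k"] by (intro less_imp_le[OF N]) auto
  have "(\<integral>\<^sup>+x. (\<Sum>k. ennreal (\<bar>2 ^ k * (t (Suc k) x - t k x)\<bar> powr p)) \<partial>m) \<noteq> \<infinity>"
  proof -
    have "(\<integral>\<^sup>+x. ennreal (\<bar>2 ^ k * (t (Suc k) x - t k x)\<bar> powr p) \<partial>m) \<le> ennreal (((1/2) powr p) ^ k)" for k
    proof -
      have "(\<integral>\<^sup>+x. ennreal (\<bar>2 ^ k * (t (Suc k) x - t k x)\<bar> powr p) \<partial>m)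
        = ennreal ((2 ^ k) powr p) * (\<integral>\<^sup>+x. ennreal (\<bar>t (Suc k) x - t k x\<bar> powr p) \<partial>m)"
        by (subst nn_integral_cmult[symmetric]) (auto simp: abs_mult powr_mult ennreal_mult)
      also have "\<dots> \<le> ennreal ((2 ^ k) powr p) * ennreal (d k)"
        by (intro mult_left_mono order_trans[OF lp_le_total tt]) auto
      also have "\<dots> = ennreal (((1/2) powr p) ^ k)"
      proof -
        have "(2 ^ k) powr p * d k = (2 powr p * (1/4) powr p) ^ k"
          unfolding d_def by (induction k) (simp_all add: powr_mult)
        also have "2 powr p * (1/4) powr p = (1/2 :: real) powr p" by (simp flip: powr_mult)
        finally show ?thesis using d[of k] by (simp add: ennreal_mult[symmetric])
      qed
      finally show ?thesis .
    qed
    then have "(\<Sum>k. \<integral>\<^sup>+x. ennreal (\<bar>2 ^ k * (t (Suc k) x - t k x)\<bar> powr p) \<partial>m) \<le> (\<Sum>k. ennreal (((1/2) powr p) ^ k))"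
      by (intro suminf_le) auto
    also have "\<dots> < \<infinity>"
    proof -
      have "(1/2) powr p < (1/2 :: real) powr 0" using p_pos by (intro powr_less_mono') auto
      then have "summable (\<lambda>k. ((1/2 :: real) powr p) ^ k)" by (intro summable_geometric) auto
      then show ?thesis by (subst suminf_ennreal2) auto
    qed
    finally show ?thesis by (subst nn_integral_suminf) auto
  qed
  then have "AE x in m. (\<Sum>k. ennreal (\<bar>2 ^ k * (t (Suc k) x - t k x)\<bar> powr p)) \<noteq> \<infinity>"
    by (intro nn_integral_PInf_AE) auto
  then have conv: "AE x in m. convergent (\<lambda>k. t k x)"
  proof eventually_elim
    fix x assume "(\<Sum>k. ennreal (\<bar>2 ^ k * (t (Suc k) x - t k x)\<bar> powr p)) \<noteq> \<infinity>"
    then have "summable (\<lambda>k. \<bar>2 ^ k * (t (Suc k) x - t k x)\<bar> powr p)" by (intro summable_suminf_not_top) auto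
    then have "(\<lambda>k. \<bar>2 ^ k * (t (Suc k) x - t k x)\<bar> powr p) \<longlonglongrightarrow> 0" by (rule summable_LIMSEQ_zero)
    then have "Bseq (\<lambda>k. \<bar>2 ^ k * (t (Suc k) x - t k x)\<bar> powr p)" by (intro convergent_imp_Bseq convergentI)
    then obtain B where B: "0 < B" "\<And>k. \<bar>2 ^ k * (t (Suc k) x - t k x)\<bar> powr p \<le> B"
      by (auto elim!: BseqE)
    have bd: "\<bar>t (Suc k) x - t k x\<bar> \<le> B powr (1/p) * (1/2) ^ k" for k
    proof -
      have "(\<bar>2 ^ k * (t (Suc k) x - t k x)\<bar> powr p) powr (1/p) \<le> B powr (1/p)"
        using B p_pos by (intro powr_mono2) auto
      then have "2 ^ k * \<bar>t (Suc k) x - t k x\<bar> \<le> B powr (1/p)" using p_pos by (simp add: powr_powr abs_mult)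
      then show ?thesis by (simp add: power_divide pos_le_divide_eq mult.commute)
    qed
    have "summable (\<lambda>k. B powr (1/p) * (1/2) ^ k)" by (intro summable_mult summable_geometric) simp
    then have "summable (\<lambda>k. t (Suc k) x - t k x)"
      by (rule summable_comparison_test'[where N=0]) (simp add: bd)
    then have "convergent (\<lambda>n. \<Sum>k<n. t (Suc k) x - t k x)" by (simp add: summable_iff_convergent)
    moreover have "(\<Sum>k<n. t (Suc k) x - t k x) = t n x - t 0 x" for n
      by (rule sum_lessThan_telescope[of "\<lambda>k. t k x"])
    ultimately have "convergent (\<lambda>n. t n x - t 0 x)" by (simp only:)
    then have "convergent (\<lambda>n. (t n x - t 0 x) + t 0 x)" by (intro convergent_add convergent_const)
    then show "convergent (\<lambda>k. t k x)" by simp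
  qed
  define u where "u x = lim (\<lambda>k. t k x)" for x
  have u [measurable]: "u \<in> borel_measurable m" unfolding u_def[abs_def] by (rule borel_measurable_lim_metric) auto
  have tu: "AE x in m. (\<lambda>k. t k x) \<longlonglongrightarrow> u x"
    using conv unfolding u_def by eventually_elim (simp add: convergent_LIMSEQ_iff)
  have su: "total (\<lambda>x. s n x - u x) \<le> ennreal (2 * d k)" if "N k \<le> n" for n k
  proof -
    have "total (\<lambda>x. s n x - u x) \<le> ennreal (d k) + ennreal (d k)"
    proof (rule total_limit_le[where f="\<lambda>j x. s n x - t j x" and N=k])
      show "AE x in m. (\<lambda>j. s n x - t j x) \<longlonglongrightarrow> s n x - u x"
        using tu by eventually_elim (intro tendsto_intros)
      show "total (\<lambda>x. s n x - t j x) \<le> ennreal (d k)" if "k \<le> j" for j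
        unfolding t_def using that \<open>N k \<le> n\<close> rN[of k] strict_mono_leD[OF r, of k j] by (intro less_imp_le[OF N]) auto
    qed auto
    then show ?thesis using d[of k] by (simp flip: ennreal_plus)
  qed
  have d0: "(\<lambda>k. ennreal (2 * d k)) \<longlonglongrightarrow> 0"
  proof -
    have "(1/4) powr p < (1/4 :: real) powr 0" using p_pos by (intro powr_less_mono') auto
    then have "(\<lambda>k. ennreal (2 * d k)) \<longlonglongrightarrow> ennreal (2 * 0)"
      unfolding d_def by (intro tendsto_intros LIMSEQ_power_zero) auto
    then show ?thesis by simp
  qed
  have lim: "(\<lambda>n. total (\<lambda>x. s n x - u x)) \<longlonglongrightarrow> 0"
  proof (rule order_tendstoI)
    fix a :: ennreal assume "0 < a"
    then obtain k where k: "ennreal (2 * d k) < a"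
      using eventually_happens[OF order_tendstoD(2)[OF d0 \<open>0 < a\<close>]] by auto
    then show "\<forall>\<^sub>F n in sequentially. total (\<lambda>x. s n x - u x) < a"
      using su[of k] by (intro eventually_sequentiallyI[of "N k"]) (auto intro: order_le_less_trans)
  qed auto
  moreover have "u \<in> F"
    using lim unfolding total_uminus[of "s _" u] by (intro F_intro[OF u s])
  ultimately show ?thesis using that r tu unfolding t_def by blast
qed

section \<open>The jump measure and the axioms of a p-energy form\<close>

lemma measurable_dist_pair: "(\<lambda>z. dist (fst z) (snd z)) \<in> borel_measurable (m \<Otimes>\<^sub>M m)"
  by (intro borel_measurable_dist measurable_compose[OF measurable_fst measurable_m_borel]
      measurable_compose[OF measurable_snd measurable_m_borel])

lemma off_diag_sets: "off_diag (space m) \<in> sets (m \<Otimes>\<^sub>M m)"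
proof -
  note [measurable] = measurable_dist_pair
  have "off_diag (space m) = {z \<in> space (m \<Otimes>\<^sub>M m). dist (fst z) (snd z) \<noteq> 0}"
    by (auto simp: off_diag_def space_pair_measure)
  also have "\<dots> \<in> sets (m \<Otimes>\<^sub>M m)" by measurable
  finally show ?thesis .
qed

lemma sets_jump_measure: "sets (jump_measure m J) = sets (restrict_space (m \<Otimes>\<^sub>M m) (off_diag (space m)))"
  by (simp add: jump_measure_def)

lemma nn_integral_jump_measure:
  assumes [measurable]: "f \<in> borel_measurable (m \<Otimes>\<^sub>M m)" and diag: "\<And>x. f (x, x) = 0"
  shows "(\<integral>\<^sup>+z. f z \<partial>jump_measure m J) = (\<integral>\<^sup>+z. f z \<partial>jm)"
proof -
  note [measurable] = off_diag_sets J_pair_measurable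
  have "(\<integral>\<^sup>+z. f z \<partial>jump_measure m J) = (\<integral>\<^sup>+z. ennreal (J (fst z) (snd z)) * f z \<partial>restrict_space (m \<Otimes>\<^sub>M m) (off_diag (space m)))"
    unfolding jump_measure_def by (intro nn_integral_density measurable_restrict_space1) auto
  also have "\<dots> = (\<integral>\<^sup>+z. ennreal (J (fst z) (snd z)) * f z * indicator (off_diag (space m)) z \<partial>(m \<Otimes>\<^sub>M m))"
    by (rule nn_integral_restrict_space) (auto intro!: sets.Int off_diag_sets)
  also have "\<dots> = (\<integral>\<^sup>+z. ennreal (J (fst z) (snd z)) * f z \<partial>(m \<Otimes>\<^sub>M m))"
    using diag by (intro nn_integral_cong) (auto simp: indicator_def off_diag_def space_pair_measure)
  also have "\<dots> = (\<integral>\<^sup>+z. f z \<partial>jm)" unfolding jm_def by (rule nn_integral_density[symmetric]) auto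
  finally show ?thesis .
qed

lemma jump_integral:
  assumes u: "u \<in> F"
  shows "integrable (jump_measure m J) (\<lambda>z. \<bar>u (fst z) - u (snd z)\<bar> powr p)"
    and "(\<integral>z. \<bar>u (fst z) - u (snd z)\<bar> powr p \<partial>jump_measure m J) = E u"
proof -
  note [measurable] = F_measurable[OF u]
  have meas [measurable]: "(\<lambda>z. \<bar>u (fst z) - u (snd z)\<bar> powr p) \<in> borel_measurable (jump_measure m J)"
    unfolding jump_measure_def by (simp add: measurable_restrict_space1)
  have eq: "(\<integral>\<^sup>+z. ennreal (\<bar>u (fst z) - u (snd z)\<bar> powr p) \<partial>jump_measure m J) = energy u"
    by (subst nn_integral_jump_measure) (auto simp: energy_eq p_pos)
  show "integrable (jump_measure m J) (\<lambda>z. \<bar>u (fst z) - u (snd z)\<bar> powr p)"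
    using F_energy[OF u] by (intro integrableI_bounded meas) (simp add: eq)
  show "(\<integral>z. \<bar>u (fst z) - u (snd z)\<bar> powr p \<partial>jump_measure m J) = E u"
    by (subst integral_eq_nn_integral) (auto simp: eq nl_form_def)
qed

lemma local_part_zero: "u \<in> F \<Longrightarrow> local_part p E (jump_measure m J) u = 0"
  by (simp add: local_part_def jump_integral)

lemma E_energy: "u \<in> F \<Longrightarrow> ennreal (E u) = energy u"
  using F_energy by (simp add: nl_form_def less_top)

lemma E_nonneg: "0 \<le> E u" by (simp add: nl_form_def)

lemma E_scale: "u \<in> F \<Longrightarrow> E (\<lambda>x. c * u x) = \<bar>c\<bar> powr p * E u"
  by (simp add: nl_form_def energy_scale F_measurable enn2real_mult)

lemma E_minkowski:
  assumes u: "u \<in> F" and v: "v \<in> F"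
  shows "E (\<lambda>x. u x + v x) powr (1/p) \<le> E u powr (1/p) + E v powr (1/p)"
proof -
  note [measurable] = F_measurable[OF u] F_measurable[OF v]
  have "ennreal (E (\<lambda>x. u x + v x)) = (\<integral>\<^sup>+z. ennreal (\<bar>(u (fst z) - u (snd z)) + (v (fst z) - v (snd z))\<bar> powr p) \<partial>jm)"
    unfolding E_energy[OF F_add[OF u v]] by (subst energy_eq) (auto simp: algebra_simps)
  also have "\<dots> \<le> ennreal ((E u powr (1/p) + E v powr (1/p)) powr p)"
    using E_energy[OF u] E_energy[OF v] p_gt_1 E_nonneg by (intro nn_integral_minkowski) (auto simp: energy_eq)
  finally have "E (\<lambda>x. u x + v x) \<le> (E u powr (1/p) + E v powr (1/p)) powr p" by simp
  then have "E (\<lambda>x. u x + v x) powr (1/p) \<le> ((E u powr (1/p) + E v powr (1/p)) powr p) powr (1/p)"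
    using p_pos E_nonneg by (intro powr_mono2) auto
  then show ?thesis using p_pos by (simp add: powr_powr)
qed

lemma p_energy_form_F: "p_energy_form m p E F"
  unfolding p_energy_form_def
proof (intro conjI ballI allI impI)
  show "F \<subseteq> Lp m p" by (auto simp: nl_dom_def)
  show "E (\<lambda>x. c * u x) powr (1/p) = \<bar>c\<bar> * E u powr (1/p)" if "u \<in> F" for u c
    using that p_pos E_nonneg by (simp add: E_scale powr_mult powr_powr)
  show "E u = E v" if "u \<in> F" "v \<in> F" "AE x in m. u x = v x" for u v
    unfolding nl_form_def using energy_cong_AE[OF _ _ that(3)] that by (simp add: F_measurable)
qed (auto intro: zero_in_F F_add F_scale E_nonneg E_minkowski)

lemma E1_norm_less: "u \<in> F \<Longrightarrow> 0 < e \<Longrightarrow> E1_norm m p E u < e \<longleftrightarrow> total u < ennreal (e powr p)"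
  by (rule E1_norm_less_iff) (simp_all only: F_measurable F_total)

lemma closed_form_F: "closed_form m p E F"
  unfolding closed_form_def
proof (intro allI impI, elim conjE)
  fix s :: "nat \<Rightarrow> 'a \<Rightarrow> real"
  assume s: "\<forall>n. s n \<in> F" and c: "\<forall>\<epsilon>>0. \<exists>N. \<forall>i\<ge>N. \<forall>j\<ge>N. E1_norm m p E (\<lambda>x. s i x - s j x) < \<epsilon>"
  have "\<exists>N. \<forall>i\<ge>N. \<forall>j\<ge>N. total (\<lambda>x. s i x - s j x) < ennreal e" if e: "0 < e" for e
  proof -
    have e': "0 < e powr (1/p)" using e by simp
    then obtain N where N: "\<forall>i\<ge>N. \<forall>j\<ge>N. E1_norm m p E (\<lambda>x. s i x - s j x) < e powr (1/p)" using c by blast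
    have "total (\<lambda>x. s i x - s j x) < ennreal e" if "i \<ge> N" "j \<ge> N" for i j
    proof -
      have "(\<lambda>x. s i x - s j x) \<in> F" using s by (intro F_diff) auto
      moreover have "E1_norm m p E (\<lambda>x. s i x - s j x) < e powr (1/p)" using N that by blast
      ultimately have "total (\<lambda>x. s i x - s j x) < ennreal ((e powr (1/p)) powr p)" using E1_norm_less e' by blast
      moreover have "(e powr (1/p)) powr p = e" using e p_pos by (intro powr_inverse_cancel) auto
      ultimately show ?thesis by simp
    qed
    then show ?thesis by blast
  qed
  then obtain u r where u: "u \<in> F" "(\<lambda>n. total (\<lambda>x. s n x - u x)) \<longlonglongrightarrow> 0"
    by (rule F_complete[of s, OF spec[OF s]])
  have "(\<lambda>n. E1_norm m p E (\<lambda>x. s n x - u x)) \<longlonglongrightarrow> 0"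
  proof (rule order_tendstoI)
    fix a :: real assume "0 < a"
    then have "eventually (\<lambda>n. total (\<lambda>x. s n x - u x) < ennreal (a powr p)) sequentially"
      using u(2) by (intro order_tendstoD) auto
    then show "eventually (\<lambda>n. E1_norm m p E (\<lambda>x. s n x - u x) < a) sequentially"
      using E1_norm_less[OF F_diff \<open>0 < a\<close>] s u(1) by (auto elim!: eventually_mono)
  next
    fix a :: real assume "a < 0"
    then show "eventually (\<lambda>n. a < E1_norm m p E (\<lambda>x. s n x - u x)) sequentially"
      by (intro always_eventually allI) (simp add: E1_norm_def less_le_trans[OF _ powr_ge_zero])
  qed
  then show "\<exists>u\<in>F. (\<lambda>n. E1_norm m p E (\<lambda>x. s n x - u x)) \<longlonglongrightarrow> 0" using u(1) by blast
qed

lemma SubAdd_F: "SubAdd m E F"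
  unfolding SubAdd_def
proof (intro ballI conjI)
  fix u v assume uv: "u \<in> F \<inter> Linf m" "v \<in> F \<inter> Linf m"
  then have u: "u \<in> F" and v: "v \<in> F" by auto
  note [measurable] = F_measurable[OF u] F_measurable[OF v]
  obtain c d where c: "AE x in m. \<bar>u x\<bar> \<le> c" and d: "AE x in m. \<bar>v x\<bar> \<le> d" using uv by (auto simp: Linf_def)
  have mn: "(\<lambda>x. min (u x) (v x)) \<in> F" and mx: "(\<lambda>x. max (u x) (v x)) \<in> F"
    by (rule F_lip2[OF lip2_min u v], rule F_lip2[OF lip2_max u v])
  have "AE x in m. \<bar>min (u x) (v x)\<bar> \<le> max c d" "AE x in m. \<bar>max (u x) (v x)\<bar> \<le> max c d"
    using c d by (eventually_elim, auto simp: min_def max_def)+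
  then show "(\<lambda>x. min (u x) (v x)) \<in> F \<inter> Linf m" "(\<lambda>x. max (u x) (v x)) \<in> F \<inter> Linf m"
    using mn mx by (auto simp: Linf_def F_measurable)
  have "energy (\<lambda>x. min (u x) (v x)) + energy (\<lambda>x. max (u x) (v x)) \<le> energy u + energy v"
    by (subst (1 2 3 4) energy_eq, measurable)
       (simp add: nn_integral_add[symmetric] ennreal_plus[symmetric] ennreal_leI[OF min_max_abs_powr_le[OF p_gt_1]] nn_integral_mono
          del: ennreal_plus)
  then have "ennreal (E (\<lambda>x. min (u x) (v x)) + E (\<lambda>x. max (u x) (v x))) \<le> ennreal (E u + E v)"
    using E_energy[OF u] E_energy[OF v] E_energy[OF mn] E_energy[OF mx] by (simp add: ennreal_plus E_nonneg)
  then show "E (\<lambda>x. min (u x) (v x)) + E (\<lambda>x. max (u x) (v x)) \<le> E u + E v"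
    by (subst (asm) ennreal_le_iff) (auto intro: add_nonneg_nonneg E_nonneg)
qed

lemma regular_form_F:
  assumes "\<And>u e. u \<in> Cc (space m) \<Longrightarrow> 0 < e \<Longrightarrow> \<exists>f\<in>core. \<forall>x\<in>space m. \<bar>u x - f x\<bar> < e"
  shows "regular_form m p E F"
  unfolding regular_form_def
proof (intro conjI ballI allI impI)
  have core: "f \<in> F \<inter> Cc (space m)" if "f \<in> core" for f
    using that core_subset_F by (auto simp: core_iff)
  fix u :: "'a \<Rightarrow> real" and e :: real assume u: "u \<in> F" and e: "0 < e"
  then obtain f where f: "f \<in> core" "total (\<lambda>x. u x - f x) < ennreal (e powr p)"
    unfolding F_iff by (metis powr_gt_zero less_irrefl)
  then show "\<exists>f\<in>F \<inter> Cc (space m). E1_norm m p E (\<lambda>x. u x - f x) < e"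
    using E1_norm_less[OF F_diff[OF u core_subset_F] e] core by blast
next
  fix u :: "'a \<Rightarrow> real" and e :: real assume "u \<in> Cc (space m)" "0 < e"
  then show "\<exists>f\<in>F \<inter> Cc (space m). \<forall>x\<in>space m. \<bar>u x - f x\<bar> < e"
    using assms[of u e] core_subset_F by (auto simp: core_iff)
qed

text \<open>The two assumptions are what depends on the geometry. The conditions on the local part
  hold because that part vanishes on the domain; for them it remains to know that the intersection
  with C_c is stable under the operations involved.\<close>

lemma purely_nonlocal_form_F:
  assumes dense: "\<And>u e. u \<in> Cc (space m) \<Longrightarrow> 0 < e \<Longrightarrow> \<exists>f\<in>core. \<forall>x\<in>space m. \<bar>u x - f x\<bar> < e"
    and radon: "symmetric_radon (space m) (jump_measure m J)"
  shows "purely_nonlocal_form m p E F J"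
proof -
  let ?L = "local_part p E (jump_measure m J)" and ?G = "F \<inter> Cc (space m)"
  have z: "?L u = 0" if "u \<in> ?G" for u using that by (simp add: local_part_zero)
  have add: "(\<lambda>x. u x + v x) \<in> ?G" if "u \<in> ?G" "v \<in> ?G" for u v
    using that by (auto intro: F_add Cc_lip2[OF lip2_add])
  have diff: "(\<lambda>x. u x - v x) \<in> ?G" if "u \<in> ?G" "v \<in> ?G" for u v
    using that by (auto intro: F_diff Cc_lip2[OF lip2_diff])
  have scale: "(\<lambda>x. c * u x) \<in> ?G" if "u \<in> ?G" for u c
    using that by (auto intro: F_scale Cc_lip2[OF lip2_scale])
  have "?G \<subseteq> Lp m p" by (auto simp: nl_dom_def)
  moreover have "(\<lambda>x. 0) \<in> ?G" using zero_in_F Cc_zero by blast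
  ultimately have "p_energy_form m p ?L ?G"
    unfolding p_energy_form_def by (simp add: z add scale del: Int_iff)
  moreover have "strongly_local m ?L ?G"
    unfolding strongly_local_def by (simp add: z add del: Int_iff)
  moreover have "markovian ?L ?G"
    unfolding markovian_def
  proof (intro allI impI ballI, elim conjE)
    fix \<psi> :: "real \<Rightarrow> real" and u
    assume \<psi>: "\<psi> 0 = 0" "\<forall>s t. \<bar>\<psi> s - \<psi> t\<bar> \<le> \<bar>s - t\<bar>" and u: "u \<in> ?G"
    have l: "lip2 1 (\<lambda>a b. \<psi> a)" using \<psi> by (intro lip2_unary) auto
    have "(\<lambda>x. \<psi> (u x)) \<in> ?G" using u F_lip2[OF l, of u u] Cc_lip2[OF l, of u u] by auto
    then show "(\<lambda>x. \<psi> (u x)) \<in> ?G \<and> ?L (\<lambda>x. \<psi> (u x)) \<le> ?L u" using u by (simp add: z)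
  qed
  moreover have "Cla p ?L ?G"
    unfolding Cla_def by (simp add: z add diff del: Int_iff)
  ultimately show ?thesis
    unfolding purely_nonlocal_form_def mixed_form_def
    by (intro conjI ballI p_energy_form_F closed_form_F SubAdd_F regular_form_F[OF dense] radon z jump_integral(1)) auto
qed

section \<open>Quasi-continuous versions\<close>

text \<open>Peeling off one summand at a time costs 2^p for each step, so the n-th summand carries
  the weight (2^p)^(n+1).\<close>

lemma total_sum_le:
  assumes "\<And>n. b n \<in> borel_measurable m"
  shows "total (\<lambda>x. \<Sum>n<l. b (i + n) x) \<le> (\<Sum>n<l. ennreal ((2 powr p) ^ Suc n) * total (b (i + n)))"
proof (induction l arbitrary: i)
  case 0 then show ?case using F_total[OF zero_in_F] by (simp add: total_def nl_energy_def p_pos)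
next
  case (Suc l)
  have "(\<lambda>x. \<Sum>n<Suc l. b (i + n) x) = (\<lambda>x. b i x + (\<Sum>n<l. b (Suc i + n) x))"
    by (subst sum.lessThan_Suc_shift) simp
  then have "total (\<lambda>x. \<Sum>n<Suc l. b (i + n) x) \<le> ennreal (2 powr p) * (total (b i) + total (\<lambda>x. \<Sum>n<l. b (Suc i + n) x))"
    using total_add_le[of "b i" "\<lambda>x. \<Sum>n<l. b (Suc i + n) x"] assms by simp
  also have "\<dots> \<le> ennreal (2 powr p) * (total (b i) + (\<Sum>n<l. ennreal ((2 powr p) ^ Suc n) * total (b (Suc i + n))))"
    by (intro mult_left_mono add_mono Suc.IH) auto
  also have "\<dots> = (\<Sum>n<Suc l. ennreal ((2 powr p) ^ Suc n) * total (b (i + n)))"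
    by (subst sum.lessThan_Suc_shift)
       (simp add: distrib_left sum_distrib_left mult.assoc[symmetric] ennreal_mult[symmetric])
  finally show ?case .
qed

lemma Cap_le_total:
  assumes "openin (top_of_set (space m)) G" "A \<subseteq> G" "w \<in> F" "AE x in m. x \<in> G \<longrightarrow> 1 \<le> w x"
  shows "Cap m p E F A \<le> total w"
proof -
  have "Cap m p E F A \<le> Cap_open m p E F G"
    unfolding Cap_def using assms(1,2) by (intro INF_lower) auto
  also have "\<dots> \<le> ennreal (E1 m p E w)"
    unfolding Cap_open_def using assms(3,4) by (intro INF_lower) auto
  also have "\<dots> = total w" using F_total[OF assms(3)] by (subst E1_eq) (auto simp: F_measurable assms less_top)
  finally show ?thesis .
qed

text \<open>Core functions \<open>f n\<close> approach u so fast that 2^n |f (n+1) - f n| is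
  summable in the energy norm. Where none of these exceeds 1 from index k on, the \<open>f n\<close>
  converge uniformly; where one does, the sum from k on is at least 1 and bounds the
  capacity.\<close>

lemma quasi_continuous_version_exists:
  assumes u: "u \<in> F"
  obtains v where "v \<in> borel_measurable m" "AE x in m. v x = u x" "quasi_continuous m p E F v"
proof -
  \<comment> \<open>All losses at once: (2^p)^(n+1) from the repeated triangle inequality, (2 *
    2^n)^p from multiplying by 2^n through \<open>total_lip2_le\<close>, and 2^p * 2 from comparing
    \<open>f (Suc n)\<close> with \<open>f n\<close> through u. Dividing by it leaves exactly
    2^-n.\<close>
  define K where "K n = (2 powr p) ^ Suc n * ((2 * 2 ^ n) powr p * (2 powr p * 2))" for n :: nat
  have K1: "1 \<le> K n" for n
  proof -
    have two: "1 \<le> (2 :: real) powr p" using p_pos by (intro ge_one_powr_ge_zero) auto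
    have "1 \<le> (2 powr p) ^ Suc n" using two by (rule one_le_power)
    moreover have "(2::real) ^ n \<ge> 1" by simp
    then have "1 \<le> (2 * 2 ^ n :: real) powr p" using p_pos by (intro ge_one_powr_ge_zero) linarith+
    moreover have "1 \<le> 2 powr p * 2" using two by simp
    ultimately show ?thesis unfolding K_def by (meson mult_ge1_I)
  qed
  have Kmono: "K n \<le> K (Suc n)" for n
  proof -
    have two: "1 \<le> (2 :: real) powr p" using p_pos by (intro ge_one_powr_ge_zero) auto
    show ?thesis unfolding K_def using two p_pos
      by (intro mult_mono power_increasing powr_mono2 mult_nonneg_nonneg) auto
  qed
  define d where "d n = (1/2) ^ n / K n" for n
  have d: "0 < d n" for n using K1[of n] by (simp add: d_def)
  have d_half: "d n \<le> (1/2) ^ n" for n unfolding d_def using K1[of n] by (simp add: divide_le_eq mult_le_cancel_left1)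
  have d_dec: "d (Suc n) \<le> d n" for n
    unfolding d_def using Kmono[of n] K1[of n] by (intro frac_le) auto
  obtain f where f: "\<And>n. f n \<in> core" "\<And>n. total (\<lambda>x. u x - f n x) < ennreal (d n)"
    by (rule F_approx[OF u, of d, OF d]) metis
  note [measurable] = F_measurable[OF u] core_measurable[OF f(1)]
  define b where "b n x = 2 ^ n * \<bar>f (Suc n) x - f n x\<bar>" for n x
  have lip: "lip2 (2 ^ n) (\<lambda>a c. 2 ^ n * \<bar>a\<bar>)" for n :: nat
    by (rule lip2_unary) (auto simp: right_diff_distrib[symmetric] abs_mult)
  have bcore: "b n \<in> core" for n
    using core_lip2[OF lip core_lip2[OF lip2_diff f(1)[of "Suc n"] f(1)[of n]] f(1)[of n], of n]
    unfolding b_def[abs_def] by simp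
  note [measurable] = core_measurable[OF bcore]
  have b_total: "ennreal ((2 powr p) ^ Suc n) * total (b n) \<le> ennreal ((1/2) ^ n)" for n
  proof -
    have "total (\<lambda>x. f (Suc n) x - f n x) \<le> ennreal (2 powr p) * (total (\<lambda>x. f (Suc n) x - u x) + total (\<lambda>x. u x - f n x))"
      by (rule total_triangle) auto
    also have "\<dots> \<le> ennreal (2 powr p) * (ennreal (d n) + ennreal (d n))"
      unfolding total_uminus[of "f (Suc n)" u]
      by (intro mult_left_mono add_mono order_trans[OF less_imp_le[OF f(2)]] ennreal_leI d_dec order_refl) auto
    also have "\<dots> = ennreal (2 powr p * (d n + d n))"
      using d[of n] by (simp only: ennreal_mult ennreal_plus less_imp_le add_nonneg_nonneg powr_ge_zero)
    also have "2 powr p * (d n + d n) = (2 powr p * 2) * d n" by simp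
    finally have 1: "total (\<lambda>x. f (Suc n) x - f n x) \<le> ennreal ((2 powr p * 2) * d n)" .
    have "total (b n) \<le> ennreal ((2 * 2 ^ n) powr p) * (total (\<lambda>x. f (Suc n) x - f n x) + total (\<lambda>x. 0))"
      using total_lip2_le[OF lip, of "\<lambda>x. f (Suc n) x - f n x" "\<lambda>x. 0" n] unfolding b_def[abs_def] by simp
    also have "total (\<lambda>x. 0) = 0" by (simp add: total_def nl_energy_def p_pos)
    finally have "total (b n) \<le> ennreal ((2 * 2 ^ n) powr p) * total (\<lambda>x. f (Suc n) x - f n x)" by simp
    also have "\<dots> \<le> ennreal ((2 * 2 ^ n) powr p) * ennreal ((2 powr p * 2) * d n)"
      by (intro mult_left_mono 1) simp
    finally have "total (b n) \<le> ennreal ((2 * 2 ^ n) powr p) * ennreal ((2 powr p * 2) * d n)" .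
    then have "ennreal ((2 powr p) ^ Suc n) * total (b n) \<le>
       ennreal ((2 powr p) ^ Suc n) * (ennreal ((2 * 2 ^ n) powr p) * ennreal ((2 powr p * 2) * d n))"
      by (rule mult_left_mono) simp
    also have "\<dots> = ennreal (K n * d n)"
      using d[of n] unfolding K_def by (simp add: ennreal_mult[symmetric] mult.assoc del: power_Suc)
    also have "K n * d n = (1/2) ^ n" using K1[of n] by (simp add: d_def)
    finally show ?thesis .
  qed
  have sum_total: "total (\<lambda>x. \<Sum>n<l. b (i + n) x) \<le> ennreal (2 * (1/2) ^ i)" for i l
  proof -
    have two: "1 \<le> (2 :: real) powr p" using p_pos by (intro ge_one_powr_ge_zero) auto
    have "total (\<lambda>x. \<Sum>n<l. b (i + n) x) \<le> (\<Sum>n<l. ennreal ((2 powr p) ^ Suc n) * total (b (i + n)))"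
      by (rule total_sum_le) auto
    also have "\<dots> \<le> (\<Sum>n<l. ennreal ((1/2) ^ (i + n)))"
    proof (rule sum_mono)
      fix n
      have "ennreal ((2 powr p) ^ Suc n) * total (b (i + n)) \<le> ennreal ((2 powr p) ^ Suc (i + n)) * total (b (i + n))"
        using two by (intro mult_right_mono ennreal_leI power_increasing) auto
      also have "\<dots> \<le> ennreal ((1/2) ^ (i + n))" by (rule b_total)
      finally show "ennreal ((2 powr p) ^ Suc n) * total (b (i + n)) \<le> ennreal ((1/2) ^ (i + n))" .
    qed
    also have "\<dots> = ennreal (\<Sum>n<l. (1/2) ^ (i + n))" by (rule sum_ennreal) simp
    also have "\<dots> \<le> ennreal (2 * (1/2) ^ i)"
    proof (rule ennreal_leI)
      have "(\<Sum>n<l. (1/2 :: real) ^ n) \<le> 2" by (subst geometric_sum) (simp_all add: field_simps)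
      then have "(1/2) ^ i * (\<Sum>n<l. (1/2 :: real) ^ n) \<le> (1/2) ^ i * 2" by (intro mult_left_mono) auto
      then show "(\<Sum>n<l. (1/2 :: real) ^ (i + n)) \<le> 2 * (1/2) ^ i" by (simp add: power_add sum_distrib_left mult.commute)
    qed
    finally show ?thesis .
  qed
  define G where "G k = {x\<in>space m. \<exists>n\<ge>k. 1 < b n x}" for k
  have G_open: "openin (top_of_set (space m)) (G k)" for k
  proof -
    have "openin (top_of_set (space m)) (\<Union>n\<in>{k..}. space m \<inter> b n -` {1<..})"
    proof (rule openin_Union, clarify)
      fix n show "openin (top_of_set (space m)) (space m \<inter> b n -` {1<..})"
        using bcore[of n] by (intro continuous_openin_preimage_gen) (auto simp: core_iff Cc_def)
    qed
    moreover have "(\<Union>n\<in>{k..}. space m \<inter> b n -` {1<..}) = G k" by (auto simp: G_def)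
    ultimately show ?thesis by simp
  qed
  have capG: "Cap m p E F (G k) \<le> ennreal (2 powr p * (4 * (1/2) ^ k))" for k
  proof -
    define s where "s l x = (\<Sum>n<l. b (k + n) x)" for l x
    have sF: "s l \<in> F" for l
    proof (induction l)
      case 0 then show ?case using zero_in_F by (simp add: s_def[abs_def])
    next
      case (Suc l)
      then show ?case using F_add[OF Suc core_subset_F[OF bcore[of "k + l"]]] by (simp add: s_def[abs_def])
    qed
    have sdiff: "total (\<lambda>x. s i x - s j x) \<le> ennreal (2 * (1/2) ^ N)" if "N \<le> i" "N \<le> j" for i j N
    proof -
      have le: "total (\<lambda>x. s i x - s j x) \<le> ennreal (2 * (1/2) ^ N)" if "N \<le> j" "j \<le> i" for i j
      proof -
        have split: "s (j + l) x = s j x + (\<Sum>n<l. b (k + j + n) x)" for l x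
          by (induction l) (simp_all add: s_def add.assoc)
        have "s i x - s j x = (\<Sum>n<i - j. b (k + j + n) x)" for x
        proof -
          have "s (j + (i - j)) x = s j x + (\<Sum>n<i - j. b (k + j + n) x)" by (rule split)
          then show ?thesis using that by simp
        qed
        then have "total (\<lambda>x. s i x - s j x) \<le> ennreal (2 * (1/2) ^ (k + j))" using sum_total[of "k + j" "i - j"] by simp
        also have "\<dots> \<le> ennreal (2 * (1/2) ^ N)" using that by (intro ennreal_leI mult_left_mono power_decreasing) auto
        finally show ?thesis .
      qed
      show ?thesis
      proof (cases "j \<le> i")
        case False then show ?thesis using le[of i j] that unfolding total_uminus[of "s i"] by simp
      qed (use le that in auto)
    qed
    \<comment> \<open>The admissible function for \<open>G k\<close> is the limit of the partial
      sums. At a point of \<open>G k\<close> a single summand above 1 keeps all late partial sums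
      above 1, and the subsequence converging almost everywhere hands this to w.\<close>
    obtain w r where w: "w \<in> F" "(\<lambda>n. total (\<lambda>x. s n x - w x)) \<longlonglongrightarrow> 0" "strict_mono r" "AE x in m. (\<lambda>n. s (r n) x) \<longlonglongrightarrow> w x"
    proof (rule F_complete[OF sF])
      fix e :: real assume e: "0 < e"
      then obtain N where "(1/2) ^ N < e / 2" using real_arch_pow_inv[of "e / 2" "1/2"] by auto
      then have "ennreal (2 * (1/2) ^ N) < ennreal e" using e by (intro ennreal_lessI) auto
      then show "\<exists>N. \<forall>i\<ge>N. \<forall>j\<ge>N. total (\<lambda>x. s i x - s j x) < ennreal e"
        using sdiff by (intro exI[of _ N]) (blast intro: order_le_less_trans)
    qed
    have "AE x in m. x \<in> G k \<longrightarrow> 1 \<le> w x"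
      using w(4)
    proof (eventually_elim, intro impI)
      fix x assume lim: "(\<lambda>n. s (r n) x) \<longlonglongrightarrow> w x" and "x \<in> G k"
      then obtain n where n: "k \<le> n" "1 < b n x" by (auto simp: G_def)
      have "1 \<le> s (r l) x" if "n - k < l" for l
      proof -
        have "n - k < r l" using that seq_suble[OF w(3), of l] by simp
        then have "b (k + (n - k)) x \<le> s (r l) x"
          unfolding s_def by (intro member_le_sum) (auto simp: b_def)
        then show ?thesis using n by simp
      qed
      then show "1 \<le> w x" by (intro LIMSEQ_le_const[OF lim]) (auto intro!: exI[of _ "Suc (n - k)"])
    qed
    then have "Cap m p E F (G k) \<le> total w" by (intro Cap_le_total[OF G_open order_refl w(1)])
    also have "\<dots> \<le> ennreal (2 powr p * (4 * (1/2) ^ k))"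
    proof -
      have "eventually (\<lambda>n. total (\<lambda>x. s n x - w x) < ennreal (2 * (1/2) ^ k)) sequentially"
        using w(2) by (intro order_tendstoD) auto
      then obtain n where n: "total (\<lambda>x. s n x - w x) < ennreal (2 * (1/2) ^ k)" by (auto dest: eventually_happens)
      have "total w \<le> ennreal (2 powr p) * (total (\<lambda>x. w x - s n x) + total (s n))"
        using total_add_le[of "\<lambda>x. w x - s n x" "s n"] F_measurable[OF w(1)] F_measurable[OF sF[of n]] by simp
      also have "\<dots> \<le> ennreal (2 powr p) * (ennreal (2 * (1/2) ^ k) + ennreal (2 * (1/2) ^ k))"
        using n sum_total[of k n] unfolding total_uminus[of w] s_def[abs_def] by (intro mult_left_mono add_mono) auto
      also have "\<dots> = ennreal (2 powr p * (2 * (1/2) ^ k + 2 * (1/2) ^ k))"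
        by (subst ennreal_mult, simp, simp, subst ennreal_plus, simp_all)
      finally show ?thesis by simp
    qed
    finally show ?thesis .
  qed
  define v where "v x = lim (\<lambda>n. f n x)" for x
  have "v \<in> borel_measurable m" unfolding v_def[abs_def] by (rule borel_measurable_lim_metric) auto
  moreover have "AE x in m. v x = u x"
  proof -
    have "AE x in m. (\<lambda>n. f n x) \<longlonglongrightarrow> u x"
      by (intro total_AE_tendsto order_trans[OF less_imp_le[OF f(2)]] ennreal_leI d_half) auto
    then show ?thesis unfolding v_def by eventually_elim (rule limI)
  qed
  moreover have "quasi_continuous m p E F v"
    unfolding quasi_continuous_def
  proof (intro allI impI)
    fix e :: real assume e: "0 < e"
    have "0 < e / (2 powr p * 4)" using e by simp
    then obtain k where "(1/2) ^ k < e / (2 powr p * 4)" using real_arch_pow_inv[of "e / (2 powr p * 4)" "1/2"] by auto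
    then have "2 powr p * (4 * (1/2) ^ k) < e" by (simp add: pos_less_divide_eq ac_simps)
    then have "ennreal (2 powr p * (4 * (1/2) ^ k)) < ennreal e" using e by (intro ennreal_lessI) auto
    then have cap: "Cap m p E F (G k) < ennreal e" using capG[of k] by (rule order_le_less_trans[rotated])
    have step: "\<bar>f (Suc n) x - f n x\<bar> \<le> (1/2) ^ n" if "x \<in> space m - G k" "k \<le> n" for n x
    proof -
      have "b n x \<le> 1" using that by (auto simp: G_def not_less)
      then show ?thesis by (simp add: b_def power_divide field_simps)
    qed
    \<comment> \<open>The subtracted term makes the geometric estimate self-reproducing in the
      induction on j.\<close>
    have far: "\<bar>f (n + j) x - f n x\<bar> \<le> 2 * (1/2) ^ n - 2 * (1/2) ^ (n + j)" if "x \<in> space m - G k" "k \<le> n" for n j x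
    proof (induction j)
      case (Suc j)
      have "\<bar>f (n + Suc j) x - f n x\<bar> \<le> \<bar>f (Suc (n + j)) x - f (n + j) x\<bar> + \<bar>f (n + j) x - f n x\<bar>" by simp
      also have "\<dots> \<le> (1/2) ^ (n + j) + (2 * (1/2) ^ n - 2 * (1/2) ^ (n + j))"
        using that by (intro add_mono Suc step) auto
      also have "\<dots> = 2 * (1/2) ^ n - 2 * (1/2) ^ (n + Suc j)" by simp
      finally show ?case .
    qed simp
    have dist: "\<bar>v x - f n x\<bar> \<le> 2 * (1/2) ^ n" if x: "x \<in> space m - G k" and n: "k \<le> n" for n x
    proof -
      have bound: "\<bar>f (l + j) x - f l x\<bar> \<le> 2 * (1/2) ^ l" if "k \<le> l" for l j
        using far[OF x that, of j] by (smt (verit) zero_le_power zero_le_divide_1_iff)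
      have "Cauchy (\<lambda>n. f n x)"
      proof (rule metric_CauchyI)
        fix e :: real assume "0 < e"
        then obtain l0 where l0: "(1/2) ^ l0 < e / 4" using real_arch_pow_inv[of "e / 4" "1/2"] by auto
        define l where "l = max k l0"
        have "(1/2 :: real) ^ l \<le> (1/2) ^ l0" by (rule power_decreasing) (auto simp: l_def)
        then have l: "(1/2 :: real) ^ l < e / 4" using l0 by linarith
        have "dist (f i x) (f j x) < e" if "l \<le> i" "l \<le> j" for i j
          using bound[of l "i - l"] bound[of l "j - l"] that l by (simp add: l_def dist_real_def)
        then show "\<exists>M. \<forall>i\<ge>M. \<forall>j\<ge>M. dist (f i x) (f j x) < e" by blast
      qed
      then have "(\<lambda>n. f n x) \<longlonglongrightarrow> v x" unfolding v_def by (simp add: Cauchy_convergent_iff convergent_LIMSEQ_iff)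
      then have "(\<lambda>j. \<bar>f (j + n) x - f n x\<bar>) \<longlonglongrightarrow> \<bar>v x - f n x\<bar>" by (intro tendsto_intros LIMSEQ_ignore_initial_segment)
      then show ?thesis
        by (rule LIMSEQ_le_const2) (use bound[OF n] in \<open>auto simp: add.commute\<close>)
    qed
    have "continuous_on (space m - G k) v"
    proof (rule uniform_limit_theorem[where F=sequentially and f=f])
      show "\<forall>\<^sub>F n in sequentially. continuous_on (space m - G k) (f n)"
        using f(1) by (intro always_eventually allI) (auto simp: core_iff Cc_def intro: continuous_on_subset)
      show "uniform_limit (space m - G k) f v sequentially"
      proof (rule uniform_limitI)
        fix e :: real assume "0 < e"
        then obtain l where l: "(1/2) ^ l < e / 2" using real_arch_pow_inv[of "e / 2" "1/2"] by auto
        show "\<forall>\<^sub>F n in sequentially. \<forall>x\<in>space m - G k. dist (f n x) (v x) < e"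
        proof (rule eventually_sequentiallyI[of "max k l"], intro ballI)
          fix n x assume n: "max k l \<le> n" and x: "x \<in> space m - G k"
          have "\<bar>v x - f n x\<bar> \<le> 2 * (1/2) ^ n" using n by (intro dist[OF x]) simp
          also have "(1/2 :: real) ^ n \<le> (1/2) ^ l" using n by (intro power_decreasing) auto
          finally show "dist (f n x) (v x) < e" using l by (simp add: dist_real_def abs_minus_commute)
        qed
      qed
    qed simp
    then show "\<exists>G. openin (top_of_set (space m)) G \<and> Cap m p E F G < ennreal e \<and> continuous_on (space m - G) v"
      using G_open cap by blast
  qed
  ultimately show thesis by (rule that)
qed

lemma dom_const_measurable: "u \<in> dom_const F \<Longrightarrow> u \<in> borel_measurable m"
  by (auto simp: dom_const_def dest!: F_measurable)

lemma F_subset_dom_const: "u \<in> F \<Longrightarrow> u \<in> dom_const F"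
  unfolding dom_const_def by (auto intro!: bexI[of _ u] exI[of _ 0])

text \<open>Adding a constant keeps quasi-continuity, so the choice in \<open>qc_version\<close> has
  a witness for every function in the domain plus a constant.\<close>

lemma qc_version:
  assumes "u \<in> dom_const F"
  shows "qc_version m p E F u \<in> borel_measurable m" "AE x in m. qc_version m p E F u x = u x"
    "quasi_continuous m p E F (qc_version m p E F u)"
proof -
  obtain f a where f: "f \<in> F" "u = (\<lambda>x. f x + a)" using assms by (auto simp: dom_const_def)
  obtain v where v: "v \<in> borel_measurable m" "AE x in m. v x = f x" "quasi_continuous m p E F v"
    using quasi_continuous_version_exists[OF f(1)] .
  have "\<exists>w. w \<in> borel_measurable m \<and> (AE x in m. w x = u x) \<and> quasi_continuous m p E F w"
    using v f(2)
    by (intro exI[of _ "\<lambda>x. v x + a"]) (fastforce simp: quasi_continuous_def intro!: continuous_on_add continuous_on_const elim: eventually_mono)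
  from someI_ex[OF this] show "qc_version m p E F u \<in> borel_measurable m" "AE x in m. qc_version m p E F u x = u x"
    "quasi_continuous m p E F (qc_version m p E F u)"
    unfolding qc_version_def by blast+
qed

text \<open>
  Enlarging the exceptional open set of a quasi-continuous function by its nonzeros outside \<open>K\<close> keeps it open and
  changes it only by a null set.
\<close>

lemma dom_in_vanishing:
  assumes v: "v \<in> F" and K: "openin (top_of_set (space m)) (space m - K)" "K \<subseteq> U"
    and zero: "\<And>x. x \<in> space m - K \<Longrightarrow> v x = 0"
  shows "v \<in> dom_in m p E F U"
proof -
  let ?q = "qc_version m p E F v" and ?O = "space m - K"
  note q = qc_version[OF F_subset_dom_const[OF v]]
  define N where "N = {x\<in>?O. ?q x \<noteq> 0}"
  have "Cap m p E F N \<le> ennreal e" if e: "0 < e" for e :: real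
  proof -
    obtain G where G: "openin (top_of_set (space m)) G" "Cap m p E F G < ennreal e" "continuous_on (space m - G) ?q"
      using q(3) e unfolding quasi_continuous_def by blast
    obtain G' where G': "openin (top_of_set (space m)) G'" "G \<subseteq> G'" "Cap_open m p E F G' < ennreal e"
      using G(2) unfolding Cap_def INF_less_iff by blast
    obtain w where w: "w \<in> F" "AE x in m. x \<in> G' \<longrightarrow> 1 \<le> w x" "ennreal (E1 m p E w) < ennreal e"
      using G'(3) unfolding Cap_open_def INF_less_iff by blast
    have "openin (top_of_set (space m - G')) ((space m - G') \<inter> ?q -` (- {0}))"
      using G'(2) by (intro continuous_openin_preimage_gen continuous_on_subset[OF G(3)]) (auto simp: open_Compl)
    then obtain T where T: "open T" "(space m - G') \<inter> ?q -` (- {0}) = (space m - G') \<inter> T" by (auto simp: openin_open)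
    define H where "H = G' \<union> (?O \<inter> T)"
    have "openin (top_of_set (space m)) H"
      unfolding H_def by (intro openin_Un G' openin_Int_open K T)
    moreover have "N \<subseteq> H" using T(2) by (auto simp: H_def N_def)
    moreover have "AE x in m. x \<in> H \<longrightarrow> 1 \<le> w x"
      using w(2) q(2) AE_space
    proof (eventually_elim, intro impI)
      fix x assume a: "x \<in> G' \<longrightarrow> 1 \<le> w x" "?q x = v x" "x \<in> space m" "x \<in> H"
      show "1 \<le> w x"
      proof (cases "x \<in> G'")
        case False
        then have "x \<in> ?O" "?q x \<noteq> 0" using a(3,4) T(2) by (auto simp: H_def)
        then show ?thesis using zero a(2) by auto
      qed (use a in auto)
    qed
    ultimately have "Cap m p E F N \<le> total w" by (intro Cap_le_total w(1))
    also have "\<dots> = ennreal (E1 m p E w)" using F_total[OF w(1)] by (subst E1_eq) (auto simp: F_measurable w less_top)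
    finally show ?thesis using w(3) by simp
  qed
  then have "Cap m p E F N = 0" using ennreal_le_epsilon[of 0 "Cap m p E F N"]
    by (metis ennreal_le_epsilon add_0 le_zero_eq)
  then show ?thesis
    unfolding dom_in_def using v K(2) by (auto simp: N_def intro!: exI[of _ N])
qed

end

section \<open>The first variation and test functions\<close>

text \<open>The mean value theorem; it provides the integrable majorant of the difference quotients
  in the first variation.\<close>

lemma abs_powr_diff_le:
  fixes x y p :: real
  assumes p: "1 < p"
  shows "\<bar>\<bar>y\<bar> powr p - \<bar>x\<bar> powr p\<bar> \<le> p * (max \<bar>x\<bar> \<bar>y\<bar>) powr (p - 1) * \<bar>y - x\<bar>"
proof -
  have *: "\<bar>\<bar>y\<bar> powr p - \<bar>x\<bar> powr p\<bar> \<le> p * (max \<bar>x\<bar> \<bar>y\<bar>) powr (p - 1) * \<bar>y - x\<bar>" if xy: "x < y" for x y :: real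
  proof -
    obtain z where z: "x < z" "z < y" "\<bar>y\<bar> powr p - \<bar>x\<bar> powr p = (y - x) * (p * spow (p - 1) z)"
      using MVT2[OF xy, of "\<lambda>x. \<bar>x\<bar> powr p" "\<lambda>x. p * spow (p - 1) x"] has_real_derivative_abs_powr[OF p] by blast
    have "\<bar>spow (p - 1) z\<bar> \<le> (max \<bar>x\<bar> \<bar>y\<bar>) powr (p - 1)"
      unfolding abs_spow using z p by (intro powr_mono2) auto
    then have "\<bar>y - x\<bar> * (p * \<bar>spow (p - 1) z\<bar>) \<le> \<bar>y - x\<bar> * (p * (max \<bar>x\<bar> \<bar>y\<bar>) powr (p - 1))"
      using p by (intro mult_left_mono) auto
    then show ?thesis unfolding z(3) using p by (simp add: abs_mult ac_simps)
  qed
  consider "x < y" | "y < x" | "x = y" by linarith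
  then show ?thesis
  proof cases
    case 2
    then show ?thesis using *[of y x] by (simp add: abs_minus_commute max.commute)
  qed (use * in auto)
qed

lemma powr_minus_one_mult_le:
  fixes a b p :: real
  assumes "1 < p" "0 \<le> b" "b \<le> a"
  shows "a powr (p - 1) * b \<le> a powr p"
proof (cases "a = 0")
  case False
  then have "a powr (p - 1) * b \<le> a powr (p - 1) * a" using assms by (intro mult_left_mono) auto
  also have "\<dots> = a powr p" using False assms by (simp add: powr_mult_base mult.commute)
  finally show ?thesis .
qed (use assms in auto)

context jump_form begin

text \<open>Puts a test inequality into the form in which V weighs, at each x, an integral of J
  against a function of y; such weights can later be cancelled.\<close>

lemma nn_integral_jm_product:
  assumes [measurable]: "V \<in> borel_measurable m" "h \<in> borel_measurable m" and nn: "\<And>x. 0 \<le> V x" "\<And>y. 0 \<le> h y"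
  shows "(\<integral>\<^sup>+z. ennreal (V (fst z) * h (snd z)) \<partial>jm) = (\<integral>\<^sup>+x. ennreal (V x) * (\<integral>\<^sup>+y. ennreal (h y * J x y) \<partial>m) \<partial>m)"
proof -
  have "(\<integral>\<^sup>+z. ennreal (V (fst z) * h (snd z)) \<partial>jm) = (\<integral>\<^sup>+x. \<integral>\<^sup>+y. ennreal (J x y) * ennreal (V x * h y) \<partial>m \<partial>m)"
    by (subst nn_integral_jm) auto
  also have "\<dots> = (\<integral>\<^sup>+x. ennreal (V x) * (\<integral>\<^sup>+y. ennreal (h y * J x y) \<partial>m) \<partial>m)"
  proof (rule nn_integral_cong)
    fix x assume [measurable]: "x \<in> space m"
    have "(\<integral>\<^sup>+y. ennreal (J x y) * ennreal (V x * h y) \<partial>m) = (\<integral>\<^sup>+y. ennreal (V x) * ennreal (h y * J x y) \<partial>m)"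
      using nn J_nonneg by (intro nn_integral_cong) (simp add: ennreal_mult[symmetric] ac_simps)
    also have "\<dots> = ennreal (V x) * (\<integral>\<^sup>+y. ennreal (h y * J x y) \<partial>m)"
      by (rule nn_integral_cmult) measurable
    finally show "(\<integral>\<^sup>+y. ennreal (J x y) * ennreal (V x * h y) \<partial>m) = ennreal (V x) * (\<integral>\<^sup>+y. ennreal (h y * J x y) \<partial>m)" .
  qed
  finally show ?thesis .
qed

lemma F_difference_integrable:
  assumes u: "u \<in> F"
  shows "integrable jm (\<lambda>z. \<bar>u (fst z) - u (snd z)\<bar> powr p)"
proof -
  note [measurable] = F_measurable[OF u]
  show ?thesis using F_energy[OF u] by (intro integrableI_bounded) (auto simp: energy_eq)
qed

lemma E_eq_integral:
  assumes u: "u \<in> F"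
  shows "E u = (\<integral>z. \<bar>u (fst z) - u (snd z)\<bar> powr p \<partial>jm)"
proof -
  note [measurable] = F_measurable[OF u]
  show ?thesis unfolding nl_form_def by (subst integral_eq_nn_integral) (auto simp: energy_eq)
qed

lemma first_variation_integrable:
  assumes u: "u \<in> F" and v: "v \<in> F"
  shows "integrable jm (\<lambda>z. spow (p - 1) (u (fst z) - u (snd z)) * (v (fst z) - v (snd z)))"
proof -
  note [measurable] = F_measurable[OF u] F_measurable[OF v]
  have "integrable jm (\<lambda>z. 2 powr p * (\<bar>u (fst z) - u (snd z)\<bar> powr p + \<bar>v (fst z) - v (snd z)\<bar> powr p))"
    by (intro integrable_mult_right Bochner_Integration.integrable_add F_difference_integrable u v)
  then show ?thesis
  proof (rule Bochner_Integration.integrable_bound)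
    show "AE z in jm. norm (spow (p - 1) (u (fst z) - u (snd z)) * (v (fst z) - v (snd z)))
       \<le> norm (2 powr p * (\<bar>u (fst z) - u (snd z)\<bar> powr p + \<bar>v (fst z) - v (snd z)\<bar> powr p))"
    proof (rule AE_I2)
      fix z
      let ?a = "u (fst z) - u (snd z)" and ?b = "v (fst z) - v (snd z)"
      have "\<bar>?a\<bar> powr (p - 1) * \<bar>?b\<bar> \<le> (\<bar>?a\<bar> + \<bar>?b\<bar>) powr (p - 1) * \<bar>?b\<bar>"
        using p_gt_1 by (intro mult_right_mono powr_mono2) auto
      also have "\<dots> \<le> (\<bar>?a\<bar> + \<bar>?b\<bar>) powr p" using p_gt_1 by (intro powr_minus_one_mult_le) auto
      also have "\<dots> \<le> 2 powr p * (\<bar>?a\<bar> powr p + \<bar>?b\<bar> powr p)" using p_pos by (intro powr_add_le) auto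
      finally show "norm (spow (p - 1) ?a * ?b) \<le> norm (2 powr p * (\<bar>?a\<bar> powr p + \<bar>?b\<bar> powr p))"
        by (simp add: abs_mult abs_spow)
    qed
  qed measurable
qed

text \<open>Differentiation under the integral by dominated convergence along sequences tending to
  0. Differentiability is established first, since \<open>deriv\<close> has no meaning without
  it.\<close>

lemma energy_pair_eq:
  assumes u: "u \<in> F" and v: "v \<in> F"
  shows "energy_pair p E u v = (\<integral>z. spow (p - 1) (u (fst z) - u (snd z)) * (v (fst z) - v (snd z)) \<partial>jm)"
proof -
  note [measurable] = F_measurable[OF u] F_measurable[OF v]
  define a where "a z = u (fst z) - u (snd z)" for z
  define b where "b z = v (fst z) - v (snd z)" for z
  have [measurable]: "a \<in> borel_measurable jm" "b \<in> borel_measurable jm"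
    unfolding a_def[abs_def] b_def[abs_def] by measurable
  have utv: "(\<lambda>x. u x + t * v x) \<in> F" for t by (intro F_add u F_scale v)
  have Eq: "E (\<lambda>x. u x + t * v x) = (\<integral>z. \<bar>a z + t * b z\<bar> powr p \<partial>jm)"
    and Int: "integrable jm (\<lambda>z. \<bar>a z + t * b z\<bar> powr p)" for t
  proof -
    have eq: "(u x + t * v x) - (u y + t * v y) = (u x - u y) + t * (v x - v y)" for x y
      by (simp add: algebra_simps)
    show "E (\<lambda>x. u x + t * v x) = (\<integral>z. \<bar>a z + t * b z\<bar> powr p \<partial>jm)"
      "integrable jm (\<lambda>z. \<bar>a z + t * b z\<bar> powr p)"
      using E_eq_integral[OF utv[of t]] F_difference_integrable[OF utv[of t]] unfolding eq a_def b_def by auto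
  qed
  have der: "((\<lambda>t. \<bar>a z + t * b z\<bar> powr p) has_real_derivative p * spow (p - 1) (a z) * b z) (at 0)" for z
  proof -
    have "((\<lambda>x. \<bar>x\<bar> powr p) has_real_derivative p * spow (p - 1) (a z + 0 * b z)) (at (a z + 0 * b z))"
      by (rule has_real_derivative_abs_powr[OF p_gt_1])
    moreover have "((\<lambda>t. a z + t * b z) has_real_derivative b z) (at 0)"
      by (auto intro!: derivative_eq_intros)
    ultimately show ?thesis using DERIV_chain2[of "\<lambda>x. \<bar>x\<bar> powr p" _ "\<lambda>t. a z + t * b z" 0] by simp
  qed
  have "((\<lambda>t. E (\<lambda>x. u x + t * v x)) has_real_derivative (\<integral>z. p * spow (p - 1) (a z) * b z \<partial>jm)) (at 0)"
    unfolding DERIV_def tendsto_at_iff_sequentially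
  proof (intro allI impI)
    fix X :: "nat \<Rightarrow> real" assume X: "\<forall>i. X i \<in> UNIV - {0}" "X \<longlonglongrightarrow> 0"
    then have Xn: "X i \<noteq> 0" for i by auto
    obtain B0 where B0: "\<And>i. \<bar>X i\<bar> \<le> B0"
      using convergent_imp_Bseq[OF convergentI[OF X(2)]] by (auto simp: Bseq_def)
    \<comment> \<open>B bounds the increments; being at least 1 it also gives |b| <= B |b|, so a
      single power of |a| + B |b| absorbs both factors.\<close>
    define B where "B = max 1 B0"
    have B: "1 \<le> B" "\<bar>X i\<bar> \<le> B" for i using B0[of i] by (auto simp: B_def)
    have "(\<lambda>i. \<integral>z. (\<bar>a z + X i * b z\<bar> powr p - \<bar>a z\<bar> powr p) / X i \<partial>jm) \<longlonglongrightarrow> (\<integral>z. p * spow (p - 1) (a z) * b z \<partial>jm)"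
    proof (rule integral_dominated_convergence)
      show "integrable jm (\<lambda>z. p * (2 powr p * (\<bar>a z\<bar> powr p + B powr p * \<bar>b z\<bar> powr p)))"
        using F_difference_integrable[OF u] F_difference_integrable[OF v] unfolding a_def b_def
        by (intro integrable_mult_right Bochner_Integration.integrable_add)
      show "AE z in jm. (\<lambda>i. (\<bar>a z + X i * b z\<bar> powr p - \<bar>a z\<bar> powr p) / X i) \<longlonglongrightarrow> p * spow (p - 1) (a z) * b z"
        using der X unfolding DERIV_def tendsto_at_iff_sequentially by (simp add: comp_def)
    next
      fix i
      show "AE z in jm. norm ((\<bar>a z + X i * b z\<bar> powr p - \<bar>a z\<bar> powr p) / X i) \<le> p * (2 powr p * (\<bar>a z\<bar> powr p + B powr p * \<bar>b z\<bar> powr p))"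
      proof (rule AE_I2)
        fix z
        let ?s = "\<bar>a z\<bar> + B * \<bar>b z\<bar>"
        have Xb: "\<bar>X i * b z\<bar> \<le> B * \<bar>b z\<bar>" using B by (simp add: abs_mult mult_right_mono)
        have "\<bar>\<bar>a z + X i * b z\<bar> powr p - \<bar>a z\<bar> powr p\<bar> \<le> p * (max \<bar>a z\<bar> \<bar>a z + X i * b z\<bar>) powr (p - 1) * \<bar>X i * b z\<bar>"
          using abs_powr_diff_le[OF p_gt_1, of "a z + X i * b z" "a z"] by simp
        also have "\<dots> \<le> p * ?s powr (p - 1) * \<bar>X i * b z\<bar>"
          using p_gt_1 Xb by (intro mult_right_mono mult_left_mono powr_mono2) auto
        also have "\<dots> = \<bar>X i\<bar> * (p * (?s powr (p - 1) * \<bar>b z\<bar>))" by (simp add: abs_mult)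
        also have "\<dots> \<le> \<bar>X i\<bar> * (p * ?s powr p)"
        proof -
          have "\<bar>b z\<bar> \<le> B * \<bar>b z\<bar>" using B(1) by (simp add: mult_le_cancel_right1)
          then show ?thesis using p_gt_1 by (intro mult_left_mono powr_minus_one_mult_le) auto
        qed
        also have "\<dots> \<le> \<bar>X i\<bar> * (p * (2 powr p * (\<bar>a z\<bar> powr p + (B * \<bar>b z\<bar>) powr p)))"
          using p_gt_1 B by (intro mult_left_mono powr_add_le) auto
        finally show "norm ((\<bar>a z + X i * b z\<bar> powr p - \<bar>a z\<bar> powr p) / X i) \<le> p * (2 powr p * (\<bar>a z\<bar> powr p + B powr p * \<bar>b z\<bar> powr p))"
          using Xn[of i] B by (simp add: abs_divide powr_mult pos_divide_le_eq mult.commute)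
      qed
    qed measurable
    moreover have "(\<integral>z. (\<bar>a z + X i * b z\<bar> powr p - \<bar>a z\<bar> powr p) / X i \<partial>jm)
       = (E (\<lambda>x. u x + (0 + X i) * v x) - E (\<lambda>x. u x + 0 * v x)) / X i" for i
      using Int[of "X i"] Int[of 0] unfolding Eq by (simp add: Bochner_Integration.integral_diff)
    ultimately show "((\<lambda>h. (E (\<lambda>x. u x + (0 + h) * v x) - E (\<lambda>x. u x + 0 * v x)) / h) \<circ> X)
       \<longlonglongrightarrow> (\<integral>z. p * spow (p - 1) (a z) * b z \<partial>jm)"
      by (simp only: comp_def)
  qed
  then have "deriv (\<lambda>t. E (\<lambda>x. u x + t * v x)) 0 = (\<integral>z. p * spow (p - 1) (a z) * b z \<partial>jm)"
    by (rule DERIV_imp_deriv)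
  also have "\<dots> = p * (\<integral>z. spow (p - 1) (a z) * b z \<partial>jm)"
    by (simp add: mult.assoc)
  finally show ?thesis using p_pos unfolding energy_pair_def a_def b_def by simp
qed

text \<open>The additive constant drops out of all differences, and a test function vanishing
  identically off a set K with open complement belongs to \<open>dom_in\<close> whatever
  quasi-continuous version was chosen.\<close>

lemma superharmonic_test:
  assumes "superharmonic m p E F U u" and v: "v \<in> F" "\<And>x. 0 \<le> v x"
    and K: "openin (top_of_set (space m)) (space m - K)" "K \<subseteq> U" "\<And>x. x \<in> space m - K \<Longrightarrow> v x = 0"
  shows "integrable jm (\<lambda>z. spow (p - 1) (u (fst z) - u (snd z)) * (v (fst z) - v (snd z)))"
    "0 \<le> (\<integral>z. spow (p - 1) (u (fst z) - u (snd z)) * (v (fst z) - v (snd z)) \<partial>jm)"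
proof -
  obtain f a where f: "f \<in> F" "u = (\<lambda>x. f x + a)" "\<And>v. v \<in> dom_in m p E F U \<Longrightarrow> (AE x in m. 0 \<le> v x) \<Longrightarrow> 0 \<le> energy_pair p E f v"
    using assms(1) unfolding superharmonic_def by blast
  have "0 \<le> energy_pair p E f v" using f(3)[OF dom_in_vanishing[OF v(1) K]] v(2) by simp
  then show "integrable jm (\<lambda>z. spow (p - 1) (u (fst z) - u (snd z)) * (v (fst z) - v (snd z)))"
    "0 \<le> (\<integral>z. spow (p - 1) (u (fst z) - u (snd z)) * (v (fst z) - v (snd z)) \<partial>jm)"
    using first_variation_integrable[OF f(1) v(1)] energy_pair_eq[OF f(1) v(1)] f(2) by simp_all
qed

lemma subharmonic_test:
  assumes "subharmonic m p E F U u" and v: "v \<in> F" "\<And>x. 0 \<le> v x"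
    and K: "openin (top_of_set (space m)) (space m - K)" "K \<subseteq> U" "\<And>x. x \<in> space m - K \<Longrightarrow> v x = 0"
  shows "integrable jm (\<lambda>z. spow (p - 1) (u (fst z) - u (snd z)) * (v (fst z) - v (snd z)))"
    "(\<integral>z. spow (p - 1) (u (fst z) - u (snd z)) * (v (fst z) - v (snd z)) \<partial>jm) \<le> 0"
proof -
  obtain f a where f: "f \<in> F" "u = (\<lambda>x. f x + a)" "\<And>v. v \<in> dom_in m p E F U \<Longrightarrow> (AE x in m. 0 \<le> v x) \<Longrightarrow> energy_pair p E f v \<le> 0"
    using assms(1) unfolding subharmonic_def by blast
  have "energy_pair p E f v \<le> 0" using f(3)[OF dom_in_vanishing[OF v(1) K]] v(2) by simp
  then show "integrable jm (\<lambda>z. spow (p - 1) (u (fst z) - u (snd z)) * (v (fst z) - v (snd z)))"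
    "(\<integral>z. spow (p - 1) (u (fst z) - u (snd z)) * (v (fst z) - v (snd z)) \<partial>jm) \<le> 0"
    using first_variation_integrable[OF f(1) v(1)] energy_pair_eq[OF f(1) v(1)] f(2) by simp_all
qed

text \<open>Coercion to \<open>ennreal\<close> cuts off at 0, so \<open>ennreal (G z)\<close> and
  \<open>ennreal (- G z)\<close> are the positive and negative parts, both with finite integral. A
  nonnegative integral puts the negative part below the positive one. P and Q record jumps in one
  direction; symmetry of J doubles both, and the 2 cancels.\<close>

lemma symmetrized_test:
  assumes G: "integrable jm G" "0 \<le> (\<integral>z. G z \<partial>jm)"
    and [measurable]: "P \<in> borel_measurable (m \<Otimes>\<^sub>M m)" "Q \<in> borel_measurable (m \<Otimes>\<^sub>M m)"
    and lower: "AE z in jm. P z + P (snd z, fst z) \<le> ennreal (- G z)"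
    and upper: "AE z in jm. ennreal (G z) \<le> Q z + Q (snd z, fst z)"
  shows "(\<integral>\<^sup>+z. P z \<partial>jm) \<le> (\<integral>\<^sup>+z. Q z \<partial>jm)"
proof -
  have two: "(\<integral>\<^sup>+z. f z + f (snd z, fst z) \<partial>jm) = 2 * (\<integral>\<^sup>+z. f z \<partial>jm)"
    if [measurable]: "f \<in> borel_measurable (m \<Otimes>\<^sub>M m)" for f :: "_ \<Rightarrow> ennreal"
    by (subst nn_integral_add, measurable) (simp add: nn_integral_jm_swap mult_2)
  have fin: "(\<integral>\<^sup>+z. ennreal (G z) \<partial>jm) < \<infinity>" "(\<integral>\<^sup>+z. ennreal (- G z) \<partial>jm) < \<infinity>"
    using real_integrable_def[of jm G] G(1) by (auto simp: less_top)
  have "(\<integral>z. G z \<partial>jm) = enn2real (\<integral>\<^sup>+z. ennreal (G z) \<partial>jm) - enn2real (\<integral>\<^sup>+z. ennreal (- G z) \<partial>jm)"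
    by (rule real_lebesgue_integral_def[OF G(1)])
  then have "enn2real (\<integral>\<^sup>+z. ennreal (- G z) \<partial>jm) \<le> enn2real (\<integral>\<^sup>+z. ennreal (G z) \<partial>jm)" using G(2) by simp
  then have GG: "(\<integral>\<^sup>+z. ennreal (- G z) \<partial>jm) \<le> (\<integral>\<^sup>+z. ennreal (G z) \<partial>jm)"
    using fin by (metis ennreal_enn2real ennreal_leI infinity_ennreal_def)
  have "2 * (\<integral>\<^sup>+z. P z \<partial>jm) \<le> (\<integral>\<^sup>+z. ennreal (- G z) \<partial>jm)"
    unfolding two[symmetric, OF assms(3)] by (rule nn_integral_mono_AE[OF lower])
  also have "\<dots> \<le> (\<integral>\<^sup>+z. ennreal (G z) \<partial>jm)" by (rule GG)
  also have "\<dots> \<le> 2 * (\<integral>\<^sup>+z. Q z \<partial>jm)"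
    unfolding two[symmetric, OF assms(4)] by (rule nn_integral_mono_AE[OF upper])
  finally show ?thesis by (simp add: ennreal_mult_le_mult_iff)
qed

section \<open>Cutting off on compact open sets\<close>

text \<open>Compactness and openness make the indicator of K a continuous function with compact
  support; the bound C on the rate of leaving K makes multiplication by it bounded on the
  domain.\<close>

definition good_cut :: "'a set \<Rightarrow> real \<Rightarrow> bool" where
  "good_cut K C \<longleftrightarrow> compact K \<and> K \<subseteq> space m \<and> openin (top_of_set (space m)) K \<and> 0 \<le> C \<and>
     (\<forall>x\<in>K. (\<integral>\<^sup>+y\<in>space m - K. ennreal (J x y) \<partial>m) \<le> ennreal C)"

definition cut :: "'a set \<Rightarrow> ('a \<Rightarrow> real) \<Rightarrow> 'a \<Rightarrow> real" where
  "cut K u x = (if x \<in> K then u x else 0)"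

lemma good_cut_sets: "good_cut K C \<Longrightarrow> K \<in> sets m"
  by (auto simp: good_cut_def intro: compact_sets)

lemma good_cut_compl_openin: "good_cut K C \<Longrightarrow> openin (top_of_set (space m)) (space m - K)"
  unfolding good_cut_def by (metis closed_subset closedin_compact_eq compact_imp_closed openin_diff openin_subtopology_self)

lemma cut_measurable:
  assumes "good_cut K C" and [measurable]: "u \<in> borel_measurable m"
  shows "cut K u \<in> borel_measurable m"
proof -
  note [measurable] = good_cut_sets[OF assms(1)]
  show ?thesis unfolding cut_def[abs_def] by measurable
qed

lemma cut_continuous:
  assumes K: "good_cut K C" and u: "continuous_on (space m) u"
  shows "continuous_on (space m) (cut K u)"
proof -
  have eq: "space m = K \<union> (space m - K)" using K by (auto simp: good_cut_def)
  have c: "closedin (top_of_set (space m)) K" "closedin (top_of_set (space m)) (space m - K)"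
    using K good_cut_compl_openin[OF K] by (auto simp: good_cut_def closedin_def Diff_Diff_Int Int_absorb1)
  have "continuous_on (K \<union> (space m - K)) (\<lambda>x. if x \<in> K then u x else 0)"
    by (rule continuous_on_cases_local) (use c K eq in \<open>auto simp: good_cut_def intro: continuous_on_subset[OF u]\<close>)
  then show ?thesis unfolding cut_def[abs_def] eq[symmetric] .
qed

lemma cut_Cc:
  assumes K: "good_cut K C" and u: "continuous_on (space m) u"
  shows "cut K u \<in> Cc (space m)"
  unfolding Cc_def using cut_continuous[OF assms] K
  by (auto simp: good_cut_def cut_def intro!: exI[of _ K])

text \<open>Pairs inside K contribute as before and pairs outside nothing. A pair separated by K
  contributes |u|^p at its inner point, weighted by the rate C of leaving K, and it is counted in
  both orders.\<close>

lemma energy_cut_le: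
  assumes K: "good_cut K C" and [measurable]: "u \<in> borel_measurable m"
  shows "energy (cut K u) \<le> energy u + 2 * ennreal C * (\<integral>\<^sup>+x\<in>K. ennreal (\<bar>u x\<bar> powr p) \<partial>m)"
proof -
  note [measurable] = good_cut_sets[OF K] cut_measurable[OF K assms(2)]
  define f where "f z = ennreal (\<bar>u (fst z)\<bar> powr p) * indicator K (fst z) * indicator (space m - K) (snd z)" for z
  have [measurable]: "f \<in> borel_measurable (m \<Otimes>\<^sub>M m)" unfolding f_def[abs_def] by measurable
  have "energy (cut K u) \<le> (\<integral>\<^sup>+z. ennreal (\<bar>u (fst z) - u (snd z)\<bar> powr p) + (f z + f (snd z, fst z)) \<partial>jm)"
    unfolding energy_eq[OF cut_measurable[OF K assms(2)]]
    by (intro nn_integral_mono) (auto simp: cut_def f_def indicator_def p_pos)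
  also have "\<dots> = energy u + (\<integral>\<^sup>+z. f z + f (snd z, fst z) \<partial>jm)"
    by (subst nn_integral_add) (auto simp: energy_eq)
  also have "(\<integral>\<^sup>+z. f z + f (snd z, fst z) \<partial>jm) = 2 * (\<integral>\<^sup>+z. f z \<partial>jm)"
    by (subst nn_integral_add, measurable) (simp add: nn_integral_jm_swap mult_2)
  also have "(\<integral>\<^sup>+z. f z \<partial>jm) = (\<integral>\<^sup>+x. (ennreal (\<bar>u x\<bar> powr p) * indicator K x) * (\<integral>\<^sup>+y\<in>space m - K. ennreal (J x y) \<partial>m) \<partial>m)"
  proof -
    have "(\<integral>\<^sup>+z. f z \<partial>jm) = (\<integral>\<^sup>+z. ennreal ((\<bar>u (fst z)\<bar> powr p * indicator K (fst z)) * indicator (space m - K) (snd z)) \<partial>jm)"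
      by (intro nn_integral_cong) (auto simp: f_def indicator_def)
    also have "\<dots> = (\<integral>\<^sup>+x. ennreal (\<bar>u x\<bar> powr p * indicator K x) * (\<integral>\<^sup>+y. ennreal (indicator (space m - K) y * J x y) \<partial>m) \<partial>m)"
      by (rule nn_integral_jm_product) auto
    also have "\<dots> = (\<integral>\<^sup>+x. (ennreal (\<bar>u x\<bar> powr p) * indicator K x) * (\<integral>\<^sup>+y\<in>space m - K. ennreal (J x y) \<partial>m) \<partial>m)"
    proof (intro nn_integral_cong arg_cong2[of _ _ _ _ "(*)"])
      show "ennreal (\<bar>u x\<bar> powr p * indicator K x) = ennreal (\<bar>u x\<bar> powr p) * indicator K x" for x
        by (simp add: indicator_def)
      show "ennreal (indicator (space m - K) y * J x y) = ennreal (J x y) * indicator (space m - K) y" for x y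
        by (simp add: indicator_def)
    qed
    finally show ?thesis .
  qed
  also have "\<dots> \<le> (\<integral>\<^sup>+x. (ennreal (\<bar>u x\<bar> powr p) * indicator K x) * ennreal C \<partial>m)"
    using K by (intro nn_integral_mono) (auto simp: good_cut_def indicator_def intro!: mult_left_mono)
  also have "\<dots> = ennreal C * (\<integral>\<^sup>+x\<in>K. ennreal (\<bar>u x\<bar> powr p) \<partial>m)"
    by (subst nn_integral_cmult[symmetric]) (auto simp: ac_simps)
  finally show ?thesis by (simp add: mult.assoc add_mono mult_left_mono)
qed

lemma total_cut_le:
  assumes K: "good_cut K C" and [measurable]: "u \<in> borel_measurable m"
  shows "total (cut K u) \<le> ennreal (2 * C + 2) * total u"
proof -
  note [measurable] = good_cut_sets[OF K]
  have C: "0 \<le> C" using K by (simp add: good_cut_def)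
  let ?l = "\<integral>\<^sup>+x. ennreal (\<bar>u x\<bar> powr p) \<partial>m"
  have l: "(\<integral>\<^sup>+x\<in>K. ennreal (\<bar>u x\<bar> powr p) \<partial>m) \<le> ?l"
    by (intro nn_integral_mono) (auto simp: indicator_def)
  have "energy (cut K u) \<le> energy u + 2 * ennreal C * ?l"
    by (rule order_trans[OF energy_cut_le[OF assms]]) (intro add_mono mult_left_mono l order_refl, simp)
  also have "\<dots> \<le> total u + 2 * ennreal C * total u"
    by (intro add_mono mult_left_mono energy_le_total lp_le_total) simp
  finally have "energy (cut K u) \<le> total u + 2 * ennreal C * total u" .
  moreover have "(\<integral>\<^sup>+x. ennreal (\<bar>cut K u x\<bar> powr p) \<partial>m) \<le> total u"
    by (rule order_trans[OF nn_integral_mono lp_le_total]) (auto simp: cut_def p_pos)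
  ultimately have "total (cut K u) \<le> (total u + 2 * ennreal C * total u) + total u"
    unfolding total_def[of "cut K u"] by (rule add_mono)
  also have "\<dots> = ennreal (2 * C + 2) * total u"
  proof -
    have "ennreal (2 * C + 2) = 2 * ennreal C + (1 + 1)" using C by (simp add: ennreal_mult)
    then have "ennreal (2 * C + 2) * total u = 2 * ennreal C * total u + (total u + total u)"
      by (simp only: distrib_right mult_1)
    then show ?thesis by (simp only: ac_simps)
  qed
  finally show ?thesis .
qed

text \<open>Cutting is linear, bounded for \<open>total\<close> and maps the core to itself, hence
  it passes to limits of core functions.\<close>

lemma cut_F:
  assumes K: "good_cut K C" and u: "u \<in> F"
  shows "cut K u \<in> F"
proof -
  obtain f where f: "\<And>n. f n \<in> core" "\<And>n. total (\<lambda>x. u x - f n x) < ennreal ((1/2) ^ n)"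
    using F_approx[OF u, of "\<lambda>n. (1/2) ^ n"] by auto
  note [measurable] = F_measurable[OF u] core_measurable[OF f(1)]
  have fin: "total (cut K (f n)) < \<infinity>" for n
    using total_cut_le[OF K, of "f n"] f(1)[of n] by (auto simp: core_iff ennreal_mult_less_top intro: order_le_less_trans)
  have core: "cut K (f n) \<in> core" for n
    using f(1)[of n] fin[of n] cut_Cc[OF K, of "f n"] unfolding core_iff by (simp add: Cc_def[of "space m"])
  have le: "total (\<lambda>x. cut K u x - cut K (f n) x) \<le> ennreal ((2 * C + 2) * (1/2) ^ n)" for n
  proof -
    have C: "0 \<le> C" using K by (simp add: good_cut_def)
    have "(\<lambda>x. cut K u x - cut K (f n) x) = cut K (\<lambda>x. u x - f n x)" by (auto simp: cut_def)
    then have "total (\<lambda>x. cut K u x - cut K (f n) x) \<le> ennreal (2 * C + 2) * total (\<lambda>x. u x - f n x)"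
      using total_cut_le[OF K, of "\<lambda>x. u x - f n x"] by simp
    also have "\<dots> \<le> ennreal (2 * C + 2) * ennreal ((1/2) ^ n)" by (rule mult_left_mono[OF less_imp_le[OF f(2)]]) simp
    also have "\<dots> = ennreal ((2 * C + 2) * (1/2) ^ n)" using C by (intro ennreal_mult[symmetric]) auto
    finally show ?thesis .
  qed
  have "(\<lambda>n. ennreal ((2 * C + 2) * (1/2) ^ n)) \<longlonglongrightarrow> ennreal ((2 * C + 2) * 0)"
    by (intro tendsto_intros LIMSEQ_power_zero) simp
  then have lim: "(\<lambda>n. ennreal ((2 * C + 2) * (1/2) ^ n)) \<longlonglongrightarrow> 0" by simp
  have "(\<lambda>n. total (\<lambda>x. cut K u x - cut K (f n) x)) \<longlonglongrightarrow> 0"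
  proof (rule tendsto_sandwich[OF _ _ tendsto_const lim])
    show "\<forall>\<^sub>F n in sequentially. total (\<lambda>x. cut K u x - cut K (f n) x) \<le> ennreal ((2 * C + 2) * (1/2) ^ n)"
      by (intro always_eventually allI le)
  qed simp
  then show ?thesis
    by (rule F_intro[of "cut K u" "\<lambda>n. cut K (f n)", rotated 2])
       (simp_all add: core_subset_F[OF core] cut_measurable[OF K])
qed

lemma cut_one_core:
  assumes K: "good_cut K C"
  shows "cut K (\<lambda>x. 1) \<in> core"
proof -
  note [measurable] = good_cut_sets[OF K]
  have "energy (\<lambda>x. 1) = 0" by (simp add: nl_energy_def p_pos)
  then have "energy (cut K (\<lambda>x. 1)) \<le> 2 * ennreal C * emeasure m K"
    using energy_cut_le[OF K, of "\<lambda>x. 1"] by simp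
  also have "\<dots> < \<infinity>" using K compact_finite[of K] by (auto simp: good_cut_def ennreal_mult_less_top)
  finally show ?thesis using cut_Cc[OF K, of "\<lambda>x. 1"] by (simp add: nl_core_def)
qed

text \<open>For u = f + a the function g(f + a) - g(a) comes from a Lipschitz function fixing 0, so
  it stays in the domain; the constant g(a) returns after cutting, as a multiple of the indicator of
  K.\<close>

lemma cut_lipschitz_F:
  assumes K: "good_cut K C" and u: "u \<in> dom_const F"
    and g: "0 \<le> L" "\<And>s t. \<bar>g s - g t\<bar> \<le> L * \<bar>s - t\<bar>"
  shows "cut K (\<lambda>x. g (u x)) \<in> F"
proof -
  obtain f a where f: "f \<in> F" "u = (\<lambda>x. f x + a)" using u by (auto simp: dom_const_def)
  have 1: "(\<lambda>x. g (f x + a) - g a) \<in> F"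
  proof (rule F_compose[OF f(1), of "\<lambda>s. g (s + a) - g a" L])
    show "\<bar>(g (s + a) - g a) - (g (t + a) - g a)\<bar> \<le> L * \<bar>s - t\<bar>" for s t using g(2)[of "s + a" "t + a"] by simp
  qed (use g in auto)
  have "(\<lambda>x. cut K (\<lambda>x. g (f x + a) - g a) x + g a * cut K (\<lambda>x. 1) x) \<in> F"
    by (intro F_add cut_F[OF K 1] F_scale core_subset_F cut_one_core[OF K])
  moreover have "(\<lambda>x. cut K (\<lambda>x. g (f x + a) - g a) x + g a * cut K (\<lambda>x. 1) x) = cut K (\<lambda>x. g (u x))"
    by (auto simp: cut_def f(2))
  ultimately show ?thesis by simp
qed

lemma superharmonic_dom_const: "superharmonic m p E F U u \<Longrightarrow> u \<in> dom_const F"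
  by (auto simp: superharmonic_def dom_const_def)

lemma subharmonic_dom_const: "subharmonic m p E F U u \<Longrightarrow> u \<in> dom_const F"
  by (auto simp: subharmonic_def dom_const_def)

text \<open>
  Testing with \<open>(k - u)\<^sub>+\<close> on the compact open set \<open>K\<close>: all values of \<open>u\<close> above \<open>k\<close> contribute with the good sign, and
  only jumps leaving \<open>K\<close> can contribute with the bad sign.
\<close>

lemma supersolution_step:
  assumes K: "good_cut K C" and KU: "K \<subseteq> U" and U: "U \<in> sets m" and sup: "superharmonic m p E F U u"
    and pos: "AE x in m. x \<in> U \<longrightarrow> 0 \<le> u x" and k: "0 < k" and t: "0 \<le> t"
    and tail: "AE x in m. x \<in> K \<longrightarrow> (\<integral>\<^sup>+y\<in>space m - U. ennreal (max (- u y) 0 powr (p - 1) * J x y) \<partial>m) \<le> ennreal t"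
  shows "(\<integral>\<^sup>+x. ennreal (cut K (\<lambda>x. max (k - u x) 0) x) * (\<integral>\<^sup>+y. ennreal (max (u y - k) 0 powr (p - 1) * J x y) \<partial>m) \<partial>m)
    \<le> ennreal (2 powr (p - 1) * (k powr (p - 1) * C + t)) * (\<integral>\<^sup>+x. ennreal (cut K (\<lambda>x. max (k - u x) 0) x) \<partial>m)"
proof -
  note super_dom_const = superharmonic_dom_const[OF sup]
  note [measurable] = good_cut_sets[OF K] U dom_const_measurable[OF super_dom_const]
  have C: "0 \<le> C" using K by (simp add: good_cut_def)
  define V where "V = cut K (\<lambda>x. max (k - u x) 0)"
  have VF: "V \<in> F" unfolding V_def by (rule cut_lipschitz_F[OF K super_dom_const, of 1 "\<lambda>s. max (k - s) 0"]) auto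
  note [measurable] = F_measurable[OF VF]
  have V0: "0 \<le> V x" for x by (simp add: V_def cut_def)
  have q: "0 < p - 1" using p_gt_1 by simp
  define G where "G z = spow (p - 1) (u (fst z) - u (snd z)) * (V (fst z) - V (snd z))" for z
  have G: "integrable jm G" "0 \<le> (\<integral>z. G z \<partial>jm)"
    unfolding G_def[abs_def]
    by (rule superharmonic_test[OF sup VF V0 good_cut_compl_openin[OF K] KU]; simp add: V_def cut_def)+
  \<comment> \<open>Bounds (u x - u y)^(p-1) for x in K with u x below k and y outside K: on U the
    value u y is nonnegative, so k alone suffices, and off U the negative part of u is added, with
    2^(p-1) from splitting the power.\<close>
  define n where "n y = (if y \<in> K then 0 else 2 powr (p - 1) * (k powr (p - 1) + (if y \<in> U then 0 else max (- u y) 0 powr (p - 1))))" for y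
  have n0: "0 \<le> n y" for y by (simp add: n_def)
  define P where "P z = ennreal (V (fst z) * max (u (snd z) - k) 0 powr (p - 1))" for z
  define Q where "Q z = ennreal (V (fst z) * n (snd z))" for z
  have [measurable]: "n \<in> borel_measurable m" unfolding n_def[abs_def] by measurable
  have [measurable]: "P \<in> borel_measurable (m \<Otimes>\<^sub>M m)" "Q \<in> borel_measurable (m \<Otimes>\<^sub>M m)"
    unfolding P_def[abs_def] Q_def[abs_def] by measurable
  \<comment> \<open>If u y > k then V y = 0, and u x < k gives u y - u x >= u y - k. The second
    summand on the left vanishes together with V y.\<close>
  have lower1: "ennreal (V x * max (u y - k) 0 powr (p - 1)) + ennreal (V y * max (u x - k) 0 powr (p - 1))
      \<le> ennreal (- (spow (p - 1) (u x - u y) * (V x - V y)))" if yk: "u y > k" "0 < V x" for x y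
  proof -
    have ux: "u x < k" using that by (auto simp: V_def cut_def max_def split: if_splits)
    have Vy: "V y = 0" using that by (simp add: V_def cut_def)
    have "V x * (u y - k) powr (p - 1) \<le> V x * (u y - u x) powr (p - 1)"
      using ux yk V0[of x] q by (intro mult_left_mono powr_mono2) auto
    also have "\<dots> = - (spow (p - 1) (u x - u y) * (V x - V y))"
      using ux yk spow_minus[of "p - 1" "u y - u x"] spow_nonneg[of "u y - u x" "p - 1"] Vy by simp
    finally show ?thesis using ux yk Vy by (simp add: ennreal_leI)
  qed
  have lower: "P z + P (snd z, fst z) \<le> ennreal (- G z)" for z
  proof -
    obtain x y where z: "z = (x, y)" by (cases z)
    consider "u y > k \<and> 0 < V x" | "u x > k \<and> 0 < V y" | "(u y \<le> k \<or> V x = 0) \<and> (u x \<le> k \<or> V y = 0)"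
      using V0[of x] V0[of y] by linarith
    then show ?thesis
    proof cases
      case 1 then show ?thesis using lower1[of y x] by (simp add: z P_def G_def)
    next
      case 2
      have "spow (p - 1) (u y - u x) * (V y - V x) = spow (p - 1) (u x - u y) * (V x - V y)"
        using spow_minus[of "p - 1" "u x - u y"] by (simp add: algebra_simps)
      then show ?thesis using lower1[of x y] 2 by (simp add: z P_def G_def add.commute)
    next
      case 3
      then have "P z = 0" "P (snd z, fst z) = 0" using q by (auto simp: z P_def max_def)
      then show ?thesis by simp
    qed
  qed
  have upper1: "spow (p - 1) (u x - u y) * V x \<le> V x * n y"
    if x: "x \<in> U \<longrightarrow> 0 \<le> u x" and y: "y \<in> U \<longrightarrow> 0 \<le> u y" and V: "0 < V x" "V y = 0" for x y
  proof -
    have ux: "0 \<le> u x" "u x < k" using V x KU by (auto simp: V_def cut_def max_def split: if_splits)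
    show ?thesis
    proof (cases "u x \<le> u y")
      case True
      then have "spow (p - 1) (u x - u y) \<le> 0" by (simp add: spow_def sgn_if)
      then have "spow (p - 1) (u x - u y) * V x \<le> 0" using V by (simp add: mult_le_0_iff)
      then show ?thesis using V0[of x] n0[of y] by (meson mult_nonneg_nonneg order_trans)
    next
      case False
      then have yK: "y \<notin> K" using V ux by (auto simp: V_def cut_def max_def split: if_splits)
      have two: "1 \<le> (2 :: real) powr (p - 1)" using q by (intro ge_one_powr_ge_zero) auto
      have "(u x - u y) powr (p - 1) \<le> n y"
      proof (cases "y \<in> U")
        case True
        have "(u x - u y) powr (p - 1) \<le> 1 * k powr (p - 1)"
          using ux y True False q by (simp, intro powr_mono2) auto
        also have "\<dots> \<le> 2 powr (p - 1) * k powr (p - 1)" using two by (intro mult_right_mono) auto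
        finally show ?thesis using True yK by (simp add: n_def)
      next
        case yU: False
        have "(u x - u y) powr (p - 1) \<le> (k + max (- u y) 0) powr (p - 1)"
          using ux False q by (intro powr_mono2) auto
        also have "\<dots> \<le> 2 powr (p - 1) * (k powr (p - 1) + max (- u y) 0 powr (p - 1))"
          using k q by (intro powr_add_le) auto
        finally show ?thesis using yU yK by (simp add: n_def)
      qed
      then show ?thesis using False V by (simp add: spow_nonneg mult.commute mult_left_mono)
    qed
  qed
  have upper: "AE z in jm. ennreal (G z) \<le> Q z + Q (snd z, fst z)"
    using AE_jm[OF pos]
  proof eventually_elim
    fix z assume a: "(fst z \<in> U \<longrightarrow> 0 \<le> u (fst z)) \<and> (snd z \<in> U \<longrightarrow> 0 \<le> u (snd z))"
    obtain x y where z: "z = (x, y)" by (cases z)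
    have sw: "spow (p - 1) (u x - u y) = - spow (p - 1) (u y - u x)"
      using spow_minus[of "p - 1" "u x - u y"] by simp
    consider "0 < V x" "0 < V y" | "0 < V x" "V y = 0" | "V x = 0" "0 < V y" | "V x = 0" "V y = 0"
      using V0[of x] V0[of y] by linarith
    then show "ennreal (G z) \<le> Q z + Q (snd z, fst z)"
    proof cases
      case 1
      \<comment> \<open>Between two points of K below the level the integrand is -|u x - u y|^p, so
        such pairs never enter the bad side.\<close>
      then have "V x - V y = - (u x - u y)" by (auto simp: V_def cut_def max_def split: if_splits)
      then have "G z = - (spow (p - 1) (u x - u y) * (u x - u y))"
        unfolding G_def z fst_conv snd_conv by (simp only: mult_minus_right)
      also have "\<dots> \<le> 0" using spow_mult_self[OF q, of "u x - u y"] by simp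
      finally show ?thesis by (simp add: ennreal_neg)
    next
      case 2
      then have "G z \<le> V x * n y" using upper1[of x y] a by (simp add: G_def z)
      then have "ennreal (G z) \<le> Q z" by (simp add: z Q_def ennreal_leI)
      then show ?thesis by (rule add_increasing2[rotated]) simp
    next
      case 3
      then have "G z \<le> V y * n x" using upper1[of y x] a by (simp add: G_def z sw)
      then have "ennreal (G z) \<le> Q (snd z, fst z)" by (simp add: z Q_def ennreal_leI)
      then show ?thesis by (rule add_increasing[rotated]) simp
    qed (simp add: G_def z)
  qed
  have main: "(\<integral>\<^sup>+z. P z \<partial>jm) \<le> (\<integral>\<^sup>+z. Q z \<partial>jm)"
    by (rule symmetrized_test[OF G _ _ _ upper]) (auto intro: lower)
  have "(\<integral>\<^sup>+z. P z \<partial>jm) = (\<integral>\<^sup>+x. ennreal (V x) * (\<integral>\<^sup>+y. ennreal (max (u y - k) 0 powr (p - 1) * J x y) \<partial>m) \<partial>m)"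
    unfolding P_def by (rule nn_integral_jm_product) (auto simp: V0)
  moreover have "(\<integral>\<^sup>+z. Q z \<partial>jm) = (\<integral>\<^sup>+x. ennreal (V x) * (\<integral>\<^sup>+y. ennreal (n y * J x y) \<partial>m) \<partial>m)"
    unfolding Q_def by (rule nn_integral_jm_product) (auto simp: V0 n0)
  moreover have "(\<integral>\<^sup>+x. ennreal (V x) * (\<integral>\<^sup>+y. ennreal (n y * J x y) \<partial>m) \<partial>m)
     \<le> (\<integral>\<^sup>+x. ennreal (2 powr (p - 1) * (k powr (p - 1) * C + t)) * ennreal (V x) \<partial>m)"
  proof (rule nn_integral_mono_AE)
    show "AE x in m. ennreal (V x) * (\<integral>\<^sup>+y. ennreal (n y * J x y) \<partial>m) \<le> ennreal (2 powr (p - 1) * (k powr (p - 1) * C + t)) * ennreal (V x)"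
      using tail AE_space
    proof eventually_elim
      fix x assume tl: "x \<in> K \<longrightarrow> (\<integral>\<^sup>+y\<in>space m - U. ennreal (max (- u y) 0 powr (p - 1) * J x y) \<partial>m) \<le> ennreal t"
        and [measurable]: "x \<in> space m"
      show "ennreal (V x) * (\<integral>\<^sup>+y. ennreal (n y * J x y) \<partial>m) \<le> ennreal (2 powr (p - 1) * (k powr (p - 1) * C + t)) * ennreal (V x)"
      proof (cases "x \<in> K")
        case True
        have "(\<integral>\<^sup>+y. ennreal (n y * J x y) \<partial>m) \<le> (\<integral>\<^sup>+y. ennreal (2 powr (p - 1)) *
            (ennreal (k powr (p - 1)) * (ennreal (J x y) * indicator (space m - K) y) + ennreal (max (- u y) 0 powr (p - 1) * J x y) * indicator (space m - U) y) \<partial>m)"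
          using KU J_nonneg
          by (intro nn_integral_mono)
             (auto simp: n_def indicator_def ennreal_mult[symmetric] ennreal_plus[symmetric] algebra_simps simp del: ennreal_plus)
        also have "\<dots> = ennreal (2 powr (p - 1)) * (ennreal (k powr (p - 1)) * (\<integral>\<^sup>+y\<in>space m - K. ennreal (J x y) \<partial>m)
             + (\<integral>\<^sup>+y\<in>space m - U. ennreal (max (- u y) 0 powr (p - 1) * J x y) \<partial>m))"
          by (subst nn_integral_cmult, measurable) (subst nn_integral_add, auto simp: nn_integral_cmult)
        also have "\<dots> \<le> ennreal (2 powr (p - 1)) * (ennreal (k powr (p - 1)) * ennreal C + ennreal t)"
          using K True tl by (intro mult_left_mono add_mono) (auto simp: good_cut_def)
        also have "\<dots> = ennreal (2 powr (p - 1) * (k powr (p - 1) * C + t))"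
          using C t by (simp add: ennreal_mult ennreal_plus)
        finally show ?thesis by (subst mult.commute) (rule mult_right_mono, auto)
      qed (simp add: V_def cut_def)
    qed
  qed
  moreover have "\<dots> = ennreal (2 powr (p - 1) * (k powr (p - 1) * C + t)) * (\<integral>\<^sup>+x. ennreal (V x) \<partial>m)"
    by (rule nn_integral_cmult) measurable
  ultimately show ?thesis using main unfolding V_def by simp
qed

text \<open>The dual test, with (u - l)_+ on K. A point of K below k pulls with strength at least (l
  - k)^(p-1), and only points outside K can push upwards, with strength at most (u y - k)_+^(p-1)
  because u x > l >= k. Reversing the sign of the integrand allows the same symmetrization.\<close>

lemma subsolution_step:
  assumes K: "good_cut K C" and KU: "K \<subseteq> U" and sub: "subharmonic m p E F U u" and kl: "k \<le> l"
  shows "(\<integral>\<^sup>+x. ennreal (cut K (\<lambda>x. max (u x - l) 0) x) * (ennreal ((l - k) powr (p - 1)) * (\<integral>\<^sup>+y\<in>{y\<in>K. u y \<le> k}. ennreal (J x y) \<partial>m)) \<partial>m)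
    \<le> (\<integral>\<^sup>+x. ennreal (cut K (\<lambda>x. max (u x - l) 0) x) * (\<integral>\<^sup>+y\<in>space m - K. ennreal (max (u y - k) 0 powr (p - 1) * J x y) \<partial>m) \<partial>m)"
proof -
  note super_dom_const = subharmonic_dom_const[OF sub]
  note [measurable] = good_cut_sets[OF K] dom_const_measurable[OF super_dom_const]
  define V where "V = cut K (\<lambda>x. max (u x - l) 0)"
  have VF: "V \<in> F" unfolding V_def by (rule cut_lipschitz_F[OF K super_dom_const, of 1 "\<lambda>s. max (s - l) 0"]) auto
  note [measurable] = F_measurable[OF VF]
  have V0: "0 \<le> V x" for x by (simp add: V_def cut_def)
  have q: "0 < p - 1" using p_gt_1 by simp
  define G where "G z = - (spow (p - 1) (u (fst z) - u (snd z)) * (V (fst z) - V (snd z)))" for z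
  have "integrable jm (\<lambda>z. - G z)" "(\<integral>z. - G z \<partial>jm) \<le> 0"
    unfolding G_def[abs_def] minus_minus
    by (rule subharmonic_test[OF sub VF V0 good_cut_compl_openin[OF K] KU]; simp add: V_def cut_def)+
  then have G: "integrable jm G" "0 \<le> (\<integral>z. G z \<partial>jm)" by simp_all
  have KS: "K \<subseteq> space m" using K by (simp add: good_cut_def)
  define A where "A = {y\<in>K. u y \<le> k}"
  have A_eq: "A = {y\<in>space m. y \<in> K \<and> u y \<le> k}" using KS by (auto simp: A_def)
  have [measurable]: "A \<in> sets m" unfolding A_eq by measurable
  define P where "P z = ennreal (V (fst z) * ((l - k) powr (p - 1) * indicator A (snd z)))" for z
  define Q where "Q z = ennreal (V (fst z) * (max (u (snd z) - k) 0 powr (p - 1) * indicator (space m - K) (snd z)))" for z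
  have [measurable]: "P \<in> borel_measurable (m \<Otimes>\<^sub>M m)" "Q \<in> borel_measurable (m \<Otimes>\<^sub>M m)"
    unfolding P_def[abs_def] Q_def[abs_def] by measurable
  have lower1: "V x * (l - k) powr (p - 1) \<le> spow (p - 1) (u x - u y) * (V x - V y)" if "y \<in> A" "0 < V x" for x y
  proof -
    have ux: "l < u x" using that by (auto simp: V_def cut_def max_def split: if_splits)
    have uy: "u y \<le> k" "V y = 0" using that kl by (auto simp: V_def cut_def A_def)
    have "V x * (l - k) powr (p - 1) \<le> V x * (u x - u y) powr (p - 1)"
      using ux uy V0[of x] q kl by (intro mult_left_mono powr_mono2) auto
    then show ?thesis using ux uy kl by (simp add: spow_nonneg mult.commute)
  qed
  have sw: "spow (p - 1) (u x - u y) * (V x - V y) = spow (p - 1) (u y - u x) * (V y - V x)" for x y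
    using spow_minus[of "p - 1" "u y - u x"] by (simp add: algebra_simps)
  have lower: "P z + P (snd z, fst z) \<le> ennreal (- G z)" for z
  proof -
    obtain x y where z: "z = (x, y)" by (cases z)
    consider "y \<in> A" "0 < V x" | "x \<in> A" "0 < V y" | "(y \<notin> A \<or> V x = 0)" "(x \<notin> A \<or> V y = 0)"
      using V0[of x] V0[of y] by (metis less_eq_real_def)
    then show ?thesis
    proof cases
      case 1
      then have "V y = 0" using kl by (auto simp: V_def cut_def A_def)
      then show ?thesis using lower1[OF 1] 1 by (simp add: z P_def G_def ennreal_leI)
    next
      case 2
      then have "V x = 0" using kl by (auto simp: V_def cut_def A_def)
      then show ?thesis using lower1[OF 2] 2 sw[of x y] by (simp add: z P_def G_def ennreal_leI)
    next
      case 3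
      then have "P z = 0" "P (snd z, fst z) = 0" by (auto simp: z P_def)
      then show ?thesis by simp
    qed
  qed
  have upper1: "- (spow (p - 1) (u x - u y) * V x) \<le> V x * (max (u y - k) 0 powr (p - 1) * indicator (space m - K) y)"
    if V: "0 < V x" "V y = 0" and y: "y \<in> space m" for x y
  proof -
    have ux: "l < u x" using V by (auto simp: V_def cut_def max_def split: if_splits)
    show ?thesis
    proof (cases "u y \<le> u x")
      case True
      then have "0 \<le> spow (p - 1) (u x - u y) * V x" using V by (simp add: spow_nonneg)
      then show ?thesis using V0[of x] by (smt (verit) mult_nonneg_nonneg powr_ge_zero indicator_pos_le)
    next
      case False
      then have yK: "y \<notin> K" using V ux by (auto simp: V_def cut_def max_def split: if_splits)
      have "- spow (p - 1) (u x - u y) = (u y - u x) powr (p - 1)"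
        using False spow_minus[of "p - 1" "u y - u x"] spow_nonneg[of "u y - u x" "p - 1"] by simp
      also have "\<dots> \<le> max (u y - k) 0 powr (p - 1)" using False ux kl q by (intro powr_mono2) auto
      finally have "V x * - spow (p - 1) (u x - u y) \<le> V x * max (u y - k) 0 powr (p - 1)"
        using V0[of x] by (rule mult_left_mono)
      then show ?thesis using yK y by (simp add: mult.commute)
    qed
  qed
  have upper: "AE z in jm. ennreal (G z) \<le> Q z + Q (snd z, fst z)"
    using AE_space
  proof eventually_elim
    fix z assume "z \<in> space jm"
    then obtain x y where z: "z = (x, y)" "x \<in> space m" "y \<in> space m" by (auto simp: space_pair_measure)
    consider "0 < V x" "0 < V y" | "0 < V x" "V y = 0" | "V x = 0" "0 < V y" | "V x = 0" "V y = 0"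
      using V0[of x] V0[of y] by linarith
    then show "ennreal (G z) \<le> Q z + Q (snd z, fst z)"
    proof cases
      case 1
      then have "V x - V y = u x - u y" by (auto simp: V_def cut_def max_def split: if_splits)
      then have "G z = - (spow (p - 1) (u x - u y) * (u x - u y))" by (simp add: G_def z)
      also have "\<dots> \<le> 0" using spow_mult_self[OF q, of "u x - u y"] by simp
      finally show ?thesis by (simp add: ennreal_neg)
    next
      case 2
      then have "G z \<le> V x * (max (u y - k) 0 powr (p - 1) * indicator (space m - K) y)"
        using upper1[of x y] z by (simp add: G_def z)
      then have "ennreal (G z) \<le> Q z" by (simp add: z Q_def ennreal_leI)
      then show ?thesis by (rule add_increasing2[rotated]) simp
    next
      case 3
      then have "G z \<le> V y * (max (u x - k) 0 powr (p - 1) * indicator (space m - K) x)"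
        using upper1[of y x] z sw[of x y] by (simp add: G_def z)
      then have "ennreal (G z) \<le> Q (snd z, fst z)" by (simp add: z Q_def ennreal_leI)
      then show ?thesis by (rule add_increasing[rotated]) simp
    qed (simp add: G_def z)
  qed
  have main: "(\<integral>\<^sup>+z. P z \<partial>jm) \<le> (\<integral>\<^sup>+z. Q z \<partial>jm)"
    by (rule symmetrized_test[OF G _ _ _ upper]) (auto intro: lower)
  have "(\<integral>\<^sup>+z. P z \<partial>jm) = (\<integral>\<^sup>+x. ennreal (V x) * (ennreal ((l - k) powr (p - 1)) * (\<integral>\<^sup>+y\<in>A. ennreal (J x y) \<partial>m)) \<partial>m)"
  proof -
    have "(\<integral>\<^sup>+z. P z \<partial>jm) = (\<integral>\<^sup>+x. ennreal (V x) * (\<integral>\<^sup>+y. ennreal ((l - k) powr (p - 1) * indicator A y * J x y) \<partial>m) \<partial>m)"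
      unfolding P_def by (rule nn_integral_jm_product) (auto simp: V0)
    also have "\<dots> = (\<integral>\<^sup>+x. ennreal (V x) * (ennreal ((l - k) powr (p - 1)) * (\<integral>\<^sup>+y\<in>A. ennreal (J x y) \<partial>m)) \<partial>m)"
    proof (rule nn_integral_cong)
      fix x assume [measurable]: "x \<in> space m"
      have "(\<integral>\<^sup>+y. ennreal ((l - k) powr (p - 1) * indicator A y * J x y) \<partial>m)
        = (\<integral>\<^sup>+y. ennreal ((l - k) powr (p - 1)) * (ennreal (J x y) * indicator A y) \<partial>m)"
        by (intro nn_integral_cong) (auto simp: indicator_def ennreal_mult J_nonneg)
      also have "\<dots> = ennreal ((l - k) powr (p - 1)) * (\<integral>\<^sup>+y\<in>A. ennreal (J x y) \<partial>m)"
        by (rule nn_integral_cmult) measurable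
      finally show "ennreal (V x) * (\<integral>\<^sup>+y. ennreal ((l - k) powr (p - 1) * indicator A y * J x y) \<partial>m)
        = ennreal (V x) * (ennreal ((l - k) powr (p - 1)) * (\<integral>\<^sup>+y\<in>A. ennreal (J x y) \<partial>m))" by simp
    qed
    finally show ?thesis .
  qed
  moreover have "(\<integral>\<^sup>+z. Q z \<partial>jm) = (\<integral>\<^sup>+x. ennreal (V x) * (\<integral>\<^sup>+y\<in>space m - K. ennreal (max (u y - k) 0 powr (p - 1) * J x y) \<partial>m) \<partial>m)"
  proof -
    have "(\<integral>\<^sup>+z. Q z \<partial>jm) = (\<integral>\<^sup>+x. ennreal (V x) * (\<integral>\<^sup>+y. ennreal (max (u y - k) 0 powr (p - 1) * indicator (space m - K) y * J x y) \<partial>m) \<partial>m)"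
      unfolding Q_def by (rule nn_integral_jm_product) (auto simp: V0)
    moreover have "(\<integral>\<^sup>+y. ennreal (max (u y - k) 0 powr (p - 1) * indicator (space m - K) y * J x y) \<partial>m)
      = (\<integral>\<^sup>+y\<in>space m - K. ennreal (max (u y - k) 0 powr (p - 1) * J x y) \<partial>m)" for x
      by (intro nn_integral_cong) (auto simp: indicator_def)
    ultimately show ?thesis by simp
  qed
  ultimately show ?thesis using main unfolding V_def A_def by simp
qed

section \<open>Energy measures and tails in terms of the functions themselves\<close>

lemma emeasure_energy_measure:
  assumes u: "u \<in> dom_const F" and A: "A \<in> sets m"
  shows "emeasure (energy_measure m p E F J A u) A
    = (\<integral>\<^sup>+x\<in>A. (\<integral>\<^sup>+y\<in>A. ennreal (\<bar>u x - u y\<bar> powr p * J x y) \<partial>m) \<partial>m)"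
proof -
  note q = qc_version[OF u]
  note [measurable] = A q(1) dom_const_measurable[OF u]
  have "emeasure (energy_measure m p E F J A u) A
    = (\<integral>\<^sup>+x\<in>A. (\<integral>\<^sup>+y\<in>A. ennreal (\<bar>qc_version m p E F u x - qc_version m p E F u y\<bar> powr p * J x y) \<partial>m) \<partial>m)"
    unfolding energy_measure_def Let_def by (subst emeasure_density) auto
  also have "\<dots> = (\<integral>\<^sup>+x\<in>A. (\<integral>\<^sup>+y\<in>A. ennreal (\<bar>u x - u y\<bar> powr p * J x y) \<partial>m) \<partial>m)"
  proof (rule nn_integral_cong_AE)
    show "AE x in m. (\<integral>\<^sup>+y\<in>A. ennreal (\<bar>qc_version m p E F u x - qc_version m p E F u y\<bar> powr p * J x y) \<partial>m) * indicator A x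
      = (\<integral>\<^sup>+y\<in>A. ennreal (\<bar>u x - u y\<bar> powr p * J x y) \<partial>m) * indicator A x"
      using q(2)
    proof eventually_elim
      fix x assume x: "qc_version m p E F u x = u x"
      have "(\<integral>\<^sup>+y\<in>A. ennreal (\<bar>qc_version m p E F u x - qc_version m p E F u y\<bar> powr p * J x y) \<partial>m)
        = (\<integral>\<^sup>+y\<in>A. ennreal (\<bar>u x - u y\<bar> powr p * J x y) \<partial>m)"
        by (rule nn_integral_cong_AE) (use q(2) in \<open>eventually_elim, simp add: x\<close>)
      then show "(\<integral>\<^sup>+y\<in>A. ennreal (\<bar>qc_version m p E F u x - qc_version m p E F u y\<bar> powr p * J x y) \<partial>m) * indicator A x
      = (\<integral>\<^sup>+y\<in>A. ennreal (\<bar>u x - u y\<bar> powr p * J x y) \<partial>m) * indicator A x" by simp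
    qed
  qed
  finally show ?thesis .
qed

lemma nn_integral_energy_measure:
  assumes u: "u \<in> dom_const F" and [measurable]: "A \<in> sets m" "f \<in> borel_measurable m"
  shows "(\<integral>\<^sup>+x\<in>A. f x \<partial>energy_measure m p E F J A u)
    = (\<integral>\<^sup>+x\<in>A. f x * (\<integral>\<^sup>+y\<in>A. ennreal (\<bar>u x - u y\<bar> powr p * J x y) \<partial>m) \<partial>m)"
proof -
  note q = qc_version[OF u]
  note [measurable] = q(1) dom_const_measurable[OF u]
  have "(\<integral>\<^sup>+x\<in>A. f x \<partial>energy_measure m p E F J A u)
    = (\<integral>\<^sup>+x. (\<integral>\<^sup>+y\<in>A. ennreal (\<bar>qc_version m p E F u x - qc_version m p E F u y\<bar> powr p * J x y) \<partial>m) * (f x * indicator A x) \<partial>m)"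
    unfolding energy_measure_def Let_def by (subst nn_integral_density) auto
  also have "\<dots> = (\<integral>\<^sup>+x\<in>A. f x * (\<integral>\<^sup>+y\<in>A. ennreal (\<bar>u x - u y\<bar> powr p * J x y) \<partial>m) \<partial>m)"
  proof (rule nn_integral_cong_AE)
    show "AE x in m. (\<integral>\<^sup>+y\<in>A. ennreal (\<bar>qc_version m p E F u x - qc_version m p E F u y\<bar> powr p * J x y) \<partial>m) * (f x * indicator A x)
      = f x * (\<integral>\<^sup>+y\<in>A. ennreal (\<bar>u x - u y\<bar> powr p * J x y) \<partial>m) * indicator A x"
      using q(2)
    proof eventually_elim
      fix x assume x: "qc_version m p E F u x = u x"
      have "(\<integral>\<^sup>+y\<in>A. ennreal (\<bar>qc_version m p E F u x - qc_version m p E F u y\<bar> powr p * J x y) \<partial>m)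
        = (\<integral>\<^sup>+y\<in>A. ennreal (\<bar>u x - u y\<bar> powr p * J x y) \<partial>m)"
        by (rule nn_integral_cong_AE) (use q(2) in \<open>eventually_elim, simp add: x\<close>)
      then show "(\<integral>\<^sup>+y\<in>A. ennreal (\<bar>qc_version m p E F u x - qc_version m p E F u y\<bar> powr p * J x y) \<partial>m) * (f x * indicator A x)
      = f x * (\<integral>\<^sup>+y\<in>A. ennreal (\<bar>u x - u y\<bar> powr p * J x y) \<partial>m) * indicator A x" by (simp add: ac_simps)
    qed
  qed
  finally show ?thesis .
qed

lemma dom_const_negative_part:
  assumes "u \<in> dom_const F"
  shows "(\<lambda>x. max (- u x) 0) \<in> dom_const F"
proof -
  obtain f a where f: "f \<in> F" "u = (\<lambda>x. f x + a)" using assms by (auto simp: dom_const_def)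
  have "(\<lambda>x. max (- (f x + a)) 0 - max (- a) 0) \<in> F"
    by (rule F_compose[OF f(1), of "\<lambda>s. max (- (s + a)) 0 - max (- a) 0" 1]) auto
  then show ?thesis unfolding dom_const_def f(2)
    by (auto intro!: bexI[of _ "\<lambda>x. max (- (f x + a)) 0 - max (- a) 0"] exI[of _ "max (- a) 0"])
qed

text \<open>A finite essential supremum becomes a bound almost everywhere. Since
  \<open>ennpowr\<close> sends infinity to infinity, the inner integral is then finite and the power
  1/(p-1) can be undone.\<close>

lemma tail_AE:
  assumes u: "u \<in> dom_const F" and U: "U \<in> sets m" and V: "V \<in> sets m"
    and T: "tail m p E F J U V (\<lambda>x. max (- u x) 0) = ennreal T" "0 \<le> T"
  shows "AE x in m. x \<in> U \<longrightarrow> (\<integral>\<^sup>+y\<in>space m - V. ennreal (max (- u y) 0 powr (p - 1) * J x y) \<partial>m) \<le> ennreal (T powr (p - 1))"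
proof -
  let ?q = "qc_version m p E F (\<lambda>x. max (- u x) 0)"
  note q = qc_version[OF dom_const_negative_part[OF u]]
  note [measurable] = q(1) V dom_const_measurable[OF u]
  let ?I = "\<lambda>x. \<integral>\<^sup>+y\<in>space m - V. ennreal (\<bar>?q y\<bar> powr (p - 1) * J x y) \<partial>m"
  have eq: "?I x = (\<integral>\<^sup>+y\<in>space m - V. ennreal (max (- u y) 0 powr (p - 1) * J x y) \<partial>m)" for x
    by (rule nn_integral_cong_AE) (use q(2) in \<open>eventually_elim, simp\<close>)
  have "AE x in restrict_space m U. ennpowr (?I x) (1 / (p - 1)) \<le> ennreal T"
    using esssup_AE[where M="restrict_space m U" and f="\<lambda>x. ennpowr (?I x) (1 / (p - 1))"] T(1)
    unfolding tail_def esup_def Let_def by simp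
  then have "AE x in m. x \<in> U \<longrightarrow> ennpowr (?I x) (1 / (p - 1)) \<le> ennreal T"
    using U by (subst (asm) AE_restrict_space_iff) (auto simp: sets.Int_space_eq2)
  then show ?thesis
  proof (eventually_elim, intro impI)
    fix x assume "x \<in> U \<longrightarrow> ennpowr (?I x) (1 / (p - 1)) \<le> ennreal T" "x \<in> U"
    then have le: "ennpowr (?I x) (1 / (p - 1)) \<le> ennreal T" by simp
    then have fin: "?I x \<noteq> \<infinity>" by (auto simp: ennpowr_def top_unique)
    then obtain i where i: "?I x = ennreal i" "0 \<le> i" by (cases "?I x") auto
    have "i powr (1 / (p - 1)) \<le> T" using le T(2) i by (simp add: ennpowr_def)
    then have "(i powr (1 / (p - 1))) powr (p - 1) \<le> T powr (p - 1)" using p_gt_1 by (intro powr_mono2) auto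
    then have "i \<le> T powr (p - 1)" using p_gt_1 i by (simp add: powr_powr)
    then show "(\<integral>\<^sup>+y\<in>space m - V. ennreal (max (- u y) 0 powr (p - 1) * J x y) \<partial>m) \<le> ennreal (T powr (p - 1))"
      unfolding eq[symmetric] i(1) by (rule ennreal_leI)
  qed
qed

end

section \<open>The jump kernel on the periodic Cantor set\<close>

text \<open>The n with 2n - 1 <= x < 2n + 1. The blocks are open intervals, so the left endpoint has
  to be excluded separately wherever this index replaces membership in a block.\<close>

definition cantor_index :: "real \<Rightarrow> int" where
  "cantor_index x = \<lfloor>(x + 1) / 2\<rfloor>"

definition cantor_linked :: "real \<Rightarrow> real \<Rightarrow> bool" where
  "cantor_linked x y \<longleftrightarrow> (\<exists>n. n \<noteq> 0 \<and> x \<in> cantor_block n \<and> y \<in> cantor_block (- n))"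

text \<open>Closed form of the sum over n in the kernel: the blocks are disjoint, so at most one
  summand differs from 0, and the index of x tells which.\<close>

definition cantor_far :: "real \<Rightarrow> real \<Rightarrow> real \<Rightarrow> real" where
  "cantor_far \<beta> x y = (if cantor_linked x y then 1 / \<bar>of_int (cantor_index x)\<bar> powr \<beta> else 0)"

definition cantor_near :: "real \<Rightarrow> real \<Rightarrow> real" where
  "cantor_near \<beta> d = 1 / (cantor_V d * d powr \<beta>)"

lemma cantor_block_iff:
  "x \<in> cantor_block n \<longleftrightarrow> x \<in> cantor_line \<and> cantor_index x = n \<and> x \<noteq> 2 * of_int (cantor_index x) - 1"
proof -
  have "2 * of_int n - 1 < x \<and> x < 2 * of_int n + 1 \<longleftrightarrow> cantor_index x = n \<and> x \<noteq> 2 * of_int (cantor_index x) - 1"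
  proof -
    have "cantor_index x = n \<longleftrightarrow> 2 * of_int n - 1 \<le> x \<and> x < 2 * of_int n + 1"
      unfolding cantor_index_def floor_eq_iff by (auto simp: field_simps)
    then show ?thesis by (cases "cantor_index x = n") auto
  qed
  then show ?thesis unfolding cantor_block_def by auto
qed

text \<open>Existential-free and with real-valued indices, the form in which measurability of the
  kernel can be derived from measurability of the floor function.\<close>

lemma cantor_linked_iff:
  "cantor_linked x y \<longleftrightarrow> x \<in> cantor_line \<and> y \<in> cantor_line \<and> real_of_int (cantor_index x) \<noteq> 0 \<and>
     x \<noteq> 2 * of_int (cantor_index x) - 1 \<and> real_of_int (cantor_index y) = - real_of_int (cantor_index x) \<and>
     y \<noteq> 2 * of_int (cantor_index y) - 1"
  unfolding cantor_linked_def cantor_block_iff by auto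

lemma cantor_linked_sym: "cantor_linked x y \<Longrightarrow> cantor_linked y x"
  unfolding cantor_linked_iff by auto

lemma cantor_far_sym: "cantor_far \<beta> x y = cantor_far \<beta> y x"
proof (cases "cantor_linked x y")
  case True
  then show ?thesis using cantor_linked_sym[OF True] by (simp add: cantor_far_def) (simp add: cantor_linked_iff)
next
  case False
  then have "\<not> cantor_linked y x" using cantor_linked_sym by blast
  then show ?thesis using False by (simp add: cantor_far_def)
qed

lemma cantor_far_nonneg: "0 \<le> cantor_far \<beta> x y" by (simp add: cantor_far_def)

lemma cantor_near_nonneg: "0 \<le> cantor_near \<beta> d" by (simp add: cantor_near_def cantor_V_nonneg)

lemma cantor_J_eq: "cantor_J \<beta> x y = cantor_near \<beta> \<bar>x - y\<bar> + cantor_far \<beta> x y"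
proof -
  let ?f = "\<lambda>n :: int. 1 / \<bar>of_int n\<bar> powr \<beta> * indicat_real (cantor_block n \<times> cantor_block (- n)) (x, y)"
  have "(\<Sum>\<^sub>\<infinity>n\<in>UNIV - {0}. ?f n) = cantor_far \<beta> x y"
  proof (cases "cantor_linked x y")
    case True
    then have n0: "cantor_index x \<noteq> 0" and xy: "x \<in> cantor_block (cantor_index x)" "y \<in> cantor_block (- cantor_index x)"
      by (auto simp: cantor_linked_def cantor_block_iff)
    have "(\<Sum>\<^sub>\<infinity>n\<in>UNIV - {0}. ?f n) = (\<Sum>\<^sub>\<infinity>n\<in>{cantor_index x}. ?f n)"
      using n0 by (intro infsum_cong_neutral) (auto simp: indicator_def cantor_block_iff)
    also have "\<dots> = cantor_far \<beta> x y" using True xy by (simp add: cantor_far_def)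
    finally show ?thesis .
  next
    case False
    then show ?thesis unfolding cantor_far_def
      by (subst infsum_0) (auto simp: cantor_linked_def indicator_def)
  qed
  then show ?thesis unfolding cantor_J_def cantor_near_def by simp
qed

text \<open>For distances up to 1 the maximum in V is the power with exponent alpha, so the near
  part is a decreasing power. The second alternative appears because positivity of \<beta> is fixed
  only in the later locale.\<close>

lemma cantor_near_ge:
  assumes "0 < d" "d \<le> r" "r \<le> 1"
  shows "1 / r powr (cantor_dim + \<beta>) \<le> cantor_near \<beta> d \<or> \<beta> \<le> 0"
proof (cases "\<beta> \<le> 0")
  case False
  have "cantor_V d * d powr \<beta> = d powr (cantor_dim + \<beta>)" using assms by (simp add: cantor_V_small powr_add)
  also have "\<dots> \<le> r powr (cantor_dim + \<beta>)" using assms False cantor_dim_bounds by (intro powr_mono2) auto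
  finally have "1 / r powr (cantor_dim + \<beta>) \<le> cantor_near \<beta> d"
    unfolding cantor_near_def using assms by (intro divide_left_mono) (auto simp: cantor_V_pos intro!: mult_pos_pos)
  then show ?thesis ..
qed simp

text \<open>The block containing x, or the whole line if x is an odd integer and lies in no block.
  Moving x to any such point cannot lower the far part of the kernel.\<close>

definition cantor_side :: "real \<Rightarrow> real set" where
  "cantor_side x = {z\<in>cantor_line. \<forall>n. x \<in> cantor_block n \<longrightarrow> z \<in> cantor_block n}"

lemma cantor_block_sets: "cantor_block n \<in> sets cantor_measure"
  by (auto simp: sets_cantor_measure_iff cantor_block_def)

lemma cantor_side_sets: "cantor_side x \<in> sets cantor_measure"
proof (cases "\<exists>n. x \<in> cantor_block n")
  case True
  then obtain n where n: "x \<in> cantor_block n" by blast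
  then have "cantor_side x = cantor_block n"
    by (auto simp: cantor_side_def cantor_block_iff)
  then show ?thesis by (simp add: cantor_block_sets)
next
  case False
  then have "cantor_side x = cantor_line" by (auto simp: cantor_side_def)
  then show ?thesis by (simp add: sets_cantor_measure_iff)
qed

text \<open>The unit cell of x lies between consecutive integers, hence in the closure of the block
  of x; only the two odd endpoints have to be removed, and they are null.\<close>

lemma emeasure_cantor_side_ge:
  assumes x: "x \<in> cantor_line" and r: "0 < r" "r \<le> 1"
  shows "ennreal (r powr cantor_dim / 8) \<le> emeasure cantor_measure (ball x r \<inter> cantor_side x)"
proof -
  obtain k where k: "x - of_int k \<in> cantor_set" using x by (rule cantor_lineE)
  let ?P = "ball x r \<inter> (\<lambda>y. y + of_int k) ` cantor_set"
  have P: "?P \<in> sets cantor_measure"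
    unfolding sets_cantor_measure_iff cantor_line_eq
    by (intro conjI sets.Int borel_open[OF open_ball] borel_closed[OF compact_imp_closed[OF compact_continuous_image]]
        continuous_intros compact_cantor_set) auto
  define N where "N = {2 * of_int (cantor_index x) - 1, 2 * of_int (cantor_index x) + 1 :: real}"
  have "ennreal (r powr cantor_dim / 8) \<le> emeasure cantor_measure ?P"
    by (rule emeasure_cantor_piece_ge[OF k r])
  also have "\<dots> = emeasure cantor_measure (?P - (N \<inter> cantor_line))"
  proof (rule emeasure_Diff_null_set[symmetric])
    have "{a} \<inter> cantor_line \<in> null_sets cantor_measure" for a
      using emeasure_cantor_singleton[of a]
      by (cases "a \<in> cantor_line") (auto simp: null_sets_def sets_cantor_measure_iff)
    then have "({2 * of_int (cantor_index x) - 1} \<inter> cantor_line) \<union> ({2 * of_int (cantor_index x) + 1} \<inter> cantor_line) \<in> null_sets cantor_measure"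
      by (intro null_sets.Un)
    then show "N \<inter> cantor_line \<in> null_sets cantor_measure" by (simp add: N_def Int_Un_distrib2[symmetric] insert_def[symmetric] Un_commute insert_commute)
  qed (rule P)
  also have "\<dots> \<le> emeasure cantor_measure (ball x r \<inter> cantor_side x)"
  proof (rule emeasure_mono)
    show "ball x r \<inter> cantor_side x \<in> sets cantor_measure"
      using cantor_side_sets[of x] by (auto simp: sets_cantor_measure_iff)
    show "?P - (N \<inter> cantor_line) \<subseteq> ball x r \<inter> cantor_side x"
    proof
      fix z assume z: "z \<in> ?P - (N \<inter> cantor_line)"
      then obtain c where c: "c \<in> cantor_set" "z = c + of_int k" by auto
      then have zM: "z \<in> cantor_line" by (auto simp: cantor_line_eq)
      have zk: "of_int k \<le> z" "z \<le> of_int k + 1" using cantor_setD[OF c(1)] c(2) by auto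
      have xk: "of_int k \<le> x" "x \<le> of_int k + 1" using cantor_setD[OF k] by auto
      have "z \<in> cantor_block n" if n: "x \<in> cantor_block n" for n
      proof -
        have in_eq: "cantor_index x = n" using n by (simp add: cantor_block_iff)
        have "2 * of_int n - 1 < x" "x < 2 * of_int n + 1" using n by (auto simp: cantor_block_def)
        then have "k = 2 * n - 1 \<or> k = 2 * n" using xk by linarith
        then have "2 * of_int n - 1 \<le> z" "z \<le> 2 * of_int n + 1" using zk by auto
        moreover have "z \<noteq> 2 * of_int n - 1" "z \<noteq> 2 * of_int n + 1"
          using z zM in_eq by (auto simp: N_def)
        ultimately show ?thesis using zM by (simp add: cantor_block_def)
      qed
      then show "z \<in> ball x r \<inter> cantor_side x" using z zM by (auto simp: cantor_side_def)
    qed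
  qed
  finally show ?thesis .
qed

lemma emeasure_cantor_ball_ge:
  assumes x: "x \<in> cantor_line" and r: "0 < r" "r \<le> 1"
  shows "ennreal (r powr cantor_dim / 8) \<le> emeasure cantor_measure (mball cantor_measure x r)"
proof (rule order_trans[OF emeasure_cantor_side_ge[OF assms] emeasure_mono])
  show "ball x r \<inter> cantor_side x \<subseteq> mball cantor_measure x r"
    by (auto simp: mball_def space_cantor_measure cantor_side_def)
  show "mball cantor_measure x r \<in> sets cantor_measure"
    unfolding mball_def space_cantor_measure by (rule Int_cantor_line_sets) simp
qed

lemma emeasure_cantor_ball_le:
  assumes r: "0 < r" "r \<le> 1"
  shows "emeasure cantor_measure (mball cantor_measure x r) \<le> ennreal (8 * r powr cantor_dim)"
proof -
  have "emeasure cantor_measure (mball cantor_measure x r) \<le> ennreal (4 * cantor_V ((x + r) - (x - r)))"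
    using r by (intro emeasure_cantor_subset_interval_le)
      (auto simp: mball_def space_cantor_measure dist_real_def intro!: Int_cantor_line_sets)
  also have "4 * cantor_V ((x + r) - (x - r)) \<le> 8 * r powr cantor_dim"
    using cantor_V_mult_le[of 2 r] cantor_V_small[of r] r by simp
  finally show ?thesis by (simp add: ennreal_leI)
qed

locale cantor_form =
  fixes p \<beta> :: real
  assumes p1: "1 < p" and beta_pos: "0 < \<beta>"
begin

text \<open>The near part is comparable at comparable distances: V grows at most linearly under
  scaling and the power contributes c^\<beta>. Positivity of d is forced by 0 < e <= c d.\<close>

lemma near_powr_mult_le:
  assumes c: "1 \<le> c" and e: "0 < e" and d: "e \<le> c * d"
  shows "cantor_near \<beta> d \<le> c powr (1 + \<beta>) * cantor_near \<beta> e"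
proof -
  have d0: "0 < d"
  proof (rule ccontr)
    assume "\<not> 0 < d"
    then have "c * d \<le> 0" using c by (intro mult_nonneg_nonpos) auto
    then show False using e d by simp
  qed
  have "cantor_V e * e powr \<beta> \<le> cantor_V (c * d) * (c * d) powr \<beta>"
    using c e d d0 beta_pos cantor_V_nonneg by (intro mult_mono cantor_V_mono powr_mono2) auto
  also have "\<dots> \<le> (c * cantor_V d) * (c powr \<beta> * d powr \<beta>)"
    using c d0 cantor_V_nonneg by (intro mult_mono cantor_V_mult_le) (auto simp: powr_mult)
  also have "\<dots> = c powr (1 + \<beta>) * (cantor_V d * d powr \<beta>)" using c by (simp add: powr_add)
  finally have le: "cantor_V e * e powr \<beta> \<le> c powr (1 + \<beta>) * (cantor_V d * d powr \<beta>)" .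
  have pos: "0 < cantor_V e * e powr \<beta>" "0 < cantor_V d * d powr \<beta>" using e d0 cantor_V_pos by auto
  show ?thesis unfolding cantor_near_def using le pos by (simp add: field_simps)
qed

text \<open>Dyadic annuli; the factor \<open>16\<close> is the growth of the measure of balls of four times the radius.\<close>

lemma near_tail:
  assumes r: "0 < r"
  shows "(\<integral>\<^sup>+y. ennreal (cantor_near \<beta> \<bar>x - y\<bar>) * indicator {y. r \<le> \<bar>x - y\<bar>} y \<partial>cantor_measure)
    \<le> ennreal (16 / (1 - 2 powr - \<beta>) * r powr - \<beta>)"
proof -
  define A where "A j = {y\<in>cantor_line. 2 ^ j * r \<le> \<bar>x - y\<bar> \<and> \<bar>x - y\<bar> < 2 ^ Suc j * r}" for j :: nat
  have A [measurable]: "A j \<in> sets cantor_measure" for j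
  proof -
    have "A j = {y. 2 ^ j * r \<le> \<bar>x - y\<bar> \<and> \<bar>x - y\<bar> < 2 ^ Suc j * r} \<inter> cantor_line" by (auto simp: A_def)
    also have "\<dots> \<in> sets cantor_measure" by (intro Int_cantor_line_sets) measurable
    finally show ?thesis .
  qed
  define c where "c j = cantor_near \<beta> (2 ^ j * r)" for j
  have b1: "2 powr - \<beta> < (1 :: real)" using beta_pos by (simp add: powr_less_one)
  have le: "ennreal (cantor_near \<beta> \<bar>x - y\<bar>) * indicator {y. r \<le> \<bar>x - y\<bar>} y \<le> (\<Sum>j. ennreal (c j) * indicator (A j) y)"
    if y: "y \<in> cantor_line" for y
  proof (cases "r \<le> \<bar>x - y\<bar>")
    case True
    obtain n where n: "\<bar>x - y\<bar> / r < 2 ^ n" using real_arch_pow[of 2 "\<bar>x - y\<bar> / r"] by auto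
    define l where "l = (LEAST n. \<bar>x - y\<bar> / r < 2 ^ n)"
    have l: "\<bar>x - y\<bar> / r < 2 ^ l" unfolding l_def by (rule LeastI[where P="\<lambda>n. \<bar>x - y\<bar> / r < 2 ^ n", OF n])
    have "l \<noteq> 0"
    proof
      assume "l = 0"
      then have "\<bar>x - y\<bar> < r" using l r by (simp add: field_simps)
      then show False using True by simp
    qed
    then obtain j where j: "l = Suc j" by (cases l) auto
    have "\<not> \<bar>x - y\<bar> / r < 2 ^ j" using not_less_Least[of j "\<lambda>n. \<bar>x - y\<bar> / r < 2 ^ n"] j by (simp add: l_def)
    then have jj: "2 ^ j * r \<le> \<bar>x - y\<bar>" "\<bar>x - y\<bar> < 2 ^ Suc j * r" using l j r by (auto simp: field_simps)
    then have yA: "y \<in> A j" using y by (simp add: A_def)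
    have "cantor_near \<beta> \<bar>x - y\<bar> \<le> 1 powr (1 + \<beta>) * c j"
      unfolding c_def using jj r by (intro near_powr_mult_le) auto
    then have "ennreal (cantor_near \<beta> \<bar>x - y\<bar>) * indicator {y. r \<le> \<bar>x - y\<bar>} y \<le> ennreal (c j) * indicator (A j) y"
      using yA True by (simp add: ennreal_leI)
    also have "\<dots> \<le> (\<Sum>j. ennreal (c j) * indicator (A j) y)"
    proof -
      define g where "g i = ennreal (c i) * indicator (A i) y" for i
      have "sum g {j} \<le> suminf g" by (intro sum_le_suminf) auto
      then have "g j \<le> suminf g" by simp
      then show ?thesis by (simp only: g_def[abs_def])
    qed
    finally show ?thesis .
  qed (simp add: indicator_def)
  have "(\<integral>\<^sup>+y. ennreal (cantor_near \<beta> \<bar>x - y\<bar>) * indicator {y. r \<le> \<bar>x - y\<bar>} y \<partial>cantor_measure)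
    \<le> (\<integral>\<^sup>+y. (\<Sum>j. ennreal (c j) * indicator (A j) y) \<partial>cantor_measure)"
    by (intro nn_integral_mono le) (simp add: space_cantor_measure)
  also have "\<dots> = (\<Sum>j. ennreal (c j) * emeasure cantor_measure (A j))"
    by (subst nn_integral_suminf) (auto simp: nn_integral_cmult_indicator)
  also have "\<dots> \<le> (\<Sum>j. ennreal (16 * r powr - \<beta> * (2 powr - \<beta>) ^ j))"
  proof (rule suminf_le)
    fix j
    have rj: "0 < 2 ^ j * r" using r by simp
    have "emeasure cantor_measure (A j) \<le> ennreal (4 * cantor_V ((x + 2 ^ Suc j * r) - (x - 2 ^ Suc j * r)))"
      using r by (intro emeasure_cantor_subset_interval_le A) (auto simp: A_def intro: add_pos_pos)
    also have "(x + 2 ^ Suc j * r) - (x - 2 ^ Suc j * r) = 4 * (2 ^ j * r)" by simp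
    also have "ennreal (4 * cantor_V (4 * (2 ^ j * r))) \<le> ennreal (16 * cantor_V (2 ^ j * r))"
      using cantor_V_mult_le[of 4 "2 ^ j * r"] rj by (intro ennreal_leI) auto
    finally have "ennreal (c j) * emeasure cantor_measure (A j) \<le> ennreal (c j) * ennreal (16 * cantor_V (2 ^ j * r))"
      by (rule mult_left_mono) simp
    also have "\<dots> = ennreal (c j * (16 * cantor_V (2 ^ j * r)))"
      unfolding c_def using cantor_near_nonneg cantor_V_nonneg by (intro ennreal_mult[symmetric]) auto
    also have "c j * (16 * cantor_V (2 ^ j * r)) = 16 * r powr - \<beta> * (2 powr - \<beta>) ^ j"
    proof -
      have "(2 ^ j * r) powr \<beta> = (2 powr \<beta>) ^ j * r powr \<beta>"
        using r by (simp add: powr_mult) (induction j, auto simp: powr_mult)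
      moreover have "0 < cantor_V (2 ^ j * r)" using rj by (rule cantor_V_pos)
      ultimately show ?thesis unfolding c_def cantor_near_def
        using r by (simp add: powr_minus power_inverse field_simps)
    qed
    finally show "ennreal (c j) * emeasure cantor_measure (A j) \<le> ennreal (16 * r powr - \<beta> * (2 powr - \<beta>) ^ j)" .
  qed auto
  also have "\<dots> = ennreal (\<Sum>j. 16 * r powr - \<beta> * (2 powr - \<beta>) ^ j)"
    using b1 by (intro suminf_ennreal2 summable_mult summable_geometric) auto
  also have "(\<Sum>j. 16 * r powr - \<beta> * (2 powr - \<beta>) ^ j) = 16 / (1 - 2 powr - \<beta>) * r powr - \<beta>"
    using b1 by (subst suminf_mult) (auto simp: suminf_geometric intro!: summable_geometric)
  finally show ?thesis .
qed

text \<open>A point of block n is linked to block -n alone, at distance at most 4|n| + 2 <= 6|n|. If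
  the tail starts at r this forces r <= 6|n|, so |n|^-\<beta> <= 6^\<beta> r^-\<beta>; the mass of a
  block is at most 8.\<close>

lemma far_tail:
  assumes r: "0 < r"
  shows "(\<integral>\<^sup>+y. ennreal (cantor_far \<beta> x y) * indicator {y. r \<le> \<bar>x - y\<bar>} y \<partial>cantor_measure) \<le> ennreal (8 * 6 powr \<beta> * r powr - \<beta>)"
proof -
  define n where "n = cantor_index x"
  note [measurable] = cantor_block_sets
  have "ennreal (cantor_far \<beta> x y) * indicator {y. r \<le> \<bar>x - y\<bar>} y \<le> ennreal (6 powr \<beta> * r powr - \<beta>) * indicator (cantor_block (- n)) y" for y
  proof (cases "cantor_linked x y \<and> r \<le> \<bar>x - y\<bar>")
    case True
    then have n0: "n \<noteq> 0" and x: "x \<in> cantor_block n" and y: "y \<in> cantor_block (- n)"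
      by (auto simp: cantor_linked_def cantor_block_iff n_def)
    have n1: "1 \<le> \<bar>real_of_int n\<bar>" using n0 by linarith
    have "\<bar>x - y\<bar> \<le> 4 * \<bar>real_of_int n\<bar> + 2" using x y by (auto simp: cantor_block_def)
    then have "r \<le> 6 * \<bar>real_of_int n\<bar>" using n1 True by linarith
    then have "r powr \<beta> \<le> 6 powr \<beta> * \<bar>real_of_int n\<bar> powr \<beta>"
      using r beta_pos powr_mono2[of \<beta> r "6 * \<bar>real_of_int n\<bar>"] by (simp add: powr_mult)
    then have "1 / \<bar>real_of_int n\<bar> powr \<beta> \<le> 6 powr \<beta> * r powr - \<beta>"
      using r n1 by (simp add: powr_minus field_simps)
    then show ?thesis using True y by (simp add: cantor_far_def n_def ennreal_leI)
  next
    case False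
    then have "ennreal (cantor_far \<beta> x y) * indicator {y. r \<le> \<bar>x - y\<bar>} y = 0" by (auto simp: cantor_far_def indicator_def)
    then show ?thesis by (simp only: zero_le)
  qed
  then have "(\<integral>\<^sup>+y. ennreal (cantor_far \<beta> x y) * indicator {y. r \<le> \<bar>x - y\<bar>} y \<partial>cantor_measure)
    \<le> (\<integral>\<^sup>+y. ennreal (6 powr \<beta> * r powr - \<beta>) * indicator (cantor_block (- n)) y \<partial>cantor_measure)"
    by (intro nn_integral_mono) auto
  also have "\<dots> = ennreal (6 powr \<beta> * r powr - \<beta>) * emeasure cantor_measure (cantor_block (- n))"
    by (rule nn_integral_cmult_indicator) measurable
  also have "\<dots> \<le> ennreal (6 powr \<beta> * r powr - \<beta>) * ennreal (4 * cantor_V ((2 * of_int (- n) + 1) - (2 * of_int (- n) - 1)))"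
    by (intro mult_left_mono emeasure_cantor_subset_interval_le cantor_block_sets) (auto simp: cantor_block_def)
  also have "\<dots> \<le> ennreal (6 powr \<beta> * r powr - \<beta>) * ennreal 8"
    using cantor_V_mult_le[of 2 1] by (intro mult_left_mono ennreal_leI) (auto simp: cantor_V_def)
  also have "\<dots> = ennreal (8 * 6 powr \<beta> * r powr - \<beta>)" by (simp add: ennreal_mult[symmetric] ac_simps del: ennreal_numeral)
  finally show ?thesis .
qed

definition tail_const :: real where
  "tail_const = 16 / (1 - 2 powr - \<beta>) + 8 * 6 powr \<beta>"

lemma tail_const_pos: "0 < tail_const"
proof -
  have "2 powr - \<beta> < (1 :: real)" using beta_pos by (simp add: powr_less_one)
  then show ?thesis by (simp add: tail_const_def add_pos_pos)
qed

lemma cantor_J_pair_measurable: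
  "(\<lambda>z. cantor_J \<beta> (fst z) (snd z)) \<in> borel_measurable (cantor_measure \<Otimes>\<^sub>M cantor_measure)"
proof -
  have id: "(\<lambda>x. x) \<in> cantor_measure \<rightarrow>\<^sub>M borel"
    unfolding measurable_cong_sets[OF sets_cantor_measure refl] by (intro measurable_restrict_space1) simp
  have [measurable]: "(\<lambda>z. fst z) \<in> cantor_measure \<Otimes>\<^sub>M cantor_measure \<rightarrow>\<^sub>M borel" "(\<lambda>z. snd z) \<in> cantor_measure \<Otimes>\<^sub>M cantor_measure \<rightarrow>\<^sub>M borel"
    by (rule measurable_compose[OF measurable_fst id], rule measurable_compose[OF measurable_snd id])
  have "(\<lambda>z. cantor_J \<beta> (fst z) (snd z)) \<in> borel_measurable (cantor_measure \<Otimes>\<^sub>M cantor_measure)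
    \<longleftrightarrow> (\<lambda>z. cantor_near \<beta> \<bar>fst z - snd z\<bar> +
     (if real_of_int (cantor_index (fst z)) \<noteq> 0 \<and>
     fst z \<noteq> 2 * of_int (cantor_index (fst z)) - 1 \<and> real_of_int (cantor_index (snd z)) = - real_of_int (cantor_index (fst z)) \<and>
     snd z \<noteq> 2 * of_int (cantor_index (snd z)) - 1 then 1 / \<bar>of_int (cantor_index (fst z))\<bar> powr \<beta> else 0))
      \<in> borel_measurable (cantor_measure \<Otimes>\<^sub>M cantor_measure)"
    by (rule measurable_cong)
       (auto simp: cantor_J_eq cantor_far_def cantor_linked_iff space_pair_measure space_cantor_measure)
  moreover have "(\<lambda>z. cantor_near \<beta> \<bar>fst z - snd z\<bar>) \<in> borel_measurable (cantor_measure \<Otimes>\<^sub>M cantor_measure)"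
    unfolding cantor_near_def cantor_V_def by measurable
  moreover have "(\<lambda>z. if real_of_int (cantor_index (fst z)) \<noteq> 0 \<and>
     fst z \<noteq> 2 * of_int (cantor_index (fst z)) - 1 \<and> real_of_int (cantor_index (snd z)) = - real_of_int (cantor_index (fst z)) \<and>
     snd z \<noteq> 2 * of_int (cantor_index (snd z)) - 1 then 1 / \<bar>of_int (cantor_index (fst z))\<bar> powr \<beta> else 0)
      \<in> borel_measurable (cantor_measure \<Otimes>\<^sub>M cantor_measure)"
  proof -
    have [measurable]: "(\<lambda>z. real_of_int (cantor_index (fst z))) \<in> borel_measurable (cantor_measure \<Otimes>\<^sub>M cantor_measure)"
      "(\<lambda>z. real_of_int (cantor_index (snd z))) \<in> borel_measurable (cantor_measure \<Otimes>\<^sub>M cantor_measure)"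
      unfolding cantor_index_def by measurable
    show ?thesis by measurable
  qed
  ultimately show ?thesis by simp
qed

lemma cantor_J_nonneg: "0 \<le> cantor_J \<beta> x y"
  unfolding cantor_J_eq by (intro add_nonneg_nonneg cantor_near_nonneg cantor_far_nonneg)

lemma cantor_J_sym: "cantor_J \<beta> x y = cantor_J \<beta> y x"
  unfolding cantor_J_eq by (simp add: abs_minus_commute cantor_far_sym)

lemma sigma_finite_cantor: "sigma_finite_measure cantor_measure"
proof
  show "\<exists>A. countable A \<and> A \<subseteq> sets cantor_measure \<and> \<Union> A = space cantor_measure \<and> (\<forall>a\<in>A. emeasure cantor_measure a \<noteq> \<infinity>)"
  proof (intro exI[of _ "range (\<lambda>n :: nat. cantor_line \<inter> {- real (Suc n)..real (Suc n)})"] conjI ballI)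
    show "\<Union> (range (\<lambda>n :: nat. cantor_line \<inter> {- real (Suc n)..real (Suc n)})) = space cantor_measure"
    proof -
      show ?thesis unfolding space_cantor_measure
      proof (intro equalityI subsetI)
        fix x assume x: "x \<in> cantor_line"
        obtain n where "\<bar>x\<bar> \<le> real n" using real_arch_simple by blast
        then have "x \<in> cantor_line \<inter> {- real (Suc n)..real (Suc n)}" using x by (simp add: abs_le_iff)
        then show "x \<in> \<Union> (range (\<lambda>n :: nat. cantor_line \<inter> {- real (Suc n)..real (Suc n)}))" by (rule UN_I[OF UNIV_I])
      next
        fix x assume "x \<in> \<Union> (range (\<lambda>n :: nat. cantor_line \<inter> {- real (Suc n)..real (Suc n)}))"
        then show "x \<in> cantor_line" by (elim UN_E IntE)
      qed
    qed
  next
    fix a assume "a \<in> range (\<lambda>n :: nat. cantor_line \<inter> {- real (Suc n)..real (Suc n)})"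
    then obtain n :: nat where a: "a = cantor_line \<inter> {- real (Suc n)..real (Suc n)}" by auto
    have "emeasure cantor_measure a \<le> ennreal (4 * cantor_V (real (Suc n) - - real (Suc n)))"
      unfolding a by (rule emeasure_cantor_interval_le) simp
    then show "emeasure cantor_measure a \<noteq> \<infinity>" by (auto simp: top_unique)
  qed (auto simp: sets_cantor_measure_iff)
qed

sublocale jump_form cantor_measure p "cantor_J \<beta>"
proof -
  interpret sigma_finite_measure cantor_measure by (rule sigma_finite_cantor)
  show "jump_form cantor_measure p (cantor_J \<beta>)"
  proof
    show "sets cantor_measure = sets (restrict_space borel (space cantor_measure))"
      by (simp add: sets_cantor_measure space_cantor_measure)
    fix K :: "real set" assume K: "compact K" "K \<subseteq> space cantor_measure"
    then obtain b where b: "\<And>x. x \<in> K \<Longrightarrow> \<bar>x\<bar> \<le> b" using compact_imp_bounded[OF K(1)] by (auto simp: bounded_iff)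
    have "emeasure cantor_measure K \<le> ennreal (4 * cantor_V ((\<bar>b\<bar> + 1) - (- \<bar>b\<bar> - 1)))"
      using K b by (intro emeasure_cantor_subset_interval_le)
        (auto simp: sets_cantor_measure_iff space_cantor_measure borel_compact dest!: b)
    then show "emeasure cantor_measure K < \<infinity>" by (auto simp: less_top[symmetric] top_unique)
  qed (auto simp: p1 cantor_J_nonneg cantor_J_pair_measurable intro: cantor_J_sym)
qed

lemma id_measurable [measurable]: "(\<lambda>x. x) \<in> cantor_measure \<rightarrow>\<^sub>M borel"
  by (rule measurable_m_borel)

lemma mball_sets [measurable]: "mball cantor_measure x r \<in> sets cantor_measure"
  unfolding mball_def space_cantor_measure by (rule Int_cantor_line_sets) simp

lemma J_tail:
  assumes r: "0 < r" and x: "x \<in> cantor_line"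
  shows "(\<integral>\<^sup>+y. ennreal (cantor_J \<beta> x y) * indicator {y. r \<le> \<bar>x - y\<bar>} y \<partial>cantor_measure) \<le> ennreal (tail_const * r powr - \<beta>)"
proof -
  have xs [measurable]: "x \<in> space cantor_measure" using x by (simp add: space_cantor_measure)
  have [measurable]: "(\<lambda>y. cantor_near \<beta> \<bar>x - y\<bar>) \<in> borel_measurable cantor_measure"
    unfolding cantor_near_def cantor_V_def by measurable
  have "(\<lambda>y. cantor_J \<beta> x y - cantor_near \<beta> \<bar>x - y\<bar>) \<in> borel_measurable cantor_measure"
    by measurable
  then have [measurable]: "(\<lambda>y. cantor_far \<beta> x y) \<in> borel_measurable cantor_measure"
    by (simp add: cantor_J_eq)
  have "(\<integral>\<^sup>+y. ennreal (cantor_J \<beta> x y) * indicator {y. r \<le> \<bar>x - y\<bar>} y \<partial>cantor_measure)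
    = (\<integral>\<^sup>+y. ennreal (cantor_near \<beta> \<bar>x - y\<bar>) * indicator {y. r \<le> \<bar>x - y\<bar>} y
        + ennreal (cantor_far \<beta> x y) * indicator {y. r \<le> \<bar>x - y\<bar>} y \<partial>cantor_measure)"
    by (intro nn_integral_cong) (simp add: cantor_J_eq cantor_near_nonneg cantor_far_nonneg distrib_right)
  also have "\<dots> = (\<integral>\<^sup>+y. ennreal (cantor_near \<beta> \<bar>x - y\<bar>) * indicator {y. r \<le> \<bar>x - y\<bar>} y \<partial>cantor_measure)
     + (\<integral>\<^sup>+y. ennreal (cantor_far \<beta> x y) * indicator {y. r \<le> \<bar>x - y\<bar>} y \<partial>cantor_measure)"
    by (rule nn_integral_add) measurable
  also have "\<dots> \<le> ennreal (16 / (1 - 2 powr - \<beta>) * r powr - \<beta>) + ennreal (8 * 6 powr \<beta> * r powr - \<beta>)"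
    by (intro add_mono near_tail far_tail r)
  also have "\<dots> = ennreal (tail_const * r powr - \<beta>)"
  proof -
    have "2 powr - \<beta> < (1 :: real)" using beta_pos by (simp add: powr_less_one)
    then show ?thesis by (subst ennreal_plus[symmetric]) (auto simp: tail_const_def distrib_right)
  qed
  finally show ?thesis .
qed

lemma TJ_holds: "TJ cantor_measure (power_scale \<beta>) (cantor_J \<beta>)"
  unfolding TJ_def
proof (intro exI[of _ tail_const] conjI ballI allI impI tail_const_pos)
  fix x r :: real assume x: "x \<in> space cantor_measure" and r: "0 < r"
  have "(\<integral>\<^sup>+y\<in>space cantor_measure - mball cantor_measure x r. ennreal (cantor_J \<beta> x y) \<partial>cantor_measure)
    \<le> (\<integral>\<^sup>+y. ennreal (cantor_J \<beta> x y) * indicator {y. r \<le> \<bar>x - y\<bar>} y \<partial>cantor_measure)"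
    by (intro nn_integral_mono) (auto simp: indicator_def mball_def dist_real_def)
  also have "\<dots> \<le> ennreal (tail_const * r powr - \<beta>)" using x by (intro J_tail r) (simp add: space_cantor_measure)
  also have "tail_const * r powr - \<beta> = tail_const / r powr \<beta>" by (simp add: powr_minus divide_inverse)
  finally show "(\<integral>\<^sup>+y\<in>space cantor_measure - mball cantor_measure x r. ennreal (cantor_J \<beta> x y) \<partial>cantor_measure) \<le> ennreal (tail_const / r powr \<beta>)" .
qed

text \<open>Separation by d yields both openness of K in the line and, because leaving K means
  jumping at least d, the bound on the rate of leaving.\<close>

lemma good_cut_separated:
  assumes K: "compact K" "K \<subseteq> cantor_line" and d: "0 < d"
    and sep: "\<And>y z. y \<in> K \<Longrightarrow> z \<in> cantor_line - K \<Longrightarrow> d \<le> \<bar>y - z\<bar>"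
  shows "good_cut K (tail_const * d powr - \<beta>)"
proof -
  have "openin (top_of_set cantor_line) K"
    unfolding openin_open
  proof (intro exI[of _ "\<Union>y\<in>K. ball y d"] conjI)
    show "K = cantor_line \<inter> (\<Union>y\<in>K. ball y d)"
    proof (intro equalityI subsetI)
      fix z assume "z \<in> cantor_line \<inter> (\<Union>y\<in>K. ball y d)"
      then obtain y where "y \<in> K" "\<bar>y - z\<bar> < d" "z \<in> cantor_line" by (auto simp: dist_real_def)
      then show "z \<in> K" using sep[of y z] by fastforce
    next
      fix z assume "z \<in> K" then show "z \<in> cantor_line \<inter> (\<Union>y\<in>K. ball y d)"
        using d K by (auto intro!: bexI[of _ z])
    qed
  qed auto
  moreover have "(\<integral>\<^sup>+y\<in>space cantor_measure - K. ennreal (cantor_J \<beta> x y) \<partial>cantor_measure) \<le> ennreal (tail_const * d powr - \<beta>)"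
    if x: "x \<in> K" for x
  proof -
    have "(\<integral>\<^sup>+y\<in>space cantor_measure - K. ennreal (cantor_J \<beta> x y) \<partial>cantor_measure)
      \<le> (\<integral>\<^sup>+y. ennreal (cantor_J \<beta> x y) * indicator {y. d \<le> \<bar>x - y\<bar>} y \<partial>cantor_measure)"
      using sep[OF x] by (intro nn_integral_mono) (auto simp: indicator_def space_cantor_measure)
    also have "\<dots> \<le> ennreal (tail_const * d powr - \<beta>)" using d x K by (intro J_tail) auto
    finally show ?thesis .
  qed
  ultimately show ?thesis
    unfolding good_cut_def using tail_const_pos K by (auto simp: space_cantor_measure)
qed

lemma good_cut_interval:
  assumes r: "0 < r" "r \<le> 1"
  obtains K where "good_cut K (tail_const * (r / 18) powr - \<beta>)" "ball x R \<inter> cantor_line \<subseteq> K" "K \<subseteq> ball x (R + r) \<inter> cantor_line"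
    "\<And>y z. y \<in> K \<Longrightarrow> z \<in> cantor_line - K \<Longrightarrow> r / 18 \<le> \<bar>y - z\<bar>"
proof -
  obtain a b where ab: "ball x R \<subseteq> {a..b}" "{a..b} \<subseteq> ball x (R + r) \<or> b < a"
    "\<And>y z. y \<in> {a..b} \<Longrightarrow> z \<in> cantor_line - {a..b} \<Longrightarrow> r / 18 \<le> \<bar>y - z\<bar>"
    using cantor_line_clopen[OF r, of x R] by blast
  define K where "K = cantor_line \<inter> {a..b}"
  have sep: "r / 18 \<le> \<bar>y - z\<bar>" if "y \<in> K" "z \<in> cantor_line - K" for y z
    using ab(3)[of y z] that by (auto simp: K_def)
  have "good_cut K (tail_const * (r / 18) powr - \<beta>)"
    by (rule good_cut_separated[of K "r / 18"]) (use r sep compact_cantor_line_Int in \<open>auto simp: K_def\<close>)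
  moreover have "ball x R \<inter> cantor_line \<subseteq> K" using ab(1) by (auto simp: K_def)
  moreover have "K \<subseteq> ball x (R + r) \<inter> cantor_line" using ab(2) by (auto simp: K_def)
  ultimately show thesis using sep by (rule that)
qed

text \<open>From r <= 18 |x - y| and |x - z| < r follows |z - y| <= 19 |x - y|, which handles the
  near part; the far part does not decrease since z shares the block of x.\<close>

lemma J_side:
  assumes xyz: "x \<in> cantor_line" "z \<in> cantor_side x" "z \<noteq> y" and r: "0 < r" "\<bar>x - z\<bar> < r" "r / 18 \<le> \<bar>x - y\<bar>"
  shows "cantor_J \<beta> x y \<le> 19 powr (1 + \<beta>) * cantor_J \<beta> z y"
proof -
  have c1: "1 \<le> (19 :: real) powr (1 + \<beta>)" using beta_pos by (intro ge_one_powr_ge_zero) auto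
  have "\<bar>z - y\<bar> \<le> \<bar>x - z\<bar> + \<bar>x - y\<bar>" by linarith
  also have "\<dots> \<le> 18 * \<bar>x - y\<bar> + \<bar>x - y\<bar>" using r by (intro add_right_mono) simp
  finally have "\<bar>z - y\<bar> \<le> 19 * \<bar>x - y\<bar>" by simp
  then have "cantor_near \<beta> \<bar>x - y\<bar> \<le> 19 powr (1 + \<beta>) * cantor_near \<beta> \<bar>z - y\<bar>"
    using xyz r by (intro near_powr_mult_le) auto
  moreover have "cantor_far \<beta> x y \<le> cantor_far \<beta> z y"
  proof (cases "cantor_linked x y")
    case True
    then obtain n where n: "n \<noteq> 0" "x \<in> cantor_block n" "y \<in> cantor_block (- n)" by (auto simp: cantor_linked_def)
    then have z: "z \<in> cantor_block n" using xyz(2) by (auto simp: cantor_side_def)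
    then have "cantor_linked z y" using n by (auto simp: cantor_linked_def)
    then show ?thesis using True n(2) z by (simp add: cantor_far_def cantor_block_iff)
  qed (simp add: cantor_far_def)
  moreover have "1 * cantor_far \<beta> z y \<le> 19 powr (1 + \<beta>) * cantor_far \<beta> z y"
    using c1 cantor_far_nonneg by (rule mult_right_mono)
  ultimately show ?thesis unfolding cantor_J_eq by (simp add: distrib_left)
qed

text \<open>Integration of the previous comparison over z, discarding the null point z = y. The set
  A is free: a ball for (UJS), a sublevel set for the Harnack inequality.\<close>

lemma J_average:
  assumes x: "x \<in> cantor_line" and y: "y \<in> cantor_line" and r: "0 < r" "r / 18 \<le> \<bar>x - y\<bar>" and [measurable]: "A \<in> sets cantor_measure"
  shows "ennreal (cantor_J \<beta> x y) * emeasure cantor_measure (A \<inter> (ball x r \<inter> cantor_side x))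
    \<le> ennreal (19 powr (1 + \<beta>)) * (\<integral>\<^sup>+z\<in>A. ennreal (cantor_J \<beta> z y) \<partial>cantor_measure)"
proof -
  have [measurable]: "y \<in> space cantor_measure" using y by (simp add: space_cantor_measure)
  let ?B = "A \<inter> (ball x r \<inter> cantor_side x)"
  have "?B = A \<inter> (mball cantor_measure x r \<inter> cantor_side x)"
    by (auto simp: mball_def space_cantor_measure cantor_side_def)
  then have [measurable]: "?B \<in> sets cantor_measure" using cantor_side_sets by auto
  have "AE z in cantor_measure. z \<notin> {y}"
    using emeasure_cantor_singleton[of y] y by (intro AE_not_in) (auto simp: null_sets_def sets_cantor_measure_iff)
  then have ae: "AE z in cantor_measure. ennreal (cantor_J \<beta> x y) * indicator ?B z
     \<le> ennreal (19 powr (1 + \<beta>)) * (ennreal (cantor_J \<beta> z y) * indicator A z)"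
  proof eventually_elim
    fix z assume z: "z \<notin> {y}"
    show "ennreal (cantor_J \<beta> x y) * indicator ?B z \<le> ennreal (19 powr (1 + \<beta>)) * (ennreal (cantor_J \<beta> z y) * indicator A z)"
    proof (cases "z \<in> ?B")
      case True
      then have "cantor_J \<beta> x y \<le> 19 powr (1 + \<beta>) * cantor_J \<beta> z y"
        using x z r by (intro J_side) (auto simp: dist_real_def)
      then show ?thesis using True by (simp add: ennreal_mult[symmetric] cantor_J_nonneg ennreal_leI)
    qed simp
  qed
  have "ennreal (cantor_J \<beta> x y) * emeasure cantor_measure ?B = (\<integral>\<^sup>+z. ennreal (cantor_J \<beta> x y) * indicator ?B z \<partial>cantor_measure)"
    by (rule nn_integral_cmult_indicator[symmetric]) measurable
  also have "\<dots> \<le> (\<integral>\<^sup>+z. ennreal (19 powr (1 + \<beta>)) * (ennreal (cantor_J \<beta> z y) * indicator A z) \<partial>cantor_measure)"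
    by (rule nn_integral_mono_AE[OF ae])
  also have "\<dots> = ennreal (19 powr (1 + \<beta>)) * (\<integral>\<^sup>+z\<in>A. ennreal (cantor_J \<beta> z y) \<partial>cantor_measure)"
    by (rule nn_integral_cmult) measurable
  finally show ?thesis .
qed

lemma ennreal_le_divide_mult:
  assumes j: "ennreal j * a \<le> ennreal c * I" and a: "ennreal s \<le> a" and b: "b \<le> ennreal t" "0 < s" "0 < t" "0 \<le> j" "0 \<le> c" "b \<noteq> 0"
  shows "ennreal j \<le> ennreal (c * t / s) / b * I"
proof -
  obtain b' where b': "b = ennreal b'" "0 < b'" "b' \<le> t"
    using b by (cases b) (auto simp: top_unique)
  have "ennreal (j * s) \<le> ennreal c * I"
    using order_trans[OF mult_left_mono[OF a, of "ennreal j"] j] b by (simp add: ennreal_mult)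
  then have "ennreal (1 / s) * ennreal (j * s) \<le> ennreal (1 / s) * (ennreal c * I)" by (rule mult_left_mono) simp
  then have "ennreal j \<le> ennreal (c / s) * I"
    using b by (simp add: ennreal_mult[symmetric] mult.assoc[symmetric])
  also have "\<dots> \<le> ennreal (c * t / s / b') * I"
  proof (intro mult_right_mono ennreal_leI)
    have "c * b' \<le> c * t" using b b' by (intro mult_left_mono) auto
    then show "c / s \<le> c * t / s / b'" using b b' by (simp add: field_simps)
  qed simp
  also have "ennreal (c * t / s / b') = ennreal (c * t / s) / b"
    unfolding b'(1) using b b' by (intro divide_ennreal[symmetric]) auto
  finally show ?thesis .
qed

text \<open>The constant 64 is the ratio between the upper bound 8 R^alpha for the mass of the ball
  and the lower bound R^alpha/8 for the mass of its part in the block of the centre.\<close>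

lemma UJS_holds: "UJS cantor_measure (1 / 2) (cantor_J \<beta>)"
  unfolding UJS_def
proof (rule exI[of _ "19 powr (1 + \<beta>) * 64"], rule conjI, simp, rule exI[of _ "1 / 2"], intro conjI allI impI)
  fix R :: real assume R: "0 < R \<and> R < 1 / 2 * (1 / 2)"
  show "AE z in cantor_measure \<Otimes>\<^sub>M cantor_measure. fst z \<noteq> snd z \<and> 2 * R \<le> dist (fst z) (snd z) \<longrightarrow>
      ennreal (cantor_J \<beta> (fst z) (snd z)) \<le> ennreal (19 powr (1 + \<beta>) * 64) / emeasure cantor_measure (mball cantor_measure (fst z) R)
        * (\<integral>\<^sup>+x\<in>mball cantor_measure (fst z) R. ennreal (cantor_J \<beta> x (snd z)) \<partial>cantor_measure)"
  proof (rule AE_I2, intro impI)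
    fix z :: "real \<times> real"
    assume z: "z \<in> space (cantor_measure \<Otimes>\<^sub>M cantor_measure)" and d: "fst z \<noteq> snd z \<and> 2 * R \<le> dist (fst z) (snd z)"
    obtain x y where xy: "z = (x, y)" by (cases z)
    have x: "x \<in> cantor_line" and y: "y \<in> cantor_line" using z xy by (auto simp: space_pair_measure space_cantor_measure)
    let ?b = "emeasure cantor_measure (mball cantor_measure x R)"
    have Ra: "0 < R powr cantor_dim" using R by simp
    have side: "mball cantor_measure x R \<inter> (ball x R \<inter> cantor_side x) = ball x R \<inter> cantor_side x"
      by (auto simp: mball_def space_cantor_measure cantor_side_def)
    have 1: "ennreal (cantor_J \<beta> x y) * emeasure cantor_measure (ball x R \<inter> cantor_side x)
      \<le> ennreal (19 powr (1 + \<beta>)) * (\<integral>\<^sup>+w\<in>mball cantor_measure x R. ennreal (cantor_J \<beta> w y) \<partial>cantor_measure)"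
      using J_average[OF x y, of R "mball cantor_measure x R"] R d xy unfolding side by (simp add: dist_real_def)
    have 2: "ennreal (R powr cantor_dim / 8) \<le> emeasure cantor_measure (ball x R \<inter> cantor_side x)"
      using R x by (intro emeasure_cantor_side_ge) auto
    have 3: "?b \<le> ennreal (8 * R powr cantor_dim)" using R by (intro emeasure_cantor_ball_le) auto
    have "ennreal (R powr cantor_dim / 8) \<le> ?b" using R x by (intro emeasure_cantor_ball_ge) auto
    then have 4: "?b \<noteq> 0" using Ra by auto
    have "ennreal (cantor_J \<beta> x y) \<le> ennreal (19 powr (1 + \<beta>) * (8 * R powr cantor_dim) / (R powr cantor_dim / 8)) / ?b *
      (\<integral>\<^sup>+w\<in>mball cantor_measure x R. ennreal (cantor_J \<beta> w y) \<partial>cantor_measure)"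
      using Ra 4 by (intro ennreal_le_divide_mult[OF 1 2 3]) (auto simp: cantor_J_nonneg)
    also have "19 powr (1 + \<beta>) * (8 * R powr cantor_dim) / (R powr cantor_dim / 8) = 19 powr (1 + \<beta>) * 64"
      using Ra by (simp add: field_simps)
    finally show "ennreal (cantor_J \<beta> (fst z) (snd z)) \<le> ennreal (19 powr (1 + \<beta>) * 64) / emeasure cantor_measure (mball cantor_measure (fst z) R)
        * (\<integral>\<^sup>+x\<in>mball cantor_measure (fst z) R. ennreal (cantor_J \<beta> x (snd z)) \<partial>cantor_measure)"
      by (simp add: xy)
  qed
qed auto

text \<open>Half-open, so that consecutive pieces are disjoint and their masses add up; the missing
  right endpoint is null.\<close>

lemma emeasure_unit_piece_ge:
  "ennreal (1 / 4) \<le> emeasure cantor_measure (cantor_line \<inter> {of_int k..<of_int k + 1})"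
proof -
  have one: "of_int k + 1 \<in> cantor_line"
    using zero_in_cantor_set by (auto simp: cantor_line_iff intro!: exI[of _ "k + 1"])
  have s: "{of_int k + 1 :: real} \<in> sets cantor_measure" using one by (simp add: sets_cantor_measure_iff)
  have "ennreal (1 / 4) \<le> cantor_H ((\<lambda>x. x + of_int k) ` cantor_set)"
    unfolding cantor_H_translate by (rule cantor_H_cantor_set_ge)
  also have "\<dots> \<le> cantor_H ((cantor_line \<inter> {of_int k..<of_int k + 1}) \<union> {of_int k + 1})"
    using cantor_setD by (intro hausdorff_outer_mono) (force simp: cantor_line_eq)
  also have "\<dots> \<le> cantor_H (cantor_line \<inter> {of_int k..<of_int k + 1}) + cantor_H {of_int k + 1}"
    by (rule hausdorff_outer_Un_le)
  also have "cantor_H {of_int k + 1} = 0"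
    using emeasure_cantor_measure[OF s] emeasure_cantor_singleton by simp
  also have "cantor_H (cantor_line \<inter> {of_int k..<of_int k + 1}) + 0 = emeasure cantor_measure (cantor_line \<inter> {of_int k..<of_int k + 1})"
    by (simp add: emeasure_cantor_measure sets_cantor_measure_iff)
  finally show ?thesis .
qed

lemma emeasure_many_pieces_ge:
  "ennreal (real N / 4) \<le> emeasure cantor_measure (cantor_line \<inter> {of_int k..<of_int k + real N})"
proof (induction N)
  case (Suc N)
  have "ennreal (real (Suc N) / 4) = ennreal (real N / 4) + ennreal (1 / 4)"
    by (subst ennreal_plus[symmetric]) (auto simp: field_simps)
  also have "\<dots> \<le> emeasure cantor_measure (cantor_line \<inter> {of_int k..<of_int k + real N})
      + emeasure cantor_measure (cantor_line \<inter> {of_int (k + int N)..<of_int (k + int N) + 1})"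
    by (intro add_mono Suc.IH emeasure_unit_piece_ge)
  also have "\<dots> = emeasure cantor_measure ((cantor_line \<inter> {of_int k..<of_int k + real N}) \<union> (cantor_line \<inter> {of_int (k + int N)..<of_int (k + int N) + 1}))"
    by (rule plus_emeasure) (auto simp: sets_cantor_measure_iff)
  also have "(cantor_line \<inter> {of_int k..<of_int k + real N}) \<union> (cantor_line \<inter> {of_int (k + int N)..<of_int (k + int N) + 1})
     = cantor_line \<inter> {of_int k..<of_int k + real (Suc N)}" by auto
  finally show ?case .
qed simp

text \<open>On the product of block N and block -N the kernel is at least N^-\<beta>, while the ball
  of radius d >= 2N has mass at least (N - 3)/4. The bound would give (N - 3)/4 * d^\<beta> <= C
  N^\<beta>, impossible for large N on a set of positive measure.\<close>

lemma J_le_fails: "\<not> J_le cantor_measure (power_scale \<beta>) (cantor_J \<beta>)"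
proof
  assume "J_le cantor_measure (power_scale \<beta>) (cantor_J \<beta>)"
  then obtain C where C: "0 < C" and ae: "AE z in cantor_measure \<Otimes>\<^sub>M cantor_measure. fst z \<noteq> snd z \<longrightarrow>
        ennreal (cantor_J \<beta> (fst z) (snd z)) \<le> ennreal C / (emeasure cantor_measure (mball cantor_measure (fst z) (dist (fst z) (snd z)))
                          * ennreal (dist (fst z) (snd z) powr \<beta>))"
    unfolding J_le_def by blast
  \<comment> \<open>Chosen so that (N - 3)/4 exceeds C; it also makes N larger than 3.\<close>
  obtain N :: nat where N: "4 * C + 3 < real N" using reals_Archimedean2 by blast
  have N3: "3 < real N" using N C by linarith
  define n where "n = int N"
  let ?S = "cantor_block n \<times> cantor_block (- n)"
  have block_pos: "0 < emeasure cantor_measure (cantor_block k)" for k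
  proof -
    have sub: "(\<lambda>y. y + of_int (2 * k)) ` cantor_set \<subseteq> cantor_line" unfolding cantor_line_eq by blast
    have "ennreal (1 powr cantor_dim / 8) \<le> emeasure cantor_measure (ball (2 * of_int k) 1 \<inter> (\<lambda>y. y + of_int (2 * k)) ` cantor_set)"
      using zero_in_cantor_set by (intro emeasure_cantor_piece_ge) auto
    also have "\<dots> \<le> emeasure cantor_measure (cantor_block k)"
      using sub by (intro emeasure_mono cantor_block_sets) (auto simp: cantor_block_def dist_real_def)
    finally show ?thesis by (auto simp: zero_less_iff_neq_zero)
  qed
  have S: "?S \<in> sets (cantor_measure \<Otimes>\<^sub>M cantor_measure)" using cantor_block_sets by auto
  have "emeasure (cantor_measure \<Otimes>\<^sub>M cantor_measure) ?S \<noteq> 0"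
    using block_pos[of n] block_pos[of "- n"] cantor_block_sets by (subst emeasure_pair_measure_Times) auto
  then have "\<not> (AE z in cantor_measure \<Otimes>\<^sub>M cantor_measure. z \<notin> ?S)"
    using AE_iff_null_sets[OF S] by (auto simp: null_sets_def)
  moreover have "AE z in cantor_measure \<Otimes>\<^sub>M cantor_measure. z \<notin> ?S"
    using ae
  proof eventually_elim
    fix z assume a: "fst z \<noteq> snd z \<longrightarrow>
        ennreal (cantor_J \<beta> (fst z) (snd z)) \<le> ennreal C / (emeasure cantor_measure (mball cantor_measure (fst z) (dist (fst z) (snd z)))
                          * ennreal (dist (fst z) (snd z) powr \<beta>))"
    show "z \<notin> ?S"
    proof
      assume zS: "z \<in> ?S"
      then obtain x y where z: "z = (x, y)" and x: "x \<in> cantor_block n" and y: "y \<in> cantor_block (- n)" by auto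
      define d where "d = \<bar>x - y\<bar>"
      have xb: "2 * real N - 1 < x" "x < 2 * real N + 1" and yb: "- 2 * real N - 1 < y" "y < - 2 * real N + 1"
        using x y by (auto simp: cantor_block_def n_def)
      have d: "2 * real N \<le> d" "d = x - y" using xb yb N3 by (auto simp: d_def)
      have "cantor_linked x y" unfolding cantor_linked_def using x y N3 by (intro exI[of _ n]) (simp add: n_def)
      then have "cantor_far \<beta> x y = 1 / real N powr \<beta>"
        using x by (simp add: cantor_far_def cantor_block_iff n_def)
      then have Jge: "1 / real N powr \<beta> \<le> cantor_J \<beta> x y" by (simp add: cantor_J_eq cantor_near_nonneg)
      \<comment> \<open>The cells from N - 1 to 2N - 4 lie strictly between y and x, hence inside
        the ball around x of radius x - y.\<close>
      have "ennreal (real (N - 3) / 4) \<le> emeasure cantor_measure (cantor_line \<inter> {of_int (n - 1)..<of_int (n - 1) + real (N - 3)})"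
        by (rule emeasure_many_pieces_ge)
      also have "\<dots> \<le> emeasure cantor_measure (mball cantor_measure x d)"
        using xb d N3 by (intro emeasure_mono mball_sets)
          (auto simp: mball_def space_cantor_measure dist_real_def n_def of_nat_diff)
      finally have B: "ennreal (real (N - 3) / 4) \<le> emeasure cantor_measure (mball cantor_measure x d)" .
      have "emeasure cantor_measure (mball cantor_measure x d) \<le> ennreal (4 * cantor_V ((x + d) - (x - d)))"
        using d N3 by (intro emeasure_cantor_subset_interval_le mball_sets) (auto simp: mball_def dist_real_def)
      then have "emeasure cantor_measure (mball cantor_measure x d) < top" by (rule order_le_less_trans) simp
      then obtain b where b: "emeasure cantor_measure (mball cantor_measure x d) = ennreal b" "0 \<le> b"
        by (cases "emeasure cantor_measure (mball cantor_measure x d)") auto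
      have b1: "real (N - 3) / 4 \<le> b" using B b by simp
      have N3': "real (N - 3) = real N - 3" using N3 by (simp add: of_nat_diff)
      have b0: "C < b" using b1 N unfolding N3' by simp
      have dp: "0 < d powr \<beta>" using d N3 by simp
      have "ennreal (cantor_J \<beta> x y) \<le> ennreal C / (ennreal b * ennreal (d powr \<beta>))"
        using a d N3 b unfolding z d_def by (auto simp: dist_real_def)
      also have "ennreal b * ennreal (d powr \<beta>) = ennreal (b * d powr \<beta>)" using b by (simp add: ennreal_mult)
      also have "ennreal C / ennreal (b * d powr \<beta>) = ennreal (C / (b * d powr \<beta>))"
        using b0 C dp by (intro divide_ennreal) auto
      finally have "cantor_J \<beta> x y \<le> C / (b * d powr \<beta>)" using C b dp by (simp add: ennreal_le_iff)
      then have "1 / real N powr \<beta> \<le> C / (b * d powr \<beta>)" using Jge by simp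
      then have "b * d powr \<beta> \<le> C * real N powr \<beta>" using b0 C dp N3 by (simp add: field_simps)
      moreover have "real N powr \<beta> \<le> d powr \<beta>" using d N3 beta_pos by (intro powr_mono2) auto
      then have "C * real N powr \<beta> \<le> C * d powr \<beta>" using C by (intro mult_left_mono) auto
      moreover have "C * d powr \<beta> < b * d powr \<beta>" using b0 dp by simp
      ultimately show False by linarith
    qed
  qed
  ultimately show False by blast
qed

end

section \<open>The jump measure as a Borel measure, and averages\<close>

context jump_form begin

lemma sets_pair_eq:
  assumes "space m \<in> sets borel"
  shows "sets (m \<Otimes>\<^sub>M m) = sets (restrict_space borel (space m \<times> space m))"
proof (intro equalityI subsetI)
  let ?R = "restrict_space borel (space m \<times> space m)"
  have c: "continuous_on (space m \<times> space m) fst" "continuous_on (space m \<times> space m) snd"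
    by (auto intro: continuous_intros)
  have f: "(\<lambda>z. fst z) \<in> ?R \<rightarrow>\<^sub>M m"
    unfolding measurable_cong_sets[OF refl sets_m]
    by (rule measurable_restrict_space2) (auto simp: space_restrict_space intro!: borel_measurable_continuous_on_restrict c)
  have s: "(\<lambda>z. snd z) \<in> ?R \<rightarrow>\<^sub>M m"
    unfolding measurable_cong_sets[OF refl sets_m]
    by (rule measurable_restrict_space2) (auto simp: space_restrict_space intro!: borel_measurable_continuous_on_restrict c)
  have id: "(\<lambda>z. z) \<in> ?R \<rightarrow>\<^sub>M m \<Otimes>\<^sub>M m" using measurable_Pair[OF f s] by simp
  fix A assume A: "A \<in> sets (m \<Otimes>\<^sub>M m)"
  have "A \<subseteq> space m \<times> space m" using sets.sets_into_space[OF A] by (simp add: space_pair_measure)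
  then have "(\<lambda>z. z) -` A \<inter> space ?R = A" by (auto simp: space_restrict_space)
  then show "A \<in> sets ?R" using measurable_sets[OF id A] by simp
next
  let ?R = "restrict_space borel (space m \<times> space m)"
  have "(\<lambda>z. (fst z, snd z)) \<in> m \<Otimes>\<^sub>M m \<rightarrow>\<^sub>M borel"
    by (intro borel_measurable_Pair measurable_compose[OF measurable_fst measurable_m_borel]
        measurable_compose[OF measurable_snd measurable_m_borel])
  then have id: "(\<lambda>z. z) \<in> m \<Otimes>\<^sub>M m \<rightarrow>\<^sub>M ?R"
    by (intro measurable_restrict_space2) (auto simp: space_pair_measure)
  fix A assume A: "A \<in> sets ?R"
  have "A \<subseteq> space m \<times> space m" using sets.sets_into_space[OF A] by (simp add: space_restrict_space)
  then have "(\<lambda>z. z) -` A \<inter> space (m \<Otimes>\<^sub>M m) = A" by (auto simp: space_pair_measure)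
  then show "A \<in> sets (m \<Otimes>\<^sub>M m)" using measurable_sets[OF id A] by simp
qed

lemma sets_jump_measure_iff: "A \<in> sets (jump_measure m J) \<longleftrightarrow> A \<in> sets (m \<Otimes>\<^sub>M m) \<and> A \<subseteq> off_diag (space m)"
  unfolding sets_jump_measure by (subst sets_restrict_space_iff) (auto intro: sets.Int off_diag_sets)

lemma emeasure_jump_measure:
  assumes A: "A \<in> sets (jump_measure m J)"
  shows "emeasure (jump_measure m J) A = emeasure jm A"
proof -
  have [measurable]: "A \<in> sets (m \<Otimes>\<^sub>M m)" and sub: "A \<subseteq> off_diag (space m)"
    using A by (auto simp: sets_jump_measure_iff)
  have "(\<integral>\<^sup>+z. indicator A z \<partial>jump_measure m J) = (\<integral>\<^sup>+z. indicator A z \<partial>jm)"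
    using sub by (intro nn_integral_jump_measure) (auto simp: off_diag_def indicator_def)
  then show ?thesis using A by simp
qed

lemma emeasure_jump_measure_swap:
  assumes A: "A \<in> sets (jump_measure m J)"
  shows "emeasure (jump_measure m J) (prod.swap ` A) = emeasure (jump_measure m J) A"
proof -
  have [measurable]: "A \<in> sets (m \<Otimes>\<^sub>M m)" and sub: "A \<subseteq> off_diag (space m)"
    using A by (auto simp: sets_jump_measure_iff)
  have eq: "prod.swap ` A = {z \<in> space (m \<Otimes>\<^sub>M m). (snd z, fst z) \<in> A}"
    using sub by (force simp: off_diag_def space_pair_measure image_iff)
  also have "\<dots> \<in> sets (m \<Otimes>\<^sub>M m)" by measurable
  finally have S: "prod.swap ` A \<in> sets (m \<Otimes>\<^sub>M m)" .
  have SA: "prod.swap ` A \<in> sets (jump_measure m J)"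
    using S sub by (auto simp: sets_jump_measure_iff off_diag_def)
  have "emeasure jm (prod.swap ` A) = (\<integral>\<^sup>+z. indicator (prod.swap ` A) z \<partial>jm)" using S by simp
  also have "\<dots> = (\<integral>\<^sup>+z. indicator A (snd z, fst z) \<partial>jm)"
    by (intro nn_integral_cong) (auto simp: eq indicator_def space_pair_measure)
  also have "\<dots> = (\<integral>\<^sup>+z. indicator A z \<partial>jm)" by (rule nn_integral_jm_swap) measurable
  also have "\<dots> = emeasure jm A" by simp
  finally show ?thesis by (simp add: emeasure_jump_measure A SA)
qed

end

lemma abs_powr_tangent:
  fixes a c p :: real
  assumes p: "1 < p"
  shows "\<bar>c\<bar> powr p + p * spow (p - 1) c * (a - c) \<le> \<bar>a\<bar> powr p"
  using convex_on_imp_above_tangent[OF convex_on_abs_powr[OF p] connected_UNIV, of c a "p * spow (p - 1) c"]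
    has_real_derivative_abs_powr[OF p, of c] by simp

text \<open>The tangent of |.|^p at t minus the average of u lies below the function; integrated
  over B, its linear term cancels. Boundedness of u on a set of finite mass supplies all
  integrability.\<close>

lemma (in jump_form) jensen_average:
  assumes B [measurable]: "B \<in> sets m" and mu: "emeasure m B = ennreal \<mu>" "0 < \<mu>"
    and u: "u \<in> Linf m"
  shows "ennreal (\<mu> * \<bar>t - avg m B u\<bar> powr p) \<le> (\<integral>\<^sup>+z\<in>B. ennreal (\<bar>t - u z\<bar> powr p) \<partial>m)"
proof -
  obtain c where um [measurable]: "u \<in> borel_measurable m" and c: "AE x in m. \<bar>u x\<bar> \<le> c"
    using u by (auto simp: Linf_def)
  have muB: "measure m B = \<mu>" using mu by (simp add: measure_def)
  have fin: "emeasure m B < \<infinity>" using mu by simp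
  have iu: "integrable m (\<lambda>z. indicator B z *\<^sub>R u z)"
    using c by (intro integrableI_bounded_set_indicator[OF B um fin, of c]) auto
  have i1: "integrable m (\<lambda>z. indicator B z *\<^sub>R (1::real))"
    by (intro integrableI_bounded_set_indicator[OF B _ fin, of _ 1]) auto
  have ip: "integrable m (\<lambda>z. indicator B z *\<^sub>R (\<bar>t - u z\<bar> powr p))"
  proof (rule integrableI_bounded_set_indicator[OF B _ fin, of _ "(\<bar>t\<bar> + c) powr p"])
    show "AE x in m. x \<in> B \<longrightarrow> norm (\<bar>t - u x\<bar> powr p) \<le> (\<bar>t\<bar> + c) powr p"
      using c by eventually_elim (use p_pos in \<open>auto intro!: powr_mono2\<close>)
  qed measurable
  define d where "d = t - avg m B u"
  have av: "(\<integral>z. indicator B z *\<^sub>R u z \<partial>m) = \<mu> * avg m B u"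
    using mu muB by (simp add: avg_def set_lebesgue_integral_def)
  have one: "(\<integral>z. indicator B z *\<^sub>R (1::real) \<partial>m) = \<mu>" using muB by simp
  have "\<mu> * \<bar>d\<bar> powr p = (\<bar>d\<bar> powr p + p * spow (p - 1) d * (t - d)) * \<mu> - p * spow (p - 1) d * (\<mu> * avg m B u)"
    by (simp add: d_def algebra_simps)
  also have "\<dots> = (\<integral>z. (\<bar>d\<bar> powr p + p * spow (p - 1) d * (t - d)) * (indicator B z *\<^sub>R (1::real)) - p * spow (p - 1) d * (indicator B z *\<^sub>R u z) \<partial>m)"
  proof -
    have "(\<integral>z. (\<bar>d\<bar> powr p + p * spow (p - 1) d * (t - d)) * (indicator B z *\<^sub>R (1::real)) - p * spow (p - 1) d * (indicator B z *\<^sub>R u z) \<partial>m)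
      = (\<integral>z. (\<bar>d\<bar> powr p + p * spow (p - 1) d * (t - d)) * (indicator B z *\<^sub>R (1::real)) \<partial>m) - (\<integral>z. p * spow (p - 1) d * (indicator B z *\<^sub>R u z) \<partial>m)"
      by (intro Bochner_Integration.integral_diff integrable_mult_right iu i1)
    also have "\<dots> = (\<bar>d\<bar> powr p + p * spow (p - 1) d * (t - d)) * \<mu> - p * spow (p - 1) d * (\<mu> * avg m B u)"
      unfolding integral_mult_right_zero av one ..
    finally show ?thesis by (rule sym)
  qed
  also have "\<dots> \<le> (\<integral>z. indicator B z *\<^sub>R (\<bar>t - u z\<bar> powr p) \<partial>m)"
  proof (rule integral_mono)
    show "integrable m (\<lambda>z. (\<bar>d\<bar> powr p + p * spow (p - 1) d * (t - d)) * (indicator B z *\<^sub>R (1::real)) - p * spow (p - 1) d * (indicator B z *\<^sub>R u z))"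
      using iu i1 by (intro Bochner_Integration.integrable_diff integrable_mult_right)
    fix z
    have "\<bar>d\<bar> powr p + p * spow (p - 1) d * ((t - u z) - d) \<le> \<bar>t - u z\<bar> powr p" by (rule abs_powr_tangent[OF p_gt_1])
    then show "(\<bar>d\<bar> powr p + p * spow (p - 1) d * (t - d)) * (indicator B z *\<^sub>R (1::real)) - p * spow (p - 1) d * (indicator B z *\<^sub>R u z)
       \<le> indicator B z *\<^sub>R (\<bar>t - u z\<bar> powr p)"
      by (cases "z \<in> B") (auto simp: algebra_simps)
  qed (rule ip)
  finally have "ennreal (\<mu> * \<bar>d\<bar> powr p) \<le> ennreal (\<integral>z. indicator B z *\<^sub>R (\<bar>t - u z\<bar> powr p) \<partial>m)"
    by (rule ennreal_leI)
  also have "\<dots> = (\<integral>\<^sup>+z. ennreal (indicator B z *\<^sub>R (\<bar>t - u z\<bar> powr p)) \<partial>m)"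
    by (rule nn_integral_eq_integral[symmetric, OF ip]) simp
  also have "\<dots> = (\<integral>\<^sup>+z\<in>B. ennreal (\<bar>t - u z\<bar> powr p) \<partial>m)"
    by (intro nn_integral_cong) (auto simp: indicator_def)
  finally show ?thesis by (simp add: d_def)
qed

context cantor_form begin

section \<open>The form, the cutoff Sobolev and the Poincare inequality\<close>

text \<open>An exhaustion of the off-diagonal by sets of finite jump measure. Bounding the first
  coordinate is enough, since \<open>J_tail\<close> controls the integral over all y at a positive
  distance.\<close>

definition jump_box :: "nat \<Rightarrow> (real \<times> real) set" where
  "jump_box n = {z \<in> cantor_line \<times> cantor_line. \<bar>fst z\<bar> \<le> real n \<and> 1 / real (Suc n) \<le> \<bar>fst z - snd z\<bar>}"

lemma fst_snd_measurable:
  "(\<lambda>z. fst z) \<in> cantor_measure \<Otimes>\<^sub>M cantor_measure \<rightarrow>\<^sub>M borel" "(\<lambda>z. snd z) \<in> cantor_measure \<Otimes>\<^sub>M cantor_measure \<rightarrow>\<^sub>M borel"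
  by (rule measurable_compose[OF measurable_fst id_measurable], rule measurable_compose[OF measurable_snd id_measurable])

lemma jump_box_sets: "jump_box n \<in> sets (jump_measure cantor_measure (cantor_J \<beta>))"
proof -
  note [measurable] = fst_snd_measurable
  have "jump_box n = {z \<in> space (cantor_measure \<Otimes>\<^sub>M cantor_measure). \<bar>fst z\<bar> \<le> real n \<and> 1 / real (Suc n) \<le> \<bar>fst z - snd z\<bar>}"
    by (auto simp: jump_box_def space_pair_measure space_cantor_measure)
  also have "\<dots> \<in> sets (cantor_measure \<Otimes>\<^sub>M cantor_measure)" by measurable
  finally have "jump_box n \<in> sets (cantor_measure \<Otimes>\<^sub>M cantor_measure)" .
  moreover have "jump_box n \<subseteq> off_diag cantor_line"
  proof
    fix z assume z: "z \<in> jump_box n"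
    then have "0 < 1 / real (Suc n)" "1 / real (Suc n) \<le> \<bar>fst z - snd z\<bar>" by (auto simp: jump_box_def)
    then have "fst z \<noteq> snd z" by auto
    then show "z \<in> off_diag cantor_line" using z by (auto simp: jump_box_def off_diag_def)
  qed
  ultimately show ?thesis by (simp add: sets_jump_measure_iff space_cantor_measure)
qed

lemma emeasure_jump_box: "emeasure (jump_measure cantor_measure (cantor_J \<beta>)) (jump_box n) < \<infinity>"
proof -
  have [measurable]: "jump_box n \<in> sets (cantor_measure \<Otimes>\<^sub>M cantor_measure)"
    using jump_box_sets by (simp add: sets_jump_measure_iff)
  define I where "I = cantor_line \<inter> {- real (Suc n)..real (Suc n)}"
  have I [measurable]: "I \<in> sets cantor_measure" by (auto simp: I_def sets_cantor_measure_iff)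
  have "emeasure (jump_measure cantor_measure (cantor_J \<beta>)) (jump_box n) = (\<integral>\<^sup>+z. indicator (jump_box n) z \<partial>jm)"
    by (simp add: emeasure_jump_measure jump_box_sets)
  also have "\<dots> = (\<integral>\<^sup>+x. \<integral>\<^sup>+y. ennreal (cantor_J \<beta> x y) * indicator (jump_box n) (x, y) \<partial>cantor_measure \<partial>cantor_measure)"
    by (rule nn_integral_jm) measurable
  also have "\<dots> \<le> (\<integral>\<^sup>+x. ennreal (tail_const * (1 / real (Suc n)) powr - \<beta>) * indicator I x \<partial>cantor_measure)"
  proof (rule nn_integral_mono)
    fix x assume x: "x \<in> space cantor_measure"
    show "(\<integral>\<^sup>+y. ennreal (cantor_J \<beta> x y) * indicator (jump_box n) (x, y) \<partial>cantor_measure)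
      \<le> ennreal (tail_const * (1 / real (Suc n)) powr - \<beta>) * indicator I x"
    proof (cases "x \<in> I")
      case True
      have "(\<integral>\<^sup>+y. ennreal (cantor_J \<beta> x y) * indicator (jump_box n) (x, y) \<partial>cantor_measure)
        \<le> (\<integral>\<^sup>+y. ennreal (cantor_J \<beta> x y) * indicator {y. 1 / real (Suc n) \<le> \<bar>x - y\<bar>} y \<partial>cantor_measure)"
        by (intro nn_integral_mono) (auto simp: indicator_def jump_box_def)
      also have "\<dots> \<le> ennreal (tail_const * (1 / real (Suc n)) powr - \<beta>)"
        using x by (intro J_tail) (auto simp: space_cantor_measure)
      finally show ?thesis using True by simp
    next
      case False
      then have "indicator (jump_box n) (x, y) = (0 :: ennreal)" for y
        using x by (auto simp: indicator_def jump_box_def I_def space_cantor_measure)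
      then show ?thesis by simp
    qed
  qed
  also have "\<dots> = ennreal (tail_const * (1 / real (Suc n)) powr - \<beta>) * emeasure cantor_measure I"
    by (rule nn_integral_cmult_indicator) measurable
  also have "\<dots> < \<infinity>"
  proof -
    have "emeasure cantor_measure I \<le> ennreal (4 * cantor_V (real (Suc n) - - real (Suc n)))"
      unfolding I_def by (rule emeasure_cantor_interval_le) simp
    then have "emeasure cantor_measure I < \<infinity>" by (rule order_le_less_trans) simp
    then show ?thesis by (simp add: ennreal_mult_less_top)
  qed
  finally show ?thesis .
qed

lemma jump_box_mono: "mono jump_box"
proof (rule monoI)
  fix i j :: nat assume "i \<le> j"
  then have "1 / real (Suc j) \<le> 1 / real (Suc i)" by (intro divide_left_mono) auto
  then show "jump_box i \<subseteq> jump_box j" using \<open>i \<le> j\<close> by (auto simp: jump_box_def)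
qed

lemma jump_box_eventually:
  assumes "0 < d" obtains n where "b \<le> real n" "1 / real (Suc n) \<le> d"
proof -
  obtain n where n: "max b (1 / d) \<le> real n" using real_arch_simple by blast
  have "1 / d \<le> real (Suc n)" using n by simp
  then have "1 / real (Suc n) \<le> d" using assms by (simp add: field_simps)
  then show thesis using that[of n] n by auto
qed

text \<open>Near an off-diagonal point a small product of balls lies in one \<open>jump_box\<close>,
  which gives local finiteness. Inner regularity is that of finite Borel measures on the plane,
  applied on each box and combined by a supremum.\<close>

lemma symmetric_radon_jump: "symmetric_radon cantor_line (jump_measure cantor_measure (cantor_J \<beta>))"
  unfolding symmetric_radon_def
proof (intro conjI ballI)
  let ?j = "jump_measure cantor_measure (cantor_J \<beta>)"
  have sub: "off_diag cantor_line \<subseteq> cantor_line \<times> cantor_line" by (auto simp: off_diag_def)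
  show "space ?j = off_diag cantor_line"
    using sub by (auto simp: jump_measure_def space_restrict_space space_pair_measure space_cantor_measure)
  have sets_pair: "sets (cantor_measure \<Otimes>\<^sub>M cantor_measure) = sets (restrict_space borel (cantor_line \<times> cantor_line))"
    using sets_pair_eq by (simp add: space_cantor_measure)
  show sets_j: "sets ?j = sets (restrict_space borel (off_diag cantor_line))"
  proof -
    have "sets ?j = sets (restrict_space (restrict_space borel (cantor_line \<times> cantor_line)) (off_diag cantor_line))"
      unfolding sets_jump_measure space_cantor_measure by (rule sets_restrict_space_cong[OF sets_pair])
    also have "\<dots> = sets (restrict_space borel (off_diag cantor_line))"
      using sub by (simp add: sets_restrict_restrict_space Int_absorb1)
    finally show ?thesis .
  qed
  show "emeasure ?j (prod.swap ` A) = emeasure ?j A" if "A \<in> sets ?j" for A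
    using that by (rule emeasure_jump_measure_swap)
  show "\<exists>G. open G \<and> z \<in> G \<and> emeasure ?j (G \<inter> off_diag cantor_line) < \<infinity>" if z: "z \<in> off_diag cantor_line" for z
  proof -
    obtain a b where ab: "z = (a, b)" "a \<noteq> b" using z by (auto simp: off_diag_def)
    define d where "d = \<bar>a - b\<bar> / 4"
    have d: "0 < d" using ab by (simp add: d_def)
    obtain n where n: "\<bar>a\<bar> + d \<le> real n" "1 / real (Suc n) \<le> d" using jump_box_eventually[OF d] by blast
    let ?G = "ball a d \<times> ball b d"
    have "?G \<inter> off_diag cantor_line \<subseteq> jump_box n"
    proof
      fix w assume w: "w \<in> ?G \<inter> off_diag cantor_line"
      then have "\<bar>a - fst w\<bar> < d" "\<bar>b - snd w\<bar> < d" by (auto simp: dist_real_def)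
      moreover have "\<bar>a - b\<bar> \<le> \<bar>a - fst w\<bar> + \<bar>fst w - snd w\<bar> + \<bar>b - snd w\<bar>" by linarith
      moreover have "\<bar>a - b\<bar> = 4 * d" by (simp add: d_def)
      ultimately have "\<bar>fst w\<bar> \<le> \<bar>a\<bar> + d" "d \<le> \<bar>fst w - snd w\<bar>" using d by linarith+
      then show "w \<in> jump_box n" using n w by (auto simp: jump_box_def off_diag_def)
    qed
    then have "emeasure ?j (?G \<inter> off_diag cantor_line) \<le> emeasure ?j (jump_box n)"
      by (intro emeasure_mono jump_box_sets)
    then have "emeasure ?j (?G \<inter> off_diag cantor_line) < \<infinity>" using emeasure_jump_box by (rule order_le_less_trans)
    moreover have "open ?G" by (intro open_Times) auto
    moreover have "z \<in> ?G" using d ab by simp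
    ultimately show ?thesis by blast
  qed
  show "emeasure ?j A = (SUP K\<in>{K. compact K \<and> K \<subseteq> A}. emeasure ?j K)" if A: "A \<in> sets ?j" for A
  proof (rule antisym)
    have Asub: "A \<subseteq> off_diag cantor_line" using A sets_jump_measure_iff by (simp add: space_cantor_measure)
    have od: "off_diag cantor_line \<in> sets borel"
      using off_diag_sets sets_pair sets_restrict_space_iff[of "cantor_line \<times> cantor_line" borel "off_diag cantor_line"]
      by (auto simp: space_cantor_measure borel_prod[symmetric] intro: pair_measureI)
    have bor: "B \<in> sets borel" if "B \<in> sets ?j" for B
      using that od unfolding sets_j by (subst (asm) sets_restrict_space_iff) auto
    have An: "A \<inter> jump_box n \<in> sets ?j" for n using A jump_box_sets by auto
    have "A = (\<Union>n. A \<inter> jump_box n)"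
    proof (intro equalityI subsetI)
      fix z assume z: "z \<in> A"
      then have zo: "z \<in> off_diag cantor_line" using Asub by blast
      then have "0 < \<bar>fst z - snd z\<bar>" by (auto simp: off_diag_def)
      then obtain n where "\<bar>fst z\<bar> \<le> real n" "1 / real (Suc n) \<le> \<bar>fst z - snd z\<bar>" by (rule jump_box_eventually)
      then have "z \<in> jump_box n" using zo by (auto simp: jump_box_def off_diag_def)
      then show "z \<in> (\<Union>n. A \<inter> jump_box n)" using z by blast
    qed auto
    then have "emeasure ?j A = emeasure ?j (\<Union>n. A \<inter> jump_box n)" by simp
    also have "\<dots> = (SUP n. emeasure ?j (A \<inter> jump_box n))"
    proof (rule SUP_emeasure_incseq[symmetric])
      show "incseq (\<lambda>n. A \<inter> jump_box n)" using jump_box_mono by (fastforce simp: incseq_def mono_def)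
    qed (use An in auto)
    also have "\<dots> \<le> (SUP K\<in>{K. compact K \<and> K \<subseteq> A}. emeasure ?j K)"
    proof (rule SUP_least)
      fix n
      \<comment> \<open>The jump measure lives on the off-diagonal subspace and may be infinite;
        restricted to a box and transported to the Borel sets of the plane, it is finite and
        regularity applies.\<close>
      define \<mu> where "\<mu> = distr (density ?j (indicator (jump_box n))) borel (\<lambda>z. z)"
      have idj: "(\<lambda>z. z) \<in> density ?j (indicator (jump_box n)) \<rightarrow>\<^sub>M borel"
        unfolding measurable_def
      proof (intro CollectI conjI ballI)
        fix B :: "(real \<times> real) set" assume "B \<in> sets borel"
        then show "(\<lambda>z. z) -` B \<inter> space (density ?j (indicator (jump_box n))) \<in> sets (density ?j (indicator (jump_box n)))"
          using sets_j \<open>space ?j = off_diag cantor_line\<close> by (auto simp: sets_restrict_space)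
      qed auto
      have em: "emeasure \<mu> B = emeasure ?j (B \<inter> jump_box n)" if B: "B \<in> sets borel" for B
      proof -
        have Bs: "B \<inter> off_diag cantor_line \<in> sets ?j" unfolding sets_j using B by (auto simp: sets_restrict_space)
        have sp: "jump_box n \<subseteq> off_diag cantor_line" using jump_box_sets[of n] sets_jump_measure_iff by (simp add: space_cantor_measure)
        have "emeasure \<mu> B = emeasure (density ?j (indicator (jump_box n))) (B \<inter> off_diag cantor_line)"
          unfolding \<mu>_def using B \<open>space ?j = off_diag cantor_line\<close> by (subst emeasure_distr[OF idj]) auto
        also have "\<dots> = (\<integral>\<^sup>+z. indicator (jump_box n) z * indicator (B \<inter> off_diag cantor_line) z \<partial>?j)"
          using jump_box_sets Bs by (intro emeasure_density) auto
        also have "\<dots> = (\<integral>\<^sup>+z. indicator (B \<inter> jump_box n) z \<partial>?j)"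
          using sp by (intro nn_integral_cong) (auto simp: indicator_def)
        also have "\<dots> = emeasure ?j (B \<inter> jump_box n)"
        proof (rule nn_integral_indicator)
          have "B \<inter> jump_box n = (B \<inter> off_diag cantor_line) \<inter> jump_box n" using sp by blast
          then show "B \<inter> jump_box n \<in> sets ?j" using Bs jump_box_sets by auto
        qed
        finally show ?thesis .
      qed
      have "emeasure \<mu> (A \<inter> jump_box n) = (SUP K\<in>{K. K \<subseteq> A \<inter> jump_box n \<and> compact K}. emeasure \<mu> K)"
      proof (rule inner_regular)
        show "sets \<mu> = sets borel" by (simp add: \<mu>_def)
        have "emeasure \<mu> (space \<mu>) = emeasure ?j (UNIV \<inter> jump_box n)" using em[of UNIV] by (simp add: \<mu>_def)
        then show "emeasure \<mu> (space \<mu>) \<noteq> \<infinity>" using emeasure_jump_box[of n] by simp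
        show "A \<inter> jump_box n \<in> sets borel" by (rule bor[OF An])
      qed
      also have "\<dots> \<le> (SUP K\<in>{K. compact K \<and> K \<subseteq> A}. emeasure ?j K)"
      proof (rule SUP_least)
        fix K assume "K \<in> {K. K \<subseteq> A \<inter> jump_box n \<and> compact K}"
        then have K: "K \<subseteq> A" "K \<subseteq> jump_box n" "compact K" by auto
        have "emeasure \<mu> K = emeasure ?j (K \<inter> jump_box n)" using K by (intro em borel_compact)
        also have "K \<inter> jump_box n = K" using K by blast
        also have "emeasure ?j K \<le> (SUP K\<in>{K. compact K \<and> K \<subseteq> A}. emeasure ?j K)" using K by (intro SUP_upper) auto
        finally show "emeasure \<mu> K \<le> (SUP K\<in>{K. compact K \<and> K \<subseteq> A}. emeasure ?j K)" .
      qed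
      finally show "emeasure ?j (A \<inter> jump_box n) \<le> (SUP K\<in>{K. compact K \<and> K \<subseteq> A}. emeasure ?j K)"
        using em[OF bor[OF An[of n]]] by (simp add: Int_assoc)
    qed
    finally show "emeasure ?j A \<le> (SUP K\<in>{K. compact K \<and> K \<subseteq> A}. emeasure ?j K)" .
    show "(SUP K\<in>{K. compact K \<and> K \<subseteq> A}. emeasure ?j K) \<le> emeasure ?j A"
      using A by (intro SUP_least emeasure_mono) auto
  qed
qed

lemma Cc_uniformly_continuous:
  assumes u: "u \<in> Cc cantor_line" and e: "0 < e"
  obtains d L where "0 < d" "d \<le> 1" "0 \<le> L" "\<And>x. x \<in> cantor_line \<Longrightarrow> L < \<bar>x\<bar> \<Longrightarrow> u x = 0"
    "\<And>x y. x \<in> cantor_line \<Longrightarrow> y \<in> cantor_line \<Longrightarrow> \<bar>x - y\<bar> < d \<Longrightarrow> \<bar>u x - u y\<bar> < e"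
proof -
  obtain K where c: "continuous_on cantor_line u" and K: "compact K" "K \<subseteq> cantor_line" "\<forall>x\<in>cantor_line - K. u x = 0"
    using u by (auto simp: Cc_def)
  obtain L0 where L0: "\<And>x. x \<in> K \<Longrightarrow> \<bar>x\<bar> \<le> L0" using compact_imp_bounded[OF K(1)] by (auto simp: bounded_iff)
  define L where "L = max 0 L0"
  have zero: "u x = 0" if "x \<in> cantor_line" "L < \<bar>x\<bar>" for x
    using K(3) L0[of x] that by (auto simp: L_def)
  \<comment> \<open>The window is wider than the support by 1. As d is at most 1, a close pair not
    contained in the window lies entirely beyond L, where u vanishes.\<close>
  let ?K = "cantor_line \<inter> {- (L + 1)..L + 1}"
  have "uniformly_continuous_on ?K u"
    by (intro compact_uniformly_continuous continuous_on_subset[OF c] compact_cantor_line_Int) auto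
  then obtain d0 where d0: "0 < d0" "\<And>x y. x \<in> ?K \<Longrightarrow> y \<in> ?K \<Longrightarrow> dist y x < d0 \<Longrightarrow> dist (u y) (u x) < e"
    using e unfolding uniformly_continuous_on_def by metis
  define d where "d = min 1 d0"
  have "\<bar>u x - u y\<bar> < e" if xy: "x \<in> cantor_line" "y \<in> cantor_line" "\<bar>x - y\<bar> < d" for x y
  proof (cases "x \<in> ?K \<and> y \<in> ?K")
    case True
    then show ?thesis using d0(2)[of y x] xy by (auto simp: d_def dist_real_def)
  next
    case False
    then have "L + 1 < \<bar>x\<bar> \<or> L + 1 < \<bar>y\<bar>" using xy by auto
    then have "L < \<bar>x\<bar>" "L < \<bar>y\<bar>" using xy(3) by (auto simp: d_def)
    then show ?thesis using zero xy e by simp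
  qed
  then show thesis using that[of d L] d0 zero by (auto simp: d_def L_def)
qed

lemma core_sum:
  assumes "finite I" "\<And>i. i \<in> I \<Longrightarrow> f i \<in> core"
  shows "(\<lambda>x. \<Sum>i\<in>I. f i x) \<in> core"
  using assms
proof (induction I)
  case empty
  have "total (\<lambda>x. 0 :: real) = 0" by (simp add: total_def nl_energy_def p_pos)
  then show ?case using Cc_zero by (simp add: core_iff)
next
  case (insert i I)
  then show ?case using core_lip2[OF lip2_add, of "f i" "\<lambda>x. \<Sum>i\<in>I. f i x"] by simp
qed

text \<open>Cutting the line along one gap in each interval of length \<delta> produces clopen
  pieces of diameter at most 2 \<delta> = 2d/3 < d. A function constant on each of finitely many
  pieces is a combination of indicators from the core.\<close>

lemma core_dense:
  assumes u: "u \<in> Cc (space cantor_measure)" and e: "0 < e"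
  shows "\<exists>f\<in>core. \<forall>x\<in>space cantor_measure. \<bar>u x - f x\<bar> < e"
proof -
  obtain d L where d: "0 < d" "d \<le> 1" "0 \<le> L" "\<And>x. x \<in> cantor_line \<Longrightarrow> L < \<bar>x\<bar> \<Longrightarrow> u x = 0"
    "\<And>x y. x \<in> cantor_line \<Longrightarrow> y \<in> cantor_line \<Longrightarrow> \<bar>x - y\<bar> < d \<Longrightarrow> \<bar>u x - u y\<bar> < e"
    using Cc_uniformly_continuous[of u e] u e unfolding space_cantor_measure by metis
  define \<delta> where "\<delta> = d / 3"
  have \<delta>: "0 < \<delta>" "\<delta> \<le> 1" using d by (auto simp: \<delta>_def)
  have "\<exists>b. of_int i * \<delta> \<le> b \<and> b + \<delta> / 18 \<le> of_int i * \<delta> + \<delta> \<and> cantor_line \<inter> {b<..<b + \<delta> / 18} = {}" for i :: int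
    using cantor_line_porous[OF \<delta>, of "of_int i * \<delta>"] by metis
  then obtain b where b: "\<And>i. of_int i * \<delta> \<le> b i" "\<And>i. b i + \<delta> / 18 \<le> of_int i * \<delta> + \<delta>"
    "\<And>i. cantor_line \<inter> {b i<..<b i + \<delta> / 18} = {}" for i :: int
    by metis
  define K where "K i = cantor_line \<inter> {b i + \<delta> / 18..b (i + 1)}" for i
  have sep: "\<delta> / 18 \<le> \<bar>y - z\<bar>" if "y \<in> K i" "z \<in> cantor_line - K i" for y z i
  proof -
    have "z \<notin> {b i<..<b i + \<delta> / 18}" "z \<notin> {b (i + 1)<..<b (i + 1) + \<delta> / 18}" using that b(3)[of i] b(3)[of "i + 1"] by auto
    then show ?thesis using that by (auto simp: K_def)
  qed
  have good: "good_cut (K i) (tail_const * (\<delta> / 18) powr - \<beta>)" for i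
    by (rule good_cut_separated[of _ "\<delta> / 18"]) (use \<delta> sep compact_cantor_line_Int in \<open>auto simp: K_def\<close>)
  have cover: "\<exists>i. x \<in> K i" if x: "x \<in> cantor_line" for x
  proof -
    define i where "i = \<lfloor>x / \<delta>\<rfloor>"
    have i: "of_int i * \<delta> \<le> x" "x < of_int i * \<delta> + \<delta>"
      using floor_divide_lower[of \<delta> x] floor_divide_upper[of \<delta> x] \<delta> by (auto simp: i_def algebra_simps)
    have "x \<notin> {b i<..<b i + \<delta> / 18}" using x b(3)[of i] by auto
    then consider "x \<le> b i" | "b i + \<delta> / 18 \<le> x" by force
    then show ?thesis
    proof cases
      case 1
      have "b (i - 1) + \<delta> / 18 \<le> x" using b(2)[of "i - 1"] i by (simp add: algebra_simps)
      then have "x \<in> K (i - 1)" using 1 x by (simp add: K_def)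
      then show ?thesis ..
    next
      case 2
      have "x \<le> b (i + 1)" using b(1)[of "i + 1"] i by (simp add: algebra_simps)
      then have "x \<in> K i" using 2 x by (simp add: K_def)
      then show ?thesis ..
    qed
  qed
  have bmono: "b i \<le> b j" if "i \<le> j" for i j
  proof (cases "i = j")
    case False
    then have "of_int (i + 1) * \<delta> \<le> of_int j * \<delta>" using that \<delta> by (intro mult_right_mono) auto
    then show ?thesis using b(2)[of i] b(1)[of j] \<delta> by (simp add: algebra_simps)
  qed simp
  have unique: "i = j" if "x \<in> K i" "x \<in> K j" for x i j
  proof -
    have "\<not> i < j" if "x \<in> K i" "x \<in> K j" for i j
    proof
      assume "i < j"
      then have "b (i + 1) \<le> b j" by (intro bmono) simp
      then show False using that \<delta> by (auto simp: K_def)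
    qed
    then show ?thesis using that by (metis linorder_neq_iff)
  qed
  have range: "of_int i * \<delta> \<le> x" "x \<le> of_int i * \<delta> + 2 * \<delta>" if "x \<in> K i" for x i
    using that b(1)[of i] b(2)[of "i + 1"] \<delta> by (auto simp: K_def algebra_simps)
  \<comment> \<open>A piece with index i lies between i \<delta> and (i + 2) \<delta>; the summand 3
    puts all pieces with |i| > N beyond L, where u is 0.\<close>
  define N where "N = \<lceil>L / \<delta>\<rceil> + 3"
  have N: "L + 2 * \<delta> < of_int N * \<delta>"
  proof -
    have "L / \<delta> + 3 \<le> of_int N" by (simp add: N_def)
    then have "(L / \<delta> + 3) * \<delta> \<le> of_int N * \<delta>" using \<delta> by (intro mult_right_mono) auto
    then show ?thesis using \<delta> by (simp add: distrib_right)
  qed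
  \<comment> \<open>For an empty piece the sample point is arbitrary, but then the corresponding
    indicator is 0.\<close>
  define s where "s i = (SOME x. x \<in> K i)" for i
  define f where "f x = (\<Sum>i\<in>{- N..N}. u (s i) * cut (K i) (\<lambda>x. 1) x)" for x
  have "f \<in> core"
    unfolding f_def[abs_def]
  proof (rule core_sum)
    fix i
    show "(\<lambda>x. u (s i) * cut (K i) (\<lambda>x. 1) x) \<in> core"
      using core_lip2[OF lip2_scale[of "u (s i)"] cut_one_core[OF good] cut_one_core[OF good]] by simp
  qed simp
  moreover have "\<bar>u x - f x\<bar> < e" if "x \<in> space cantor_measure" for x
  proof -
    have x: "x \<in> cantor_line" using that by (simp add: space_cantor_measure)
    obtain i where i: "x \<in> K i" using cover[OF x] by blast
    have cut: "cut (K j) (\<lambda>x. 1) x = (if j = i then 1 else 0)" for j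
      using i unique by (auto simp: cut_def)
    show ?thesis
    proof (cases "i \<in> {- N..N}")
      case True
      have "f x = u (s i)" unfolding f_def cut using True by (simp add: if_distrib sum.delta cong: if_cong)
      moreover have si: "s i \<in> K i" unfolding s_def by (rule someI[of _ x]) (rule i)
      then have "\<bar>x - s i\<bar> < d" using range[OF i] range[OF si] \<delta> d by (auto simp: \<delta>_def)
      ultimately show ?thesis using d(5)[OF x, of "s i"] si by (auto simp: K_def)
    next
      case False
      then have "f x = 0" unfolding f_def cut by (intro sum.neutral) auto
      moreover have "L < \<bar>x\<bar>"
      proof (cases "N < i")
        case True
        then have "of_int N * \<delta> \<le> of_int i * \<delta>" using \<delta> by (intro mult_right_mono) auto
        then show ?thesis using range[OF i] N \<delta> d(3) by linarith
      next
        case False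
        then have "i \<le> - N" using \<open>i \<notin> {- N..N}\<close> by auto
        then have "of_int i * \<delta> \<le> of_int (- N) * \<delta>" using \<delta> by (intro mult_right_mono) auto
        then show ?thesis using range[OF i] N \<delta> d(3) by simp
      qed
      ultimately show ?thesis using d(4)[OF x] e by simp
    qed
  qed
  ultimately show ?thesis by blast
qed

lemma purely_nonlocal_holds: "purely_nonlocal_form cantor_measure p E F (cantor_J \<beta>)"
  using symmetric_radon_jump by (intro purely_nonlocal_form_F core_dense) (simp_all add: space_cantor_measure)

text \<open>The indicator changes only across a separation of width r/18, so the density of its
  energy measure is at most the rate of jumps longer than that, which is \<open>tail_const\<close>
  times 18^\<beta> / r^\<beta>.\<close>

lemma CS_holds: "CS cantor_measure p E F (cantor_J \<beta>) (power_scale \<beta>) (1 / 2)"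
  unfolding CS_def Let_def
proof (rule exI[of _ 1], rule conjI, simp, rule exI[of _ "tail_const * 18 powr \<beta>"], intro conjI ballI allI impI)
  show "0 < tail_const * 18 powr \<beta>" using tail_const_pos by simp
  fix x0 R r :: real
  assume x0: "x0 \<in> space cantor_measure" and R: "0 < R" and r: "0 < r" and Rr: "R + 2 * r < 1 / 2"
  let ?B0 = "mball cantor_measure x0 R" and ?B1 = "mball cantor_measure x0 (R + r)" and ?O = "mball cantor_measure x0 (R + 2 * r)"
  have r1: "r \<le> 1" using R Rr by simp
  obtain K where K: "good_cut K (tail_const * (r / 18) powr - \<beta>)" "ball x0 R \<inter> cantor_line \<subseteq> K" "K \<subseteq> ball x0 (R + r) \<inter> cantor_line"
    "\<And>y z. y \<in> K \<Longrightarrow> z \<in> cantor_line - K \<Longrightarrow> r / 18 \<le> \<bar>y - z\<bar>"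
    using good_cut_interval[OF r r1, of x0 R] by blast
  let ?\<phi> = "cut K (\<lambda>x. 1)"
  have \<phi>F: "?\<phi> \<in> F" by (rule core_subset_F[OF cut_one_core[OF K(1)]])
  have "?\<phi> \<in> cutoff cantor_measure F ?B0 ?B1"
    unfolding cutoff_def using \<phi>F K(2,3) by (auto simp: cut_def mball_def space_cantor_measure)
  moreover have "(\<integral>\<^sup>+x\<in>?O. ennreal (\<bar>qc_version cantor_measure p E F u x\<bar> powr p) \<partial>energy_measure cantor_measure p E F (cantor_J \<beta>) ?O ?\<phi>)
      \<le> ennreal 1 * emeasure (energy_measure cantor_measure p E F (cantor_J \<beta>) ?O u) ?O
        + (SUP x\<in>?O. ennreal (tail_const * 18 powr \<beta> / r powr \<beta>)) * (\<integral>\<^sup>+x\<in>?O. ennreal (\<bar>u x\<bar> powr p) \<partial>cantor_measure)"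
    if u: "u \<in> dom_const F \<inter> Linf cantor_measure" for u
  proof -
    have super_dom_const: "u \<in> dom_const F" using u by simp
    note q = qc_version[OF super_dom_const]
    note [measurable] = q(1) dom_const_measurable[OF super_dom_const]
    have inner: "(\<integral>\<^sup>+y\<in>?O. ennreal (\<bar>?\<phi> x - ?\<phi> y\<bar> powr p * cantor_J \<beta> x y) \<partial>cantor_measure) \<le> ennreal (tail_const * 18 powr \<beta> / r powr \<beta>)"
      if x: "x \<in> cantor_line" for x
    proof -
      have "(\<integral>\<^sup>+y\<in>?O. ennreal (\<bar>?\<phi> x - ?\<phi> y\<bar> powr p * cantor_J \<beta> x y) \<partial>cantor_measure)
        \<le> (\<integral>\<^sup>+y. ennreal (cantor_J \<beta> x y) * indicator {y. r / 18 \<le> \<bar>x - y\<bar>} y \<partial>cantor_measure)"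
      proof (rule nn_integral_mono)
        fix y assume y: "y \<in> space cantor_measure"
        show "ennreal (\<bar>?\<phi> x - ?\<phi> y\<bar> powr p * cantor_J \<beta> x y) * indicator ?O y \<le> ennreal (cantor_J \<beta> x y) * indicator {y. r / 18 \<le> \<bar>x - y\<bar>} y"
        proof (cases "(x \<in> K) = (y \<in> K)")
          case True then show ?thesis using p_pos by (auto simp: cut_def)
        next
          case False
          then have "r / 18 \<le> \<bar>x - y\<bar>" using K(4)[of x y] K(4)[of y x] x y
            by (auto simp: space_cantor_measure abs_minus_commute)
          moreover have "\<bar>?\<phi> x - ?\<phi> y\<bar> powr p = 1" using False p_pos by (auto simp: cut_def)
          ultimately show ?thesis by (simp add: indicator_def)
        qed
      qed
      also have "\<dots> \<le> ennreal (tail_const * (r / 18) powr - \<beta>)" using r by (intro J_tail x) simp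
      also have "tail_const * (r / 18) powr - \<beta> = tail_const * 18 powr \<beta> / r powr \<beta>"
      proof -
        have "(r / 18) powr - \<beta> = 1 / (r / 18) powr \<beta>" by (rule powr_minus_divide)
        also have "\<dots> = 18 powr \<beta> / r powr \<beta>" using r by (simp only: powr_divide divide_divide_eq_right mult_1)
        finally show ?thesis by simp
      qed
      finally show ?thesis .
    qed
    have "(\<integral>\<^sup>+x\<in>?O. ennreal (\<bar>qc_version cantor_measure p E F u x\<bar> powr p) \<partial>energy_measure cantor_measure p E F (cantor_J \<beta>) ?O ?\<phi>)
      = (\<integral>\<^sup>+x\<in>?O. ennreal (\<bar>qc_version cantor_measure p E F u x\<bar> powr p) * (\<integral>\<^sup>+y\<in>?O. ennreal (\<bar>?\<phi> x - ?\<phi> y\<bar> powr p * cantor_J \<beta> x y) \<partial>cantor_measure) \<partial>cantor_measure)"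
      by (rule nn_integral_energy_measure[OF F_subset_dom_const[OF \<phi>F]]) measurable
    also have "\<dots> \<le> (\<integral>\<^sup>+x. ennreal (tail_const * 18 powr \<beta> / r powr \<beta>) * (ennreal (\<bar>u x\<bar> powr p) * indicator ?O x) \<partial>cantor_measure)"
    proof (rule nn_integral_mono_AE)
      show "AE x in cantor_measure. ennreal (\<bar>qc_version cantor_measure p E F u x\<bar> powr p)
          * (\<integral>\<^sup>+y\<in>?O. ennreal (\<bar>?\<phi> x - ?\<phi> y\<bar> powr p * cantor_J \<beta> x y) \<partial>cantor_measure) * indicator ?O x
        \<le> ennreal (tail_const * 18 powr \<beta> / r powr \<beta>) * (ennreal (\<bar>u x\<bar> powr p) * indicator ?O x)"
        using q(2) AE_space
      proof eventually_elim
        fix x assume eq: "qc_version cantor_measure p E F u x = u x" and x: "x \<in> space cantor_measure"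
        have "ennreal (\<bar>u x\<bar> powr p) * indicator ?O x * (\<integral>\<^sup>+y\<in>?O. ennreal (\<bar>?\<phi> x - ?\<phi> y\<bar> powr p * cantor_J \<beta> x y) \<partial>cantor_measure)
          \<le> ennreal (\<bar>u x\<bar> powr p) * indicator ?O x * ennreal (tail_const * 18 powr \<beta> / r powr \<beta>)"
          using inner[of x] x by (intro mult_left_mono) (auto simp: space_cantor_measure)
        then show "ennreal (\<bar>qc_version cantor_measure p E F u x\<bar> powr p)
          * (\<integral>\<^sup>+y\<in>?O. ennreal (\<bar>?\<phi> x - ?\<phi> y\<bar> powr p * cantor_J \<beta> x y) \<partial>cantor_measure) * indicator ?O x
        \<le> ennreal (tail_const * 18 powr \<beta> / r powr \<beta>) * (ennreal (\<bar>u x\<bar> powr p) * indicator ?O x)"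
          unfolding eq by (simp only: mult.assoc mult.commute mult.left_commute)
      qed
    qed
    also have "\<dots> = ennreal (tail_const * 18 powr \<beta> / r powr \<beta>) * (\<integral>\<^sup>+x\<in>?O. ennreal (\<bar>u x\<bar> powr p) \<partial>cantor_measure)"
      by (rule nn_integral_cmult) measurable
    also have "\<dots> \<le> (SUP x\<in>?O. ennreal (tail_const * 18 powr \<beta> / r powr \<beta>)) * (\<integral>\<^sup>+x\<in>?O. ennreal (\<bar>u x\<bar> powr p) \<partial>cantor_measure)"
      using x0 R r by (intro mult_right_mono SUP_upper[of x0]) (auto simp: mball_def)
    also have "\<dots> \<le> ennreal 1 * emeasure (energy_measure cantor_measure p E F (cantor_J \<beta>) ?O u) ?O
        + (SUP x\<in>?O. ennreal (tail_const * 18 powr \<beta> / r powr \<beta>)) * (\<integral>\<^sup>+x\<in>?O. ennreal (\<bar>u x\<bar> powr p) \<partial>cantor_measure)"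
      by (rule add_increasing) auto
    finally show ?thesis .
  qed
  ultimately show "\<exists>\<phi>\<in>cutoff cantor_measure F ?B0 ?B1. \<forall>u\<in>dom_const F \<inter> Linf cantor_measure.
      (\<integral>\<^sup>+x\<in>?O. ennreal (\<bar>qc_version cantor_measure p E F u x\<bar> powr p) \<partial>energy_measure cantor_measure p E F (cantor_J \<beta>) ?O \<phi>)
      \<le> ennreal 1 * emeasure (energy_measure cantor_measure p E F (cantor_J \<beta>) ?O u) ?O
        + (SUP x\<in>?O. ennreal (tail_const * 18 powr \<beta> / r powr \<beta>)) * (\<integral>\<^sup>+x\<in>?O. ennreal (\<bar>u x\<bar> powr p) \<partial>cantor_measure)"
    by blast
qed

lemma J_ge:
  assumes "x \<noteq> y" "\<bar>x - y\<bar> \<le> d" "d \<le> 1"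
  shows "1 / d powr (cantor_dim + \<beta>) \<le> cantor_J \<beta> x y"
  using cantor_near_ge[of "\<bar>x - y\<bar>" d \<beta>] assms beta_pos cantor_far_nonneg[of \<beta> x y] unfolding cantor_J_eq by simp

text \<open>Works with \<kappa> = 1: distinct points of the ball are at distance below 2r < 1, where
  J is at least (2r)^-(alpha+\<beta>). Jensen's inequality divides by the mass of the ball, at least
  r^alpha/8, leaving 8 * 2^(alpha+\<beta>) r^\<beta>.\<close>

lemma PI_holds: "PI cantor_measure p E F (cantor_J \<beta>) (power_scale \<beta>) (1 / 2)"
  unfolding PI_def Let_def
proof (rule exI[of _ "8 * 2 powr (cantor_dim + \<beta>)"], rule conjI, simp, rule exI[of _ 1], intro conjI ballI allI impI)
  fix x r :: real and u
  assume x: "x \<in> space cantor_measure" and r': "0 < r \<and> r < 1 / 2 / 1" and u: "u \<in> dom_const F \<inter> Linf cantor_measure"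
  have r: "0 < r" "r < 1 / 2" using r' by auto
  have super_dom_const: "u \<in> dom_const F" using u by simp
  note [measurable] = dom_const_measurable[OF super_dom_const]
  let ?B = "mball cantor_measure x r"
  have bge: "ennreal (r powr cantor_dim / 8) \<le> emeasure cantor_measure ?B"
    using x r by (intro emeasure_cantor_ball_ge) (auto simp: space_cantor_measure)
  obtain \<mu> where \<mu>: "emeasure cantor_measure ?B = ennreal \<mu>" "0 \<le> \<mu>"
    using emeasure_cantor_ball_le[of r x] r by (cases "emeasure cantor_measure ?B") (auto simp: top_unique)
  have \<mu>ge: "r powr cantor_dim / 8 \<le> \<mu>" using bge \<mu> by simp
  have \<mu>pos: "0 < \<mu>" using \<mu>ge r by (smt (verit) divide_pos_pos powr_gt_zero)
  define D where "D = (2 * r) powr (cantor_dim + \<beta>)"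
  have D: "0 < D" using r by (simp add: D_def)
  have const: "D / \<mu> \<le> 8 * 2 powr (cantor_dim + \<beta>) * r powr \<beta>"
  proof -
    have "D / \<mu> \<le> D / (r powr cantor_dim / 8)" using D \<mu>ge \<mu>pos r by (intro divide_left_mono) auto
    also have "\<dots> = 8 * 2 powr (cantor_dim + \<beta>) * r powr \<beta>"
      using r by (simp add: D_def powr_mult powr_add)
    finally show ?thesis .
  qed
  have "(\<integral>\<^sup>+y\<in>?B. ennreal (\<bar>u y - avg cantor_measure ?B u\<bar> powr p) \<partial>cantor_measure)
    \<le> (\<integral>\<^sup>+y. ennreal (D / \<mu>) * ((\<integral>\<^sup>+z\<in>?B. ennreal (\<bar>u y - u z\<bar> powr p * cantor_J \<beta> y z) \<partial>cantor_measure) * indicator ?B y) \<partial>cantor_measure)"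
  proof (rule nn_integral_mono)
    fix y assume ys [measurable]: "y \<in> space cantor_measure"
    show "ennreal (\<bar>u y - avg cantor_measure ?B u\<bar> powr p) * indicator ?B y
      \<le> ennreal (D / \<mu>) * ((\<integral>\<^sup>+z\<in>?B. ennreal (\<bar>u y - u z\<bar> powr p * cantor_J \<beta> y z) \<partial>cantor_measure) * indicator ?B y)"
    proof (cases "y \<in> ?B")
      case True
      have "ennreal (\<mu> * \<bar>u y - avg cantor_measure ?B u\<bar> powr p) \<le> (\<integral>\<^sup>+z\<in>?B. ennreal (\<bar>u y - u z\<bar> powr p) \<partial>cantor_measure)"
        using u by (intro jensen_average \<mu> \<mu>pos mball_sets) auto
      also have "\<dots> \<le> (\<integral>\<^sup>+z. ennreal D * (ennreal (\<bar>u y - u z\<bar> powr p * cantor_J \<beta> y z) * indicator ?B z) \<partial>cantor_measure)"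
      proof (rule nn_integral_mono)
        fix z
        show "ennreal (\<bar>u y - u z\<bar> powr p) * indicator ?B z \<le> ennreal D * (ennreal (\<bar>u y - u z\<bar> powr p * cantor_J \<beta> y z) * indicator ?B z)"
        proof (cases "z \<in> ?B \<and> y \<noteq> z")
          case zB: True
          then have "1 / D \<le> cantor_J \<beta> y z"
            using True r unfolding D_def by (intro J_ge) (auto simp: mball_def dist_real_def)
          then have "1 \<le> D * cantor_J \<beta> y z" using D by (simp add: field_simps)
          then have "\<bar>u y - u z\<bar> powr p * 1 \<le> \<bar>u y - u z\<bar> powr p * (D * cantor_J \<beta> y z)" by (intro mult_left_mono) auto
          then have "ennreal (\<bar>u y - u z\<bar> powr p) \<le> ennreal (D * (\<bar>u y - u z\<bar> powr p * cantor_J \<beta> y z))"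
            by (intro ennreal_leI) (simp add: ac_simps)
          also have "\<dots> = ennreal D * ennreal (\<bar>u y - u z\<bar> powr p * cantor_J \<beta> y z)"
            using D cantor_J_nonneg by (intro ennreal_mult) auto
          finally show ?thesis using zB by simp
        qed (use p_pos in \<open>auto simp: indicator_def\<close>)
      qed
      also have "\<dots> = ennreal D * (\<integral>\<^sup>+z\<in>?B. ennreal (\<bar>u y - u z\<bar> powr p * cantor_J \<beta> y z) \<partial>cantor_measure)"
        by (rule nn_integral_cmult) measurable
      finally have "ennreal (1 / \<mu>) * ennreal (\<mu> * \<bar>u y - avg cantor_measure ?B u\<bar> powr p)
        \<le> ennreal (1 / \<mu>) * (ennreal D * (\<integral>\<^sup>+z\<in>?B. ennreal (\<bar>u y - u z\<bar> powr p * cantor_J \<beta> y z) \<partial>cantor_measure))"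
        by (rule mult_left_mono) simp
      then show ?thesis using True \<mu>pos D by (simp add: mult.assoc[symmetric] ennreal_mult[symmetric])
    qed simp
  qed
  also have "\<dots> = ennreal (D / \<mu>) * (\<integral>\<^sup>+y\<in>?B. (\<integral>\<^sup>+z\<in>?B. ennreal (\<bar>u y - u z\<bar> powr p * cantor_J \<beta> y z) \<partial>cantor_measure) \<partial>cantor_measure)"
    by (rule nn_integral_cmult) measurable
  also have "\<dots> = ennreal (D / \<mu>) * emeasure (energy_measure cantor_measure p E F (cantor_J \<beta>) ?B u) ?B"
    by (simp add: emeasure_energy_measure[OF super_dom_const mball_sets])
  also have "\<dots> \<le> ennreal (8 * 2 powr (cantor_dim + \<beta>) * r powr \<beta>) * emeasure (energy_measure cantor_measure p E F (cantor_J \<beta>) ?B u) ?B"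
    by (intro mult_right_mono ennreal_leI const) simp
  finally show "(\<integral>\<^sup>+y\<in>?B. ennreal (\<bar>u y - avg cantor_measure ?B u\<bar> powr p) \<partial>cantor_measure)
    \<le> ennreal (8 * 2 powr (cantor_dim + \<beta>) * r powr \<beta>) * emeasure (energy_measure cantor_measure p E F (cantor_J \<beta>) (mball cantor_measure x (1 * r)) u) (mball cantor_measure x (1 * r))"
    by simp
qed simp

end

section \<open>The Harnack inequalities\<close>

lemma ennpowr_le:
  assumes "X \<le> ennreal y" "0 \<le> y" "0 \<le> a"
  shows "ennpowr X a \<le> ennreal (y powr a)"
proof -
  obtain x where x: "X = ennreal x" "0 \<le> x" using assms(1) by (cases X) (auto simp: top_unique)
  then have "x \<le> y" using assms by simp
  then show ?thesis using x assms by (auto simp: ennpowr_def intro!: ennreal_leI powr_mono2)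
qed

lemma ennreal_mult_right_cancel_le:
  fixes a b v :: ennreal
  assumes "a * v \<le> b * v" "0 < v" "v < \<infinity>"
  shows "a \<le> b"
  using assms ennreal_mult_le_mult_iff[of v a b] by (simp add: mult.commute)

lemma not_AE_einf:
  assumes "einf m B f < c" and B: "B \<in> sets m"
  shows "\<not> (AE x in m. x \<in> B \<longrightarrow> c \<le> f x)"
proof
  assume "AE x in m. x \<in> B \<longrightarrow> c \<le> f x"
  then have "AE x in restrict_space m B. c \<le> f x"
    using B by (subst AE_restrict_space_iff) (auto simp: sets.Int_space_eq2)
  then have "c \<le> einf m B f" unfolding einf_def by (intro Sup_upper) simp
  then show False using assms(1) by simp
qed

context cantor_form begin

abbreviation tail_bounded :: "real \<Rightarrow> real \<Rightarrow> (real \<Rightarrow> real) \<Rightarrow> real set \<Rightarrow> real \<Rightarrow> bool" where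
  "tail_bounded x0 R u K t \<equiv> AE x in cantor_measure. x \<in> K \<longrightarrow>
    (\<integral>\<^sup>+y\<in>space cantor_measure - mball cantor_measure x0 R. ennreal (max (- u y) 0 powr (p - 1) * cantor_J \<beta> x y) \<partial>cantor_measure) \<le> ennreal t"

abbreviation inf_plus_tail :: "real \<Rightarrow> real \<Rightarrow> real \<Rightarrow> (real \<Rightarrow> real) \<Rightarrow> ennreal" where
  "inf_plus_tail x0 r R u \<equiv> einf cantor_measure (mball cantor_measure x0 r) (\<lambda>y. ennreal (u y)) +
    ennreal ((r powr \<beta>) powr (1 / (p - 1))) *
    tail cantor_measure p E F (cantor_J \<beta>) (mball cantor_measure x0 (R / 2)) (mball cantor_measure x0 R) (\<lambda>y. max (- u y) 0)"

text \<open>The constant of \<open>supersolution_step\<close> for the leaving rate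
  \<open>tail_const * (r / 18) powr - \<beta>\<close> and a tail bound k^(p-1) r^-\<beta>. The next
  two constants divide by the least value of J on K, whose points are less than 8r apart, and return
  from (u - k)_+ to u, with 32 from the mass of K.\<close>

definition testing_const :: real where "testing_const = 2 powr (p - 1) * (tail_const * 18 powr \<beta> + 1)"
definition excess_const :: real where "excess_const = testing_const * 8 powr (cantor_dim + \<beta>)"
definition power_const :: real where "power_const = 2 powr (p - 1) * (excess_const + 32)"
text \<open>Makes Markov's inequality leave at most r^alpha/16 of mass to the set in K where u
  exceeds half the new level.\<close>

definition level_const :: real where "level_const = 2 * (16 * power_const) powr (1 / (p - 1))"
text \<open>Here 16 is the reciprocal of the mass fraction r^alpha/16 averaged over, 64 is the mass
  constant 32 divided by the 1/2 from half the level, and 19^(1+\<beta>) comes from averaging the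
  kernel.\<close>

definition escape_const :: real where "escape_const = 16 * 64 * 19 powr (1 + \<beta>) * testing_const"
text \<open>Solved from the requirement that the pull of the low points at height l exceed the
  escape bound strictly; the summand 1 inside the power gives the strictness, the leading 1 starts
  from the lower level.\<close>

definition cap_const :: real where "cap_const = 1 + (16 * 8 powr (cantor_dim + \<beta>) * (escape_const + 1)) powr (1 / (p - 1))"

lemma p_minus_1_pos: "0 < p - 1" using p_gt_1 by simp

lemma harnack_consts_pos: "0 < testing_const" "0 < excess_const" "1 \<le> power_const" "2 \<le> level_const" "0 < escape_const" "1 \<le> cap_const"
proof -
  show h1: "0 < testing_const" using tail_const_pos by (simp add: testing_const_def add_pos_pos)
  then show h2: "0 < excess_const" by (simp add: excess_const_def)
  have "1 \<le> (2 :: real) powr (p - 1)" using p_minus_1_pos by (intro ge_one_powr_ge_zero) auto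
  then have "1 * 1 \<le> 2 powr (p - 1) * (excess_const + 32)" using h2 by (intro mult_mono) auto
  then show h3: "1 \<le> power_const" by (simp add: power_const_def)
  have "1 \<le> (16 * power_const) powr (1 / (p - 1))" using h3 p_minus_1_pos by (intro ge_one_powr_ge_zero) auto
  then show "2 \<le> level_const" by (simp add: level_const_def)
  show "0 < escape_const" using h1 by (simp add: escape_const_def)
  show "1 \<le> cap_const" by (simp add: cap_const_def)
qed

text \<open>Radius 3r leaves room for balls of radius r around points of a smaller cut inside radius
  2r. Since r <= R/16, the set K stays inside half the large ball, where the tail in the Harnack
  inequality is measured.\<close>

context
  fixes x0 R r :: real and u :: "real \<Rightarrow> real" and K :: "real set"
  assumes x0: "x0 \<in> cantor_line" and r: "0 < r" "r \<le> R / 16" and R: "R < 1 / 4"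
    and K: "good_cut K (tail_const * (r / 18) powr - \<beta>)" "ball x0 (3 * r) \<inter> cantor_line \<subseteq> K" "K \<subseteq> ball x0 (4 * r) \<inter> cantor_line"
    and sup: "superharmonic cantor_measure p E F (mball cantor_measure x0 R) u"
    and pos: "AE y in cantor_measure. y \<in> mball cantor_measure x0 R \<longrightarrow> 0 \<le> u y"
begin

lemma super_dom_const: "u \<in> dom_const F" by (rule superharmonic_dom_const[OF sup])

lemma u_measurable [measurable]: "u \<in> borel_measurable cantor_measure" by (rule dom_const_measurable[OF super_dom_const])

lemma K_measurable [measurable]: "K \<in> sets cantor_measure" by (rule good_cut_sets[OF K(1)])

lemma K_near: "x \<in> K \<Longrightarrow> \<bar>x - x0\<bar> < 4 * r"
  using K(3) by (auto simp: dist_real_def)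

lemma K_subset_ball: "K \<subseteq> mball cantor_measure x0 R"
  using K(3) r R by (auto simp: mball_def space_cantor_measure)

lemma emeasure_K: "emeasure cantor_measure K \<le> ennreal (32 * r powr cantor_dim)"
proof -
  have "emeasure cantor_measure K \<le> ennreal (4 * cantor_V ((x0 + 4 * r) - (x0 - 4 * r)))"
    using K(3) K_near r by (intro emeasure_cantor_subset_interval_le) (force simp: abs_less_iff)+
  also have "4 * cantor_V ((x0 + 4 * r) - (x0 - 4 * r)) \<le> 32 * r powr cantor_dim"
    using cantor_V_mult_le[of 8 r] cantor_V_small[of r] r R by simp
  finally show ?thesis by (simp add: ennreal_leI)
qed

lemma nonneg_K: "AE y in cantor_measure. y \<in> K \<longrightarrow> 0 \<le> u y"
  using pos K_subset_ball by (auto elim!: eventually_mono)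

lemma J_ge_K: "x \<in> K \<Longrightarrow> y \<in> K \<Longrightarrow> x \<noteq> y \<Longrightarrow> 1 / (8 * r) powr (cantor_dim + \<beta>) \<le> cantor_J \<beta> x y"
  using K_near[of x] K_near[of y] K(3) r R by (intro J_ge) auto

context
  fixes k :: real
  assumes k: "0 < k"
    and tail: "tail_bounded x0 R u K (k powr (p - 1) * r powr - \<beta>)"
begin

lemma super_integral_le:
  "(\<integral>\<^sup>+x. ennreal (cut K (\<lambda>x. max (k - u x) 0) x) * (\<integral>\<^sup>+y. ennreal (max (u y - k) 0 powr (p - 1) * cantor_J \<beta> x y) \<partial>cantor_measure) \<partial>cantor_measure)
    \<le> ennreal (testing_const * k powr (p - 1) * r powr - \<beta>) * (\<integral>\<^sup>+x. ennreal (cut K (\<lambda>x. max (k - u x) 0) x) \<partial>cantor_measure)"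
proof -
  have "(r / 18) powr - \<beta> = 18 powr \<beta> * r powr - \<beta>"
    using r by (simp add: powr_minus powr_divide field_simps)
  then have "2 powr (p - 1) * (k powr (p - 1) * (tail_const * (r / 18) powr - \<beta>) + k powr (p - 1) * r powr - \<beta>) = testing_const * k powr (p - 1) * r powr - \<beta>"
    by (simp add: testing_const_def algebra_simps)
  then show ?thesis
    using supersolution_step[OF K(1) K_subset_ball mball_sets sup pos k _ tail] by simp
qed

lemma cut_integral_le: "(\<integral>\<^sup>+x. ennreal (cut K (\<lambda>x. max (k - u x) 0) x) \<partial>cantor_measure) \<le> ennreal (k * (32 * r powr cantor_dim))"
proof -
  have "(\<integral>\<^sup>+x. ennreal (cut K (\<lambda>x. max (k - u x) 0) x) \<partial>cantor_measure) \<le> (\<integral>\<^sup>+x. ennreal k * indicator K x \<partial>cantor_measure)"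
    using nonneg_K k by (intro nn_integral_mono_AE) (auto elim!: eventually_mono simp: cut_def intro!: ennreal_leI)
  also have "\<dots> = ennreal k * emeasure cantor_measure K" by (rule nn_integral_cmult_indicator) measurable
  also have "\<dots> \<le> ennreal k * ennreal (32 * r powr cantor_dim)" by (intro mult_left_mono emeasure_K) simp
  also have "\<dots> = ennreal (k * (32 * r powr cantor_dim))" using k by (intro ennreal_mult[symmetric]) auto
  finally show ?thesis .
qed

text \<open>For x in K below k and y in K above k the kernel has a lower bound independent of x and
  y, so the integral of the excess factors out against V. The assumption \<open>below\<close> makes
  the integral of V positive, and it can be cancelled.\<close>

lemma excess_le:
  assumes below: "\<not> (AE x in cantor_measure. x \<in> K \<longrightarrow> k \<le> u x)"
  shows "(\<integral>\<^sup>+y\<in>K. ennreal (max (u y - k) 0 powr (p - 1)) \<partial>cantor_measure) \<le> ennreal (excess_const * k powr (p - 1) * r powr cantor_dim)"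
proof -
  let ?V = "cut K (\<lambda>x. max (k - u x) 0)" and ?X = "\<integral>\<^sup>+y\<in>K. ennreal (max (u y - k) 0 powr (p - 1)) \<partial>cantor_measure"
  define D where "D = (8 * r) powr (cantor_dim + \<beta>)"
  have D: "0 < D" using r by (simp add: D_def)
  have [measurable]: "?V \<in> borel_measurable cantor_measure" by (rule cut_measurable[OF K(1)]) measurable
  have low: "ennreal (?V x) * (ennreal (1 / D) * ?X) \<le> ennreal (?V x) * (\<integral>\<^sup>+y. ennreal (max (u y - k) 0 powr (p - 1) * cantor_J \<beta> x y) \<partial>cantor_measure)"
    if [measurable]: "x \<in> space cantor_measure" for x
  proof (cases "x \<in> K \<and> u x < k")
    case True
    have "ennreal (1 / D) * ?X = (\<integral>\<^sup>+y. ennreal (1 / D) * (ennreal (max (u y - k) 0 powr (p - 1)) * indicator K y) \<partial>cantor_measure)"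
      by (rule nn_integral_cmult[symmetric]) measurable
    also have "\<dots> \<le> (\<integral>\<^sup>+y. ennreal (max (u y - k) 0 powr (p - 1) * cantor_J \<beta> x y) \<partial>cantor_measure)"
    proof (rule nn_integral_mono)
      fix y
      show "ennreal (1 / D) * (ennreal (max (u y - k) 0 powr (p - 1)) * indicator K y) \<le> ennreal (max (u y - k) 0 powr (p - 1) * cantor_J \<beta> x y)"
      proof (cases "y \<in> K \<and> k < u y")
        case y: True
        then have "1 / D \<le> cantor_J \<beta> x y" using True unfolding D_def by (intro J_ge_K) auto
        then have "1 / D * max (u y - k) 0 powr (p - 1) \<le> cantor_J \<beta> x y * max (u y - k) 0 powr (p - 1)"
          by (rule mult_right_mono) simp
        then show ?thesis using y D by (simp add: ennreal_mult[symmetric] mult.commute ennreal_leI)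
      next
        case False
        then have 0: "ennreal (max (u y - k) 0 powr (p - 1)) * indicator K y = 0" by (auto simp: indicator_def max_def)
        show ?thesis unfolding 0 by simp
      qed
    qed
    finally show ?thesis by (intro mult_left_mono) auto
  qed (auto simp: cut_def)
  have "(ennreal (1 / D) * ?X) * (\<integral>\<^sup>+x. ennreal (?V x) \<partial>cantor_measure) = (\<integral>\<^sup>+x. ennreal (?V x) * (ennreal (1 / D) * ?X) \<partial>cantor_measure)"
    by (subst nn_integral_multc) (auto simp: mult.commute)
  also have "\<dots> \<le> (\<integral>\<^sup>+x. ennreal (?V x) * (\<integral>\<^sup>+y. ennreal (max (u y - k) 0 powr (p - 1) * cantor_J \<beta> x y) \<partial>cantor_measure) \<partial>cantor_measure)"
    by (rule nn_integral_mono) (rule low)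
  also have "\<dots> \<le> ennreal (testing_const * k powr (p - 1) * r powr - \<beta>) * (\<integral>\<^sup>+x. ennreal (?V x) \<partial>cantor_measure)"
    by (rule super_integral_le)
  finally have "ennreal (1 / D) * ?X \<le> ennreal (testing_const * k powr (p - 1) * r powr - \<beta>)"
  proof (rule ennreal_mult_right_cancel_le)
    have "(\<integral>\<^sup>+x. ennreal (?V x) \<partial>cantor_measure) \<noteq> 0"
    proof
      assume "(\<integral>\<^sup>+x. ennreal (?V x) \<partial>cantor_measure) = 0"
      then have "AE x in cantor_measure. ennreal (?V x) = 0" by (subst (asm) nn_integral_0_iff_AE) auto
      then have "AE x in cantor_measure. x \<in> K \<longrightarrow> k \<le> u x" by eventually_elim (auto simp: cut_def max_def split: if_splits)
      then show False using below by blast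
    qed
    then show "0 < (\<integral>\<^sup>+x. ennreal (?V x) \<partial>cantor_measure)" by (simp add: zero_less_iff_neq_zero)
    show "(\<integral>\<^sup>+x. ennreal (?V x) \<partial>cantor_measure) < \<infinity>" using cut_integral_le by (rule order_le_less_trans) simp
  qed
  then have "ennreal D * (ennreal (1 / D) * ?X) \<le> ennreal D * ennreal (testing_const * k powr (p - 1) * r powr - \<beta>)"
    by (rule mult_left_mono) simp
  then have "?X \<le> ennreal (D * (testing_const * k powr (p - 1) * r powr - \<beta>))"
    using D harnack_consts_pos(1) by (simp add: mult.assoc[symmetric] ennreal_mult[symmetric])
  also have "D * (testing_const * k powr (p - 1) * r powr - \<beta>) = excess_const * k powr (p - 1) * r powr cantor_dim"
    using r by (simp add: D_def excess_const_def powr_mult powr_add powr_minus field_simps)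
  finally show ?thesis .
qed

lemma power_integral_le:
  assumes below: "\<not> (AE x in cantor_measure. x \<in> K \<longrightarrow> k \<le> u x)"
  shows "(\<integral>\<^sup>+y\<in>K. ennreal (\<bar>u y\<bar> powr (p - 1)) \<partial>cantor_measure) \<le> ennreal (power_const * k powr (p - 1) * r powr cantor_dim)"
proof -
  have "(\<integral>\<^sup>+y\<in>K. ennreal (\<bar>u y\<bar> powr (p - 1)) \<partial>cantor_measure)
    \<le> (\<integral>\<^sup>+y. ennreal (2 powr (p - 1)) * (ennreal (max (u y - k) 0 powr (p - 1)) * indicator K y + ennreal (k powr (p - 1)) * indicator K y) \<partial>cantor_measure)"
  proof (rule nn_integral_mono_AE)
    show "AE y in cantor_measure. ennreal (\<bar>u y\<bar> powr (p - 1)) * indicator K y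
      \<le> ennreal (2 powr (p - 1)) * (ennreal (max (u y - k) 0 powr (p - 1)) * indicator K y + ennreal (k powr (p - 1)) * indicator K y)"
      using nonneg_K
    proof eventually_elim
      fix y assume y: "y \<in> K \<longrightarrow> 0 \<le> u y"
      show "ennreal (\<bar>u y\<bar> powr (p - 1)) * indicator K y
        \<le> ennreal (2 powr (p - 1)) * (ennreal (max (u y - k) 0 powr (p - 1)) * indicator K y + ennreal (k powr (p - 1)) * indicator K y)"
      proof (cases "y \<in> K")
        case True
        have "\<bar>u y\<bar> powr (p - 1) \<le> (max (u y - k) 0 + k) powr (p - 1)"
          using True y p_minus_1_pos by (intro powr_mono2) auto
        also have "\<dots> \<le> 2 powr (p - 1) * (max (u y - k) 0 powr (p - 1) + k powr (p - 1))"
          using k p_minus_1_pos by (intro powr_add_le) auto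
        finally have "ennreal (\<bar>u y\<bar> powr (p - 1)) \<le> ennreal (2 powr (p - 1) * (max (u y - k) 0 powr (p - 1) + k powr (p - 1)))"
          by (rule ennreal_leI)
        then show ?thesis using True by (simp add: ennreal_mult ennreal_plus)
      qed simp
    qed
  qed
  also have "\<dots> = ennreal (2 powr (p - 1)) * ((\<integral>\<^sup>+y\<in>K. ennreal (max (u y - k) 0 powr (p - 1)) \<partial>cantor_measure) + ennreal (k powr (p - 1)) * emeasure cantor_measure K)"
    by (subst nn_integral_cmult, measurable) (subst nn_integral_add, auto simp: nn_integral_cmult_indicator)
  also have "\<dots> \<le> ennreal (2 powr (p - 1)) * (ennreal (excess_const * k powr (p - 1) * r powr cantor_dim) + ennreal (k powr (p - 1)) * ennreal (32 * r powr cantor_dim))"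
    by (intro mult_left_mono add_mono excess_le[OF below] emeasure_K) auto
  also have "\<dots> = ennreal (2 powr (p - 1) * (excess_const * k powr (p - 1) * r powr cantor_dim + k powr (p - 1) * (32 * r powr cantor_dim)))"
    using harnack_consts_pos(2) by (simp add: ennreal_mult[symmetric] ennreal_plus[symmetric] del: ennreal_plus)
  also have "2 powr (p - 1) * (excess_const * k powr (p - 1) * r powr cantor_dim + k powr (p - 1) * (32 * r powr cantor_dim)) = power_const * k powr (p - 1) * r powr cantor_dim"
    by (simp add: power_const_def algebra_simps)
  finally show ?thesis .
qed

text \<open>Where u exceeds k, an exponent q at most p - 1 gives u^q <= k^(q-(p-1)) u^(p-1), which
  reduces the average to the bound for the power p - 1; elsewhere u^q <= k^q.\<close>

lemma small_power_average_le:
  assumes below: "\<not> (AE x in cantor_measure. x \<in> K \<longrightarrow> k \<le> u x)" and q: "0 < q" "q \<le> p - 1"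
  shows "ennpowr ((\<integral>\<^sup>+y\<in>mball cantor_measure x0 r. ennreal (u y powr q) \<partial>cantor_measure) / emeasure cantor_measure (mball cantor_measure x0 r)) (1 / q)
    \<le> ennreal ((8 * (32 + power_const)) powr (1 / q) * k)"
proof -
  let ?B = "mball cantor_measure x0 r"
  have BK: "?B \<subseteq> K" using K(2) r by (auto simp: mball_def space_cantor_measure)
  have "(\<integral>\<^sup>+y\<in>?B. ennreal (u y powr q) \<partial>cantor_measure)
    \<le> (\<integral>\<^sup>+y. ennreal (k powr q) * indicator K y + ennreal (k powr (q - (p - 1))) * (ennreal (\<bar>u y\<bar> powr (p - 1)) * indicator K y) \<partial>cantor_measure)"
  proof (rule nn_integral_mono_AE)
    show "AE y in cantor_measure. ennreal (u y powr q) * indicator ?B y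
      \<le> ennreal (k powr q) * indicator K y + ennreal (k powr (q - (p - 1))) * (ennreal (\<bar>u y\<bar> powr (p - 1)) * indicator K y)"
      using nonneg_K
    proof eventually_elim
      fix y assume y: "y \<in> K \<longrightarrow> 0 \<le> u y"
      show "ennreal (u y powr q) * indicator ?B y
        \<le> ennreal (k powr q) * indicator K y + ennreal (k powr (q - (p - 1))) * (ennreal (\<bar>u y\<bar> powr (p - 1)) * indicator K y)"
      proof (cases "y \<in> ?B")
        case True
        then have yK: "y \<in> K" and u0: "0 \<le> u y" using BK y by auto
        have "u y powr q \<le> k powr q + k powr (q - (p - 1)) * u y powr (p - 1)"
        proof (cases "u y \<le> k")
          case True
          then have "u y powr q \<le> k powr q" using u0 q by (intro powr_mono2) auto
          moreover have "0 \<le> k powr (q - (p - 1)) * u y powr (p - 1)" by simp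
          ultimately show ?thesis by linarith
        next
          case False
          then have "u y powr q = u y powr (q - (p - 1)) * u y powr (p - 1)" by (simp add: powr_add[symmetric])
          also have "\<dots> \<le> k powr (q - (p - 1)) * u y powr (p - 1)"
            using False k q by (intro mult_right_mono powr_mono2') auto
          finally show ?thesis by (simp add: add_increasing)
        qed
        then have "ennreal (u y powr q) \<le> ennreal (k powr q + k powr (q - (p - 1)) * u y powr (p - 1))" by (rule ennreal_leI)
        then show ?thesis using True yK u0 by (simp add: ennreal_mult ennreal_plus)
      qed simp
    qed
  qed
  also have "\<dots> = ennreal (k powr q) * emeasure cantor_measure K + ennreal (k powr (q - (p - 1))) * (\<integral>\<^sup>+y\<in>K. ennreal (\<bar>u y\<bar> powr (p - 1)) \<partial>cantor_measure)"
    by (subst nn_integral_add) (auto simp: nn_integral_cmult_indicator nn_integral_cmult)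
  also have "\<dots> \<le> ennreal (k powr q) * ennreal (32 * r powr cantor_dim) + ennreal (k powr (q - (p - 1))) * ennreal (power_const * k powr (p - 1) * r powr cantor_dim)"
    by (intro add_mono mult_left_mono emeasure_K power_integral_le[OF below]) auto
  also have "\<dots> = ennreal (k powr q * (32 * r powr cantor_dim) + k powr (q - (p - 1)) * (power_const * k powr (p - 1) * r powr cantor_dim))"
    using harnack_consts_pos(3) by (simp add: ennreal_mult[symmetric] ennreal_plus[symmetric] del: ennreal_plus)
  also have "k powr q * (32 * r powr cantor_dim) + k powr (q - (p - 1)) * (power_const * k powr (p - 1) * r powr cantor_dim) = (32 + power_const) * k powr q * r powr cantor_dim"
  proof -
    have "k powr (q - (p - 1)) * k powr (p - 1) = k powr q" by (simp add: powr_add[symmetric])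
    then have "k powr (q - (p - 1)) * (power_const * k powr (p - 1) * r powr cantor_dim) = power_const * k powr q * r powr cantor_dim"
      by (metis (no_types, opaque_lifting) mult.assoc mult.left_commute)
    then show ?thesis by (simp add: algebra_simps)
  qed
  finally have int: "(\<integral>\<^sup>+y\<in>?B. ennreal (u y powr q) \<partial>cantor_measure) \<le> ennreal ((32 + power_const) * k powr q * r powr cantor_dim)" .
  have bge: "ennreal (r powr cantor_dim / 8) \<le> emeasure cantor_measure ?B"
    using x0 r R by (intro emeasure_cantor_ball_ge) auto
  have rp: "0 < r powr cantor_dim" using r by simp
  have "(\<integral>\<^sup>+y\<in>?B. ennreal (u y powr q) \<partial>cantor_measure) / emeasure cantor_measure ?B \<le> ennreal (8 * (32 + power_const) * k powr q)"
  proof (rule divide_le_posI_ennreal)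
    show "0 < emeasure cantor_measure ?B" using bge rp by (simp add: ennreal_less_zero_iff less_le_trans[OF _ bge])
    have "ennreal ((32 + power_const) * k powr q * r powr cantor_dim) = ennreal (r powr cantor_dim / 8) * ennreal (8 * (32 + power_const) * k powr q)"
    proof (subst ennreal_mult[symmetric])
      show "ennreal ((32 + power_const) * k powr q * r powr cantor_dim) = ennreal (r powr cantor_dim / 8 * (8 * (32 + power_const) * k powr q))"
        by (rule arg_cong[where f = ennreal]) simp
    qed (use harnack_consts_pos(3) in auto)
    then show "(\<integral>\<^sup>+y\<in>?B. ennreal (u y powr q) \<partial>cantor_measure) \<le> emeasure cantor_measure ?B * ennreal (8 * (32 + power_const) * k powr q)"
      using order_trans[OF int] mult_right_mono[OF bge, of "ennreal (8 * (32 + power_const) * k powr q)"] by simp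
  qed
  then have "ennpowr ((\<integral>\<^sup>+y\<in>?B. ennreal (u y powr q) \<partial>cantor_measure) / emeasure cantor_measure ?B) (1 / q)
    \<le> ennreal ((8 * (32 + power_const) * k powr q) powr (1 / q))"
    using harnack_consts_pos(3) q by (intro ennpowr_le) auto
  also have "(8 * (32 + power_const) * k powr q) powr (1 / q) = (8 * (32 + power_const)) powr (1 / q) * k"
    using harnack_consts_pos(3) k q by (simp add: powr_mult powr_powr)
  finally show ?thesis .
qed

end

lemma tail_level_mono:
  assumes "0 < k" "k \<le> k'"
    and "tail_bounded x0 R u K (k powr (p - 1) * r powr - \<beta>)"
  shows "tail_bounded x0 R u K (k' powr (p - 1) * r powr - \<beta>)"
proof -
  have "k powr (p - 1) * r powr - \<beta> \<le> k' powr (p - 1) * r powr - \<beta>"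
    using assms(1,2) p_minus_1_pos by (intro mult_right_mono powr_mono2) auto
  from ennreal_leI[OF this] show ?thesis
    using assms(3) by (auto elim!: eventually_mono intro: order_trans)
qed

text \<open>
  At a level far above \<open>k\<close> the set where \<open>u\<close> is small fills most of \<open>K\<close>, so the bound on the averaged tail of \<open>u\<close>
  turns into a pointwise one; testing once more from above then caps \<open>u\<close> without any iteration.
\<close>

lemma harnack_step:
  assumes k: "0 < k"
    and tail: "tail_bounded x0 R u K (k powr (p - 1) * r powr - \<beta>)"
    and below: "\<not> (AE x in cantor_measure. x \<in> K \<longrightarrow> k \<le> u x)"
    and sub: "subharmonic cantor_measure p E F (mball cantor_measure x0 R) u"
  shows "AE x in cantor_measure. x \<in> mball cantor_measure x0 r \<longrightarrow> u x \<le> cap_const * level_const * k"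
proof -
  define k' where "k' = level_const * k"
  have kk': "k \<le> k'" "0 < k'" using harnack_consts_pos(4) k by (auto simp: k'_def mult_le_cancel_right1)
  note tail' = tail_level_mono[OF k kk'(1) tail]
  have ra: "0 < r powr cantor_dim" using r by simp
  define Z where "Z = {y\<in>space cantor_measure. y \<in> K \<and> k' / 2 < u y}"
  have [measurable]: "Z \<in> sets cantor_measure" unfolding Z_def by measurable
  define A where "A = {y\<in>space cantor_measure. y \<in> K \<and> u y \<le> k' / 2}"
  have [measurable]: "A \<in> sets cantor_measure" unfolding A_def by measurable
  have KM: "K \<subseteq> space cantor_measure" using K(3) by (auto simp: space_cantor_measure)
  \<comment> \<open>Markov's inequality for |u|^(p-1) at height k'/2; \<open>level_const\<close> is
    calibrated for this bound.\<close>
  have Zle: "emeasure cantor_measure Z \<le> ennreal (r powr cantor_dim / 16)"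
  proof -
    have kp: "0 < (k' / 2) powr (p - 1)" using kk' by simp
    have "ennreal ((k' / 2) powr (p - 1)) * emeasure cantor_measure Z = (\<integral>\<^sup>+y. ennreal ((k' / 2) powr (p - 1)) * indicator Z y \<partial>cantor_measure)"
      by (rule nn_integral_cmult_indicator[symmetric]) measurable
    also have "\<dots> \<le> (\<integral>\<^sup>+y\<in>K. ennreal (\<bar>u y\<bar> powr (p - 1)) \<partial>cantor_measure)"
      using kk' p_minus_1_pos by (intro nn_integral_mono) (auto simp: indicator_def Z_def intro!: ennreal_leI powr_mono2)
    also have "\<dots> \<le> ennreal (power_const * k powr (p - 1) * r powr cantor_dim)" by (rule power_integral_le[OF k tail below])
    also have "power_const * k powr (p - 1) * r powr cantor_dim = (k' / 2) powr (p - 1) * (r powr cantor_dim / 16)"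
    proof -
      have "(k' / 2) powr (p - 1) = ((16 * power_const) powr (1 / (p - 1)) * k) powr (p - 1)" by (simp add: k'_def level_const_def)
      also have "\<dots> = 16 * power_const * k powr (p - 1)" using harnack_consts_pos(3) p_minus_1_pos k by (simp add: powr_mult powr_powr)
      finally show ?thesis by simp
    qed
    also have "ennreal ((k' / 2) powr (p - 1) * (r powr cantor_dim / 16)) = ennreal ((k' / 2) powr (p - 1)) * ennreal (r powr cantor_dim / 16)"
      by (intro ennreal_mult) auto
    finally show ?thesis using kp by (subst (asm) ennreal_mult_le_mult_iff) auto
  qed
  \<comment> \<open>A ball or one-sided piece of radius r has mass at least r^alpha/8, twice the
    bound for Z, so at least half of that bound survives the removal of Z.\<close>
  have minus: "ennreal (r powr cantor_dim / 16) \<le> emeasure cantor_measure (S - Z)"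
    if S: "S \<in> sets cantor_measure" "ennreal (r powr cantor_dim / 8) \<le> emeasure cantor_measure S" for S
  proof -
    have "ennreal (r powr cantor_dim / 16) + ennreal (r powr cantor_dim / 16) = ennreal (r powr cantor_dim / 8)"
      by (subst ennreal_plus[symmetric]) auto
    also have "\<dots> \<le> emeasure cantor_measure S" by (rule S)
    also have "\<dots> \<le> emeasure cantor_measure ((S - Z) \<union> Z)" using S by (intro emeasure_mono) auto
    also have "\<dots> \<le> emeasure cantor_measure (S - Z) + emeasure cantor_measure Z" using S by (intro emeasure_subadditive) auto
    also have "\<dots> \<le> emeasure cantor_measure (S - Z) + ennreal (r powr cantor_dim / 16)" by (intro add_mono Zle order_refl)
    finally have "ennreal (r powr cantor_dim / 16) + ennreal (r powr cantor_dim / 16) \<le> ennreal (r powr cantor_dim / 16) + emeasure cantor_measure (S - Z)"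
      by (simp add: add.commute)
    then show ?thesis by (subst (asm) ennreal_add_left_cancel_le) auto
  qed
  define P where "P x = (\<integral>\<^sup>+y. ennreal (max (u y - k') 0 powr (p - 1) * cantor_J \<beta> x y) \<partial>cantor_measure)" for x
  have [measurable]: "P \<in> borel_measurable cantor_measure" unfolding P_def[abs_def] by measurable
  let ?V = "cut K (\<lambda>x. max (k' - u x) 0)"
  have [measurable]: "?V \<in> borel_measurable cantor_measure" by (rule cut_measurable[OF K(1)]) measurable
  \<comment> \<open>On A the weight k' - u is at least k'/2, so the supersolution test at level k'
    bounds the tail \<open>P\<close> integrated over A.\<close>
  have PA: "(\<integral>\<^sup>+x\<in>A. P x \<partial>cantor_measure) \<le> ennreal (64 * testing_const * k' powr (p - 1) * r powr - \<beta> * r powr cantor_dim)"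
  proof -
    have "ennreal (k' / 2) * (\<integral>\<^sup>+x\<in>A. P x \<partial>cantor_measure) = (\<integral>\<^sup>+x. ennreal (k' / 2) * (P x * indicator A x) \<partial>cantor_measure)"
      by (rule nn_integral_cmult[symmetric]) measurable
    also have "\<dots> \<le> (\<integral>\<^sup>+x. ennreal (?V x) * P x \<partial>cantor_measure)"
    proof (rule nn_integral_mono)
      fix x
      have "k' / 2 \<le> ?V x" if "x \<in> A" using that by (auto simp: A_def cut_def max_def field_simps)
      then show "ennreal (k' / 2) * (P x * indicator A x) \<le> ennreal (?V x) * P x"
        by (auto simp: indicator_def intro!: mult_right_mono ennreal_leI)
    qed
    also have "\<dots> \<le> ennreal (testing_const * k' powr (p - 1) * r powr - \<beta>) * (\<integral>\<^sup>+x. ennreal (?V x) \<partial>cantor_measure)"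
      unfolding P_def by (rule super_integral_le[OF kk'(2) tail'])
    also have "\<dots> \<le> ennreal (testing_const * k' powr (p - 1) * r powr - \<beta>) * ennreal (k' * (32 * r powr cantor_dim))"
      by (intro mult_left_mono cut_integral_le[OF kk'(2) tail']) simp
    also have "\<dots> = ennreal (k' / 2) * ennreal (64 * testing_const * k' powr (p - 1) * r powr - \<beta> * r powr cantor_dim)"
      using harnack_consts_pos(1) kk' by (simp add: ennreal_mult[symmetric] mult_ac)
    finally show ?thesis using kk' by (subst (asm) ennreal_mult_le_mult_iff) auto
  qed
  have r1: "r \<le> 1" using r R by simp
  obtain L where L: "good_cut L (tail_const * (r / 18) powr - \<beta>)" "ball x0 r \<inter> cantor_line \<subseteq> L" "L \<subseteq> ball x0 (r + r) \<inter> cantor_line"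
    "\<And>y z. y \<in> L \<Longrightarrow> z \<in> cantor_line - L \<Longrightarrow> r / 18 \<le> \<bar>y - z\<bar>"
    using good_cut_interval[OF r(1) r1, of x0 r] by blast
  note [measurable] = good_cut_sets[OF L(1)]
  have LK: "L \<subseteq> K" using L(3) K(2) r by force
  \<comment> \<open>For y off L the value J x y is dominated by an average of J z y over the low
    points z in A near x on its side; exchanging the integrals turns the tail at x into the integral
    of \<open>P\<close> over A.\<close>
  have pointwise: "(\<integral>\<^sup>+y\<in>space cantor_measure - L. ennreal (max (u y - k') 0 powr (p - 1) * cantor_J \<beta> x y) \<partial>cantor_measure)
      \<le> ennreal (escape_const * k' powr (p - 1) * r powr - \<beta>)" if x: "x \<in> L" for x
  proof -
    have xM: "x \<in> cantor_line" using x L(3) by auto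
    have xs [measurable]: "x \<in> space cantor_measure" using xM by (simp add: space_cantor_measure)
    define S where "S = ball x r \<inter> cantor_side x"
    have S_eq: "S = mball cantor_measure x r \<inter> cantor_side x" by (auto simp: S_def mball_def space_cantor_measure cantor_side_def)
    have S [measurable]: "S \<in> sets cantor_measure" unfolding S_eq using cantor_side_sets by auto
    have SK: "S \<subseteq> K"
    proof
      fix z assume z: "z \<in> S"
      then have "z \<in> cantor_line" "dist x z < r" by (auto simp: S_def cantor_side_def)
      moreover have "dist x0 x < r + r" using x L(3) by auto
      ultimately have "dist x0 z < 3 * r" using dist_triangle[of x0 z x] by linarith
      then show "z \<in> K" using K(2) \<open>z \<in> cantor_line\<close> by auto
    qed
    have "S - Z \<subseteq> A \<inter> S" using SK KM by (auto simp: Z_def A_def)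
    moreover have "ennreal (r powr cantor_dim / 16) \<le> emeasure cantor_measure (S - Z)"
      unfolding S_def by (rule minus) (use S emeasure_cantor_side_ge[OF xM r(1) r1] in \<open>auto simp: S_def\<close>)
    ultimately have AS: "ennreal (r powr cantor_dim / 16) \<le> emeasure cantor_measure (A \<inter> S)"
      by (meson emeasure_mono order_trans S \<open>A \<in> sets cantor_measure\<close> sets.Int)
    have Jle: "ennreal (r powr cantor_dim / 16) * ennreal (cantor_J \<beta> x y) \<le> ennreal (19 powr (1 + \<beta>)) * (\<integral>\<^sup>+z\<in>A. ennreal (cantor_J \<beta> z y) \<partial>cantor_measure)"
      if y: "y \<in> cantor_line - L" for y
    proof -
      have "ennreal (r powr cantor_dim / 16) * ennreal (cantor_J \<beta> x y) \<le> ennreal (cantor_J \<beta> x y) * emeasure cantor_measure (A \<inter> S)"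
        using AS by (subst mult.commute) (intro mult_left_mono, auto)
      also have "\<dots> \<le> ennreal (19 powr (1 + \<beta>)) * (\<integral>\<^sup>+z\<in>A. ennreal (cantor_J \<beta> z y) \<partial>cantor_measure)"
        unfolding S_def using y L(4)[OF x, of y] r by (intro J_average xM) auto
      finally show ?thesis .
    qed
    define w where "w y = ennreal (max (u y - k') 0 powr (p - 1))" for y
    have [measurable]: "w \<in> borel_measurable cantor_measure" unfolding w_def[abs_def] by measurable
    have "ennreal (r powr cantor_dim / 16) * (\<integral>\<^sup>+y\<in>space cantor_measure - L. ennreal (max (u y - k') 0 powr (p - 1) * cantor_J \<beta> x y) \<partial>cantor_measure)
      = (\<integral>\<^sup>+y. ennreal (r powr cantor_dim / 16) * (ennreal (max (u y - k') 0 powr (p - 1) * cantor_J \<beta> x y) * indicator (space cantor_measure - L) y) \<partial>cantor_measure)"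
      by (rule nn_integral_cmult[symmetric]) measurable
    also have "\<dots> \<le> (\<integral>\<^sup>+y. ennreal (19 powr (1 + \<beta>)) * (\<integral>\<^sup>+z. w y * (ennreal (cantor_J \<beta> z y) * indicator A z) \<partial>cantor_measure) \<partial>cantor_measure)"
    proof (rule nn_integral_mono)
      fix y assume ys [measurable]: "y \<in> space cantor_measure"
      have eq: "(\<integral>\<^sup>+z. w y * (ennreal (cantor_J \<beta> z y) * indicator A z) \<partial>cantor_measure) = w y * (\<integral>\<^sup>+z\<in>A. ennreal (cantor_J \<beta> z y) \<partial>cantor_measure)"
        by (rule nn_integral_cmult) measurable
      show "ennreal (r powr cantor_dim / 16) * (ennreal (max (u y - k') 0 powr (p - 1) * cantor_J \<beta> x y) * indicator (space cantor_measure - L) y)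
        \<le> ennreal (19 powr (1 + \<beta>)) * (\<integral>\<^sup>+z. w y * (ennreal (cantor_J \<beta> z y) * indicator A z) \<partial>cantor_measure)"
      proof (cases "y \<in> L")
        case False
        have "w y * (ennreal (r powr cantor_dim / 16) * ennreal (cantor_J \<beta> x y)) \<le> w y * (ennreal (19 powr (1 + \<beta>)) * (\<integral>\<^sup>+z\<in>A. ennreal (cantor_J \<beta> z y) \<partial>cantor_measure))"
          using False ys by (intro mult_left_mono Jle) (auto simp: space_cantor_measure)
        then show ?thesis
          unfolding eq using False ys by (simp add: w_def ennreal_mult cantor_J_nonneg mult_ac)
      qed simp
    qed
    also have "\<dots> = ennreal (19 powr (1 + \<beta>)) * (\<integral>\<^sup>+y. \<integral>\<^sup>+z. w y * (ennreal (cantor_J \<beta> z y) * indicator A z) \<partial>cantor_measure \<partial>cantor_measure)"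
      by (rule nn_integral_cmult) measurable
    also have "(\<integral>\<^sup>+y. \<integral>\<^sup>+z. w y * (ennreal (cantor_J \<beta> z y) * indicator A z) \<partial>cantor_measure \<partial>cantor_measure)
      = (\<integral>\<^sup>+z. \<integral>\<^sup>+y. w y * (ennreal (cantor_J \<beta> z y) * indicator A z) \<partial>cantor_measure \<partial>cantor_measure)"
      by (rule pair.Fubini') measurable
    also have "\<dots> = (\<integral>\<^sup>+z\<in>A. P z \<partial>cantor_measure)"
    proof (rule nn_integral_cong)
      fix z assume [measurable]: "z \<in> space cantor_measure"
      show "(\<integral>\<^sup>+y. w y * (ennreal (cantor_J \<beta> z y) * indicator A z) \<partial>cantor_measure) = P z * indicator A z"
        unfolding P_def w_def
        by (subst nn_integral_multc[symmetric], measurable)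
           (auto intro!: nn_integral_cong simp: ennreal_mult cantor_J_nonneg mult.assoc)
    qed
    also have "ennreal (19 powr (1 + \<beta>)) * (\<integral>\<^sup>+z\<in>A. P z \<partial>cantor_measure) \<le> ennreal (19 powr (1 + \<beta>)) * ennreal (64 * testing_const * k' powr (p - 1) * r powr - \<beta> * r powr cantor_dim)"
      by (intro mult_left_mono PA) simp
    also have "\<dots> = ennreal (r powr cantor_dim / 16) * ennreal (escape_const * k' powr (p - 1) * r powr - \<beta>)"
      using harnack_consts_pos(1,5) by (simp add: ennreal_mult[symmetric]) (simp add: escape_const_def mult_ac)
    finally show ?thesis using ra by (subst (asm) ennreal_mult_le_mult_iff) auto
  qed
  define l where "l = cap_const * k'"
  have kl: "k' \<le> l" using harnack_consts_pos(6) kk' by (simp add: l_def mult_le_cancel_right1)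
  let ?W = "cut L (\<lambda>x. max (u x - l) 0)"
  have [measurable]: "?W \<in> borel_measurable cantor_measure" by (rule cut_measurable[OF L(1)]) measurable
  define D where "D = (8 * r) powr (cantor_dim + \<beta>)"
  have D: "0 < D" using r by (simp add: D_def)
  define Y where "Y = {y\<in>L. u y \<le> k'}"
  have LM: "L \<subseteq> space cantor_measure" using L(3) by (auto simp: space_cantor_measure)
  have Y_eq: "Y = {y\<in>space cantor_measure. y \<in> L \<and> u y \<le> k'}" using LM by (auto simp: Y_def)
  have [measurable]: "Y \<in> sets cantor_measure" unfolding Y_eq by measurable
  have Yge: "ennreal (r powr cantor_dim / 16) \<le> emeasure cantor_measure Y"
  proof -
    have "ennreal (r powr cantor_dim / 16) \<le> emeasure cantor_measure (mball cantor_measure x0 r - Z)"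
      using emeasure_cantor_ball_ge[OF x0 r(1) r1] by (intro minus) auto
    also have "\<dots> \<le> emeasure cantor_measure Y"
      using L(2) LK kk' by (intro emeasure_mono) (auto simp: mball_def space_cantor_measure Z_def Y_def)
    finally show ?thesis .
  qed
  \<comment> \<open>A point of L above l is pulled down by all of Y, whose mass is at least
    r^alpha/16, through a kernel of size at least 1/D.\<close>
  have lower: "ennreal (?W x) * ennreal ((l - k') powr (p - 1) * (1 / D * (r powr cantor_dim / 16)))
     \<le> ennreal (?W x) * (ennreal ((l - k') powr (p - 1)) * (\<integral>\<^sup>+y\<in>Y. ennreal (cantor_J \<beta> x y) \<partial>cantor_measure))" for x
  proof (cases "x \<in> L \<and> l < u x")
    case True
    have "ennreal (1 / D * (r powr cantor_dim / 16)) = ennreal (1 / D) * ennreal (r powr cantor_dim / 16)"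
      using D by (intro ennreal_mult) auto
    also have "\<dots> \<le> ennreal (1 / D) * emeasure cantor_measure Y" by (intro mult_left_mono Yge) simp
    also have "\<dots> = (\<integral>\<^sup>+y. ennreal (1 / D) * indicator Y y \<partial>cantor_measure)"
      by (rule nn_integral_cmult_indicator[symmetric]) measurable
    also have "\<dots> \<le> (\<integral>\<^sup>+y\<in>Y. ennreal (cantor_J \<beta> x y) \<partial>cantor_measure)"
    proof (rule nn_integral_mono)
      fix y
      show "ennreal (1 / D) * indicator Y y \<le> ennreal (cantor_J \<beta> x y) * indicator Y y"
      proof (cases "y \<in> Y")
        case y: True
        then have "x \<noteq> y" "x \<in> K" "y \<in> K" using True kl LK by (auto simp: Y_def)
        then have "1 / D \<le> cantor_J \<beta> x y" unfolding D_def by (intro J_ge_K)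
        then show ?thesis using y by (simp add: ennreal_leI)
      qed simp
    qed
    finally have "ennreal ((l - k') powr (p - 1)) * ennreal (1 / D * (r powr cantor_dim / 16))
       \<le> ennreal ((l - k') powr (p - 1)) * (\<integral>\<^sup>+y\<in>Y. ennreal (cantor_J \<beta> x y) \<partial>cantor_measure)"
      by (rule mult_left_mono) simp
    then show ?thesis using D by (intro mult_left_mono) (auto simp: ennreal_mult[symmetric])
  qed (auto simp: cut_def)
  let ?c = "(l - k') powr (p - 1) * (1 / D * (r powr cantor_dim / 16))" and ?b = "escape_const * k' powr (p - 1) * r powr - \<beta>"
  have "ennreal ?c * (\<integral>\<^sup>+x. ennreal (?W x) \<partial>cantor_measure) = (\<integral>\<^sup>+x. ennreal (?W x) * ennreal ?c \<partial>cantor_measure)"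
    by (subst nn_integral_multc) (auto simp: mult.commute)
  also have "\<dots> \<le> (\<integral>\<^sup>+x. ennreal (?W x) * (ennreal ((l - k') powr (p - 1)) * (\<integral>\<^sup>+y\<in>Y. ennreal (cantor_J \<beta> x y) \<partial>cantor_measure)) \<partial>cantor_measure)"
    by (rule nn_integral_mono) (rule lower)
  also have "\<dots> \<le> (\<integral>\<^sup>+x. ennreal (?W x) * (\<integral>\<^sup>+y\<in>space cantor_measure - L. ennreal (max (u y - k') 0 powr (p - 1) * cantor_J \<beta> x y) \<partial>cantor_measure) \<partial>cantor_measure)"
    unfolding Y_def by (rule subsolution_step[OF L(1) _ sub kl]) (use LK K_subset_ball in blast)
  also have "\<dots> \<le> (\<integral>\<^sup>+x. ennreal (?W x) * ennreal ?b \<partial>cantor_measure)"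
  proof (rule nn_integral_mono)
    fix x
    show "ennreal (?W x) * (\<integral>\<^sup>+y\<in>space cantor_measure - L. ennreal (max (u y - k') 0 powr (p - 1) * cantor_J \<beta> x y) \<partial>cantor_measure) \<le> ennreal (?W x) * ennreal ?b"
      using pointwise[of x] by (cases "x \<in> L") (auto simp: cut_def intro!: mult_left_mono)
  qed
  also have "\<dots> = ennreal ?b * (\<integral>\<^sup>+x. ennreal (?W x) \<partial>cantor_measure)"
    by (subst nn_integral_multc) (auto simp: mult.commute)
  finally have main: "ennreal ?c * (\<integral>\<^sup>+x. ennreal (?W x) \<partial>cantor_measure) \<le> ennreal ?b * (\<integral>\<^sup>+x. ennreal (?W x) \<partial>cantor_measure)" .
  \<comment> \<open>The powers of r cancel, and the comparison reduces to
    \<open>escape_const\<close> against \<open>escape_const + 1\<close>.\<close>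
  have cb: "?b < ?c"
  proof -
    have "l - k' = (16 * 8 powr (cantor_dim + \<beta>) * (escape_const + 1)) powr (1 / (p - 1)) * k'"
      by (simp add: l_def cap_const_def algebra_simps)
    then have "(l - k') powr (p - 1) = 16 * 8 powr (cantor_dim + \<beta>) * (escape_const + 1) * k' powr (p - 1)"
      using harnack_consts_pos(5) kk' p_minus_1_pos by (simp add: powr_mult powr_powr)
    moreover have "D = 8 powr (cantor_dim + \<beta>) * (r powr cantor_dim * r powr \<beta>)" using r by (simp add: D_def powr_mult powr_add)
    ultimately have "?c = (escape_const + 1) * k' powr (p - 1) * r powr - \<beta>"
      using r by (simp add: powr_minus field_simps)
    also have "\<dots> > ?b" using kk' r by simp
    finally show ?thesis .
  qed
  \<comment> \<open>Needed to cancel the integral of W in \<open>main\<close>. Only p-integrability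
    is at hand, and W <= 1_L + W^p reduces integrability to it.\<close>
  have Wfin: "(\<integral>\<^sup>+x. ennreal (?W x) \<partial>cantor_measure) < \<infinity>"
  proof -
    have WF: "?W \<in> F" by (rule cut_lipschitz_F[OF L(1) super_dom_const, of 1 "\<lambda>s. max (s - l) 0"]) auto
    have "(\<integral>\<^sup>+x. ennreal (?W x) \<partial>cantor_measure) \<le> (\<integral>\<^sup>+x. indicator L x + ennreal (\<bar>?W x\<bar> powr p) \<partial>cantor_measure)"
    proof (rule nn_integral_mono)
      fix x
      have W0: "0 \<le> ?W x" by (simp add: cut_def)
      show "ennreal (?W x) \<le> indicator L x + ennreal (\<bar>?W x\<bar> powr p)"
      proof (cases "?W x \<le> 1")
        case True
        then have "ennreal (?W x) \<le> indicator L x" by (auto simp: cut_def indicator_def)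
        then show ?thesis by (rule add_increasing2[rotated]) simp
      next
        case False
        then have "?W x powr 1 \<le> ?W x powr p" using p_gt_1 by (intro powr_mono) auto
        then have "ennreal (?W x) \<le> ennreal (\<bar>?W x\<bar> powr p)" using W0 False by (intro ennreal_leI) simp
        then show ?thesis by (rule add_increasing[rotated]) simp
      qed
    qed
    also have "\<dots> = emeasure cantor_measure L + (\<integral>\<^sup>+x. ennreal (\<bar>?W x\<bar> powr p) \<partial>cantor_measure)"
      by (subst nn_integral_add) auto
    also have "\<dots> < \<infinity>"
    proof -
      have "emeasure cantor_measure L < \<infinity>" using L(1) compact_finite[of L] by (auto simp: good_cut_def)
      moreover have "(\<integral>\<^sup>+x. ennreal (\<bar>?W x\<bar> powr p) \<partial>cantor_measure) < \<infinity>"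
        using lp_le_total F_total[OF WF] by (rule order_le_less_trans)
      ultimately show ?thesis by simp
    qed
    finally show ?thesis .
  qed
  have "(\<integral>\<^sup>+x. ennreal (?W x) \<partial>cantor_measure) = 0"
  proof (rule ccontr)
    assume "(\<integral>\<^sup>+x. ennreal (?W x) \<partial>cantor_measure) \<noteq> 0"
    then have "ennreal ?c \<le> ennreal ?b" using main Wfin by (intro ennreal_mult_right_cancel_le[of "ennreal ?c"]) (auto simp: zero_less_iff_neq_zero)
    moreover have "0 \<le> ?b" using harnack_consts_pos(5) by simp
    ultimately show False using cb by (simp add: ennreal_le_iff)
  qed
  then have "AE x in cantor_measure. ennreal (?W x) = 0" by (subst (asm) nn_integral_0_iff_AE) auto
  then show ?thesis
  proof (eventually_elim, intro impI)
    fix x assume "ennreal (?W x) = 0" "x \<in> mball cantor_measure x0 r"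
    moreover have "x \<in> L" using calculation L(2) by (auto simp: mball_def space_cantor_measure)
    ultimately have "u x \<le> l" by (auto simp: cut_def max_def split: if_splits)
    then show "u x \<le> cap_const * level_const * k" by (simp add: l_def k'_def mult.assoc)
  qed
qed

end

text \<open>
  It suffices to compare with levels \<open>k\<close> above both the essential infimum and the scaled tail.
\<close>

lemma harnack_levels:
  assumes x0: "x0 \<in> cantor_line" and r: "0 < r" "r \<le> R / 16" and R: "R < 1 / 4" and C: "0 < C"
    and u: "u \<in> dom_const F"
    and levels: "\<And>K k. good_cut K (tail_const * (r / 18) powr - \<beta>) \<Longrightarrow> ball x0 (3 * r) \<inter> cantor_line \<subseteq> K \<Longrightarrow> K \<subseteq> ball x0 (4 * r) \<inter> cantor_line \<Longrightarrow> 0 < k \<Longrightarrow>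
      tail_bounded x0 R u K (k powr (p - 1) * r powr - \<beta>) \<Longrightarrow>
      \<not> (AE x in cantor_measure. x \<in> K \<longrightarrow> k \<le> u x) \<Longrightarrow> X \<le> ennreal (C * k)"
  shows "X \<le> ennreal C * inf_plus_tail x0 r R u"
proof -
  let ?e = "einf cantor_measure (mball cantor_measure x0 r) (\<lambda>y. ennreal (u y))"
  let ?t = "tail cantor_measure p E F (cantor_J \<beta>) (mball cantor_measure x0 (R / 2)) (mball cantor_measure x0 R) (\<lambda>y. max (- u y) 0)"
  let ?w = "(r powr \<beta>) powr (1 / (p - 1))"
  have w: "0 < ?w" using r by simp
  have r1: "r \<le> 1" using r R by simp
  obtain K where K: "good_cut K (tail_const * (r / 18) powr - \<beta>)" "ball x0 (3 * r) \<inter> cantor_line \<subseteq> K" "K \<subseteq> ball x0 (3 * r + r) \<inter> cantor_line"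
    by (rule good_cut_interval[OF r(1) r1, of x0 "3 * r"], rule that)
  have K4: "K \<subseteq> ball x0 (4 * r) \<inter> cantor_line" using K(3) by simp
  show ?thesis
  proof (cases "?e + ennreal ?w * ?t = \<infinity>")
    case True
    have "ennreal C * \<infinity> = \<infinity>" using C by (simp add: ennreal_mult_top)
    then show ?thesis unfolding True by (metis top_greatest infinity_ennreal_def)
  next
    case False
    then have e: "?e \<noteq> top" and "ennreal ?w * ?t \<noteq> top" by auto
    then have "?t \<noteq> top" using w by (auto simp: ennreal_mult_eq_top_iff)
    then obtain T where T: "?t = ennreal T" "0 \<le> T" by (cases ?t) auto
    obtain i where i: "?e = ennreal i" "0 \<le> i" using e by (cases ?e) auto
    define s where "s = i + ?w * T"
    have s: "?e + ennreal ?w * ?t = ennreal s" "0 \<le> s" "i \<le> s" "?w * T \<le> s"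
      using T i w by (auto simp: s_def ennreal_mult ennreal_plus)
    have lev: "X \<le> ennreal (C * k)" if k: "s < k" for k
    proof (rule levels[OF K(1,2) K4])
      show k0: "0 < k" using k s by simp
      have "AE x in cantor_measure. x \<in> mball cantor_measure x0 (R / 2) \<longrightarrow>
        (\<integral>\<^sup>+y\<in>space cantor_measure - mball cantor_measure x0 R. ennreal (max (- u y) 0 powr (p - 1) * cantor_J \<beta> x y) \<partial>cantor_measure) \<le> ennreal (T powr (p - 1))"
        by (rule tail_AE[OF u _ _ T]) measurable
      moreover have "K \<subseteq> mball cantor_measure x0 (R / 2)"
        using K4 r by (auto simp: mball_def space_cantor_measure)
      moreover have "T powr (p - 1) \<le> k powr (p - 1) * r powr - \<beta>"
      proof -
        have "(?w * T) powr (p - 1) \<le> k powr (p - 1)" using s(4) k w T p_minus_1_pos by (intro powr_mono2) auto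
        then have "r powr \<beta> * T powr (p - 1) \<le> k powr (p - 1)" using p_minus_1_pos T r by (simp add: powr_mult powr_powr)
        then show ?thesis using r by (simp add: powr_minus field_simps)
      qed
      then have "ennreal (T powr (p - 1)) \<le> ennreal (k powr (p - 1) * r powr - \<beta>)" by (rule ennreal_leI)
      ultimately show "tail_bounded x0 R u K (k powr (p - 1) * r powr - \<beta>)"
        by (auto elim!: eventually_mono intro: order_trans)
      \<comment> \<open>A level strictly above the essential infimum is one that u fails to reach on
        a set of positive measure.\<close>
      have "?e < ennreal k" unfolding i(1) using s(3) k i(2) by (intro ennreal_lessI) auto
      then have not: "\<not> (AE x in cantor_measure. x \<in> mball cantor_measure x0 r \<longrightarrow> ennreal k \<le> ennreal (u x))"
        by (rule not_AE_einf) measurable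
      show "\<not> (AE x in cantor_measure. x \<in> K \<longrightarrow> k \<le> u x)"
      proof
        assume "AE x in cantor_measure. x \<in> K \<longrightarrow> k \<le> u x"
        then have "AE x in cantor_measure. x \<in> mball cantor_measure x0 r \<longrightarrow> ennreal k \<le> ennreal (u x)"
        proof (eventually_elim, intro impI)
          fix x assume "x \<in> K \<longrightarrow> k \<le> u x" "x \<in> mball cantor_measure x0 r"
          moreover have "x \<in> K" using calculation(2) r K(2) by (auto simp: mball_def space_cantor_measure)
          ultimately show "ennreal k \<le> ennreal (u x)" by (simp add: ennreal_leI)
        qed
        then show False using not by blast
      qed
    qed
    \<comment> \<open>The levels have to lie strictly above s, the sum of infimum and scaled tail;
      they are taken as s + e/C and the error e is sent to 0.\<close>
    have "X \<le> ennreal (C * s)"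
    proof (rule ennreal_le_epsilon)
      fix e :: real assume e: "0 < e"
      have "X \<le> ennreal (C * (s + e / C))" using e C by (intro lev) simp
      also have "C * (s + e / C) = C * s + e" using C by (simp add: distrib_left)
      also have "ennreal (C * s + e) = ennreal (C * s) + ennreal e" using C s e by (intro ennreal_plus) auto
      finally show "X \<le> ennreal (C * s) + ennreal e" .
    qed
    then show ?thesis unfolding s(1) using C s(2) by (simp add: ennreal_mult)
  qed
qed

lemma wEH_holds: "wEH cantor_measure p E F (cantor_J \<beta>) (power_scale \<beta>) (1 / 2)"
proof -
  \<comment> \<open>Below 1 as the weak inequality demands, and at most p - 1 as the comparison of
    powers above the level demands.\<close>
  define q where "q = min (1 / 2) (p - 1)"
  have q: "0 < q" "q < 1" "q \<le> p - 1" using p_minus_1_pos by (auto simp: q_def min_def)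
  define C where "C = (8 * (32 + power_const)) powr (1 / q)"
  have C: "1 \<le> C" unfolding C_def using harnack_consts_pos(3) q by (intro ge_one_powr_ge_zero) auto
  have "ennpowr ((\<integral>\<^sup>+y\<in>mball cantor_measure x r. ennreal (u y powr q) \<partial>cantor_measure) / emeasure cantor_measure (mball cantor_measure x r)) (1 / q)
      \<le> ennreal C * inf_plus_tail x r R u"
    if "x \<in> space cantor_measure" "0 < R" "R < 1 / 2 * (1 / 2)" "0 < r" "r \<le> 1 / 16 * R" "u \<in> dom_const F"
      "AE y in cantor_measure. y \<in> mball cantor_measure x R \<longrightarrow> 0 \<le> u y" "superharmonic cantor_measure p E F (mball cantor_measure x R) u" for x R r u
  proof (rule harnack_levels)
    fix K k
    assume "good_cut K (tail_const * (r / 18) powr - \<beta>)" "ball x (3 * r) \<inter> cantor_line \<subseteq> K" "K \<subseteq> ball x (4 * r) \<inter> cantor_line" "0 < k"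
      "tail_bounded x R u K (k powr (p - 1) * r powr - \<beta>)"
      "\<not> (AE x in cantor_measure. x \<in> K \<longrightarrow> k \<le> u x)"
    then show "ennpowr ((\<integral>\<^sup>+y\<in>mball cantor_measure x r. ennreal (u y powr q) \<partial>cantor_measure) / emeasure cantor_measure (mball cantor_measure x r)) (1 / q)
      \<le> ennreal (C * k)"
      unfolding C_def using that q
      by (intro small_power_average_le[of x r R K]) (auto simp: space_cantor_measure)
  qed (use that C in \<open>auto simp: space_cantor_measure\<close>)
  then show ?thesis
    unfolding wEH_def Let_def using q C
    by (intro exI[of _ q] exI[of _ "1 / 16 :: real"] exI[of _ "1 / 2 :: real"] exI[of _ C]) auto
qed

lemma sEH_holds: "sEH cantor_measure p E F (cantor_J \<beta>) (power_scale \<beta>) (1 / 2)"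
proof -
  define C where "C = cap_const * level_const"
  have C: "1 \<le> C" using mult_mono[of 1 cap_const 1 level_const] harnack_consts_pos by (simp add: C_def)
  have "esup cantor_measure (mball cantor_measure x r) (\<lambda>y. ennreal (u y))
      \<le> ennreal C * inf_plus_tail x r R u"
    if "x \<in> space cantor_measure" "0 < R" "R < 1 / 2 * (1 / 2)" "0 < r" "r \<le> 1 / 16 * R" and u: "u \<in> dom_const F"
      and "AE y in cantor_measure. y \<in> mball cantor_measure x R \<longrightarrow> 0 \<le> u y" "harmonic cantor_measure p E F (mball cantor_measure x R) u" for x R r u
  proof (rule harnack_levels)
    fix K k
    assume "good_cut K (tail_const * (r / 18) powr - \<beta>)" "ball x (3 * r) \<inter> cantor_line \<subseteq> K" "K \<subseteq> ball x (4 * r) \<inter> cantor_line" "0 < k"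
      "tail_bounded x R u K (k powr (p - 1) * r powr - \<beta>)"
      "\<not> (AE x in cantor_measure. x \<in> K \<longrightarrow> k \<le> u x)"
    then have ae: "AE y in cantor_measure. y \<in> mball cantor_measure x r \<longrightarrow> u y \<le> cap_const * level_const * k"
      using that by (intro harnack_step[of x r R K]) (auto simp: space_cantor_measure harmonic_def)
    have [measurable]: "u \<in> borel_measurable cantor_measure" by (rule dom_const_measurable[OF u])
    show "esup cantor_measure (mball cantor_measure x r) (\<lambda>y. ennreal (u y)) \<le> ennreal (C * k)"
      unfolding esup_def
    proof (rule esssup_I)
      show "(\<lambda>y. ennreal (u y)) \<in> borel_measurable (restrict_space cantor_measure (mball cantor_measure x r))"
        by (intro measurable_restrict_space1) measurable
      show "AE y in restrict_space cantor_measure (mball cantor_measure x r). ennreal (u y) \<le> ennreal (C * k)"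
        using ae by (subst AE_restrict_space_iff) (auto elim!: eventually_mono simp: C_def intro!: ennreal_leI)
    qed
  qed (use that C in \<open>auto simp: space_cantor_measure\<close>)
  then show ?thesis
    unfolding sEH_def Let_def using C
    by (intro exI[of _ "1 / 16 :: real"] exI[of _ "1 / 2 :: real"] exI[of _ C]) auto
qed

end

theorem proposition6p2:
  fixes p \<beta> :: real
  assumes "1 < p" and "0 < \<beta>" and "\<beta> < p"
  shows
    "let m = cantor_measure; J = cantor_J \<beta>;
         E = nl_form m p J; F = nl_dom m p J;
         W = power_scale \<beta>; Rbar = 1 / 2
     in purely_nonlocal_form m p E F J \<and>
        (TJ m W J \<and> UJS m Rbar J \<and> \<not> J_le m W J) \<and>
        (CS m p E F J W Rbar \<and> PI m p E F J W Rbar \<and>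
         wEH m p E F J W Rbar \<and> sEH m p E F J W Rbar)"
proof -
  interpret cantor_form p \<beta> by unfold_locales (use assms in auto)
  show ?thesis
    unfolding Let_def
    by (intro conjI purely_nonlocal_holds TJ_holds UJS_holds J_le_fails CS_holds PI_holds wEH_holds sEH_holds)
qed

end
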